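(* Let $\{X_i, i\in\mathbf{Z}\}$ be weakly stationary, $(m,\alpha_X)$-short range dependent random variables with $m\geq 8$ and $\alpha_X>2$ constants, and let $X_1,\dots,X_T$ be observed. Put $\sigma_j=\mathbf{E}X_iX_{i-j}$, $\rho_j=\sigma_j/\sigma_0$, $\widehat{\sigma}_j=\frac1T\sum_{i=j+1}^T X_iX_{i-j}$ and $\widehat\rho_j=\widehat\sigma_j/\widehat\sigma_0$. Let $d=O(T^{\beta_X})$ be a positive integer and let $\mathcal{H}\subset\{0,1,\dots,d\}$ and $\mathcal{I}\subset\{1,2,\dots,d\}$ be non-empty sets. Assume that there exist constants $0<\alpha_s<\alpha_l<1$ such that $$\frac{2\beta_X}{m}+2\alpha_X\beta_X<(\alpha_X-1)\alpha_s,\quad \frac{4\beta_X}{m}+4\alpha_X\beta_X+\alpha_s<\alpha_l,\quad \frac{12\beta_X}{m}+12\alpha_X\beta_X+\alpha_l<1,$$ $$4\alpha_X\beta_X<(\alpha_X-1)\alpha_s,\quad 8\alpha_X\beta_X+\alpha_s<\alpha_l.$$ (i) If there exists a constant $c>0$ such that $\big\Vert\frac{1}{\sqrt T}\sum_{i=1}^T(X_iX_{i-j}-\sigma_j)\big\Vert_2>c$ for all $j\in\mathcal{H}$, then $$\sup_{x\in\mathbf{R}}\Big|Prob\Big(\max_{j\in\mathcal{H}}\sqrt T|\widehat\sigma_j-\sigma_j|\leq x\Big)-Prob\Big(\max_{j\in\mathcal{H}}|\xi_j|\leq x\Big)\Big|=o(1),$$ where $\xi_j$, $j\in\mathcal{H}$,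 are jointly Gaussian random variables with $\mathbf{E}\xi_j=0$ and $\mathbf{E}\xi_{j_1}\xi_{j_2}=\frac1T\sum_{i_1=1}^T\sum_{i_2=1}^T\mathbf{E}(X_{i_1}X_{i_1-j_1}-\sigma_{j_1})(X_{i_2}X_{i_2-j_2}-\sigma_{j_2})$. (ii) Define $Z_{i,j}=-\frac{\sigma_j}{\sigma_0^2}(X_i^2-\sigma_0)+\frac{1}{\sigma_0}(X_iX_{i-j}-\sigma_j)$ and suppose there exists a constant $c>0$ such that $\sigma_0>c$ and $\big\Vert\frac{1}{\sqrt T}\sum_{i=1}^T Z_{i,j}\big\Vert_2>c$ for all $j\in\mathcal{I}$. Then $$\sup_{x\in\mathbf{R}}\Big|Prob\Big(\max_{j\in\mathcal{I}}\sqrt T|\widehat\rho_j-\rho_j|\leq x\Big)-Prob\Big(\max_{j\in\mathcal{I}}|\zeta_j|\leq x\Big)\Big|=o(1),$$ where $\zeta_j$, $j\in\mathcal{I}$, are jointly Gaussian random variables with $\mathbf{E}\zeta_j=0$ and $\mathbf{E}\zeta_{j_1}\zeta_{j_2}=\frac1T\sum_{i_1=1}^T\sum_{i_2=1}^T\mathbf{E}Z_{i_1,j_1}Z_{i_2,j_2}$.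
   Context: Asymptotic framework: for each sample size $T$ there is a process $\{X_i\}_{i\in\mathbf{Z}}$ (which may be different for different $T$; this dependence is suppressed). All order notation is as $T\to\infty$; "constants" do not depend on $T$, while $d$ and the sets $\mathcal{H},\mathcal{I}$ may depend on $T$. For a random variable $X$ and $m\ge1$, $\Vert X\Vert_m=(\mathbf{E}|X|^m)^{1/m}$. Weakly stationary with mean zero: $\mathbf{E}X_i=0$ and $\mathbf{E}X_iX_{i-j}$ does not depend on $i$. Short range dependence: let $e_i$, $i\in\mathbf{Z}$, be independent (not necessarily identically distributed) random variables and $X_i=g_i(\dots,e_{i-2},e_{i-1},e_i)$ with measurable functions $g_i$, which may depend on $i$ and on $T$. Let $e_i^\dagger$, $i\in\mathbf{Z}$, be mutually independent, independent of all the $e_j$, with $e_i^\dagger$ distributed as $e_i$. For $k\ge0$ set $X_i(k)=g_i(\dots,e_{i-k-1},e^\dagger_{i-k},e_{i-k+1},\dots,e_i)$, and $X_i(k)=X_i$ for $k<0$. Let $\delta_m(k)=\sup_{i\in\mathbf{Z}}\Vert X_i-X_i(k)\Vert_m$. For constants $m\geq4$, $\alpha>1$, the $X_i$ are called $(m,\alpha)$-short range dependent if $\mathbf{E}X_i=0$ for all $i$, $\sup_{i}\Vert X_i\Vert_m=O(1)$, and $\sup_{k=0,1,\dots}(1+k)^\alpha\sum_{l=k}^\infty\delta_m(l)=O(1)$. *)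

theory Defs
  imports "HOL-Probability.Probability" "HOL-Library.Landau_Symbols"
begin

(* The L^m norm of a random variable, with values in [0,\<infinity>]. *)
definition Lnorm :: "'a measure \<Rightarrow> real \<Rightarrow> ('a \<Rightarrow> real) \<Rightarrow> ennreal" where
  "Lnorm M m Y =
     (let I = \<integral>\<^sup>+\<omega>. ennreal (\<bar>Y \<omega>\<bar> powr m) \<partial>M
      in if I = \<infinity> then \<infinity> else ennreal (enn2real I powr (1 / m)))"

definition weakly_stationary_mean_zero :: "'a measure \<Rightarrow> (int \<Rightarrow> 'a \<Rightarrow> real) \<Rightarrow> bool" where
  "weakly_stationary_mean_zero M X \<longleftrightarrow>
     (\<forall>i. integrable M (X i) \<and> (\<integral>\<omega>. X i \<omega> \<partial>M) = 0) \<and>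
     (\<forall>i j. integrable M (\<lambda>\<omega>. X i \<omega> * X (i - j) \<omega>)) \<and>
     (\<forall>i i' j. (\<integral>\<omega>. X i \<omega> * X (i - j) \<omega> \<partial>M) = (\<integral>\<omega>. X i' \<omega> * X (i' - j) \<omega> \<partial>M))"

(* The argument of g i is the past of the innovations, read backwards:
   its l-th coordinate is e (i - l). *)
definition causal_representation ::
  "'a measure \<Rightarrow> (int \<Rightarrow> 'a \<Rightarrow> real) \<Rightarrow> (int \<Rightarrow> (nat \<Rightarrow> real) \<Rightarrow> real) \<Rightarrow> (int \<Rightarrow> 'a \<Rightarrow> real) \<Rightarrow> bool" where
  "causal_representation M e g X \<longleftrightarrow>
     prob_space.indep_vars M (\<lambda>_. borel) e UNIV \<and>
     (\<forall>i. g i \<in> borel_measurable (PiM UNIV (\<lambda>_. borel))) \<and>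
     (\<forall>i. \<forall>\<omega>\<in>space M. X i \<omega> = g i (\<lambda>l. e (i - int l) \<omega>))"

(* Joint independence of the combined family says that the e' i are mutually independent
   and independent of all the (mutually independent) e j. *)
definition independent_copy ::
  "'a measure \<Rightarrow> (int \<Rightarrow> 'a \<Rightarrow> real) \<Rightarrow> (int \<Rightarrow> 'a \<Rightarrow> real) \<Rightarrow> bool" where
  "independent_copy M e e' \<longleftrightarrow>
     prob_space.indep_vars M (\<lambda>_. borel) (case_sum e e') UNIV \<and>
     (\<forall>i. distr M borel (e' i) = distr M borel (e i))"

definition coupled ::
  "(int \<Rightarrow> 'a \<Rightarrow> real) \<Rightarrow> (int \<Rightarrow> 'a \<Rightarrow> real) \<Rightarrow> (int \<Rightarrow> (nat \<Rightarrow> real) \<Rightarrow> real) \<Rightarrow> int \<Rightarrow> nat \<Rightarrow> 'a \<Rightarrow> real" where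
  "coupled e e' g i k \<omega> =
     g i (\<lambda>l. if l = k then e' (i - int k) \<omega> else e (i - int l) \<omega>)"

definition dependence_coeff ::
  "'a measure \<Rightarrow> (int \<Rightarrow> 'a \<Rightarrow> real) \<Rightarrow> (int \<Rightarrow> 'a \<Rightarrow> real) \<Rightarrow> (int \<Rightarrow> (nat \<Rightarrow> real) \<Rightarrow> real) \<Rightarrow>
   (int \<Rightarrow> 'a \<Rightarrow> real) \<Rightarrow> real \<Rightarrow> nat \<Rightarrow> ennreal" where
  "dependence_coeff M e e' g X m k = (SUP i. Lnorm M m (\<lambda>\<omega>. X i \<omega> - coupled e e' g i k \<omega>))"

(* Boundedness as T \<rightarrow> \<infinity> of a [0,\<infinity>]-valued sequence. *)
definition bigo_one :: "(nat \<Rightarrow> ennreal) \<Rightarrow> bool" where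
  "bigo_one a \<longleftrightarrow> (\<exists>C::real. \<forall>\<^sub>F T in sequentially. a T \<le> ennreal C)"

(* All objects are indexed by the sample size T \<ge> 1. *)
definition short_range_dependent ::
  "(nat \<Rightarrow> 'a measure) \<Rightarrow> (nat \<Rightarrow> int \<Rightarrow> 'a \<Rightarrow> real) \<Rightarrow> (nat \<Rightarrow> int \<Rightarrow> 'a \<Rightarrow> real) \<Rightarrow>
   (nat \<Rightarrow> int \<Rightarrow> (nat \<Rightarrow> real) \<Rightarrow> real) \<Rightarrow> (nat \<Rightarrow> int \<Rightarrow> 'a \<Rightarrow> real) \<Rightarrow> real \<Rightarrow> real \<Rightarrow> bool" where
  "short_range_dependent M e e' g X m \<alpha> \<longleftrightarrow>
     m \<ge> 4 \<and> \<alpha> > 1 \<and>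
     (\<forall>T\<ge>1. causal_representation (M T) (e T) (g T) (X T) \<and>
            independent_copy (M T) (e T) (e' T) \<and>
            (\<forall>i. integrable (M T) (X T i) \<and> (\<integral>\<omega>. X T i \<omega> \<partial>M T) = 0)) \<and>
     bigo_one (\<lambda>T. SUP i. Lnorm (M T) m (X T i)) \<and>
     bigo_one (\<lambda>T. SUP k. ennreal ((1 + real k) powr \<alpha>) *
                 (\<Sum>l. dependence_coeff (M T) (e T) (e' T) (g T) (X T) m (k + l)))"

(* E(X_i X_{i-j}); under weak stationarity the choice i = 0 is immaterial. *)
definition autocov :: "'a measure \<Rightarrow> (int \<Rightarrow> 'a \<Rightarrow> real) \<Rightarrow> nat \<Rightarrow> real" where
  "autocov M X j = (\<integral>\<omega>. X 0 \<omega> * X (0 - int j) \<omega> \<partial>M)"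

definition autocorr :: "'a measure \<Rightarrow> (int \<Rightarrow> 'a \<Rightarrow> real) \<Rightarrow> nat \<Rightarrow> real" where
  "autocorr M X j = autocov M X j / autocov M X 0"

definition sample_autocov :: "nat \<Rightarrow> (int \<Rightarrow> 'a \<Rightarrow> real) \<Rightarrow> nat \<Rightarrow> 'a \<Rightarrow> real" where
  "sample_autocov T X j \<omega> = (1 / real T) * (\<Sum>i = int j + 1..int T. X i \<omega> * X (i - int j) \<omega>)"

definition sample_autocorr :: "nat \<Rightarrow> (int \<Rightarrow> 'a \<Rightarrow> real) \<Rightarrow> nat \<Rightarrow> 'a \<Rightarrow> real" where
  "sample_autocorr T X j \<omega> = sample_autocov T X j \<omega> / sample_autocov T X 0 \<omega>"

definition cov_summand :: "'a measure \<Rightarrow> (int \<Rightarrow> 'a \<Rightarrow> real) \<Rightarrow> int \<Rightarrow> nat \<Rightarrow> 'a \<Rightarrow> real" where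
  "cov_summand M X i j \<omega> = X i \<omega> * X (i - int j) \<omega> - autocov M X j"

(* First-order (delta method) expansion of the ratio defining the sample autocorrelation. *)
definition corr_summand :: "'a measure \<Rightarrow> (int \<Rightarrow> 'a \<Rightarrow> real) \<Rightarrow> int \<Rightarrow> nat \<Rightarrow> 'a \<Rightarrow> real" where
  "corr_summand M X i j \<omega> =
     - (autocov M X j / (autocov M X 0)\<^sup>2) * ((X i \<omega>)\<^sup>2 - autocov M X 0)
     + (1 / autocov M X 0) * (X i \<omega> * X (i - int j) \<omega> - autocov M X j)"

definition scaled_sum :: "nat \<Rightarrow> (int \<Rightarrow> nat \<Rightarrow> 'a \<Rightarrow> real) \<Rightarrow> nat \<Rightarrow> 'a \<Rightarrow> real" where
  "scaled_sum T W j \<omega> = (1 / sqrt (real T)) * (\<Sum>i = 1..int T. W i j \<omega>)"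

definition scaled_sum_cov ::
  "'a measure \<Rightarrow> nat \<Rightarrow> (int \<Rightarrow> nat \<Rightarrow> 'a \<Rightarrow> real) \<Rightarrow> nat \<Rightarrow> nat \<Rightarrow> real" where
  "scaled_sum_cov M T W j1 j2 =
     (1 / real T) * (\<Sum>i1 = 1..int T. \<Sum>i2 = 1..int T. \<integral>\<omega>. W i1 j1 \<omega> * W i2 j2 \<omega> \<partial>M)"

(* Every linear combination is normal; the variance may be zero, in which case the law is
   a point mass. *)
definition jointly_gaussian :: "'b measure \<Rightarrow> nat set \<Rightarrow> (nat \<Rightarrow> 'b \<Rightarrow> real) \<Rightarrow> bool" where
  "jointly_gaussian N J \<xi> \<longleftrightarrow>
     (\<forall>j\<in>J. \<xi> j \<in> borel_measurable N) \<and>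
     (\<forall>a. \<exists>\<mu> s. s \<ge> 0 \<and>
        distr N borel (\<lambda>\<omega>. \<Sum>j\<in>J. a j * \<xi> j \<omega>) =
          (if s = 0 then return borel \<mu> else density lborel (\<lambda>x. ennreal (normal_density \<mu> s x))))"

definition centered_gaussian ::
  "'b measure \<Rightarrow> nat set \<Rightarrow> (nat \<Rightarrow> 'b \<Rightarrow> real) \<Rightarrow> (nat \<Rightarrow> nat \<Rightarrow> real) \<Rightarrow> bool" where
  "centered_gaussian N J \<xi> \<Gamma> \<longleftrightarrow>
     prob_space N \<and> jointly_gaussian N J \<xi> \<and>
     (\<forall>j\<in>J. (\<integral>\<omega>. \<xi> j \<omega> \<partial>N) = 0) \<and>
     (\<forall>j1\<in>J. \<forall>j2\<in>J. (\<integral>\<omega>. \<xi> j1 \<omega> * \<xi> j2 \<omega> \<partial>N) = \<Gamma> j1 j2)"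

definition kolmogorov_dist ::
  "'a measure \<Rightarrow> ('a \<Rightarrow> real) \<Rightarrow> 'b measure \<Rightarrow> ('b \<Rightarrow> real) \<Rightarrow> real" where
  "kolmogorov_dist M U N V =
     (SUP x. \<bar>\<P>(\<omega> in M. U \<omega> \<le> x) - \<P>(\<omega> in N. V \<omega> \<le> x)\<bar>)"

end

theory Submission
  imports Defs "HOL-Real_Asymp.Real_Asymp"
begin

text \<open>
  The sample autocovariances are, up to a remainder, normalized sums of \<open>X i * X (i - j) - \<sigma> j\<close>; for the
  autocorrelations the delta method leads to sums of the \<open>Z i j\<close>. Realising the process as a function of independent
  coordinates, the summands are replaced by their conditional expectations given the last \<open>L\<close> innovations. The error is
  controlled by martingale projections, whose sizes are the dependence coefficients.

  For the resulting \<open>L\<close>-dependent sums, the events \<open>max \<bar>w j\<bar> \<le> x\<close> are approximated by products \<open>\<Prod>j. \<phi> (w j)\<close> of smooth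
  bumps. Along the interpolation \<open>sqrt s * W + sqrt (1 - s) * \<xi>\<close>, Gaussian integration by parts and a leave-out Taylor
  expansion bound the change of the expectation of such a product. Since the third derivatives are bounded, the cost in
  the number of lags is a fixed power, affordable because the assumptions on the exponents force \<open>\<beta>\<^sub>X < 1/48\<close>.
  Finally each Gaussian coordinate has variance at least \<open>c\<^sup>2\<close>, so a union bound over the lags gives the
  anti-concentration needed to return from bumps to indicators.
\<close>

subsection \<open>Smooth bumps and their products\<close>

text \<open>Under the product law of the innovations a conditional expectation is an everywhere
  defined integral over resampled coordinates, independence is disjointness of the coordinate sets
  involved, and dependence coefficients are norms of single-coordinate resamplings. The
  interpolation is run through with sqrt s = sin t, so that its speed stays bounded at both ends.
  Products of bumps fit because undifferentiated factors are at most 1: a mixed partial of order n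
  is at most \<open>\<beta> ^ n\<close> for any number of lags, and the sums over lags are absorbed
  by one random envelope of the summands near an index. Slope b, width t, truncation lag L and
  number p of lags have to be balanced: the comparison costs about b^3 L^3 p^3 / sqrt T + b^2 p^2 /
  L^2, smoothing wants b t large, anti-concentration wants p t small. With p of order T^(1/48), the
  choice L = T^(1/12), b = T^(1/24), t = T^(-1/32) meets all demands. Eighth moments give products
  of two observations fourth moments, and a tail exponent above 2 gives the decay 1 / L^2.\<close>

definition logistic :: "real \<Rightarrow> real" where
  "logistic u = 1 / (1 + exp (- u))"

lemma logistic_pos: "0 < logistic u" and logistic_less_1: "logistic u < 1"
  by (auto simp: logistic_def field_simps add_pos_pos)

lemma DERIV_logistic:
  "(logistic has_real_derivative logistic u * (1 - logistic u)) (at u)"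
proof -
  have [simp]: "1 + exp (- u) \<noteq> 0" by (metis add_pos_pos exp_gt_zero less_irrefl zero_less_one)
  show ?thesis unfolding logistic_def
    by (auto intro!: derivative_eq_intros simp: field_simps power2_eq_square)
qed

text \<open>Since (1 - x)(1 + x) <= 1 at x = exp (- u). Exponential tails on both sides make the
  smoothing error exponentially small in slope times width.\<close>

lemma logistic_ge: "1 - exp (- u) \<le> logistic u"
proof -
  have "(1 - exp (- u)) * (1 + exp (- u)) \<le> 1"
    by (simp add: algebra_simps)
  then show ?thesis by (simp add: logistic_def pos_le_divide_eq add_pos_pos)
qed

lemma logistic_le: "logistic u \<le> exp u"
  by (simp add: logistic_def field_simps exp_minus add_pos_pos)

text \<open>The derivatives of the bump \<open>logistic (b (x - u)) * logistic (b (x + u))\<close> are polynomials in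
  the two factors, because \<open>logistic' = logistic (1 - logistic)\<close>.\<close>

fun bump_poly :: "nat \<Rightarrow> real \<Rightarrow> real \<Rightarrow> real" where
  "bump_poly 0 a b = a * b"
| "bump_poly (Suc 0) a b = a * b * (a - b)"
| "bump_poly (Suc (Suc 0)) a b = a * b * (2*a^2 + 2*b^2 - 2*a*b - a - b)"
| "bump_poly (Suc (Suc (Suc n))) a b =
     - (a * (1 - a)) * (6*a^2*b + 2*b^3 - 4*a*b^2 - 2*a*b - b^2)
     + (b * (1 - b)) * (6*a*b^2 + 2*a^3 - 4*a^2*b - 2*a*b - a^2)"

text \<open>The index n is the order of the derivative in u, with the chain-rule factor
  \<open>b ^ n\<close> kept outside; n = 0 is a smooth indicator of [-x, x]. A negative x, for which
  the interval is empty, is allowed.\<close>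

definition bump :: "real \<Rightarrow> real \<Rightarrow> nat \<Rightarrow> real \<Rightarrow> real" where
  "bump b x n u = b ^ n * bump_poly n (logistic (b * (x - u))) (logistic (b * (x + u)))"

text \<open>The restriction on n reflects that from order 3 on \<open>bump_poly\<close> repeats the
  same polynomial and no longer follows the derivatives.\<close>

lemma DERIV_bump:
  assumes "n < 3"
  shows "(bump b x n has_real_derivative bump b x (Suc n) u) (at u)"
proof -
  define p q where "p = (\<lambda>u. logistic (b * (x - u)))" and "q = (\<lambda>u. logistic (b * (x + u)))"
  have p': "(p has_real_derivative - b * (p u * (1 - p u))) (at u)"
    unfolding p_def by (rule DERIV_chain2[OF DERIV_logistic, THEN DERIV_cong]) (auto intro!: derivative_eq_intros)
  have q': "(q has_real_derivative b * (q u * (1 - q u))) (at u)"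
    unfolding q_def by (rule DERIV_chain2[OF DERIV_logistic, THEN DERIV_cong]) (auto intro!: derivative_eq_intros)
  note [derivative_intros] = p' q'
  have b_eq: "bump b x k = (\<lambda>u. b ^ k * bump_poly k (p u) (q u))" for k
    by (simp add: bump_def p_def q_def fun_eq_iff)
  consider "n = 0" | "n = Suc 0" | "n = Suc (Suc 0)" using assms by linarith
  then show ?thesis
    unfolding b_eq
    by cases (auto intro!: derivative_eq_intros simp: algebra_simps power2_eq_square power3_eq_cube)
qed

lemma abs_mult_le_bounds:
  fixes a b :: real
  assumes "\<bar>a\<bar> \<le> c" "\<bar>b\<bar> \<le> d"
  shows "\<bar>a * b\<bar> \<le> c * d"
  using assms by (simp add: abs_mult mult_mono)

text \<open>Every monomial in a and b lies in [0, 1], so counting coefficients suffices. The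
  constant 8 is generous; the geometric form \<open>8 ^ n\<close> matters, because such bounds
  multiply to one that depends on the total order alone.\<close>

lemma bump_poly_bound:
  assumes "0 \<le> a" "a \<le> 1" "0 \<le> b" "b \<le> 1" "n \<le> 3"
  shows "\<bar>bump_poly n a b\<bar> \<le> 8 ^ n"
proof -
  have m: "0 \<le> a * b" "a * b \<le> 1" "0 \<le> a^2" "a^2 \<le> 1" "0 \<le> b^2" "b^2 \<le> 1"
    "0 \<le> a^3" "a^3 \<le> 1" "0 \<le> b^3" "b^3 \<le> 1" "0 \<le> a^2 * b" "a^2 * b \<le> 1" "0 \<le> a * b^2" "a * b^2 \<le> 1"
    "0 \<le> a * (1 - a)" "a * (1 - a) \<le> 1" "0 \<le> b * (1 - b)" "b * (1 - b) \<le> 1"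
    using assms by (auto intro: mult_le_one power_le_one)
  consider "n = 0" | "n = Suc 0" | "n = Suc (Suc 0)" | "n = Suc (Suc (Suc 0))" using assms by linarith
  then show ?thesis
  proof cases
    case 1 then show ?thesis using m by simp
  next
    case 2
    have "\<bar>a * b * (a - b)\<bar> \<le> 1 * 8" using m assms by (intro abs_mult_le_bounds) auto
    with 2 show ?thesis by simp
  next
    case 3
    have "\<bar>a * b * (2*a^2 + 2*b^2 - 2*a*b - a - b)\<bar> \<le> 1 * 64"
      using m assms by (intro abs_mult_le_bounds) linarith+
    with 3 show ?thesis by simp
  next
    case 4
    have "\<bar>(a * (1 - a)) * (6*a^2*b + 2*b^3 - 4*a*b^2 - 2*a*b - b^2)\<bar> \<le> 1 * 16"
      using m assms by (intro abs_mult_le_bounds) linarith+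
    moreover have "\<bar>(b * (1 - b)) * (6*a*b^2 + 2*a^3 - 4*a^2*b - 2*a*b - a^2)\<bar> \<le> 1 * 16"
      using m assms by (intro abs_mult_le_bounds) linarith+
    ultimately show ?thesis using 4 by simp
  qed
qed

lemma bump_bound:
  assumes "n \<le> 3" "0 \<le> b"
  shows "\<bar>bump b x n u\<bar> \<le> (8 * b) ^ n"
proof -
  have "\<bar>bump b x n u\<bar> = b ^ n * \<bar>bump_poly n (logistic (b * (x - u))) (logistic (b * (x + u)))\<bar>"
    using assms by (simp add: bump_def abs_mult)
  also have "\<dots> \<le> b ^ n * 8 ^ n"
    using assms bump_poly_bound[OF _ _ _ _ \<open>n \<le> 3\<close>] logistic_pos logistic_less_1
    by (intro mult_left_mono) (auto simp: less_imp_le)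
  finally show ?thesis by (simp add: power_mult_distrib mult.commute)
qed

lemma bump_0_range: "0 \<le> bump b x 0 u" "bump b x 0 u \<le> 1"
  using logistic_pos logistic_less_1
  by (auto simp: bump_def intro!: mult_le_one simp: less_imp_le)

text \<open>For factors p, q below 1, (1 - p)(1 - q) >= 0 gives p q >= p + q - 1, and inside the
  interval each factor misses 1 by at most \<open>exp (- (b * t))\<close>; hence the 2.\<close>

lemma bump_0_inside:
  assumes "\<bar>u\<bar> \<le> x - t" "0 \<le> b"
  shows "1 - 2 * exp (- (b * t)) \<le> bump b x 0 u"
proof -
  let ?p = "logistic (b * (x - u))" and ?q = "logistic (b * (x + u))"
  have "1 - exp (- (b * t)) \<le> 1 - exp (- (b * (x - u)))" "1 - exp (- (b * t)) \<le> 1 - exp (- (b * (x + u)))"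
    using assms by (auto simp: abs_le_iff intro!: mult_left_mono)
  then have "1 - exp (- (b * t)) \<le> ?p" "1 - exp (- (b * t)) \<le> ?q"
    using logistic_ge order_trans by blast+
  moreover have "0 \<le> (1 - ?p) * (1 - ?q)" using logistic_less_1 by (simp add: less_imp_le)
  ultimately show ?thesis by (simp add: bump_def algebra_simps)
qed

text \<open>The product is at most each factor, and on either side of the interval one of the two
  arguments is at most \<open>- (b * t)\<close>.\<close>

lemma bump_0_outside:
  assumes "\<bar>u\<bar> \<ge> x + t" "0 \<le> b"
  shows "bump b x 0 u \<le> exp (- (b * t))"
proof -
  let ?p = "logistic (b * (x - u))" and ?q = "logistic (b * (x + u))"
  have *: "?p * ?q \<le> ?p" "?p * ?q \<le> ?q"
    using logistic_less_1 logistic_pos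
    by (auto simp: less_imp_le intro!: mult_left_le mult_left_le_one_le)
  have "x - u \<le> - t \<or> x + u \<le> - t" using assms by linarith
  then have "b * (x - u) \<le> - (b * t) \<or> b * (x + u) \<le> - (b * t)"
    using mult_left_mono[OF _ \<open>0 \<le> b\<close>] by (metis mult_minus_right)
  then have "?p \<le> exp (- (b * t)) \<or> ?q \<le> exp (- (b * t))"
    using logistic_le order_trans exp_le_cancel_iff by meson
  then show ?thesis using * by (auto simp: bump_def)
qed

text \<open>The case n = 0 of \<open>factor_bound\<close> says that undifferentiated factors are at
  most 1 in modulus; this frees all derivative bounds below from the number of coordinates.\<close>

locale smooth_product =
  fixes J :: "'i set" and \<phi> :: "nat \<Rightarrow> real \<Rightarrow> real" and \<beta> :: real
  assumes finite_J: "finite J"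
    and DERIV_factor: "\<And>n u. n < 3 \<Longrightarrow> (\<phi> n has_real_derivative \<phi> (Suc n) u) (at u)"
    and factor_bound: "\<And>n u. n \<le> 3 \<Longrightarrow> \<bar>\<phi> n u\<bar> \<le> \<beta> ^ n"
    and \<beta>_nonneg: "0 \<le> \<beta>"
begin

text \<open>\<open>G \<nu>\<close> is the mixed partial derivative of \<open>w \<mapsto> \<Prod>k\<in>J. \<phi> 0 (w k)\<close> with multi-index \<open>\<nu>\<close>.\<close>

definition G :: "('i \<Rightarrow> nat) \<Rightarrow> ('i \<Rightarrow> real) \<Rightarrow> real" where
  "G \<nu> w = (\<Prod>k\<in>J. \<phi> (\<nu> k) (w k))"

abbreviation incr :: "('i \<Rightarrow> nat) \<Rightarrow> 'i \<Rightarrow> 'i \<Rightarrow> nat" where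
  "incr \<nu> l \<equiv> \<nu>(l := Suc (\<nu> l))"

abbreviation e0 :: "'i \<Rightarrow> nat" where "e0 \<equiv> \<lambda>_. 0"
definition e1 :: "'i \<Rightarrow> 'i \<Rightarrow> nat" where "e1 j = incr e0 j"
text \<open>\<open>incr\<close> adds to the current entry, so \<open>e2 j j\<close> has the single
  entry 2: pure and mixed second derivatives share one notation.\<close>

definition e2 :: "'i \<Rightarrow> 'i \<Rightarrow> 'i \<Rightarrow> nat" where "e2 j l = incr (e1 j) l"

lemma sum_incr: "l \<in> J \<Longrightarrow> sum (incr \<nu> l) J = Suc (sum \<nu> J)"
  using finite_J by (simp add: sum.remove[of J l])

lemma DERIV_G:
  assumes "\<And>k. k \<in> J \<Longrightarrow> \<nu> k < 3"
    and "\<And>k. k \<in> J \<Longrightarrow> ((\<lambda>u. w u k) has_real_derivative w' k) (at t)"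
  shows "((\<lambda>u. G \<nu> (w u)) has_real_derivative (\<Sum>l\<in>J. w' l * G (incr \<nu> l) (w t))) (at t)"
proof -
  have "((\<lambda>u. G \<nu> (w u)) has_real_derivative
      (\<Sum>l\<in>J. (\<phi> (Suc (\<nu> l)) (w t l) * w' l) * (\<Prod>k\<in>J-{l}. \<phi> (\<nu> k) (w t k)))) (at t)"
    unfolding G_def using assms
    by (intro has_field_derivative_prod DERIV_chain2[OF DERIV_factor]) auto
  also have "(\<Sum>l\<in>J. (\<phi> (Suc (\<nu> l)) (w t l) * w' l) * (\<Prod>k\<in>J-{l}. \<phi> (\<nu> k) (w t k)))
      = (\<Sum>l\<in>J. w' l * G (incr \<nu> l) (w t))"
  proof (intro sum.cong refl)
    fix l assume "l \<in> J"
    then show "(\<phi> (Suc (\<nu> l)) (w t l) * w' l) * (\<Prod>k\<in>J-{l}. \<phi> (\<nu> k) (w t k)) = w' l * G (incr \<nu> l) (w t)"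
      using finite_J by (simp add: G_def prod.remove[of J l])
  qed
  finally show ?thesis .
qed

lemma G_bound:
  assumes "sum \<nu> J \<le> 3"
  shows "\<bar>G \<nu> w\<bar> \<le> \<beta> ^ sum \<nu> J"
proof -
  have "\<nu> k \<le> 3" if "k \<in> J" for k
    using member_le_sum[of k J \<nu>] that finite_J assms by auto
  then have "(\<Prod>k\<in>J. \<bar>\<phi> (\<nu> k) (w k)\<bar>) \<le> (\<Prod>k\<in>J. \<beta> ^ \<nu> k)"
    by (intro prod_mono) (auto simp: factor_bound)
  then show ?thesis by (simp add: G_def abs_prod power_sum)
qed

text \<open>Mean value theorem on the segment from p to p + q; total order below 3 leaves room for
  one further derivative.\<close>

lemma line_MVT:
  assumes "sum \<nu> J < 3"
  obtains u where "0 < u" "u < 1"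
    "G \<nu> (\<lambda>k. p k + q k) - G \<nu> p = (\<Sum>l\<in>J. q l * G (incr \<nu> l) (\<lambda>k. p k + u * q k))"
proof -
  have *: "\<nu> k < 3" if "k \<in> J" for k
    using member_le_sum[of k J \<nu>] that finite_J assms by auto
  have "\<exists>u>0. u < 1 \<and> G \<nu> (\<lambda>k. p k + 1 * q k) - G \<nu> (\<lambda>k. p k + 0 * q k)
      = (1 - 0) * (\<Sum>l\<in>J. q l * G (incr \<nu> l) (\<lambda>k. p k + u * q k))"
    by (rule MVT2) (auto intro!: DERIV_G derivative_eq_intros *)
  then show ?thesis using that by auto
qed

text \<open>Each first partial is bounded separately, so distances are measured in the sum norm over
  coordinates; this is the norm that the envelope of the summands controls later.\<close>

lemma G_lipschitz:
  assumes "sum \<nu> J < 3"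
  shows "\<bar>G \<nu> w - G \<nu> w'\<bar> \<le> \<beta> ^ Suc (sum \<nu> J) * (\<Sum>l\<in>J. \<bar>w l - w' l\<bar>)"
proof -
  obtain u where u: "G \<nu> (\<lambda>k. w' k + (w k - w' k)) - G \<nu> w' =
      (\<Sum>l\<in>J. (w l - w' l) * G (incr \<nu> l) (\<lambda>k. w' k + u * (w k - w' k)))"
    by (rule line_MVT[OF assms, of w' "\<lambda>k. w k - w' k"])
  have "\<bar>\<Sum>l\<in>J. (w l - w' l) * G (incr \<nu> l) (\<lambda>k. w' k + u * (w k - w' k))\<bar>
      \<le> (\<Sum>l\<in>J. \<bar>w l - w' l\<bar> * \<beta> ^ Suc (sum \<nu> J))"
  proof (rule order_trans[OF sum_abs], intro sum_mono)
    fix l assume "l \<in> J"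
    then have "\<bar>G (incr \<nu> l) (\<lambda>k. w' k + u * (w k - w' k))\<bar> \<le> \<beta> ^ Suc (sum \<nu> J)"
      using G_bound[of "incr \<nu> l"] assms by (simp only: sum_incr)
    then show "\<bar>(w l - w' l) * G (incr \<nu> l) (\<lambda>k. w' k + u * (w k - w' k))\<bar>
        \<le> \<bar>w l - w' l\<bar> * \<beta> ^ Suc (sum \<nu> J)"
      by (simp only: abs_mult mult_left_mono abs_ge_zero)
  qed
  then show ?thesis using u by (simp add: sum_distrib_left mult.commute)
qed

text \<open>The first-order term is evaluated at an arbitrary nearby point \<open>r\<close>; in the leave-out argument
  \<open>r\<close> omits a larger neighbourhood than \<open>p\<close> does.\<close>

lemma G_taylor:
  assumes "sum \<nu> J < 2"
  shows "\<bar>G \<nu> (\<lambda>k. p k + q k) - G \<nu> p - (\<Sum>l\<in>J. q l * G (incr \<nu> l) r)\<bar>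
    \<le> \<beta> ^ Suc (Suc (sum \<nu> J)) * (\<Sum>l\<in>J. \<bar>q l\<bar>) * (\<Sum>l\<in>J. \<bar>p l - r l\<bar> + \<bar>q l\<bar>)"
proof -
  obtain u where u01: "0 < u" "u < 1" and u: "G \<nu> (\<lambda>k. p k + q k) - G \<nu> p =
      (\<Sum>l\<in>J. q l * G (incr \<nu> l) (\<lambda>k. p k + u * q k))"
    using line_MVT[of \<nu> p q] assms by auto
  have "\<bar>\<Sum>l\<in>J. q l * (G (incr \<nu> l) (\<lambda>k. p k + u * q k) - G (incr \<nu> l) r)\<bar>
      \<le> (\<Sum>l\<in>J. \<bar>q l\<bar> * (\<beta> ^ Suc (Suc (sum \<nu> J)) * (\<Sum>l\<in>J. \<bar>p l - r l\<bar> + \<bar>q l\<bar>)))"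
  proof (rule order_trans[OF sum_abs], intro sum_mono)
    fix l assume l: "l \<in> J"
    have "\<bar>G (incr \<nu> l) (\<lambda>k. p k + u * q k) - G (incr \<nu> l) r\<bar>
        \<le> \<beta> ^ Suc (sum (incr \<nu> l) J) * (\<Sum>k\<in>J. \<bar>p k + u * q k - r k\<bar>)"
      using l assms by (intro G_lipschitz) (simp only: sum_incr)
    also have "sum (incr \<nu> l) J = Suc (sum \<nu> J)"
      by (rule sum_incr[OF l])
    also have "\<beta> ^ Suc (Suc (sum \<nu> J)) * (\<Sum>k\<in>J. \<bar>p k + u * q k - r k\<bar>) \<le>
        \<beta> ^ Suc (Suc (sum \<nu> J)) * (\<Sum>l\<in>J. \<bar>p l - r l\<bar> + \<bar>q l\<bar>)"
    proof (intro mult_left_mono sum_mono)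
      fix k
      have "\<bar>u * q k\<bar> \<le> 1 * \<bar>q k\<bar>"
        unfolding abs_mult using u01 by (intro mult_right_mono) auto
      then show "\<bar>p k + u * q k - r k\<bar> \<le> \<bar>p k - r k\<bar> + \<bar>q k\<bar>" by linarith
    qed (use \<beta>_nonneg in auto)
    finally show "\<bar>q l * (G (incr \<nu> l) (\<lambda>k. p k + u * q k) - G (incr \<nu> l) r)\<bar>
        \<le> \<bar>q l\<bar> * (\<beta> ^ Suc (Suc (sum \<nu> J)) * (\<Sum>l\<in>J. \<bar>p l - r l\<bar> + \<bar>q l\<bar>))"
      by (simp only: abs_mult mult_left_mono abs_ge_zero)
  qed
  also have "\<dots> = \<beta> ^ Suc (Suc (sum \<nu> J)) * (\<Sum>l\<in>J. \<bar>q l\<bar>) * (\<Sum>l\<in>J. \<bar>p l - r l\<bar> + \<bar>q l\<bar>)"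
    by (simp add: sum_distrib_right sum_distrib_left mult_ac)
  also have "(\<Sum>l\<in>J. q l * (G (incr \<nu> l) (\<lambda>k. p k + u * q k) - G (incr \<nu> l) r)) =
     G \<nu> (\<lambda>k. p k + q k) - G \<nu> p - (\<Sum>l\<in>J. q l * G (incr \<nu> l) r)"
    by (simp only: u right_diff_distrib sum_subtractf)
  finally show ?thesis .
qed

lemma sum_e0: "sum e0 J = 0"
  by simp

lemma sum_e1: "j \<in> J \<Longrightarrow> sum (e1 j) J = 1"
  unfolding e1_def by (rule trans[OF sum_incr]) (auto simp: sum_e0)

lemma sum_e2: "j \<in> J \<Longrightarrow> l \<in> J \<Longrightarrow> sum (e2 j l) J = 2"
  unfolding e2_def by (rule trans[OF sum_incr]) (assumption, subst sum_e1, auto)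

lemma sum_e2_less: "j \<in> J \<Longrightarrow> l \<in> J \<Longrightarrow> sum (e2 j l) J < 3"
  by (simp only: sum_e2)

lemma sum_e1_less: "j \<in> J \<Longrightarrow> sum (e1 j) J < 3"
  by (simp only: sum_e1)

lemma G_e1_bound: "j \<in> J \<Longrightarrow> \<bar>G (e1 j) v\<bar> \<le> \<beta>"
  using G_bound[of "e1 j" v] sum_e1[of j] by simp

lemma G_e2_bound: "j \<in> J \<Longrightarrow> l \<in> J \<Longrightarrow> \<bar>G (e2 j l) v\<bar> \<le> \<beta>\<^sup>2"
  using G_bound[of "e2 j l" v] sum_e2[of j l] by simp

lemma borel_measurable_factor[measurable]:
  assumes "n < 3"
  shows "\<phi> n \<in> borel_measurable borel"
  by (intro borel_measurable_continuous_onI continuous_at_imp_continuous_on ballI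
      DERIV_isCont[OF DERIV_factor[OF assms]])

lemma borel_measurable_G:
  assumes "sum \<nu> J < 3" "\<And>k. k \<in> J \<Longrightarrow> (\<lambda>x. w x k) \<in> borel_measurable M"
  shows "(\<lambda>x. G \<nu> (w x)) \<in> borel_measurable M"
  unfolding G_def
proof (intro borel_measurable_prod)
  fix k assume k: "k \<in> J"
  then have "\<nu> k < 3" using member_le_sum[of k J \<nu>] finite_J assms by auto
  then show "(\<lambda>x. \<phi> (\<nu> k) (w x k)) \<in> borel_measurable M"
    by (rule measurable_compose[OF assms(2)[OF k] borel_measurable_factor])
qed

end

section \<open>Joint laws are determined by trigonometric integrals of linear combinations\<close>

lemma integrable_mult_bounded:
  fixes u g :: "'a \<Rightarrow> real"
  assumes "integrable N u" "g \<in> borel_measurable N" "\<And>x. \<bar>g x\<bar> \<le> C"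
  shows "integrable N (\<lambda>x. u x * g x)"
proof (rule Bochner_Integration.integrable_bound)
  show "integrable N (\<lambda>x. C * \<bar>u x\<bar>)" using assms by auto
  show "AE x in N. norm (u x * g x) \<le> norm (C * \<bar>u x\<bar>)"
  proof (intro AE_I2)
    fix x
    have "\<bar>g x\<bar> \<le> \<bar>C\<bar>" using assms(3)[of x] by linarith
    then show "norm (u x * g x) \<le> norm (C * \<bar>u x\<bar>)"
      by (simp add: abs_mult mult.commute mult_right_mono)
  qed
qed (use assms in measurable)

lemma integral_weighted_distr:
  fixes u V :: "'a \<Rightarrow> real" and f :: "real \<Rightarrow> 'd::{banach, second_countable_topology}"
  assumes [measurable]: "u \<in> borel_measurable N" "V \<in> borel_measurable N" "f \<in> borel_measurable borel"
    and u: "\<And>x. 0 \<le> u x" and m: "0 < m"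
  shows "(\<integral>y. f y \<partial>distr (density N (\<lambda>x. ennreal (u x / m))) borel V) = (\<integral>x. (u x / m) *\<^sub>R f (V x) \<partial>N)"
  using u m by (subst integral_distr) (auto intro!: integral_density)

lemma real_distribution_weighted:
  fixes u V :: "'a \<Rightarrow> real"
  assumes u: "integrable N u" "\<And>x. 0 \<le> u x" and V[measurable]: "V \<in> borel_measurable N"
    and m: "0 < m" "(\<integral>x. u x \<partial>N) = m"
  shows "real_distribution (distr (density N (\<lambda>x. ennreal (u x / m))) borel V)"
proof -
  note [measurable] = borel_measurable_integrable[OF u(1)]
  have "(\<integral>\<^sup>+x. ennreal (u x / m) \<partial>N) = ennreal (\<integral>x. u x / m \<partial>N)"
    using u m by (intro nn_integral_eq_integral) auto
  also have "\<dots> = 1" using m by simp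
  finally have "prob_space (density N (\<lambda>x. ennreal (u x / m)))"
    by (intro prob_spaceI) (simp add: emeasure_density cong: nn_integral_cong)
  then interpret D: prob_space "density N (\<lambda>x. ennreal (u x / m))" .
  show ?thesis by simp
qed

lemma char_weighted:
  fixes u V :: "'a \<Rightarrow> real"
  assumes u: "integrable N u" "\<And>x. 0 \<le> u x" and V[measurable]: "V \<in> borel_measurable N" and m: "0 < m"
  shows "char (distr (density N (\<lambda>x. ennreal (u x / m))) borel V) t
        = Complex ((\<integral>x. u x * cos (t * V x) \<partial>N) / m) ((\<integral>x. u x * sin (t * V x) \<partial>N) / m)"
proof -
  note [measurable] = borel_measurable_integrable[OF u(1)]
  have int: "integrable N (\<lambda>x. (u x / m) *\<^sub>R iexp (t * V x))"
  proof (rule Bochner_Integration.integrable_bound)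
    show "integrable N (\<lambda>x. u x / m)" using u by simp
  qed (auto simp: norm_mult)
  have "char (distr (density N (\<lambda>x. ennreal (u x / m))) borel V) t = (\<integral>x. (u x / m) *\<^sub>R iexp (t * V x) \<partial>N)"
    unfolding char_def using u m by (subst integral_weighted_distr) auto
  also have "\<dots> = Complex ((\<integral>x. u x * cos (t * V x) \<partial>N) / m) ((\<integral>x. u x * sin (t * V x) \<partial>N) / m)"
    using int by (intro complex_eqI)
      (simp_all add: integral_Re[symmetric] integral_Im[symmetric] Re_exp Im_exp del: integral_Re integral_Im)
  finally show ?thesis .
qed

lemma integral_weight_null:
  fixes u g :: "'a \<Rightarrow> real"
  assumes "integrable N u" "\<And>x. 0 \<le> u x" and "(\<integral>x. u x \<partial>N) = 0"
  shows "(\<integral>x. u x * g x \<partial>N) = 0"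
proof -
  have "AE x in N. u x = 0"
    using assms by (subst integral_nonneg_eq_0_iff_AE[symmetric]) auto
  then have "AE x in N. u x * g x = 0" by eventually_elim simp
  then show ?thesis by (rule integral_eq_zero_AE)
qed

text \<open>The weights, divided by their common total mass m, are probability densities, and the
  two trigonometric hypotheses equate the characteristic functions of the resulting image laws. Mass
  0 is treated apart because the division fails there.\<close>

lemma weighted_uniqueness:
  fixes u1 V1 :: "'a \<Rightarrow> real" and u2 V2 :: "'b \<Rightarrow> real"
  assumes u1: "integrable N1 u1" "\<And>x. 0 \<le> u1 x" and V1[measurable]: "V1 \<in> borel_measurable N1"
    and u2: "integrable N2 u2" "\<And>x. 0 \<le> u2 x" and V2[measurable]: "V2 \<in> borel_measurable N2"
    and cos_eq: "\<And>s. (\<integral>x. u1 x * cos (s * V1 x) \<partial>N1) = (\<integral>x. u2 x * cos (s * V2 x) \<partial>N2)"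
    and sin_eq: "\<And>s. (\<integral>x. u1 x * sin (s * V1 x) \<partial>N1) = (\<integral>x. u2 x * sin (s * V2 x) \<partial>N2)"
    and B: "B \<in> sets borel"
  shows "(\<integral>x. u1 x * indicator B (V1 x) \<partial>N1) = (\<integral>x. u2 x * indicator B (V2 x) \<partial>N2)"
proof -
  define m where "m = (\<integral>x. u1 x \<partial>N1)"
  have m2: "m = (\<integral>x. u2 x \<partial>N2)" using cos_eq[of 0] by (simp add: m_def)
  have m0: "0 \<le> m" unfolding m_def using u1 by (intro integral_nonneg_AE) auto
  note [measurable] = borel_measurable_integrable[OF u1(1)] borel_measurable_integrable[OF u2(1)]
  show ?thesis
  proof (cases "m = 0")
    case True
    show ?thesis
      using integral_weight_null[OF u1] integral_weight_null[OF u2] m2 True by (simp add: m_def)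
  next
    case False
    then have m: "m > 0" using m0 by simp
    have eq: "distr (density N1 (\<lambda>x. ennreal (u1 x / m))) borel V1 = distr (density N2 (\<lambda>x. ennreal (u2 x / m))) borel V2"
      by (intro Levy_uniqueness real_distribution_weighted ext u1 u2 V1 V2 m m_def[symmetric] m2[symmetric])
         (simp add: char_weighted u1 u2 m cos_eq sin_eq)
    have "(\<integral>x. (u1 x / m) *\<^sub>R (indicator B (V1 x) :: real) \<partial>N1) = (\<integral>x. (u2 x / m) *\<^sub>R indicator B (V2 x) \<partial>N2)"
      using integral_weighted_distr[OF _ _ _ _ m, of u1 N1 V1 "indicator B :: real \<Rightarrow> real"]
        integral_weighted_distr[OF _ _ _ _ m, of u2 N2 V2 "indicator B :: real \<Rightarrow> real"] B u1 u2 m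
      by (simp add: eq)
    then show ?thesis using m by simp
  qed
qed

text \<open>Induction over the coordinates: an indicator of one coordinate is absorbed into the weight, which is
  possible because \<open>1 + cos\<close> and \<open>1 + sin\<close> are nonnegative, so the one-dimensional uniqueness theorem applies.\<close>

lemma weighted_uniqueness_box:
  fixes u1 :: "'a \<Rightarrow> real" and u2 :: "'b \<Rightarrow> real" and V1 :: "'i \<Rightarrow> 'a \<Rightarrow> real"
  assumes "finite J"
    and "integrable N1 u1" "\<And>x. 0 \<le> u1 x" and "\<And>k. k \<in> J \<Longrightarrow> V1 k \<in> borel_measurable N1"
    and "integrable N2 u2" "\<And>x. 0 \<le> u2 x" and "\<And>k. k \<in> J \<Longrightarrow> V2 k \<in> borel_measurable N2"
    and "\<And>a. (\<integral>x. u1 x * cos (\<Sum>k\<in>J. a k * V1 k x) \<partial>N1) = (\<integral>x. u2 x * cos (\<Sum>k\<in>J. a k * V2 k x) \<partial>N2)"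
    and "\<And>a. (\<integral>x. u1 x * sin (\<Sum>k\<in>J. a k * V1 k x) \<partial>N1) = (\<integral>x. u2 x * sin (\<Sum>k\<in>J. a k * V2 k x) \<partial>N2)"
    and "\<And>k. k \<in> J \<Longrightarrow> B k \<in> sets borel"
  shows "(\<integral>x. u1 x * (\<Prod>k\<in>J. indicator (B k) (V1 k x)) \<partial>N1) = (\<integral>x. u2 x * (\<Prod>k\<in>J. indicator (B k) (V2 k x)) \<partial>N2)"
  using assms
proof (induction J arbitrary: u1 u2 rule: finite_induct)
  case empty
  from empty.prems(7) show ?case by simp
next
  case (insert j J)
  note u1 = insert.prems(1,2) and u2 = insert.prems(4,5)
  have V1[measurable]: "V1 j \<in> borel_measurable N1" and V1'[measurable]: "\<And>k. k \<in> J \<Longrightarrow> V1 k \<in> borel_measurable N1"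
    and V2[measurable]: "V2 j \<in> borel_measurable N2" and V2'[measurable]: "\<And>k. k \<in> J \<Longrightarrow> V2 k \<in> borel_measurable N2"
    using insert.prems by auto
  have B[measurable]: "B j \<in> sets borel" using insert.prems by auto
  note [measurable] = borel_measurable_integrable[OF u1(1)] borel_measurable_integrable[OF u2(1)]
  define A1 where "A1 = (\<lambda>a x. \<Sum>k\<in>J. a k * V1 k x)"
  define A2 where "A2 = (\<lambda>a x. \<Sum>k\<in>J. a k * V2 k x)"
  have [measurable]: "A1 a \<in> borel_measurable N1" "A2 a \<in> borel_measurable N2" for a
    unfolding A1_def A2_def by measurable
  \<comment> \<open>Updating one coefficient splits off the new coordinate, so the hypotheses cover
    every sum of a combination over J and a multiple of \<open>V j\<close>.\<close>
  have upd: "(\<Sum>k\<in>insert j J. (a(j := s)) k * v k) = (\<Sum>k\<in>J. a k * v k) + s * v j" for a s and v :: "'i \<Rightarrow> real"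
    using insert.hyps by (subst sum.insert) (auto intro!: sum.cong)
  have c: "(\<integral>x. u1 x * cos (A1 a x + s * V1 j x) \<partial>N1) = (\<integral>x. u2 x * cos (A2 a x + s * V2 j x) \<partial>N2)" for a s
    using insert.prems(7)[of "a(j := s)"] unfolding upd A1_def A2_def .
  have s: "(\<integral>x. u1 x * sin (A1 a x + s * V1 j x) \<partial>N1) = (\<integral>x. u2 x * sin (A2 a x + s * V2 j x) \<partial>N2)" for a s
    using insert.prems(8)[of "a(j := s)"] unfolding upd A1_def A2_def .
  have c0: "(\<integral>x. u1 x * cos (s * V1 j x) \<partial>N1) = (\<integral>x. u2 x * cos (s * V2 j x) \<partial>N2)" for s
    using c[of "\<lambda>_. 0" s] by (simp add: A1_def A2_def)
  have s0: "(\<integral>x. u1 x * sin (s * V1 j x) \<partial>N1) = (\<integral>x. u2 x * sin (s * V2 j x) \<partial>N2)" for s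
    using s[of "\<lambda>_. 0" s] by (simp add: A1_def A2_def)
  have i1: "integrable N1 (\<lambda>x. u1 x * g x)" if "g \<in> borel_measurable N1" "\<And>x. \<bar>g x\<bar> \<le> 1" for g
    using integrable_mult_bounded[OF u1(1) that] .
  have i2: "integrable N2 (\<lambda>x. u2 x * g x)" if "g \<in> borel_measurable N2" "\<And>x. \<bar>g x\<bar> \<le> 1" for g
    using integrable_mult_bounded[OF u2(1) that] .
  \<comment> \<open>Product-to-sum formulas: trigonometric integrals against the new weights reduce
    to integrals of single cosines and sines, which agree by \<open>c\<close> and
    \<open>s\<close>.\<close>
  have expand: "u * (1 + cos A) * cos B = u * cos B + (u * cos (A + B) / 2 + u * cos (A + - B) / 2)"
    "u * (1 + cos A) * sin B = u * sin B + (u * sin (A + B) / 2 - u * sin (A + - B) / 2)"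
    "u * (1 + sin A) * cos B = u * cos B + (u * sin (A + B) / 2 + u * sin (A + - B) / 2)"
    "u * (1 + sin A) * sin B = u * sin B + (u * cos (A + - B) / 2 - u * cos (A + B) / 2)" for u A B :: real
    by (simp_all add: cos_add sin_add cos_diff sin_diff field_simps)
  have ge: "0 \<le> 1 + cos z" "0 \<le> 1 + sin z" for z :: real
    using cos_ge_minus_one[of z] sin_ge_minus_one[of z] by linarith+
  have pc: "(\<integral>x. u1 x * (1 + cos (A1 a x)) * indicator (B j) (V1 j x) \<partial>N1)
      = (\<integral>x. u2 x * (1 + cos (A2 a x)) * indicator (B j) (V2 j x) \<partial>N2)" for a
  proof (rule weighted_uniqueness[OF _ _ V1 _ _ V2 _ _ B])
    show "integrable N1 (\<lambda>x. u1 x * (1 + cos (A1 a x)))" "integrable N2 (\<lambda>x. u2 x * (1 + cos (A2 a x)))"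
      using i1[of "\<lambda>x. cos (A1 a x)"] i2[of "\<lambda>x. cos (A2 a x)"] u1 u2 by (simp_all add: distrib_left)
    fix t
    show "(\<integral>x. u1 x * (1 + cos (A1 a x)) * cos (t * V1 j x) \<partial>N1)
      = (\<integral>x. u2 x * (1 + cos (A2 a x)) * cos (t * V2 j x) \<partial>N2)"
      using c[of a t] c[of a "-t"] c0[of t] unfolding expand
      by (simp add: i1 i2)
    show "(\<integral>x. u1 x * (1 + cos (A1 a x)) * sin (t * V1 j x) \<partial>N1)
      = (\<integral>x. u2 x * (1 + cos (A2 a x)) * sin (t * V2 j x) \<partial>N2)"
      using s[of a t] s[of a "-t"] s0[of t] unfolding expand
      by (simp add: i1 i2)
  qed (use u1 u2 ge in auto)
  have ps: "(\<integral>x. u1 x * (1 + sin (A1 a x)) * indicator (B j) (V1 j x) \<partial>N1)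
      = (\<integral>x. u2 x * (1 + sin (A2 a x)) * indicator (B j) (V2 j x) \<partial>N2)" for a
  proof (rule weighted_uniqueness[OF _ _ V1 _ _ V2 _ _ B])
    show "integrable N1 (\<lambda>x. u1 x * (1 + sin (A1 a x)))" "integrable N2 (\<lambda>x. u2 x * (1 + sin (A2 a x)))"
      using i1[of "\<lambda>x. sin (A1 a x)"] i2[of "\<lambda>x. sin (A2 a x)"] u1 u2 by (simp_all add: distrib_left)
    fix t
    show "(\<integral>x. u1 x * (1 + sin (A1 a x)) * cos (t * V1 j x) \<partial>N1)
      = (\<integral>x. u2 x * (1 + sin (A2 a x)) * cos (t * V2 j x) \<partial>N2)"
      using s[of a t] s[of a "-t"] c0[of t] unfolding expand
      by (simp add: i1 i2)
    show "(\<integral>x. u1 x * (1 + sin (A1 a x)) * sin (t * V1 j x) \<partial>N1)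
      = (\<integral>x. u2 x * (1 + sin (A2 a x)) * sin (t * V2 j x) \<partial>N2)"
      using c[of a t] c[of a "-t"] s0[of t] unfolding expand
      by (simp add: i1 i2)
  qed (use u1 u2 ge in auto)
  have I1: "integrable N1 (\<lambda>x. u1 x * indicator (B j) (V1 j x))"
    and I2: "integrable N2 (\<lambda>x. u2 x * indicator (B j) (V2 j x))"
    by (auto intro!: i1 i2 simp: indicator_def)
  have J1: "integrable N1 (\<lambda>x. u1 x * indicator (B j) (V1 j x) * g x)" if "g \<in> borel_measurable N1" "\<And>x. \<bar>g x\<bar> \<le> 1" for g
    by (rule integrable_mult_bounded[OF I1 that])
  have J2: "integrable N2 (\<lambda>x. u2 x * indicator (B j) (V2 j x) * g x)" if "g \<in> borel_measurable N2" "\<And>x. \<bar>g x\<bar> \<le> 1" for g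
    by (rule integrable_mult_bounded[OF I2 that])
  \<comment> \<open>At zero coefficients the weight \<open>1 + sin\<close> is exactly 1, which gives
    the identity for the bare indicator; subtracting it removes the summand 1 from the
    weights.\<close>
  have base: "(\<integral>x. u1 x * indicator (B j) (V1 j x) \<partial>N1) = (\<integral>x. u2 x * indicator (B j) (V2 j x) \<partial>N2)"
    using ps[of "\<lambda>_. 0"] by (simp add: A1_def A2_def)
  have ring: "u * (1 + z) * i = u * i + u * i * z" for u z i :: real
    by (simp add: algebra_simps)
  have "(\<integral>x. u1 x * indicator (B j) (V1 j x) * (\<Prod>k\<in>J. indicator (B k) (V1 k x)) \<partial>N1)
      = (\<integral>x. u2 x * indicator (B j) (V2 j x) * (\<Prod>k\<in>J. indicator (B k) (V2 k x)) \<partial>N2)"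
  proof (rule insert.IH)
    fix a
    show "(\<integral>x. u1 x * indicator (B j) (V1 j x) * cos (\<Sum>k\<in>J. a k * V1 k x) \<partial>N1)
        = (\<integral>x. u2 x * indicator (B j) (V2 j x) * cos (\<Sum>k\<in>J. a k * V2 k x) \<partial>N2)"
    proof -
      have "(\<integral>x. u1 x * indicator (B j) (V1 j x) * cos (A1 a x) \<partial>N1)
          = (\<integral>x. u2 x * indicator (B j) (V2 j x) * cos (A2 a x) \<partial>N2)"
        using pc[of a] base unfolding ring by (simp add: I1 I2 J1 J2)
      then show ?thesis unfolding A1_def A2_def .
    qed
    show "(\<integral>x. u1 x * indicator (B j) (V1 j x) * sin (\<Sum>k\<in>J. a k * V1 k x) \<partial>N1)
        = (\<integral>x. u2 x * indicator (B j) (V2 j x) * sin (\<Sum>k\<in>J. a k * V2 k x) \<partial>N2)"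
    proof -
      have "(\<integral>x. u1 x * indicator (B j) (V1 j x) * sin (A1 a x) \<partial>N1)
          = (\<integral>x. u2 x * indicator (B j) (V2 j x) * sin (A2 a x) \<partial>N2)"
        using ps[of a] base unfolding ring by (simp add: I1 I2 J1 J2)
      then show ?thesis unfolding A1_def A2_def .
    qed
  qed (use insert.prems I1 I2 u1 u2 in auto)
  then show ?case using insert.hyps by (simp add: mult.assoc)
qed

text \<open>The factor 1 is the trivial weight, kept so that box probabilities have the form of
  \<open>weighted_uniqueness_box\<close>.\<close>

lemma emeasure_distr_box:
  fixes V :: "'i \<Rightarrow> 'a \<Rightarrow> real"
  assumes "prob_space N" and J: "finite J" and [measurable]: "\<And>k. k \<in> J \<Longrightarrow> V k \<in> borel_measurable N"
    and B: "\<And>k. k \<in> J \<Longrightarrow> B k \<in> sets borel"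
  shows "emeasure (distr N (PiM J (\<lambda>_. borel)) (\<lambda>x. \<lambda>k\<in>J. V k x)) (Pi\<^sub>E J B)
      = ennreal (\<integral>x. 1 * (\<Prod>k\<in>J. indicator (B k) (V k x)) \<partial>N)"
proof -
  interpret N: prob_space N by fact
  let ?S = "{x \<in> space N. \<forall>k\<in>J. V k x \<in> B k}"
  have [measurable]: "?S \<in> sets N" using J B by measurable
  have "emeasure (distr N (PiM J (\<lambda>_. borel)) (\<lambda>x. \<lambda>k\<in>J. V k x)) (Pi\<^sub>E J B)
     = emeasure N ((\<lambda>x. \<lambda>k\<in>J. V k x) -` Pi\<^sub>E J B \<inter> space N)"
    using J B by (intro emeasure_distr) (auto intro!: sets_PiM_I_finite)
  also have "(\<lambda>x. \<lambda>k\<in>J. V k x) -` Pi\<^sub>E J B \<inter> space N = ?S"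
    by (auto simp: PiE_iff)
  also have "emeasure N ?S = ennreal (\<integral>x. indicator ?S x \<partial>N)"
    by (simp add: N.emeasure_eq_measure)
  also have "(\<integral>x. indicator ?S x \<partial>N) = (\<integral>x. (1::real) * (\<Prod>k\<in>J. indicator (B k) (V k x)) \<partial>N)"
    using J by (intro Bochner_Integration.integral_cong) (auto simp: indicator_def)
  finally show ?thesis .
qed

text \<open>Boxes generate the product sigma-algebra and are stable under intersection, so equality
  of box probabilities, the weighted statement at weight 1, determines the law.\<close>

lemma cramer_wold:
  fixes V1 :: "'i \<Rightarrow> 'a \<Rightarrow> real" and V2 :: "'i \<Rightarrow> 'b \<Rightarrow> real"
  assumes N1: "prob_space N1" and N2: "prob_space N2" and J: "finite J"
    and V1[measurable]: "\<And>k. k \<in> J \<Longrightarrow> V1 k \<in> borel_measurable N1"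
    and V2[measurable]: "\<And>k. k \<in> J \<Longrightarrow> V2 k \<in> borel_measurable N2"
    and cos_eq: "\<And>a. (\<integral>x. cos (\<Sum>k\<in>J. a k * V1 k x) \<partial>N1) = (\<integral>x. cos (\<Sum>k\<in>J. a k * V2 k x) \<partial>N2)"
    and sin_eq: "\<And>a. (\<integral>x. sin (\<Sum>k\<in>J. a k * V1 k x) \<partial>N1) = (\<integral>x. sin (\<Sum>k\<in>J. a k * V2 k x) \<partial>N2)"
  shows "distr N1 (PiM J (\<lambda>_. borel)) (\<lambda>x. \<lambda>k\<in>J. V1 k x) = distr N2 (PiM J (\<lambda>_. borel)) (\<lambda>x. \<lambda>k\<in>J. V2 k x)"
proof (rule measure_eqI_PiM_finite[OF J])
  interpret N1: prob_space N1 by fact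
  interpret N2: prob_space N2 by fact
  fix B :: "'i \<Rightarrow> real set" assume B: "\<And>i. i \<in> J \<Longrightarrow> B i \<in> sets borel"
  show "emeasure (distr N1 (PiM J (\<lambda>_. borel)) (\<lambda>x. \<lambda>k\<in>J. V1 k x)) (Pi\<^sub>E J B) =
    emeasure (distr N2 (PiM J (\<lambda>_. borel)) (\<lambda>x. \<lambda>k\<in>J. V2 k x)) (Pi\<^sub>E J B)"
  proof -
    have "(\<integral>x. (1::real) * (\<Prod>k\<in>J. indicator (B k) (V1 k x)) \<partial>N1) = (\<integral>x. 1 * (\<Prod>k\<in>J. indicator (B k) (V2 k x)) \<partial>N2)"
      using weighted_uniqueness_box[of J N1 "\<lambda>_. 1" V1 N2 "\<lambda>_. 1" V2 B] J B cos_eq sin_eq V1 V2 by simp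
    then show ?thesis
      by (simp only: emeasure_distr_box N1 N2 J V1 V2 B)
  qed
next
  interpret N1: prob_space N1 by fact
  show "range (\<lambda>_::nat. \<Pi>\<^sub>E k\<in>J. (UNIV :: real set)) \<subseteq> prod_algebra J (\<lambda>_. borel)"
    using prod_algebraI_finite[OF J, of "\<lambda>_. UNIV" "\<lambda>_. borel"] by auto
  show "(\<Union>i::nat. \<Pi>\<^sub>E k\<in>J. UNIV) = space (PiM J (\<lambda>_. borel :: real measure))"
    by (simp add: space_PiM)
  have "prob_space (distr N1 (PiM J (\<lambda>_. borel)) (\<lambda>x. \<lambda>k\<in>J. V1 k x))"
    by (rule N1.prob_space_distr) measurable
  then interpret D: prob_space "distr N1 (PiM J (\<lambda>_. borel)) (\<lambda>x. \<lambda>k\<in>J. V1 k x)" .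
  show "emeasure (distr N1 (PiM J (\<lambda>_. borel)) (\<lambda>x. \<lambda>k\<in>J. V1 k x)) (\<Pi>\<^sub>E k\<in>J. UNIV) \<noteq> \<infinity>" for i :: nat
    by simp
qed simp_all

subsection \<open>Gaussian vectors\<close>

text \<open>The law occurring in \<open>jointly_gaussian\<close>, parametrised by the standard
  deviation and including the point mass at s = 0.\<close>

definition gauss_law :: "real \<Rightarrow> real \<Rightarrow> real measure" where
  "gauss_law \<mu> s = (if s = 0 then return borel \<mu> else density lborel (\<lambda>x. ennreal (normal_density \<mu> s x)))"

lemma sets_gauss_law[simp, measurable_cong]: "sets (gauss_law \<mu> s) = sets borel"
  by (simp add: gauss_law_def)

lemma space_gauss_law[simp]: "space (gauss_law \<mu> s) = UNIV"
  by (simp add: gauss_law_def)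

lemma prob_space_gauss_law: "0 \<le> s \<Longrightarrow> prob_space (gauss_law \<mu> s)"
  by (auto simp: gauss_law_def prob_space_return intro!: prob_space_normal_density)

lemma gauss_law_integral:
  fixes f :: "real \<Rightarrow> real"
  assumes "0 < s" "f \<in> borel_measurable borel"
  shows "(\<integral>x. f x \<partial>gauss_law \<mu> s) = (\<integral>x. normal_density \<mu> s x * f x \<partial>lborel)"
    and "integrable (gauss_law \<mu> s) f \<longleftrightarrow> integrable lborel (\<lambda>x. normal_density \<mu> s x * f x)"
  using assms by (auto simp: gauss_law_def integral_density integrable_density)

lemma gauss_law_moments:
  assumes "0 \<le> s"
  shows "integrable (gauss_law \<mu> s) (\<lambda>x. x)" "(\<integral>x. x \<partial>gauss_law \<mu> s) = \<mu>"
    and "integrable (gauss_law \<mu> s) (\<lambda>x. x\<^sup>2)" "(\<integral>x. x\<^sup>2 \<partial>gauss_law \<mu> s) = s\<^sup>2 + \<mu>\<^sup>2"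
proof -
  have "integrable (gauss_law \<mu> s) (\<lambda>x. x) \<and> (\<integral>x. x \<partial>gauss_law \<mu> s) = \<mu>
    \<and> integrable (gauss_law \<mu> s) (\<lambda>x. x\<^sup>2) \<and> (\<integral>x. x\<^sup>2 \<partial>gauss_law \<mu> s) = s\<^sup>2 + \<mu>\<^sup>2"
  proof (cases "s = 0")
    case True
    then show ?thesis
      by (auto simp: gauss_law_def integral_return integrable_iff_bounded nn_integral_return)
  next
    case False
    then have s: "0 < s" using assms by simp
    have 1: "has_bochner_integral lborel (\<lambda>x. normal_density \<mu> s x * x) \<mu>"
      by (rule normal_moment_nz_1[OF s])
    have 2: "has_bochner_integral lborel (\<lambda>x. normal_density \<mu> s x * (x - \<mu>)\<^sup>2) (s\<^sup>2)"
    proof -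
      have "fact (2 * 1) / ((2 / s\<^sup>2) ^ 1 * fact 1) = s\<^sup>2" using s by (simp add: field_simps)
      then show ?thesis using normal_moment_even[OF s, of \<mu> 1] by simp
    qed
    have 3: "has_bochner_integral lborel (normal_density \<mu> s) 1"
      using s by (auto simp: has_bochner_integral_iff)
    have "has_bochner_integral lborel (\<lambda>x. normal_density \<mu> s x * (x - \<mu>)\<^sup>2 + 2 * \<mu> * (normal_density \<mu> s x * x)
        - \<mu>\<^sup>2 * normal_density \<mu> s x) (s\<^sup>2 + 2 * \<mu> * \<mu> - \<mu>\<^sup>2 * 1)"
      by (intro has_bochner_integral_add has_bochner_integral_diff has_bochner_integral_mult_right 1 2 3)
    then have 4: "has_bochner_integral lborel (\<lambda>x. normal_density \<mu> s x * x\<^sup>2) (s\<^sup>2 + \<mu>\<^sup>2)"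
      by (rule has_bochner_integral_cong[THEN iffD1, rotated 3]) (auto simp: power2_eq_square algebra_simps)
    show ?thesis
      using 1 4 s by (auto simp: gauss_law_integral has_bochner_integral_iff)
  qed
  then show "integrable (gauss_law \<mu> s) (\<lambda>x. x)" "(\<integral>x. x \<partial>gauss_law \<mu> s) = \<mu>"
    "integrable (gauss_law \<mu> s) (\<lambda>x. x\<^sup>2)" "(\<integral>x. x\<^sup>2 \<partial>gauss_law \<mu> s) = s\<^sup>2 + \<mu>\<^sup>2"
    by blast+
qed

lemma gauss_law_scale:
  assumes "0 < s"
  shows "gauss_law 0 s = distr std_normal_distribution borel (\<lambda>x. s * x)"
proof -
  interpret S: prob_space std_normal_distribution by (rule prob_space_normal_density) simp
  have "distributed std_normal_distribution lborel (\<lambda>x. x) (\<lambda>x. ennreal (std_normal_density x))"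
    by (auto simp: distributed_def distr_id2)
  then have "distributed std_normal_distribution lborel (\<lambda>x. 0 + s * x) (\<lambda>x. ennreal (normal_density (0 + s * 0) (\<bar>s\<bar> * 1) x))"
    using assms by (intro S.normal_density_affine) auto
  then show ?thesis
    using assms by (simp add: distributed_def gauss_law_def cong: distr_cong)
qed

text \<open>Real and imaginary part of the standard normal characteristic function at the point
  s.\<close>

lemma gauss_law_trig:
  assumes "0 \<le> s"
  shows "(\<integral>x. cos x \<partial>gauss_law 0 s) = exp (- s\<^sup>2 / 2)" "(\<integral>x. sin x \<partial>gauss_law 0 s) = 0"
proof -
  have "(\<integral>x. cos x \<partial>gauss_law 0 s) = exp (- s\<^sup>2 / 2) \<and> (\<integral>x. sin x \<partial>gauss_law 0 s) = 0"
  proof (cases "s = 0")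
    case True
    then show ?thesis by (simp add: gauss_law_def integral_return)
  next
    case False
    then have s: "0 < s" using assms by simp
    interpret S: prob_space std_normal_distribution by (rule prob_space_normal_density) simp
    have int: "integrable std_normal_distribution (\<lambda>x. iexp (s * x))"
      by (rule S.integrable_const_bound[of _ 1]) auto
    have "(\<integral>x. iexp (s * x) \<partial>std_normal_distribution) = complex_of_real (exp (- s\<^sup>2 / 2))"
      using char_std_normal_distribution by (simp add: char_def fun_eq_iff)
    from arg_cong[OF this, of Re] arg_cong[OF this, of Im]
    have "(\<integral>x. cos (s * x) \<partial>std_normal_distribution) = exp (- s\<^sup>2 / 2)" "(\<integral>x. sin (s * x) \<partial>std_normal_distribution) = 0"
      using int by (simp_all add: integral_Re[symmetric] integral_Im[symmetric] Re_exp Im_exp del: integral_Re integral_Im)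
    then show ?thesis
      by (simp add: gauss_law_scale[OF s] integral_distr)
  qed
  then show "(\<integral>x. cos x \<partial>gauss_law 0 s) = exp (- s\<^sup>2 / 2)" "(\<integral>x. sin x \<partial>gauss_law 0 s) = 0"
    by blast+
qed

text \<open>The density is at most 1 / s because sqrt (2 pi) >= 1.\<close>

lemma measure_gauss_law_interval:
  assumes "0 < s" "u \<le> v"
  shows "measure (gauss_law \<mu> s) {u..v} \<le> (v - u) / s"
proof -
  have le: "normal_density \<mu> s x \<le> 1 / s" for x
  proof -
    have "1 \<le> sqrt (2 * pi)" using pi_gt3 by (subst real_le_rsqrt) auto
    then have "s \<le> sqrt (2 * pi) * s" using assms by simp
    moreover have "sqrt (2 * pi * s\<^sup>2) = sqrt (2 * pi) * s" using assms by (simp add: real_sqrt_mult)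
    ultimately have "1 / sqrt (2 * pi * s\<^sup>2) \<le> 1 / s" using assms by (simp add: frac_le)
    moreover have "exp (- (x - \<mu>)\<^sup>2 / (2 * s\<^sup>2)) \<le> 1" by simp
    moreover have "0 \<le> 1 / sqrt (2 * pi * s\<^sup>2)" by simp
    ultimately have "1 / sqrt (2 * pi * s\<^sup>2) * exp (- (x - \<mu>)\<^sup>2 / (2 * s\<^sup>2)) \<le> 1 / s * 1"
      using assms by (intro mult_mono) auto
    then show ?thesis by (simp add: normal_density_def)
  qed
  have "emeasure (gauss_law \<mu> s) {u..v} = (\<integral>\<^sup>+x. ennreal (normal_density \<mu> s x) * indicator {u..v} x \<partial>lborel)"
    using assms by (simp add: gauss_law_def emeasure_density)
  also have "\<dots> \<le> (\<integral>\<^sup>+x. ennreal (1 / s) * indicator {u..v} x \<partial>lborel)"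
    by (intro nn_integral_mono mult_right_mono ennreal_leI le) simp
  also have "\<dots> = ennreal ((v - u) / s)"
    using assms by (simp add: nn_integral_cmult ennreal_mult[symmetric])
  finally show ?thesis
    using assms unfolding measure_def by (simp add: enn2real_leI)
qed

text \<open>The density n satisfies n' = - x n / s^2, so (n h)' = n h' - x n h / s^2; this
  integrates to 0 because n h vanishes at both infinities. The bounds on h and h' supply
  integrability.\<close>

lemma gauss_law_stein:
  fixes h h' :: "real \<Rightarrow> real"
  assumes s: "0 < s" and h: "\<And>x. (h has_real_derivative h' x) (at x)" and h': "\<And>x. isCont h' x"
    and bound: "\<And>x. \<bar>h x\<bar> \<le> C" "\<And>x. \<bar>h' x\<bar> \<le> C"
  shows "(\<integral>x. x * h x \<partial>gauss_law 0 s) = s\<^sup>2 * (\<integral>x. h' x \<partial>gauss_law 0 s)"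
proof -
  let ?n = "normal_density 0 s"
  define F where "F = (\<lambda>x. ?n x * h x)"
  define f where "f = (\<lambda>x. ?n x * h' x - (?n x * x * h x) / s\<^sup>2)"
  have cont_h: "isCont h x" for x using h by (rule DERIV_isCont)
  have [measurable]: "h \<in> borel_measurable borel" "h' \<in> borel_measurable borel"
    using cont_h h' by (auto intro!: borel_measurable_continuous_onI continuous_at_imp_continuous_on)
  have n': "(?n has_real_derivative - x / s\<^sup>2 * ?n x) (at x)" for x
    unfolding normal_density_def using s
    by (auto intro!: derivative_eq_intros simp: field_simps power2_eq_square)
  have F': "(F has_real_derivative f x) (at x)" for x
    unfolding F_def f_def using s by (auto intro!: derivative_eq_intros n' h simp: field_simps)
  have cont_n: "isCont ?n x" for x using n' by (rule DERIV_isCont)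
  have i1: "integrable lborel (\<lambda>x. ?n x * h' x)"
    using s by (intro integrable_mult_bounded[OF integrable_normal_density _ bound(2)]) auto
  have i2: "integrable lborel (\<lambda>x. ?n x * x * h x)"
    using s by (intro integrable_mult_bounded[OF integrable_normal_moment_nz_1 _ bound(1)]) auto
  have top: "(?n \<longlongrightarrow> 0) at_top" and bot: "(?n \<longlongrightarrow> 0) at_bot"
    unfolding normal_density_def using s by real_asymp+
  have Flim: "(F \<longlongrightarrow> 0) G" if "(?n \<longlongrightarrow> 0) G" for G
  proof (rule tendsto_rabs_zero_cancel, rule tendsto_sandwich[where f = "\<lambda>_. 0" and h = "\<lambda>x. ?n x * C"])
    show "((\<lambda>x. ?n x * C) \<longlongrightarrow> 0) G" using tendsto_mult_left_zero[OF that] .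
    show "eventually (\<lambda>x. \<bar>F x\<bar> \<le> ?n x * C) G"
      by (intro always_eventually allI) (auto simp: F_def abs_mult intro!: mult_left_mono bound)
  qed auto
  have "(LBINT x=-\<infinity>..\<infinity>. f x) = 0 - 0"
  proof (rule interval_integral_FTC_integrable)
    show "(F has_vector_derivative f x) (at x)" for x
      using F' by (simp add: has_real_derivative_iff_has_vector_derivative)
    show "isCont f x" for x
      unfolding f_def using s by (intro continuous_intros cont_n cont_h h') auto
    show "set_integrable lborel (einterval (-\<infinity>) \<infinity>) f"
      unfolding f_def set_integrable_def using i1 i2 by (auto simp: einterval_def)
    show "((F \<circ> real_of_ereal) \<longlongrightarrow> 0) (at_right (-\<infinity>))" "((F \<circ> real_of_ereal) \<longlongrightarrow> 0) (at_left \<infinity>)"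
      using Flim[OF top] Flim[OF bot] by (simp_all add: ereal_tendsto_simps)
  qed simp
  then have "(\<integral>x. f x \<partial>lborel) = 0"
    by (simp add: interval_lebesgue_integral_def set_lebesgue_integral_def einterval_def)
  then have "(\<integral>x. ?n x * h' x \<partial>lborel) = (\<integral>x. ?n x * x * h x \<partial>lborel) / s\<^sup>2"
    unfolding f_def using i1 i2 by simp
  then show ?thesis
    using s by (simp add: gauss_law_integral mult.assoc)
qed

lemma centered_gaussian_combination:
  assumes "centered_gaussian N J \<xi> \<Gamma>"
  obtains \<mu> s where "0 \<le> s" "distr N borel (\<lambda>\<omega>. \<Sum>j\<in>J. a j * \<xi> j \<omega>) = gauss_law \<mu> s"
proof -
  have "\<exists>\<mu> s. s \<ge> 0 \<and> distr N borel (\<lambda>\<omega>. \<Sum>j\<in>J. a j * \<xi> j \<omega>) = gauss_law \<mu> s"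
    using assms unfolding centered_gaussian_def jointly_gaussian_def gauss_law_def by (elim conjE allE[of _ a])
  then show ?thesis using that by blast
qed

lemma centered_gaussian_moments:
  assumes "centered_gaussian N J \<xi> \<Gamma>" and J: "finite J" "j \<in> J"
  shows "integrable N (\<xi> j)" "integrable N (\<lambda>\<omega>. (\<xi> j \<omega>)\<^sup>2)"
proof -
  interpret prob_space N using assms by (simp add: centered_gaussian_def)
  have [measurable]: "\<xi> j \<in> borel_measurable N"
    using assms by (auto simp: centered_gaussian_def jointly_gaussian_def)
  obtain \<mu> s where s: "s \<ge> 0" and "distr N borel (\<lambda>\<omega>. \<Sum>k\<in>J. (if k = j then 1 else 0) * \<xi> k \<omega>) = gauss_law \<mu> s"
    by (rule centered_gaussian_combination[OF assms(1), of "\<lambda>k. if k = j then 1 else 0"])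
  moreover have "(\<lambda>\<omega>. \<Sum>k\<in>J. (if k = j then 1 else 0) * \<xi> k \<omega>) = \<xi> j"
  proof
    fix \<omega>
    have "(\<Sum>k\<in>J. (if k = j then 1 else 0) * \<xi> k \<omega>) = (\<Sum>k\<in>J. if k = j then \<xi> k \<omega> else 0)"
      by (intro sum.cong) auto
    then show "(\<Sum>k\<in>J. (if k = j then 1 else 0) * \<xi> k \<omega>) = \<xi> j \<omega>" using J by simp
  qed
  ultimately have "distr N borel (\<xi> j) = gauss_law \<mu> s" by simp
  then have "integrable (distr N borel (\<xi> j)) (\<lambda>x. x)" "integrable (distr N borel (\<xi> j)) (\<lambda>x. x\<^sup>2)"
    using gauss_law_moments(1,3)[OF s, of \<mu>] by (simp_all only:)
  note * = this
  have [measurable]: "\<xi> j \<in> measurable N borel" by measurable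
  show "integrable N (\<xi> j)" by (rule integrable_distr[OF _ *(1)]) measurable
  show "integrable N (\<lambda>\<omega>. (\<xi> j \<omega>)\<^sup>2)" by (rule integrable_distr[OF _ *(2)]) measurable
qed

lemma integrable_mult_square:
  fixes f g :: "'a \<Rightarrow> real"
  assumes [measurable]: "f \<in> borel_measurable M" "g \<in> borel_measurable M"
    and "integrable M (\<lambda>x. (f x)\<^sup>2)" "integrable M (\<lambda>x. (g x)\<^sup>2)"
  shows "integrable M (\<lambda>x. f x * g x)"
proof (rule Bochner_Integration.integrable_bound)
  show "integrable M (\<lambda>x. (f x)\<^sup>2 + (g x)\<^sup>2)" using assms by simp
  show "AE x in M. norm (f x * g x) \<le> norm ((f x)\<^sup>2 + (g x)\<^sup>2)"
  proof (intro AE_I2)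
    fix x
    have "0 \<le> (\<bar>f x\<bar> - \<bar>g x\<bar>)\<^sup>2" "0 \<le> \<bar>f x\<bar> * \<bar>g x\<bar>" by auto
    then have "\<bar>f x\<bar> * \<bar>g x\<bar> \<le> (f x)\<^sup>2 + (g x)\<^sup>2"
      by (simp only: power2_diff power2_abs)
    then show "norm (f x * g x) \<le> norm ((f x)\<^sup>2 + (g x)\<^sup>2)"
      by (simp add: abs_mult)
  qed
qed measurable

text \<open>\<open>jointly_gaussian\<close> leaves mean and deviation of each combination open.
  Computing the first two moments once from the law and once from the covariances identifies
  them.\<close>

lemma centered_gaussian_linear:
  fixes a :: "nat \<Rightarrow> real"
  assumes cg: "centered_gaussian N J \<xi> \<Gamma>" and J: "finite J"
  shows "distr N borel (\<lambda>\<omega>. \<Sum>j\<in>J. a j * \<xi> j \<omega>) = gauss_law 0 (sqrt (\<Sum>j\<in>J. \<Sum>k\<in>J. a j * a k * \<Gamma> j k))"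
    and "0 \<le> (\<Sum>j\<in>J. \<Sum>k\<in>J. a j * a k * \<Gamma> j k)"
proof -
  interpret prob_space N using cg by (simp add: centered_gaussian_def)
  have xi[measurable]: "\<And>j. j \<in> J \<Longrightarrow> \<xi> j \<in> borel_measurable N"
    using cg by (auto simp: centered_gaussian_def jointly_gaussian_def)
  have mean: "\<And>j. j \<in> J \<Longrightarrow> (\<integral>\<omega>. \<xi> j \<omega> \<partial>N) = 0"
    and cov: "\<And>j k. j \<in> J \<Longrightarrow> k \<in> J \<Longrightarrow> (\<integral>\<omega>. \<xi> j \<omega> * \<xi> k \<omega> \<partial>N) = \<Gamma> j k"
    using cg by (auto simp: centered_gaussian_def)
  define V where "V = (\<lambda>\<omega>. \<Sum>j\<in>J. a j * \<xi> j \<omega>)"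
  have [measurable]: "V \<in> borel_measurable N" unfolding V_def by measurable
  obtain \<mu> s where s: "s \<ge> 0" and d: "distr N borel V = gauss_law \<mu> s"
    unfolding V_def by (rule centered_gaussian_combination[OF cg, of a])
  note m = centered_gaussian_moments[OF cg J]
  have "(\<integral>\<omega>. V \<omega> \<partial>N) = (\<Sum>j\<in>J. a j * (\<integral>\<omega>. \<xi> j \<omega> \<partial>N))"
    unfolding V_def using m by simp
  also have "\<dots> = 0"
    by (intro sum.neutral ballI) (simp add: mean)
  finally have V0: "(\<integral>\<omega>. V \<omega> \<partial>N) = 0" .
  have "\<mu> = (\<integral>x. x \<partial>distr N borel V)"
    unfolding d by (rule gauss_law_moments(2)[OF s, symmetric])
  also have "\<dots> = (\<integral>\<omega>. V \<omega> \<partial>N)" by (rule integral_distr) measurable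
  finally have "\<mu> = 0" using V0 by simp
  have "s\<^sup>2 = (\<integral>x. x\<^sup>2 \<partial>distr N borel V)"
    unfolding d using gauss_law_moments(4)[OF s, of \<mu>] \<open>\<mu> = 0\<close> by simp
  also have "\<dots> = (\<integral>\<omega>. (V \<omega>)\<^sup>2 \<partial>N)" by (rule integral_distr) measurable
  also have "\<dots> = (\<integral>\<omega>. (\<Sum>j\<in>J. \<Sum>k\<in>J. a j * a k * (\<xi> j \<omega> * \<xi> k \<omega>)) \<partial>N)"
    unfolding V_def by (simp add: power2_eq_square sum_product mult_ac)
  also have "\<dots> = (\<Sum>j\<in>J. \<Sum>k\<in>J. a j * a k * (\<integral>\<omega>. \<xi> j \<omega> * \<xi> k \<omega> \<partial>N))"
    using m xi by (simp add: integrable_mult_square)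
  also have "\<dots> = (\<Sum>j\<in>J. \<Sum>k\<in>J. a j * a k * \<Gamma> j k)"
    by (intro sum.cong refl) (simp add: cov)
  finally have v: "s\<^sup>2 = (\<Sum>j\<in>J. \<Sum>k\<in>J. a j * a k * \<Gamma> j k)" .
  then show "0 \<le> (\<Sum>j\<in>J. \<Sum>k\<in>J. a j * a k * \<Gamma> j k)" by (metis zero_le_power2)
  show "distr N borel (\<lambda>\<omega>. \<Sum>j\<in>J. a j * \<xi> j \<omega>) = gauss_law 0 (sqrt (\<Sum>j\<in>J. \<Sum>k\<in>J. a j * a k * \<Gamma> j k))"
    using d s \<open>\<mu> = 0\<close> unfolding V_def by (simp flip: v)
qed

lemma centered_gaussian_trig:
  fixes a :: "nat \<Rightarrow> real"
  assumes cg: "centered_gaussian N J \<xi> \<Gamma>" and J: "finite J"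
  shows "(\<integral>\<omega>. cos (\<Sum>j\<in>J. a j * \<xi> j \<omega>) \<partial>N) = exp (- (\<Sum>j\<in>J. \<Sum>k\<in>J. a j * a k * \<Gamma> j k) / 2)"
    and "(\<integral>\<omega>. sin (\<Sum>j\<in>J. a j * \<xi> j \<omega>) \<partial>N) = 0"
proof -
  have [measurable]: "\<And>j. j \<in> J \<Longrightarrow> \<xi> j \<in> borel_measurable N"
    using cg by (auto simp: centered_gaussian_def jointly_gaussian_def)
  have "(\<integral>\<omega>. f (\<Sum>j\<in>J. a j * \<xi> j \<omega>) \<partial>N) = (\<integral>x. f x \<partial>gauss_law 0 (sqrt (\<Sum>j\<in>J. \<Sum>k\<in>J. a j * a k * \<Gamma> j k)))"
    if [measurable]: "f \<in> borel_measurable borel" for f :: "real \<Rightarrow> real"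
    unfolding centered_gaussian_linear(1)[OF cg J, of a, symmetric] by (subst integral_distr) auto
  note * = this
  define v where "v = (\<Sum>j\<in>J. \<Sum>k\<in>J. a j * a k * \<Gamma> j k)"
  have v: "0 \<le> v" unfolding v_def by (rule centered_gaussian_linear(2)[OF cg J])
  show "(\<integral>\<omega>. cos (\<Sum>j\<in>J. a j * \<xi> j \<omega>) \<partial>N) = exp (- (\<Sum>j\<in>J. \<Sum>k\<in>J. a j * a k * \<Gamma> j k) / 2)"
    unfolding *[of cos, OF borel_measurable_continuous_onI[OF continuous_on_cos[OF continuous_on_id]]] v_def[symmetric] using v by (simp add: gauss_law_trig)
  show "(\<integral>\<omega>. sin (\<Sum>j\<in>J. a j * \<xi> j \<omega>) \<partial>N) = 0"
    unfolding *[of sin, OF borel_measurable_continuous_onI[OF continuous_on_sin[OF continuous_on_id]]] v_def[symmetric] using v by (simp add: gauss_law_trig)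
qed

lemma centered_gaussian_component:
  assumes cg: "centered_gaussian N J \<xi> \<Gamma>" and J: "finite J" "j \<in> J"
  shows "distr N borel (\<xi> j) = gauss_law 0 (sqrt (\<Gamma> j j))"
proof -
  have *: "(\<Sum>k\<in>J. (if k = j then 1 else 0) * v k) = v j" for v :: "nat \<Rightarrow> real"
  proof -
    have "(\<Sum>k\<in>J. (if k = j then 1 else 0) * v k) = (\<Sum>k\<in>J. if k = j then v k else 0)"
      by (intro sum.cong) auto
    then show ?thesis using J by simp
  qed
  show ?thesis
    using centered_gaussian_linear(1)[OF cg J(1), of "\<lambda>k. if k = j then 1 else 0"]
    by (simp add: * mult.assoc sum_distrib_left[symmetric])
qed

section \<open>Gaussian regression and integration by parts\<close>

lemma distr_pair_snd:
  assumes "prob_space M" "prob_space N"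
  shows "distr (M \<Otimes>\<^sub>M N) N snd = N"
proof (intro measure_eqI)
  interpret M: prob_space M by fact
  interpret N: prob_space N by fact
  fix A assume "A \<in> sets (distr (M \<Otimes>\<^sub>M N) N snd)"
  then have A: "A \<in> sets N" by simp
  then have "snd -` A \<inter> space (M \<Otimes>\<^sub>M N) = space M \<times> A"
    using sets.sets_into_space by (auto simp: space_pair_measure)
  with A show "emeasure (distr (M \<Otimes>\<^sub>M N) N snd) A = emeasure N A"
    by (simp add: emeasure_distr N.emeasure_pair_measure_Times M.emeasure_space_1)
qed simp

text \<open>In the addition formulas the terms containing the integral of sin B vanish, which leaves
  a product of two one-factor integrals.\<close>

lemma integral_trig_pair:
  fixes A :: "'a \<Rightarrow> real" and B :: "'b \<Rightarrow> real"
  assumes "prob_space M" "prob_space N"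
    and [measurable]: "A \<in> borel_measurable M" "B \<in> borel_measurable N"
    and "(\<integral>y. sin (B y) \<partial>N) = 0"
  shows "(\<integral>z. cos (A (fst z) + B (snd z)) \<partial>(M \<Otimes>\<^sub>M N)) = (\<integral>x. cos (A x) \<partial>M) * (\<integral>y. cos (B y) \<partial>N)"
    and "(\<integral>z. sin (A (fst z) + B (snd z)) \<partial>(M \<Otimes>\<^sub>M N)) = (\<integral>x. sin (A x) \<partial>M) * (\<integral>y. cos (B y) \<partial>N)"
proof -
  interpret M: prob_space M by fact
  interpret N: prob_space N by fact
  interpret P: pair_prob_space M N ..
  have i: "integrable N (\<lambda>y. cos (B y))" "integrable N (\<lambda>y. sin (B y))"
    "integrable M (\<lambda>x. cos (A x))" "integrable M (\<lambda>x. sin (A x))"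
    by (auto intro!: N.integrable_const_bound[of _ 1] M.integrable_const_bound[of _ 1])
  have "(\<integral>z. cos (A (fst z) + B (snd z)) \<partial>(M \<Otimes>\<^sub>M N)) = (\<integral>x. (\<integral>y. cos (A x + B y) \<partial>N) \<partial>M)"
    by (subst P.integral_fst'[symmetric]) (auto intro!: P.P.integrable_const_bound[of _ 1])
  also have "\<dots> = (\<integral>x. cos (A x) * (\<integral>y. cos (B y) \<partial>N) \<partial>M)"
    using i assms(5) by (simp add: cos_add)
  finally show "(\<integral>z. cos (A (fst z) + B (snd z)) \<partial>(M \<Otimes>\<^sub>M N)) = (\<integral>x. cos (A x) \<partial>M) * (\<integral>y. cos (B y) \<partial>N)"
    by simp
  have "(\<integral>z. sin (A (fst z) + B (snd z)) \<partial>(M \<Otimes>\<^sub>M N)) = (\<integral>x. (\<integral>y. sin (A x + B y) \<partial>N) \<partial>M)"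
    by (subst P.integral_fst'[symmetric]) (auto intro!: P.P.integrable_const_bound[of _ 1])
  also have "\<dots> = (\<integral>x. sin (A x) * (\<integral>y. cos (B y) \<partial>N) \<partial>M)"
    using i assms(5) by (simp add: sin_add)
  finally show "(\<integral>z. sin (A (fst z) + B (snd z)) \<partial>(M \<Otimes>\<^sub>M N)) = (\<integral>x. sin (A x) \<partial>M) * (\<integral>y. cos (B y) \<partial>N)"
    by simp
qed

lemma centered_gaussian_measurable:
  "centered_gaussian N J \<xi> \<Gamma> \<Longrightarrow> j \<in> J \<Longrightarrow> \<xi> j \<in> borel_measurable N"
  by (auto simp: centered_gaussian_def jointly_gaussian_def)

lemma centered_gaussian_sym:
  assumes "centered_gaussian N J \<xi> \<Gamma>" "j \<in> J" "k \<in> J"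
  shows "\<Gamma> j k = \<Gamma> k j"
proof -
  have "(\<integral>\<omega>. \<xi> j \<omega> * \<xi> k \<omega> \<partial>N) = \<Gamma> j k" "(\<integral>\<omega>. \<xi> k \<omega> * \<xi> j \<omega> \<partial>N) = \<Gamma> k j"
    using assms by (auto simp: centered_gaussian_def)
  then show ?thesis by (simp add: mult.commute)
qed

text \<open>Regression on \<open>\<xi> j\<close>: the residuals \<open>\<xi> k - (\<Gamma> j k / \<Gamma> j j) \<xi> j\<close> are independent of \<open>\<xi> j\<close>, so replacing
  \<open>\<xi> j\<close> by an independent copy does not change the joint law.\<close>

lemma centered_gaussian_regression:
  fixes \<xi> :: "nat \<Rightarrow> 'b \<Rightarrow> real"
  assumes cg: "centered_gaussian N J \<xi> \<Gamma>" and J: "finite J" "j \<in> J" and pos: "0 < \<Gamma> j j"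
  defines "V \<equiv> \<lambda>k z. (\<xi> k (fst z) - \<Gamma> j k / \<Gamma> j j * \<xi> j (fst z)) + \<Gamma> j k / \<Gamma> j j * \<xi> j (snd z)"
  shows "distr N (PiM J (\<lambda>_. borel)) (\<lambda>x. \<lambda>k\<in>J. \<xi> k x) = distr (N \<Otimes>\<^sub>M N) (PiM J (\<lambda>_. borel)) (\<lambda>z. \<lambda>k\<in>J. V k z)"
proof -
  interpret prob_space N using cg by (simp add: centered_gaussian_def)
  interpret P: pair_prob_space N N ..
  have xi[measurable]: "\<And>k. k \<in> J \<Longrightarrow> \<xi> k \<in> borel_measurable N"
    by (rule centered_gaussian_measurable[OF cg])
  have xij[measurable]: "\<xi> j \<in> borel_measurable N" using J by simp
  have key: "(\<integral>z. cos (\<Sum>k\<in>J. a k * V k z) \<partial>(N \<Otimes>\<^sub>M N)) = (\<integral>\<omega>. cos (\<Sum>k\<in>J. a k * \<xi> k \<omega>) \<partial>N) \<and>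
    (\<integral>z. sin (\<Sum>k\<in>J. a k * V k z) \<partial>(N \<Otimes>\<^sub>M N)) = 0" for a :: "nat \<Rightarrow> real"
  proof -
    \<comment> \<open>\<open>\<alpha>\<close> is the total weight that the combination puts on the
      fresh copy of \<open>\<xi> j\<close>, and \<open>d\<close> carries this weight at coordinate
      j: the combination is \<open>a - d\<close> on the first factor plus \<open>d\<close> on the
      second.\<close>
    define \<alpha> where "\<alpha> = (\<Sum>k\<in>J. a k * (\<Gamma> j k / \<Gamma> j j))"
    define d where "d = (\<lambda>k. if k = j then \<alpha> else 0)"
    have dsum: "(\<Sum>k\<in>J. d k * v k) = \<alpha> * v j" for v :: "nat \<Rightarrow> real"
    proof -
      have "(\<Sum>k\<in>J. d k * v k) = (\<Sum>k\<in>J. if k = j then \<alpha> * v k else 0)"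
        by (intro sum.cong) (auto simp: d_def)
      then show ?thesis using J by simp
    qed
    have split: "(\<Sum>k\<in>J. a k * V k z) = (\<Sum>k\<in>J. (a k - d k) * \<xi> k (fst z)) + (\<Sum>k\<in>J. d k * \<xi> k (snd z))" for z
    proof -
      have "(\<Sum>k\<in>J. a k * V k z) = (\<Sum>k\<in>J. a k * \<xi> k (fst z)) - (\<Sum>k\<in>J. a k * (\<Gamma> j k / \<Gamma> j j)) * \<xi> j (fst z)
          + (\<Sum>k\<in>J. a k * (\<Gamma> j k / \<Gamma> j j)) * \<xi> j (snd z)"
        unfolding V_def by (simp add: algebra_simps sum.distrib sum_subtractf sum_distrib_left sum_distrib_right)
      then show ?thesis
        by (simp only: left_diff_distrib sum_subtractf dsum \<alpha>_def)
    qed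
    have "\<alpha> * \<Gamma> j j = (\<Sum>k\<in>J. a k * \<Gamma> j k)"
      using pos by (simp add: \<alpha>_def sum_distrib_right)
    moreover have "(\<Sum>k\<in>J. a k * \<Gamma> k j) = (\<Sum>k\<in>J. a k * \<Gamma> j k)"
      using centered_gaussian_sym[OF cg _ J(2)] by (intro sum.cong) auto
    ultimately have \<alpha>: "(\<Sum>k\<in>J. a k * \<Gamma> j k) = \<alpha> * \<Gamma> j j" "(\<Sum>k\<in>J. a k * \<Gamma> k j) = \<alpha> * \<Gamma> j j" by simp_all
    have inner: "(\<Sum>l\<in>J. x * d l * \<Gamma> k l) = x * (\<alpha> * \<Gamma> k j)" for x k
      using dsum[of "\<Gamma> k"] by (simp add: mult.assoc sum_distrib_left[symmetric])
    have q1: "(\<Sum>k\<in>J. \<Sum>l\<in>J. d k * d l * \<Gamma> k l) = \<alpha> * \<alpha> * \<Gamma> j j"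
      unfolding inner by (simp add: dsum)
    have q2: "(\<Sum>k\<in>J. \<Sum>l\<in>J. a k * d l * \<Gamma> k l) = \<alpha> * \<alpha> * \<Gamma> j j"
    proof -
      have "(\<Sum>k\<in>J. a k * (\<alpha> * \<Gamma> k j)) = \<alpha> * (\<Sum>k\<in>J. a k * \<Gamma> k j)"
        unfolding sum_distrib_left by (intro sum.cong) auto
      then show ?thesis unfolding inner by (simp add: \<alpha>)
    qed
    have q3: "(\<Sum>k\<in>J. \<Sum>l\<in>J. d k * a l * \<Gamma> k l) = \<alpha> * \<alpha> * \<Gamma> j j"
    proof -
      have "(\<Sum>k\<in>J. \<Sum>l\<in>J. d k * a l * \<Gamma> k l) = (\<Sum>k\<in>J. d k * (\<Sum>l\<in>J. a l * \<Gamma> k l))"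
        unfolding sum_distrib_left by (intro sum.cong) auto
      then show ?thesis by (simp add: dsum \<alpha>)
    qed
    \<comment> \<open>The three forms involving \<open>d\<close> coincide, which expresses the
      orthogonality of residual and regressor: the variances of the two independent parts add up to
      the variance for \<open>a\<close>.\<close>
    have q: "(\<Sum>k\<in>J. \<Sum>l\<in>J. (a k - d k) * (a l - d l) * \<Gamma> k l)
        = (\<Sum>k\<in>J. \<Sum>l\<in>J. a k * a l * \<Gamma> k l) - \<alpha> * \<alpha> * \<Gamma> j j"
    proof -
      have "(\<Sum>k\<in>J. \<Sum>l\<in>J. (a k - d k) * (a l - d l) * \<Gamma> k l) = (\<Sum>k\<in>J. \<Sum>l\<in>J. a k * a l * \<Gamma> k l)
        - (\<Sum>k\<in>J. \<Sum>l\<in>J. a k * d l * \<Gamma> k l) - (\<Sum>k\<in>J. \<Sum>l\<in>J. d k * a l * \<Gamma> k l) + (\<Sum>k\<in>J. \<Sum>l\<in>J. d k * d l * \<Gamma> k l)"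
        by (simp add: left_diff_distrib right_diff_distrib sum_subtractf)
      then show ?thesis by (simp add: q1 q2 q3)
    qed
    note t1 = centered_gaussian_trig[OF cg J(1), of "\<lambda>k. a k - d k"]
    note t2 = centered_gaussian_trig[OF cg J(1), of d]
    note t3 = integral_trig_pair[OF prob_space_axioms prob_space_axioms, of "\<lambda>\<omega>. \<Sum>k\<in>J. (a k - d k) * \<xi> k \<omega>" "\<lambda>\<omega>. \<Sum>k\<in>J. d k * \<xi> k \<omega>"]
    show ?thesis
      unfolding split using t3[OF _ _ t2(2)] unfolding t1 t2 centered_gaussian_trig[OF cg J(1), of a] q q1
      by (simp add: exp_add[symmetric] field_simps)
  qed
  show ?thesis
    by (rule cramer_wold[OF prob_space_axioms P.P.prob_space_axioms J(1)])
       (use key centered_gaussian_trig(2)[OF cg J(1)] in \<open>auto simp: V_def\<close>)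
qed

context smooth_product
begin

lemma G_cong: "(\<And>k. k \<in> J \<Longrightarrow> w k = w' k) \<Longrightarrow> G \<nu> w = G \<nu> w'"
  by (simp add: G_def)

end

text \<open>Stein's identity along the line through p with direction q. The order stays below 2
  because the derivative raises it by one and continuity of that derivative takes one more.\<close>

lemma (in smooth_product) G_gauss_law:
  assumes s: "0 < s" and \<nu>: "sum \<nu> J < 2"
  shows "(\<integral>x. x * G \<nu> (\<lambda>k. p k + q k * x) \<partial>gauss_law 0 s) =
    s\<^sup>2 * (\<integral>x. (\<Sum>l\<in>J. q l * G (incr \<nu> l) (\<lambda>k. p k + q k * x)) \<partial>gauss_law 0 s)"
proof -
  have nu3: "\<nu> k < 3" "l \<in> J \<Longrightarrow> incr \<nu> l k < 3" if "k \<in> J" for k l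
    using member_le_sum[of k J \<nu>] member_le_sum[of k J "incr \<nu> l"] that finite_J \<nu> sum_incr[of l \<nu>] by auto
  have line: "((\<lambda>u. p k + q k * u) has_real_derivative q k) (at x)" for k x
    by (auto intro!: derivative_eq_intros)
  define C where "C = \<beta> ^ sum \<nu> J + (\<Sum>l\<in>J. \<bar>q l\<bar> * \<beta> ^ Suc (sum \<nu> J))"
  show ?thesis
  proof (rule gauss_law_stein[OF s])
    fix x
    show "((\<lambda>x. G \<nu> (\<lambda>k. p k + q k * x)) has_real_derivative (\<Sum>l\<in>J. q l * G (incr \<nu> l) (\<lambda>k. p k + q k * x))) (at x)"
      by (rule DERIV_G[of \<nu> "\<lambda>x k. p k + q k * x"]) (use nu3 line in auto)
    have "isCont (\<lambda>x. G (incr \<nu> l) (\<lambda>k. p k + q k * x)) x" if "l \<in> J" for l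
      by (rule DERIV_isCont[OF DERIV_G[of "incr \<nu> l" "\<lambda>x k. p k + q k * x"]]) (use nu3 line that in auto)
    then show "isCont (\<lambda>x. \<Sum>l\<in>J. q l * G (incr \<nu> l) (\<lambda>k. p k + q k * x)) x"
      by (intro continuous_intros) auto
    have "\<bar>G \<nu> (\<lambda>k. p k + q k * x)\<bar> \<le> \<beta> ^ sum \<nu> J"
      using \<nu> by (intro G_bound) auto
    also have "\<dots> \<le> C" using \<beta>_nonneg by (simp add: C_def sum_nonneg)
    finally show "\<bar>G \<nu> (\<lambda>k. p k + q k * x)\<bar> \<le> C" .
    have "\<bar>\<Sum>l\<in>J. q l * G (incr \<nu> l) (\<lambda>k. p k + q k * x)\<bar> \<le> (\<Sum>l\<in>J. \<bar>q l\<bar> * \<beta> ^ Suc (sum \<nu> J))"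
    proof (rule order_trans[OF sum_abs], intro sum_mono)
      fix l assume "l \<in> J"
      then have "\<bar>G (incr \<nu> l) (\<lambda>k. p k + q k * x)\<bar> \<le> \<beta> ^ Suc (sum \<nu> J)"
        using G_bound[of "incr \<nu> l"] \<nu> by (simp only: sum_incr)
      then show "\<bar>q l * G (incr \<nu> l) (\<lambda>k. p k + q k * x)\<bar> \<le> \<bar>q l\<bar> * \<beta> ^ Suc (sum \<nu> J)"
        by (simp only: abs_mult mult_left_mono abs_ge_zero)
    qed
    also have "\<dots> \<le> C" using \<beta>_nonneg by (simp add: C_def)
    finally show "\<bar>\<Sum>l\<in>J. q l * G (incr \<nu> l) (\<lambda>k. p k + q k * x)\<bar> \<le> C" .
  qed
qed

text \<open>After the regression, coordinate k moves with the fresh copy of \<open>\<xi> j\<close>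
  at slope \<open>\<Gamma> j k / \<Gamma> j j\<close>, and all else is independent of that copy. The
  one-dimensional identity in it contributes \<open>\<Gamma> j j\<close> times the slope, that is,
  the covariance.\<close>

lemma gaussian_integration_by_parts:
  fixes \<xi> :: "nat \<Rightarrow> 'b \<Rightarrow> real"
  assumes "smooth_product J \<phi> \<beta>"
    and cg: "centered_gaussian N J \<xi> \<Gamma>" and j: "j \<in> J" and pos: "0 < \<Gamma> j j" and \<nu>: "sum \<nu> J < 2"
  shows "(\<integral>\<omega>. \<xi> j \<omega> * smooth_product.G J \<phi> \<nu> (\<lambda>k. w k + c * \<xi> k \<omega>) \<partial>N) =
    c * (\<Sum>l\<in>J. \<Gamma> j l * (\<integral>\<omega>. smooth_product.G J \<phi> (\<nu>(l := Suc (\<nu> l))) (\<lambda>k. w k + c * \<xi> k \<omega>) \<partial>N))"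
proof -
  interpret smooth_product J \<phi> \<beta> by fact
  interpret prob_space N using cg by (simp add: centered_gaussian_def)
  interpret P: pair_prob_space N N ..
  have xi[measurable]: "\<And>k. k \<in> J \<Longrightarrow> \<xi> k \<in> borel_measurable N"
    by (rule centered_gaussian_measurable[OF cg])
  have xij[measurable]: "\<xi> j \<in> borel_measurable N" using j by simp
  define b where "b = (\<lambda>k. \<Gamma> j k / \<Gamma> j j)"
  define V where "V = (\<lambda>k z. (\<xi> k (fst z) - b k * \<xi> j (fst z)) + b k * \<xi> j (snd z))"
  have [measurable]: "\<And>k. k \<in> J \<Longrightarrow> V k \<in> borel_measurable (N \<Otimes>\<^sub>M N)" unfolding V_def by measurable
  have law: "distr N (PiM J (\<lambda>_. borel)) (\<lambda>x. \<lambda>k\<in>J. \<xi> k x) = distr (N \<Otimes>\<^sub>M N) (PiM J (\<lambda>_. borel)) (\<lambda>z. \<lambda>k\<in>J. V k z)"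
    using centered_gaussian_regression[where j=j, OF cg finite_J j pos] unfolding V_def b_def .
  have transfer: "(\<integral>\<omega>. F (\<lambda>k\<in>J. \<xi> k \<omega>) \<partial>N) = (\<integral>z. F (\<lambda>k\<in>J. V k z) \<partial>(N \<Otimes>\<^sub>M N))"
    if [measurable]: "F \<in> borel_measurable (PiM J (\<lambda>_. borel))" for F :: "(nat \<Rightarrow> real) \<Rightarrow> real"
  proof -
    have "(\<integral>\<omega>. F (\<lambda>k\<in>J. \<xi> k \<omega>) \<partial>N) = (\<integral>y. F y \<partial>distr N (PiM J (\<lambda>_. borel)) (\<lambda>x. \<lambda>k\<in>J. \<xi> k x))"
      by (rule integral_distr[symmetric]) measurable
    also have "\<dots> = (\<integral>z. F (\<lambda>k\<in>J. V k z) \<partial>(N \<Otimes>\<^sub>M N))"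
      unfolding law by (rule integral_distr) measurable
    finally show ?thesis .
  qed
  have meas: "(\<lambda>y. G \<mu> (\<lambda>k. w k + c * y k)) \<in> borel_measurable (PiM J (\<lambda>_. borel))" if "sum \<mu> J < 3" for \<mu>
    by (rule borel_measurable_G[OF that, where w="\<lambda>y k. w k + c * y k"]) measurable
  have measP: "(\<lambda>z. G \<mu> (\<lambda>k. w k + c * V k z)) \<in> borel_measurable (N \<Otimes>\<^sub>M N)" if "sum \<mu> J < 3" for \<mu>
    by (rule borel_measurable_G[OF that, where w="\<lambda>z k. w k + c * V k z"]) measurable
  have restr: "G \<mu> (\<lambda>k. w k + c * (\<lambda>k\<in>J. y k) k) = G \<mu> (\<lambda>k. w k + c * y k)" for \<mu> y
    by (rule G_cong) simp
  \<comment> \<open>Slope 1 at j itself: \<open>V j\<close> is the fresh copy, with no residual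
    left.\<close>
  have bj: "b j = 1" using pos by (simp add: b_def)
  have \<nu>3: "sum \<nu> J < 3" and \<nu>l3: "sum (incr \<nu> l) J < 3" if "l \<in> J" for l
    using \<nu> sum_incr[OF that, of \<nu>] by auto
  have int_xi: "integrable (N \<Otimes>\<^sub>M N) (\<lambda>z. \<xi> j (snd z))"
  proof -
    have "integrable (distr (N \<Otimes>\<^sub>M N) N snd) (\<xi> j)"
      using distr_pair_snd[OF prob_space_axioms prob_space_axioms] centered_gaussian_moments(1)[OF cg finite_J j] by simp
    then show ?thesis by (rule integrable_distr[rotated]) simp
  qed
  have intP: "integrable (N \<Otimes>\<^sub>M N) (\<lambda>z. G (incr \<nu> l) (\<lambda>k. w k + c * V k z))" if "l \<in> J" for l
    using G_bound[of "incr \<nu> l"] \<nu>l3[OF that]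
    by (intro P.P.integrable_const_bound[where B="\<beta> ^ sum (incr \<nu> l) J"] measP AE_I2) auto
  have lin: "w k + c * V k (x, y) = (w k + c * (\<xi> k x - b k * \<xi> j x)) + c * b k * \<xi> j y" for k x y
    by (simp add: V_def algebra_simps)
  have "(\<integral>\<omega>. \<xi> j \<omega> * G \<nu> (\<lambda>k. w k + c * \<xi> k \<omega>) \<partial>N) = (\<integral>z. V j z * G \<nu> (\<lambda>k. w k + c * V k z) \<partial>(N \<Otimes>\<^sub>M N))"
    using transfer[of "\<lambda>y. y j * G \<nu> (\<lambda>k. w k + c * y k)"] meas[OF \<nu>3[OF j]] j by (simp add: restr[unfolded restrict_apply])
  also have "\<dots> = (\<integral>z. \<xi> j (snd z) * G \<nu> (\<lambda>k. w k + c * V k z) \<partial>(N \<Otimes>\<^sub>M N))"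
    by (simp add: V_def bj)
  also have "\<dots> = (\<integral>x. (\<integral>y. \<xi> j y * G \<nu> (\<lambda>k. w k + c * V k (x, y)) \<partial>N) \<partial>N)"
    using G_bound[of \<nu>] \<nu>
    by (subst P.integral_fst'[symmetric])
       (auto intro!: integrable_mult_bounded[OF int_xi measP[OF \<nu>3[OF j]], where C="\<beta> ^ sum \<nu> J"])
  also have "\<dots> = (\<integral>x. \<Gamma> j j * (\<integral>y. (\<Sum>l\<in>J. c * b l * G (incr \<nu> l) (\<lambda>k. w k + c * V k (x, y))) \<partial>N) \<partial>N)"
  proof (intro Bochner_Integration.integral_cong refl)
    fix x
    let ?p = "\<lambda>k. w k + c * (\<xi> k x - b k * \<xi> j x)"
    have m[measurable]: "(\<lambda>u. G \<mu> (\<lambda>k. ?p k + c * b k * u)) \<in> borel_measurable borel" if "sum \<mu> J < 3" for \<mu>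
      by (rule borel_measurable_G[OF that, where w="\<lambda>u k. ?p k + c * b k * u"]) measurable
    have "(\<integral>y. \<xi> j y * G \<nu> (\<lambda>k. w k + c * V k (x, y)) \<partial>N) = (\<integral>u. u * G \<nu> (\<lambda>k. ?p k + c * b k * u) \<partial>distr N borel (\<xi> j))"
      unfolding lin using m[OF \<nu>3[OF j]] by (subst integral_distr) auto
    also have "\<dots> = \<Gamma> j j * (\<integral>u. (\<Sum>l\<in>J. c * b l * G (incr \<nu> l) (\<lambda>k. ?p k + c * b k * u)) \<partial>distr N borel (\<xi> j))"
      unfolding centered_gaussian_component[OF cg finite_J j] using pos \<nu> by (subst G_gauss_law) auto
    also have "(\<integral>u. (\<Sum>l\<in>J. c * b l * G (incr \<nu> l) (\<lambda>k. ?p k + c * b k * u)) \<partial>distr N borel (\<xi> j))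
        = (\<integral>y. (\<Sum>l\<in>J. c * b l * G (incr \<nu> l) (\<lambda>k. w k + c * V k (x, y))) \<partial>N)"
      unfolding lin
      by (subst integral_distr) (auto intro!: borel_measurable_sum borel_measurable_times m \<nu>l3)
    finally show "(\<integral>y. \<xi> j y * G \<nu> (\<lambda>k. w k + c * V k (x, y)) \<partial>N) =
        \<Gamma> j j * (\<integral>y. (\<Sum>l\<in>J. c * b l * G (incr \<nu> l) (\<lambda>k. w k + c * V k (x, y))) \<partial>N)" .
  qed
  also have "\<dots> = \<Gamma> j j * (\<integral>z. (\<Sum>l\<in>J. c * b l * G (incr \<nu> l) (\<lambda>k. w k + c * V k z)) \<partial>(N \<Otimes>\<^sub>M N))"
    using intP by (subst P.integral_fst'[symmetric]) auto
  also have "\<dots> = (\<Sum>l\<in>J. c * \<Gamma> j l * (\<integral>z. G (incr \<nu> l) (\<lambda>k. w k + c * V k z) \<partial>(N \<Otimes>\<^sub>M N)))"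
    using intP pos by (simp add: sum_distrib_left b_def)
  also have "\<dots> = (\<Sum>l\<in>J. c * \<Gamma> j l * (\<integral>\<omega>. G (incr \<nu> l) (\<lambda>k. w k + c * \<xi> k \<omega>) \<partial>N))"
  proof (intro sum.cong refl)
    fix l assume "l \<in> J"
    then show "c * \<Gamma> j l * (\<integral>z. G (incr \<nu> l) (\<lambda>k. w k + c * V k z) \<partial>(N \<Otimes>\<^sub>M N)) =
        c * \<Gamma> j l * (\<integral>\<omega>. G (incr \<nu> l) (\<lambda>k. w k + c * \<xi> k \<omega>) \<partial>N)"
      using transfer[OF meas[OF \<nu>l3]] by (simp add: restr[unfolded restrict_apply])
  qed
  finally show ?thesis by (simp add: sum_distrib_left mult.assoc)
qed

subsection \<open>Independent coordinates, resampling and projections\<close>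

text \<open>Independence is equality of the joint law with the product law, and product laws are
  preserved under injective reindexing.\<close>

lemma (in prob_space) indep_vars_reindex:
  fixes X :: "'j \<Rightarrow> 'a \<Rightarrow> real" and f :: "'i \<Rightarrow> 'j"
  assumes ind: "indep_vars (\<lambda>_. borel) X UNIV" and f: "inj f"
  shows "indep_vars (\<lambda>_. borel) (\<lambda>i. X (f i)) UNIV"
proof -
  have rv[measurable]: "random_variable borel (X s)" for s
    using ind by (auto simp: indep_vars_def)
  let ?D = "\<lambda>s. distr M borel (X s)"
  have X: "distr M (PiM UNIV (\<lambda>_. borel)) (\<lambda>x s. X s x) = PiM UNIV ?D"
    using ind by (subst (asm) indep_vars_iff_distr_eq_PiM) (auto simp: restrict_UNIV)
  have "distr M (PiM UNIV (\<lambda>_. borel)) (\<lambda>x i. X (f i) x)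
      = distr (distr M (PiM UNIV (\<lambda>_. borel)) (\<lambda>x s. X s x)) (PiM UNIV (\<lambda>_. borel)) (\<lambda>z i. z (f i))"
    by (subst distr_distr) (auto intro!: measurable_PiM_single' simp: comp_def)
  also have "\<dots> = distr (PiM UNIV ?D) (PiM UNIV (\<lambda>i. ?D (f i))) (\<lambda>z. \<lambda>i\<in>UNIV. z (f i))"
    unfolding X by (rule distr_cong) (auto intro!: sets_PiM_cong)
  also have "\<dots> = PiM UNIV (\<lambda>i. ?D (f i))"
    by (rule distr_PiM_reindex) (use f in \<open>auto intro: prob_space_distr\<close>)
  finally show ?thesis
    by (subst indep_vars_iff_distr_eq_PiM) (auto simp: restrict_UNIV)
qed

lemma (in prob_space) distr_pair_indep_vars:
  fixes e :: "'i \<Rightarrow> 'a \<Rightarrow> real" and e' :: "'i \<Rightarrow> 'a \<Rightarrow> real"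
  assumes ind: "indep_vars (\<lambda>_. borel) (case_sum e e') UNIV"
  shows "distr M (PiM UNIV (\<lambda>_. borel) \<Otimes>\<^sub>M PiM UNIV (\<lambda>_. borel)) (\<lambda>\<omega>. (\<lambda>i. e i \<omega>, \<lambda>i. e' i \<omega>))
    = PiM UNIV (\<lambda>i. distr M borel (e i)) \<Otimes>\<^sub>M PiM UNIV (\<lambda>i. distr M borel (e' i))"
proof -
  have rv: "random_variable borel (case_sum e e' s)" for s
    using ind by (auto simp: indep_vars_def)
  have rve[measurable]: "random_variable borel (e i)" "random_variable borel (e' j)" for i j
    using rv[of "Inl i"] rv[of "Inr j"] by simp_all
  have ind1: "indep_vars (\<lambda>_. borel) e UNIV" and ind2: "indep_vars (\<lambda>_. borel) e' UNIV"
    using indep_vars_reindex[OF ind inj_Inl] indep_vars_reindex[OF ind inj_Inr] by simp_all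
  have "indep_var (PiM (range Inl) (\<lambda>_. borel)) (\<lambda>\<omega>. restrict (\<lambda>i. case_sum e e' i \<omega>) (range Inl))
      (PiM (range Inr) (\<lambda>_. borel)) (\<lambda>\<omega>. restrict (\<lambda>i. case_sum e e' i \<omega>) (range Inr))"
    by (rule indep_var_restrict[OF ind]) auto
  then have "indep_var (PiM UNIV (\<lambda>_. borel)) ((\<lambda>z i. z (Inl i)) \<circ> (\<lambda>\<omega>. restrict (\<lambda>i. case_sum e e' i \<omega>) (range Inl)))
      (PiM UNIV (\<lambda>_. borel)) ((\<lambda>z i. z (Inr i)) \<circ> (\<lambda>\<omega>. restrict (\<lambda>i. case_sum e e' i \<omega>) (range Inr)))"
    by (rule indep_var_compose) (auto intro!: measurable_PiM_single')
  then have "indep_var (PiM UNIV (\<lambda>_. borel)) (\<lambda>\<omega> i. e i \<omega>) (PiM UNIV (\<lambda>_. borel)) (\<lambda>\<omega> i. e' i \<omega>)"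
    by (simp add: comp_def)
  then have "distr M (PiM UNIV (\<lambda>_. borel)) (\<lambda>\<omega> i. e i \<omega>) \<Otimes>\<^sub>M distr M (PiM UNIV (\<lambda>_. borel)) (\<lambda>\<omega> i. e' i \<omega>)
      = distr M (PiM UNIV (\<lambda>_. borel) \<Otimes>\<^sub>M PiM UNIV (\<lambda>_. borel)) (\<lambda>\<omega>. (\<lambda>i. e i \<omega>, \<lambda>i. e' i \<omega>))"
    by (simp add: indep_var_distribution_eq)
  moreover have "distr M (PiM UNIV (\<lambda>_. borel)) (\<lambda>\<omega> i. e i \<omega>) = PiM UNIV (\<lambda>i. distr M borel (e i))"
    using ind1 by (subst (asm) indep_vars_iff_distr_eq_PiM) (auto simp: restrict_UNIV)
  moreover have "distr M (PiM UNIV (\<lambda>_. borel)) (\<lambda>\<omega> i. e' i \<omega>) = PiM UNIV (\<lambda>i. distr M borel (e' i))"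
    using ind2 by (subst (asm) indep_vars_iff_distr_eq_PiM) (auto simp: restrict_UNIV)
  ultimately show ?thesis by simp
qed

locale coordinate_space =
  fixes \<mu> :: "'i \<Rightarrow> real measure"
  assumes prob_\<mu>: "\<And>i. prob_space (\<mu> i)" and sets_\<mu>[simp]: "\<And>i. sets (\<mu> i) = sets borel"
begin

lemma space_\<mu>[simp]: "space (\<mu> i) = UNIV"
  using sets_eq_imp_space_eq[OF sets_\<mu>[of i]] by simp

definition P :: "('i \<Rightarrow> real) measure" where "P = PiM UNIV \<mu>"

lemma sets_P[measurable_cong]: "sets P = sets (PiM UNIV (\<lambda>_. borel))"
  unfolding P_def by (intro sets_PiM_cong) auto

lemma space_P[simp]: "space P = UNIV"
  by (simp add: P_def space_PiM)

sublocale P: prob_space P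
  unfolding P_def by (intro prob_space_PiM prob_\<mu>)

sublocale PP: pair_prob_space P P ..

definition mix :: "'i set \<Rightarrow> ('i \<Rightarrow> real) \<Rightarrow> ('i \<Rightarrow> real) \<Rightarrow> 'i \<Rightarrow> real" where
  "mix K x y = (\<lambda>i. if i \<in> K then x i else y i)"

lemma measurable_coord[measurable]: "(\<lambda>x. x i) \<in> borel_measurable P"
  by (subst measurable_cong_sets[OF sets_P refl]) measurable

lemma measurable_to_P: "(\<And>i. (\<lambda>z. f z i) \<in> borel_measurable M) \<Longrightarrow> f \<in> measurable M P"
  by (subst measurable_cong_sets[OF refl sets_P]) (rule measurable_PiM_single', auto)

lemma measurable_mix[measurable (raw)]:
  assumes f: "f \<in> measurable M P" and g: "g \<in> measurable M P"
  shows "(\<lambda>z. mix K (f z) (g z)) \<in> measurable M P"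
proof (rule measurable_to_P)
  fix i
  show "(\<lambda>z. mix K (f z) (g z) i) \<in> borel_measurable M"
    using measurable_compose[OF f measurable_coord[of i]] measurable_compose[OF g measurable_coord[of i]]
    by (simp add: mix_def)
qed

text \<open>The pair is viewed as one independent family over the sum type \<open>'i + 'i\<close>.
  Exchanging the two copies outside K is an injective reindexing that replaces every coordinate by a
  twin of the same law.\<close>

lemma swap_law:
  "distr (P \<Otimes>\<^sub>M P) (P \<Otimes>\<^sub>M P) (\<lambda>z. (mix K (fst z) (snd z), mix K (snd z) (fst z))) = P \<Otimes>\<^sub>M P"
proof -
  define \<nu> :: "'i + 'i \<Rightarrow> real measure" where "\<nu> = case_sum \<mu> \<mu>"
  have \<nu>: "prob_space (\<nu> s)" "sets (\<nu> s) = sets borel" for s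
    by (auto simp: \<nu>_def prob_\<mu> split: sum.split)
  define Q where "Q = PiM UNIV \<nu>"
  interpret Q: prob_space Q unfolding Q_def by (intro prob_space_PiM \<nu>)
  have sets_Q[measurable_cong]: "sets Q = sets (PiM UNIV (\<lambda>_. borel))"
    unfolding Q_def by (intro sets_PiM_cong) (auto simp: \<nu>)
  have cQ[measurable]: "(\<lambda>z. z s) \<in> borel_measurable Q" for s
    by (subst measurable_cong_sets[OF sets_Q refl]) measurable
  have comp: "distr Q borel (\<lambda>z. z s) = \<nu> s" for s
  proof -
    have "distr Q borel (\<lambda>z. z s) = distr Q (\<nu> s) (\<lambda>z. z s)" by (rule distr_cong) (auto simp: \<nu>)
    also have "\<dots> = \<nu> s" unfolding Q_def by (rule distr_PiM_component) (auto simp: \<nu>)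
    finally show ?thesis .
  qed
  have indep: "Q.indep_vars (\<lambda>_. borel) (\<lambda>s z. z s) UNIV"
  proof (subst Q.indep_vars_iff_distr_eq_PiM)
    have "distr Q (PiM UNIV (\<lambda>_. borel)) (\<lambda>x. \<lambda>i\<in>UNIV. x i) = Q"
      by (simp add: restrict_UNIV distr_id2 sets_Q)
    then show "distr Q (PiM UNIV (\<lambda>_. borel)) (\<lambda>x. \<lambda>i\<in>UNIV. x i) = PiM UNIV (\<lambda>i. distr Q borel (\<lambda>z. z i))"
      unfolding comp Q_def[symmetric] .
  qed auto
  \<comment> \<open>Used twice: for the plain splitting into left and right halves, and for the
    splitting with the halves exchanged outside K.\<close>
  have law: "distr Q (P \<Otimes>\<^sub>M P) (\<lambda>z. (\<lambda>i. z (a i), \<lambda>i. z (b i))) = P \<Otimes>\<^sub>M P"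
    if inj: "inj (case_sum a b)" and ab: "\<And>i. \<nu> (a i) = \<mu> i" "\<And>i. \<nu> (b i) = \<mu> i" for a b :: "'i \<Rightarrow> 'i + 'i"
  proof -
    have "(\<lambda>s z. z (case_sum a b s)) = case_sum (\<lambda>i z. z (a i)) (\<lambda>i z. (z (b i) :: real))"
      by (auto simp: fun_eq_iff split: sum.split)
    with Q.indep_vars_reindex[OF indep inj] have "Q.indep_vars (\<lambda>_. borel) (case_sum (\<lambda>i z. z (a i)) (\<lambda>i z. z (b i))) UNIV"
      by simp
    from Q.distr_pair_indep_vars[OF this]
    have "distr Q (PiM UNIV (\<lambda>_. borel) \<Otimes>\<^sub>M PiM UNIV (\<lambda>_. borel)) (\<lambda>z. (\<lambda>i. z (a i), \<lambda>i. z (b i))) = P \<Otimes>\<^sub>M P"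
      by (simp add: comp ab P_def)
    moreover have "distr Q (PiM UNIV (\<lambda>_. borel) \<Otimes>\<^sub>M PiM UNIV (\<lambda>_. borel)) (\<lambda>z. (\<lambda>i. z (a i), \<lambda>i. z (b i)))
        = distr Q (P \<Otimes>\<^sub>M P) (\<lambda>z. (\<lambda>i. z (a i), \<lambda>i. z (b i)))"
      by (rule distr_cong) (auto intro!: sets_pair_measure_cong sets_P[symmetric])
    ultimately show ?thesis by simp
  qed
  have split: "distr Q (P \<Otimes>\<^sub>M P) (\<lambda>z. (\<lambda>i. z (Inl i), \<lambda>i. z (Inr i))) = P \<Otimes>\<^sub>M P"
    by (rule law) (auto simp: \<nu>_def inj_def split: sum.splits)
  have meas: "(\<lambda>z. (\<lambda>i. z (a i), \<lambda>i. z (b i))) \<in> measurable Q (P \<Otimes>\<^sub>M P)" for a b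
    by (intro measurable_Pair measurable_to_P) auto
  have "distr (P \<Otimes>\<^sub>M P) (P \<Otimes>\<^sub>M P) (\<lambda>z. (mix K (fst z) (snd z), mix K (snd z) (fst z)))
     = distr (distr Q (P \<Otimes>\<^sub>M P) (\<lambda>z. (\<lambda>i. z (Inl i), \<lambda>i. z (Inr i)))) (P \<Otimes>\<^sub>M P) (\<lambda>z. (mix K (fst z) (snd z), mix K (snd z) (fst z)))"
    by (simp only: split)
  also have "\<dots> = distr Q (P \<Otimes>\<^sub>M P) ((\<lambda>z. (mix K (fst z) (snd z), mix K (snd z) (fst z))) \<circ> (\<lambda>z. (\<lambda>i. z (Inl i), \<lambda>i. z (Inr i))))"
    by (rule distr_distr) (use meas in \<open>auto intro!: measurable_Pair measurable_mix\<close>)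
  also have "((\<lambda>z. (mix K (fst z) (snd z), mix K (snd z) (fst z))) \<circ> (\<lambda>z. (\<lambda>i. z (Inl i), \<lambda>i. z (Inr i))))
     = (\<lambda>z. (\<lambda>i. z (if i \<in> K then Inl i else Inr i), \<lambda>i. z (if i \<in> K then Inr i else Inl i)))"
    by (auto simp: mix_def fun_eq_iff)
  also have "distr Q (P \<Otimes>\<^sub>M P) \<dots> = P \<Otimes>\<^sub>M P"
    by (rule law) (auto simp: \<nu>_def inj_def split: sum.splits if_splits)
  finally show ?thesis .
qed

lemma mix_law: "distr (P \<Otimes>\<^sub>M P) P (\<lambda>z. mix K (fst z) (snd z)) = P"
proof -
  have "distr (P \<Otimes>\<^sub>M P) P (\<lambda>z. mix K (fst z) (snd z))
     = distr (distr (P \<Otimes>\<^sub>M P) (P \<Otimes>\<^sub>M P) (\<lambda>z. (mix K (fst z) (snd z), mix K (snd z) (fst z)))) P fst"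
    by (subst distr_distr) (auto simp: comp_def)
  also have "\<dots> = P" unfolding swap_law by (rule P.distr_pair_fst)
  finally show ?thesis .
qed

end

section \<open>Moment inequalities\<close>

lemma (in prob_space) integrable_of_power4:
  fixes f :: "'a \<Rightarrow> real"
  assumes [measurable]: "f \<in> borel_measurable M" and i: "integrable M (\<lambda>x. (f x) ^ 4)"
  shows "integrable M f" "integrable M (\<lambda>x. (f x)\<^sup>2)" "integrable M (\<lambda>x. \<bar>f x\<bar> ^ 3)"
proof -
  have *: "\<bar>f x\<bar> \<le> 1 + (f x) ^ 4" "(f x)\<^sup>2 \<le> 1 + (f x) ^ 4" "\<bar>f x\<bar> ^ 3 \<le> 1 + (f x) ^ 4" for x
  proof -
    have a: "\<bar>f x\<bar> ^ k \<le> 1 + \<bar>f x\<bar> ^ 4" if "k \<le> 4" for k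
    proof (cases "\<bar>f x\<bar> \<le> 1")
      case True
      then have "\<bar>f x\<bar> ^ k \<le> 1" by (simp add: power_le_one)
      then show ?thesis by (simp add: add_increasing2)
    next
      case False
      then have "\<bar>f x\<bar> ^ k \<le> \<bar>f x\<bar> ^ 4" using that by (intro power_increasing) auto
      then show ?thesis by simp
    qed
    from a[of 1] a[of 2] a[of 3]
    show "\<bar>f x\<bar> \<le> 1 + (f x) ^ 4" "(f x)\<^sup>2 \<le> 1 + (f x) ^ 4" "\<bar>f x\<bar> ^ 3 \<le> 1 + (f x) ^ 4" by simp_all
  qed
  have p: "0 \<le> (f x) ^ 4" for x by simp
  have b: "integrable M (\<lambda>x. 1 + (f x) ^ 4)" using i by simp
  show "integrable M f" "integrable M (\<lambda>x. (f x)\<^sup>2)" "integrable M (\<lambda>x. \<bar>f x\<bar> ^ 3)"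
    by (rule Bochner_Integration.integrable_bound[OF b]; use * p in \<open>auto simp: add_nonneg_nonneg\<close>)+
qed

lemma (in prob_space) integrable_of_square:
  fixes f :: "'a \<Rightarrow> real"
  assumes [measurable]: "f \<in> borel_measurable M" and i: "integrable M (\<lambda>x. (f x)\<^sup>2)"
  shows "integrable M f"
proof (rule Bochner_Integration.integrable_bound)
  show "integrable M (\<lambda>x. 1 + (f x)\<^sup>2)" using i by simp
  show "AE x in M. norm (f x) \<le> norm (1 + (f x)\<^sup>2)"
  proof (intro AE_I2)
    fix x
    have "0 \<le> (\<bar>f x\<bar> - 1)\<^sup>2" "0 \<le> \<bar>f x\<bar>" by auto
    then show "norm (f x) \<le> norm (1 + (f x)\<^sup>2)" by (simp add: power2_diff)
  qed
qed measurable

lemma (in prob_space) jensen_square: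
  fixes f :: "'a \<Rightarrow> real"
  assumes [measurable]: "f \<in> borel_measurable M" and i: "integrable M (\<lambda>x. (f x)\<^sup>2)"
  shows "(\<integral>x. f x \<partial>M)\<^sup>2 \<le> (\<integral>x. (f x)\<^sup>2 \<partial>M)"
proof -
  have "0 \<le> variance f" by (rule variance_positive)
  also have "\<dots> = (\<integral>x. (f x)\<^sup>2 \<partial>M) - (\<integral>x. f x \<partial>M)\<^sup>2"
    using integrable_of_square[OF assms] i by (rule variance_eq)
  finally show ?thesis by simp
qed

lemma nn_integral_not_integrable:
  fixes f :: "'a \<Rightarrow> real"
  assumes "f \<in> borel_measurable M" "\<And>x. 0 \<le> f x" "\<not> integrable M f"
  shows "(\<integral>\<^sup>+x. ennreal (f x) \<partial>M) = \<infinity>"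
proof (rule ccontr)
  assume "\<not> ?thesis"
  then have "(\<integral>\<^sup>+x. ennreal (f x) \<partial>M) < \<infinity>" by (simp add: less_top)
  then have "integrable M f" using assms by (intro integrableI_nonneg) auto
  with assms show False by simp
qed

text \<open>Phrased with a nonnegative integral so that it applies to sections of unknown
  integrability: where the square is not integrable, the right side is infinite.\<close>

lemma (in prob_space) jensen_square_nn:
  fixes f :: "'a \<Rightarrow> real"
  assumes m[measurable]: "f \<in> borel_measurable M"
  shows "ennreal ((\<integral>x. f x \<partial>M)\<^sup>2) \<le> (\<integral>\<^sup>+x. ennreal ((f x)\<^sup>2) \<partial>M)"
proof (cases "integrable M (\<lambda>x. (f x)\<^sup>2)")
  case True
  then show ?thesis
    using jensen_square[OF m True] by (subst nn_integral_eq_integral) (auto intro: ennreal_leI)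
next
  case False
  then show ?thesis by (subst nn_integral_not_integrable) auto
qed

lemma (in prob_space) jensen_power4_nn:
  fixes f :: "'a \<Rightarrow> real"
  assumes m[measurable]: "f \<in> borel_measurable M"
  shows "ennreal ((\<integral>x. f x \<partial>M) ^ 4) \<le> (\<integral>\<^sup>+x. ennreal ((f x) ^ 4) \<partial>M)"
proof (cases "integrable M (\<lambda>x. (f x) ^ 4)")
  case True
  have "((\<integral>x. f x \<partial>M)\<^sup>2)\<^sup>2 \<le> (\<integral>x. (f x)\<^sup>2 \<partial>M)\<^sup>2"
    using jensen_square[OF m integrable_of_power4(2)[OF m True]] by (intro power_mono) auto
  also have "\<dots> \<le> (\<integral>x. ((f x)\<^sup>2)\<^sup>2 \<partial>M)"
    using True by (intro jensen_square) (auto simp flip: power_mult)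
  finally have "(\<integral>x. f x \<partial>M) ^ 4 \<le> (\<integral>x. (f x) ^ 4 \<partial>M)" by (simp flip: power_mult)
  then show ?thesis
    using True by (subst nn_integral_eq_integral) (auto intro: ennreal_leI)
next
  case False
  then show ?thesis by (subst nn_integral_not_integrable) auto
qed

text \<open>Weighted AM-GM: 2 |f g| <= (b' / a') f^2 + (a' / b') g^2. The bounds are shifted to a' =
  a + e and b' = b + e to allow a = 0 or b = 0, and e tends to 0.\<close>

lemma integral_cauchy_schwarz:
  fixes f g :: "'a \<Rightarrow> real"
  assumes [measurable]: "f \<in> borel_measurable M" "g \<in> borel_measurable M"
    and i: "integrable M (\<lambda>x. (f x)\<^sup>2)" "integrable M (\<lambda>x. (g x)\<^sup>2)"
    and a: "(\<integral>x. (f x)\<^sup>2 \<partial>M) \<le> a\<^sup>2" "0 \<le> a" and b: "(\<integral>x. (g x)\<^sup>2 \<partial>M) \<le> b\<^sup>2" "0 \<le> b"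
  shows "(\<integral>x. \<bar>f x * g x\<bar> \<partial>M) \<le> a * b"
proof -
  have *: "(\<integral>x. \<bar>f x * g x\<bar> \<partial>M) \<le> (a + e) * (b + e)" if e: "0 < e" for e
  proof -
    define a' where "a' = a + e"
    define b' where "b' = b + e"
    have pos: "0 < a'" "0 < b'" using a b e by (auto simp: a'_def b'_def)
    have "\<bar>f x * g x\<bar> \<le> (b' / a' * (f x)\<^sup>2 + a' / b' * (g x)\<^sup>2) / 2" for x
    proof -
      have "0 \<le> (b' * \<bar>f x\<bar> - a' * \<bar>g x\<bar>)\<^sup>2" by simp
      then have "2 * (a' * b') * \<bar>f x * g x\<bar> \<le> b'\<^sup>2 * (f x)\<^sup>2 + a'\<^sup>2 * (g x)\<^sup>2"
        by (simp add: power2_diff power_mult_distrib abs_mult mult_ac)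
      then show ?thesis using pos
        by (simp add: field_simps power2_eq_square)
    qed
    then have "(\<integral>x. \<bar>f x * g x\<bar> \<partial>M) \<le> (\<integral>x. (b' / a' * (f x)\<^sup>2 + a' / b' * (g x)\<^sup>2) / 2 \<partial>M)"
      using i by (intro integral_mono integrable_abs integrable_mult_square) auto
    also have "\<dots> = (b' / a' * (\<integral>x. (f x)\<^sup>2 \<partial>M) + a' / b' * (\<integral>x. (g x)\<^sup>2 \<partial>M)) / 2"
      using i by simp
    also have "\<dots> \<le> (b' / a' * a'\<^sup>2 + a' / b' * b'\<^sup>2) / 2"
    proof -
      have "a\<^sup>2 \<le> a'\<^sup>2" "b\<^sup>2 \<le> b'\<^sup>2" using a b e by (auto simp: a'_def b'_def intro!: power_mono)
      then have "(\<integral>x. (f x)\<^sup>2 \<partial>M) \<le> a'\<^sup>2" "(\<integral>x. (g x)\<^sup>2 \<partial>M) \<le> b'\<^sup>2" using a b by linarith+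
      then show ?thesis using pos by (intro divide_right_mono add_mono mult_left_mono) auto
    qed
    also have "\<dots> = a' * b'" using pos by (simp add: power2_eq_square)
    finally show ?thesis by (simp add: a'_def b'_def)
  qed
  have "((\<lambda>e. (a + e) * (b + e)) \<longlongrightarrow> (a + 0) * (b + 0)) (at_right 0)"
    by (intro tendsto_intros)
  then show ?thesis
    using * by (intro tendsto_lowerbound[where F="at_right (0::real)" and f="\<lambda>e. (a + e) * (b + e)"])
      (auto simp: eventually_at_right_less intro: eventually_mono[OF eventually_at_right_less])
qed

lemma integral_minkowski:
  fixes f g :: "'a \<Rightarrow> real"
  assumes [measurable]: "f \<in> borel_measurable M" "g \<in> borel_measurable M"
    and i: "integrable M (\<lambda>x. (f x)\<^sup>2)" "integrable M (\<lambda>x. (g x)\<^sup>2)"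
    and a: "(\<integral>x. (f x)\<^sup>2 \<partial>M) \<le> a\<^sup>2" "0 \<le> a" and b: "(\<integral>x. (g x)\<^sup>2 \<partial>M) \<le> b\<^sup>2" "0 \<le> b"
  shows "integrable M (\<lambda>x. (f x + g x)\<^sup>2)" "(\<integral>x. (f x + g x)\<^sup>2 \<partial>M) \<le> (a + b)\<^sup>2"
proof -
  have fg: "integrable M (\<lambda>x. f x * g x)" using i by (intro integrable_mult_square) auto
  have eq: "(f x + g x)\<^sup>2 = (f x)\<^sup>2 + (g x)\<^sup>2 + 2 * (f x * g x)" for x
    by (simp add: power2_sum)
  show "integrable M (\<lambda>x. (f x + g x)\<^sup>2)" unfolding eq using i fg by simp
  have "(\<integral>x. f x * g x \<partial>M) \<le> (\<integral>x. \<bar>f x * g x\<bar> \<partial>M)"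
    using fg by (intro integral_mono) auto
  also have "\<dots> \<le> a * b" using assms by (intro integral_cauchy_schwarz) auto
  finally show "(\<integral>x. (f x + g x)\<^sup>2 \<partial>M) \<le> (a + b)\<^sup>2"
    unfolding eq using i fg a b by (simp add: power2_sum)
qed

lemma power4_sum_le: "((a::real) + b) ^ 4 \<le> 8 * (a ^ 4 + b ^ 4)"
proof -
  have 1: "(u + v)\<^sup>2 \<le> 2 * (u\<^sup>2 + v\<^sup>2)" for u v :: real
    using zero_le_power2[of "u - v"] by (simp add: power2_sum power2_diff)
  have "((a + b)\<^sup>2)\<^sup>2 \<le> (2 * (a\<^sup>2 + b\<^sup>2))\<^sup>2" by (intro power_mono 1) auto
  also have "\<dots> = 4 * (a\<^sup>2 + b\<^sup>2)\<^sup>2" by (simp add: power2_eq_square algebra_simps)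
  also have "\<dots> \<le> 4 * (2 * ((a\<^sup>2)\<^sup>2 + (b\<^sup>2)\<^sup>2))" using 1[of "a\<^sup>2" "b\<^sup>2"] by simp
  finally show ?thesis by (simp flip: power_mult)
qed

section \<open>Conditional expectations and resampling on the product space\<close>

context coordinate_space
begin

text \<open>A pointwise substitute for measurability with respect to the coordinates in K: it is
  stable under arbitrary pointwise operations, and disjoint sets give independence under the product
  law.\<close>

definition dep :: "'i set \<Rightarrow> (('i \<Rightarrow> real) \<Rightarrow> 'c) \<Rightarrow> bool" where
  "dep K f \<longleftrightarrow> (\<forall>x x'. (\<forall>i\<in>K. x i = x' i) \<longrightarrow> f x = f x')"

lemma dep_mono: "dep K f \<Longrightarrow> K \<subseteq> K' \<Longrightarrow> dep K' f"
  unfolding dep_def by blast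

lemma dep_mix: "dep K f \<Longrightarrow> f (mix K x y) = f x"
  unfolding dep_def mix_def by simp

text \<open>The conditional expectation of \<open>f\<close> given the coordinates in \<open>K\<close>, as an everywhere defined function.\<close>

definition cexp :: "'i set \<Rightarrow> (('i \<Rightarrow> real) \<Rightarrow> real) \<Rightarrow> ('i \<Rightarrow> real) \<Rightarrow> real" where
  "cexp K f x = (\<integral>y. f (mix K x y) \<partial>P)"

lemma measurable_cexp[measurable]:
  assumes [measurable]: "f \<in> borel_measurable P"
  shows "cexp K f \<in> borel_measurable P"
  unfolding cexp_def by measurable

lemma dep_cexp: "dep K f \<Longrightarrow> dep (K \<inter> K') (cexp K' f)"
  unfolding dep_def cexp_def
  by (intro allI impI Bochner_Integration.integral_cong refl) (auto simp: mix_def)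

lemma dep_cexp_self: "dep K (cexp K f)"
  using dep_cexp[of UNIV f K] by (auto simp: dep_def) (metis ext)

lemma integrable_mix:
  fixes f :: "('i \<Rightarrow> real) \<Rightarrow> real"
  assumes "integrable P f"
  shows "integrable (P \<Otimes>\<^sub>M P) (\<lambda>z. f (mix K (fst z) (snd z)))"
proof -
  have "integrable (distr (P \<Otimes>\<^sub>M P) P (\<lambda>z. mix K (fst z) (snd z))) f" using assms by (simp add: mix_law)
  then show ?thesis by (rule integrable_distr[rotated]) measurable
qed

lemma integral_mix:
  fixes f :: "('i \<Rightarrow> real) \<Rightarrow> real"
  assumes [measurable]: "f \<in> borel_measurable P"
  shows "(\<integral>z. f (mix K (fst z) (snd z)) \<partial>(P \<Otimes>\<^sub>M P)) = (\<integral>x. f x \<partial>P)"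
proof -
  have "(\<integral>x. f x \<partial>P) = (\<integral>x. f x \<partial>distr (P \<Otimes>\<^sub>M P) P (\<lambda>z. mix K (fst z) (snd z)))" by (simp add: mix_law)
  also have "\<dots> = (\<integral>z. f (mix K (fst z) (snd z)) \<partial>(P \<Otimes>\<^sub>M P))" by (rule integral_distr) measurable
  finally show ?thesis by simp
qed

lemma nn_integral_mix:
  assumes [measurable]: "f \<in> borel_measurable P"
  shows "(\<integral>\<^sup>+x. (\<integral>\<^sup>+y. f (mix K x y) \<partial>P) \<partial>P) = (\<integral>\<^sup>+x. f x \<partial>P)"
proof -
  have "(\<integral>\<^sup>+x. f x \<partial>P) = (\<integral>\<^sup>+x. f x \<partial>distr (P \<Otimes>\<^sub>M P) P (\<lambda>z. mix K (fst z) (snd z)))" by (simp add: mix_law)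
  also have "\<dots> = (\<integral>\<^sup>+z. f (mix K (fst z) (snd z)) \<partial>(P \<Otimes>\<^sub>M P))" by (rule nn_integral_distr) measurable
  also have "\<dots> = (\<integral>\<^sup>+x. (\<integral>\<^sup>+y. f (mix K x y) \<partial>P) \<partial>P)"
    by (subst P.nn_integral_fst[symmetric]) auto
  finally show ?thesis by simp
qed

text \<open>Conditional Jensen inequality: Jensen in the inner integral, after which
  \<open>mix\<close> has law \<open>P\<close> under the product.\<close>

lemma cexp_power4:
  assumes [measurable]: "f \<in> borel_measurable P" and i: "integrable P (\<lambda>x. (f x) ^ 4)"
  shows "integrable P (\<lambda>x. (cexp K f x) ^ 4)" "(\<integral>x. (cexp K f x) ^ 4 \<partial>P) \<le> (\<integral>x. (f x) ^ 4 \<partial>P)"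
proof -
  have "(\<integral>\<^sup>+x. ennreal ((cexp K f x) ^ 4) \<partial>P) \<le> (\<integral>\<^sup>+x. (\<integral>\<^sup>+y. ennreal ((f (mix K x y)) ^ 4) \<partial>P) \<partial>P)"
    unfolding cexp_def by (intro nn_integral_mono P.jensen_power4_nn) measurable
  also have "\<dots> = (\<integral>\<^sup>+x. ennreal ((f x) ^ 4) \<partial>P)" by (rule nn_integral_mix) measurable
  also have "\<dots> = ennreal (\<integral>x. (f x) ^ 4 \<partial>P)" using i by (intro nn_integral_eq_integral) auto
  finally have *: "(\<integral>\<^sup>+x. ennreal ((cexp K f x) ^ 4) \<partial>P) \<le> ennreal (\<integral>x. (f x) ^ 4 \<partial>P)" .
  show I: "integrable P (\<lambda>x. (cexp K f x) ^ 4)"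
    by (rule integrableI_nonneg) (use * in \<open>auto intro: le_less_trans\<close>)
  have "ennreal (\<integral>x. (cexp K f x) ^ 4 \<partial>P) \<le> ennreal (\<integral>x. (f x) ^ 4 \<partial>P)"
    using * by (subst nn_integral_eq_integral[OF I, symmetric]) auto
  then show "(\<integral>x. (cexp K f x) ^ 4 \<partial>P) \<le> (\<integral>x. (f x) ^ 4 \<partial>P)"
    by (subst (asm) ennreal_le_iff) auto
qed

text \<open>The defining property of a conditional expectation: g does not see the resampled
  coordinates, so Fubini pulls it out of the inner integral.\<close>

lemma integral_cexp_mult:
  assumes [measurable]: "f \<in> borel_measurable P" "g \<in> borel_measurable P"
    and "dep K g" and i: "integrable P (\<lambda>x. f x * g x)"
  shows "(\<integral>x. cexp K f x * g x \<partial>P) = (\<integral>x. f x * g x \<partial>P)"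
proof -
  have "(\<integral>x. f x * g x \<partial>P) = (\<integral>z. f (mix K (fst z) (snd z)) * g (mix K (fst z) (snd z)) \<partial>(P \<Otimes>\<^sub>M P))"
    by (rule integral_mix[symmetric]) measurable
  also have "\<dots> = (\<integral>x. (\<integral>y. f (mix K x y) * g (mix K x y) \<partial>P) \<partial>P)"
    using integrable_mix[OF i] by (subst PP.integral_fst'[symmetric]) auto
  also have "\<dots> = (\<integral>x. cexp K f x * g x \<partial>P)"
    by (simp add: dep_mix[OF \<open>dep K g\<close>] cexp_def)
  finally show ?thesis by simp
qed

lemma integral_cexp:
  assumes [measurable]: "f \<in> borel_measurable P" and "integrable P f"
  shows "(\<integral>x. cexp K f x \<partial>P) = (\<integral>x. f x \<partial>P)"
  using integral_cexp_mult[of f "\<lambda>_. 1" K] assms by (simp add: dep_def)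

text \<open>Because f depends on none of the coordinates in K', its conditional expectation given K'
  is the constant mean.\<close>

lemma integral_mult_dep:
  fixes f g :: "('i \<Rightarrow> real) \<Rightarrow> real"
  assumes [measurable]: "f \<in> borel_measurable P" "g \<in> borel_measurable P"
    and "dep K f" "dep K' g" "K \<inter> K' = {}" and i: "integrable P (\<lambda>x. f x * g x)"
  shows "(\<integral>x. f x * g x \<partial>P) = (\<integral>x. f x \<partial>P) * (\<integral>x. g x \<partial>P)"
proof -
  have "f (mix K' x y) = f y" for x y
  proof -
    have "\<forall>i\<in>K. mix K' x y i = y i" using \<open>K \<inter> K' = {}\<close> by (auto simp: mix_def)
    then show ?thesis using \<open>dep K f\<close> unfolding dep_def by blast
  qed
  then have "cexp K' f x = (\<integral>x. f x \<partial>P)" for x by (simp add: cexp_def)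
  then show ?thesis
    using integral_cexp_mult[of f g K'] assms by simp
qed

end

lemma tendsto_0_sandwich:
  fixes a b :: "nat \<Rightarrow> real"
  assumes "\<And>n. 0 \<le> a n" "\<And>n. a n \<le> b n" "b \<longlonglongrightarrow> 0"
  shows "a \<longlonglongrightarrow> 0"
  by (rule tendsto_sandwich[OF _ _ tendsto_const assms(3)]) (simp_all add: assms)

context coordinate_space
begin

lemma mix_UNIV[simp]: "mix UNIV x y = x"
  by (simp add: mix_def)

lemma integrable_pair_fst: "integrable P f \<Longrightarrow> integrable (P \<Otimes>\<^sub>M P) (\<lambda>z. f (fst z))" for f :: "('i \<Rightarrow> real) \<Rightarrow> real"
  using integrable_mix[of f UNIV] by simp

lemma integral_pair_fst: "f \<in> borel_measurable P \<Longrightarrow> (\<integral>z. f (fst z) \<partial>(P \<Otimes>\<^sub>M P)) = (\<integral>x. f x \<partial>P)" for f :: "('i \<Rightarrow> real) \<Rightarrow> real"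
  using integral_mix[of f UNIV] by simp

text \<open>Exchanges the single coordinate k for that of an independent copy. For a causal
  functional at time i and k = i - l this is the coupling difference X_i - X_i(l).\<close>

definition resample :: "'i \<Rightarrow> (('i \<Rightarrow> real) \<Rightarrow> real) \<Rightarrow> ('i \<Rightarrow> real) \<times> ('i \<Rightarrow> real) \<Rightarrow> real" where
  "resample k f z = f (fst z) - f (mix (- {k}) (fst z) (snd z))"

lemma measurable_resample[measurable]:
  assumes [measurable]: "f \<in> borel_measurable P"
  shows "resample k f \<in> borel_measurable (P \<Otimes>\<^sub>M P)"
  unfolding resample_def[abs_def] by measurable

lemma integrable_resample_square:
  assumes [measurable]: "f \<in> borel_measurable P" and i: "integrable P (\<lambda>x. (f x)\<^sup>2)"
  shows "integrable (P \<Otimes>\<^sub>M P) (\<lambda>z. (resample k f z)\<^sup>2)"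
proof (rule Bochner_Integration.integrable_bound)
  show "integrable (P \<Otimes>\<^sub>M P) (\<lambda>z. 2 * (f (fst z))\<^sup>2 + 2 * (f (mix (- {k}) (fst z) (snd z)))\<^sup>2)"
    using integrable_mix[OF i, of "- {k}"] integrable_pair_fst[OF i] by simp
  have "(a - b)\<^sup>2 \<le> 2 * a\<^sup>2 + 2 * b\<^sup>2" for a b :: real
    using zero_le_power2[of "a + b"] by (simp add: power2_sum power2_diff)
  then show "AE z in P \<Otimes>\<^sub>M P. norm ((resample k f z)\<^sup>2) \<le> norm (2 * (f (fst z))\<^sup>2 + 2 * (f (mix (- {k}) (fst z) (snd z)))\<^sup>2)"
    by (intro AE_I2) (simp add: resample_def)
qed measurable

text \<open>Both conditional expectations average over the same y, at arguments that differ in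
  coordinate k only. Jensen bounds the squared difference by a double integral, and
  \<open>swap_law\<close> recognises the two arguments as a point and its resampling at k. This is
  the bridge from projections to dependence coefficients.\<close>

lemma cexp_insert_diff:
  assumes [measurable]: "f \<in> borel_measurable P" and i: "integrable P (\<lambda>x. (f x)\<^sup>2)" and k: "k \<notin> K"
  shows "integrable P (\<lambda>x. (cexp (insert k K) f x - cexp K f x)\<^sup>2)"
    and "(\<integral>x. (cexp (insert k K) f x - cexp K f x)\<^sup>2 \<partial>P) \<le> (\<integral>z. (resample k f z)\<^sup>2 \<partial>(P \<Otimes>\<^sub>M P))"
proof -
  let ?I = "insert k K" and ?s = "\<lambda>z. (mix (insert k K) (fst z) (snd z), mix (insert k K) (snd z) (fst z))"
  have int: "integrable P f" by (rule P.integrable_of_square[OF assms(1) i])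
  have AE1: "AE x in P. integrable P (\<lambda>y. f (mix K' x y))" for K'
    using PP.AE_integrable_fst'[OF integrable_mix[OF int, of K']] by simp
  \<comment> \<open>Coordinate k of the second component is \<open>y k\<close>, because k lies in
    \<open>?I\<close>; inserting it turns \<open>mix ?I x y\<close> into
    \<open>mix K x y\<close>.\<close>
  have res: "resample k f (?s (x, y)) = f (mix ?I x y) - f (mix K x y)" for x y
  proof -
    have "mix (- {k}) (mix ?I x y) (mix ?I y x) = mix K x y"
      using k by (auto simp: mix_def fun_eq_iff)
    then show ?thesis by (simp add: resample_def)
  qed
  have "(\<integral>\<^sup>+x. ennreal ((cexp ?I f x - cexp K f x)\<^sup>2) \<partial>P) \<le> (\<integral>\<^sup>+x. (\<integral>\<^sup>+y. ennreal ((f (mix ?I x y) - f (mix K x y))\<^sup>2) \<partial>P) \<partial>P)"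
  proof (rule nn_integral_mono_AE)
    show "AE x in P. ennreal ((cexp ?I f x - cexp K f x)\<^sup>2) \<le> (\<integral>\<^sup>+y. ennreal ((f (mix ?I x y) - f (mix K x y))\<^sup>2) \<partial>P)"
      using AE1[of ?I] AE1[of K]
    proof eventually_elim
      case (elim x)
      then have "cexp ?I f x - cexp K f x = (\<integral>y. f (mix ?I x y) - f (mix K x y) \<partial>P)"
        by (simp add: cexp_def)
      also have "ennreal (\<dots>\<^sup>2) \<le> (\<integral>\<^sup>+y. ennreal ((f (mix ?I x y) - f (mix K x y))\<^sup>2) \<partial>P)"
        by (rule P.jensen_square_nn) measurable
      finally show ?case .
    qed
  qed
  also have "\<dots> = (\<integral>\<^sup>+z. ennreal ((resample k f (?s z))\<^sup>2) \<partial>(P \<Otimes>\<^sub>M P))"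
    by (subst P.nn_integral_fst[symmetric]) (auto simp only: res, measurable)
  also have "\<dots> = (\<integral>\<^sup>+z. ennreal ((resample k f z)\<^sup>2) \<partial>distr (P \<Otimes>\<^sub>M P) (P \<Otimes>\<^sub>M P) ?s)"
    by (rule nn_integral_distr[symmetric]) measurable
  also have "\<dots> = (\<integral>\<^sup>+z. ennreal ((resample k f z)\<^sup>2) \<partial>(P \<Otimes>\<^sub>M P))"
    by (simp only: swap_law)
  also have "\<dots> = ennreal (\<integral>z. (resample k f z)\<^sup>2 \<partial>(P \<Otimes>\<^sub>M P))"
    by (rule nn_integral_eq_integral[OF integrable_resample_square]) (use i in auto)
  finally have *: "(\<integral>\<^sup>+x. ennreal ((cexp ?I f x - cexp K f x)\<^sup>2) \<partial>P) \<le> ennreal (\<integral>z. (resample k f z)\<^sup>2 \<partial>(P \<Otimes>\<^sub>M P))" .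
  show I: "integrable P (\<lambda>x. (cexp ?I f x - cexp K f x)\<^sup>2)"
    by (rule integrableI_nonneg) (use * in \<open>auto intro: le_less_trans\<close>)
  have "ennreal (\<integral>x. (cexp ?I f x - cexp K f x)\<^sup>2 \<partial>P) \<le> ennreal (\<integral>z. (resample k f z)\<^sup>2 \<partial>(P \<Otimes>\<^sub>M P))"
    using * by (subst nn_integral_eq_integral[OF I, symmetric]) auto
  then show "(\<integral>x. (cexp ?I f x - cexp K f x)\<^sup>2 \<partial>P) \<le> (\<integral>z. (resample k f z)\<^sup>2 \<partial>(P \<Otimes>\<^sub>M P))"
    by (subst (asm) ennreal_le_iff) auto
qed

text \<open>An L1 measure of how far f is from depending on K alone. It dominates the L1 error of
  \<open>cexp K f\<close> and passes directly through sums and limits, which suits an induction over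
  integrable functions.\<close>

definition approx_gap :: "'i set \<Rightarrow> (('i \<Rightarrow> real) \<Rightarrow> real) \<Rightarrow> real" where
  "approx_gap K f = (\<integral>z. \<bar>f (fst z) - f (mix K (fst z) (snd z))\<bar> \<partial>(P \<Otimes>\<^sub>M P))"

lemma integrable_gap: "integrable P f \<Longrightarrow> integrable (P \<Otimes>\<^sub>M P) (\<lambda>z. \<bar>f (fst z) - f (mix K (fst z) (snd z))\<bar>)"
  for f :: "('i \<Rightarrow> real) \<Rightarrow> real"
  using integrable_mix[of f K] integrable_pair_fst[of f] by simp

lemma approx_gap_nonneg: "0 \<le> approx_gap K f"
  unfolding approx_gap_def by (rule integral_nonneg_AE) auto

lemma approx_gap_le:
  assumes f: "integrable P f" and g: "integrable P g"
  shows "approx_gap K f \<le> approx_gap K g + 2 * (\<integral>x. \<bar>f x - g x\<bar> \<partial>P)"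
proof -
  have [measurable]: "f \<in> borel_measurable P" "g \<in> borel_measurable P" using f g by auto
  have i: "integrable P (\<lambda>x. \<bar>f x - g x\<bar>)" using f g by simp
  have "approx_gap K f \<le> (\<integral>z. \<bar>g (fst z) - g (mix K (fst z) (snd z))\<bar> + (\<bar>f (fst z) - g (fst z)\<bar>
      + \<bar>f (mix K (fst z) (snd z)) - g (mix K (fst z) (snd z))\<bar>) \<partial>(P \<Otimes>\<^sub>M P))"
    unfolding approx_gap_def
    using integrable_gap[OF f] integrable_gap[OF g] integrable_mix[OF i] integrable_pair_fst[OF i]
    by (intro integral_mono) auto
  also have "\<dots> = approx_gap K g + ((\<integral>x. \<bar>f x - g x\<bar> \<partial>P) + (\<integral>x. \<bar>f x - g x\<bar> \<partial>P))"
    using integrable_gap[OF g] integrable_mix[OF i] integrable_pair_fst[OF i]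
      integral_pair_fst[of "\<lambda>x. \<bar>f x - g x\<bar>"] integral_mix[of "\<lambda>x. \<bar>f x - g x\<bar>" K]
    by (simp add: approx_gap_def)
  finally show ?thesis by simp
qed

lemma approx_gap_add:
  assumes f: "integrable P f" and g: "integrable P g"
  shows "approx_gap K (\<lambda>x. f x + g x) \<le> approx_gap K f + approx_gap K g"
proof -
  have "approx_gap K (\<lambda>x. f x + g x) \<le> (\<integral>z. \<bar>f (fst z) - f (mix K (fst z) (snd z))\<bar> + \<bar>g (fst z) - g (mix K (fst z) (snd z))\<bar> \<partial>(P \<Otimes>\<^sub>M P))"
    unfolding approx_gap_def
    using integrable_gap[OF f] integrable_gap[OF g] integrable_gap[of "\<lambda>x. f x + g x"] f g
    by (intro integral_mono) auto
  also have "\<dots> = approx_gap K f + approx_gap K g"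
    using integrable_gap[OF f] integrable_gap[OF g] by (simp add: approx_gap_def)
  finally show ?thesis .
qed

context
  fixes K :: "nat \<Rightarrow> 'i set"
  assumes exhaust: "\<And>j. eventually (\<lambda>n. j \<in> K n) sequentially"
begin

text \<open>The gap changes by at most twice the L1 distance, so dominated convergence transfers the
  limit. The factor 2 in the domination is the one that the induction rule for integrable functions
  provides.\<close>

lemma approx_gap_dominated:
  fixes s :: "nat \<Rightarrow> ('i \<Rightarrow> real) \<Rightarrow> real"
  assumes s: "\<And>i. integrable P (s i)" "\<And>i. (\<lambda>n. approx_gap (K n) (s i)) \<longlonglongrightarrow> 0"
    and lim: "\<And>x. (\<lambda>i. s i x) \<longlonglongrightarrow> f x" and dom: "\<And>i x. \<bar>s i x\<bar> \<le> 2 * \<bar>f x\<bar>" and f: "integrable P f"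
  shows "(\<lambda>n. approx_gap (K n) f) \<longlonglongrightarrow> 0"
proof (rule LIMSEQ_I)
  fix r :: real assume r: "0 < r"
  have "(\<lambda>i. \<integral>x. \<bar>f x - s i x\<bar> \<partial>P) \<longlonglongrightarrow> (\<integral>x. 0 \<partial>P)"
  proof (rule integral_dominated_convergence[where w="\<lambda>x. 3 * \<bar>f x\<bar>"])
    show "AE x in P. (\<lambda>i. \<bar>f x - s i x\<bar>) \<longlonglongrightarrow> 0"
    proof (intro AE_I2)
      fix x
      have "(\<lambda>i. \<bar>f x - s i x\<bar>) \<longlonglongrightarrow> \<bar>f x - f x\<bar>" by (intro tendsto_intros lim)
      then show "(\<lambda>i. \<bar>f x - s i x\<bar>) \<longlonglongrightarrow> 0" by simp
    qed
    show "AE x in P. norm \<bar>f x - s i x\<bar> \<le> 3 * \<bar>f x\<bar>" for i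
    proof (intro AE_I2)
      fix x show "norm \<bar>f x - s i x\<bar> \<le> 3 * \<bar>f x\<bar>"
        using dom[of i x] by simp
    qed
  qed (use f s borel_measurable_integrable in auto)
  then have "eventually (\<lambda>i. (\<integral>x. \<bar>f x - s i x\<bar> \<partial>P) < r / 4) sequentially"
    using r by (intro order_tendstoD(2)[where y=0]) auto
  then obtain i where i: "(\<integral>x. \<bar>f x - s i x\<bar> \<partial>P) < r / 4" by (auto simp: eventually_sequentially)
  have "eventually (\<lambda>n. approx_gap (K n) (s i) < r / 2) sequentially"
    using r s(2)[of i] by (intro order_tendstoD(2)[where y=0]) auto
  then obtain N where N: "\<And>n. n \<ge> N \<Longrightarrow> approx_gap (K n) (s i) < r / 2" by (auto simp: eventually_sequentially)
  show "\<exists>N. \<forall>n\<ge>N. norm (approx_gap (K n) f - 0) < r"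
  proof (intro exI allI impI)
    fix n assume "n \<ge> N"
    from N[OF this] approx_gap_le[OF f s(1)[of i], of "K n"] i approx_gap_nonneg[of "K n" f]
    show "norm (approx_gap (K n) f - 0) < r" by simp
  qed
qed

text \<open>Dynkin's argument: a cylinder has gap exactly 0 once \<open>K n\<close> contains its
  finitely many coordinates, a complement has the same gap, and a disjoint union is the dominated
  limit of its finite partial unions.\<close>

lemma approx_gap_indicator:
  assumes "A \<in> sets P"
  shows "(\<lambda>n. approx_gap (K n) (indicator A)) \<longlonglongrightarrow> 0"
proof -
  have ind: "integrable P (indicator A :: _ \<Rightarrow> real)" if "A \<in> sets P" for A
    using that by (intro integrable_real_indicator) (auto simp: P.emeasure_eq_measure)
  have sP: "sets P = sigma_sets UNIV (prod_algebra UNIV \<mu>)"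
    by (simp add: P_def sets_PiM)
  have cl: "prod_algebra UNIV \<mu> \<subseteq> Pow UNIV" by simp
  have A: "A \<in> sigma_sets UNIV (prod_algebra UNIV \<mu>)" using assms sP by simp
  from Int_stable_prod_algebra cl A show ?thesis
  proof (induction A rule: sigma_sets_induct_disjoint)
    case (basic A)
    then obtain J E where A: "A = prod_emb UNIV \<mu> J (\<Pi>\<^sub>E j\<in>J. E j)" and J: "finite J"
      by (elim prod_algebraE)
    have mem: "x \<in> A \<longleftrightarrow> (\<forall>j\<in>J. x j \<in> E j)" for x
      by (auto simp: A prod_emb_def PiE_iff)
    have "eventually (\<lambda>n. \<forall>j\<in>J. j \<in> K n) sequentially"
      using J exhaust by (intro eventually_ball_finite) auto
    then have "eventually (\<lambda>n. approx_gap (K n) (indicator A) = 0) sequentially"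
    proof eventually_elim
      case (elim n)
      have "indicator A (mix (K n) x y) = (indicator A x :: real)" for x y
        using elim by (auto simp: indicator_def mem mix_def)
      then show ?case by (simp add: approx_gap_def)
    qed
    then show ?case by (rule tendsto_eventually)
  next
    case empty
    show ?case by (simp add: approx_gap_def)
  next
    case (compl A)
    have "\<bar>indicator (UNIV - A) x - indicator (UNIV - A) y :: real\<bar> = \<bar>indicator A x - indicator A y\<bar>" for x y
      by (auto simp: indicator_def)
    then have "approx_gap (K n) (indicator (UNIV - A)) = approx_gap (K n) (indicator A)" for n
      by (simp add: approx_gap_def)
    with compl show ?case by simp
  next
    case (union A)
    then have A: "A i \<in> sets P" for i using sP by auto
    have part: "(\<lambda>n. approx_gap (K n) (indicator (\<Union>i<N. A i))) \<longlonglongrightarrow> 0" for N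
    proof (induction N)
      case 0
      show ?case by (simp add: approx_gap_def)
    next
      case (Suc N)
      have "A i \<inter> A N = {}" if "i < N" for i
        using \<open>disjoint_family A\<close> that by (simp add: disjoint_family_on_def)
      then have "(\<Union>i<N. A i) \<inter> A N = {}" by blast
      then have eq: "indicator (\<Union>i<Suc N. A i) x = indicator (\<Union>i<N. A i) x + (indicator (A N) x :: real)" for x
        by (auto simp: indicator_def lessThan_Suc)
      have "approx_gap (K n) (indicator (\<Union>i<Suc N. A i)) \<le> approx_gap (K n) (indicator (\<Union>i<N. A i)) + approx_gap (K n) (indicator (A N))" for n
        unfolding eq[abs_def] using A by (intro approx_gap_add ind) auto
      moreover have "(\<lambda>n. approx_gap (K n) (indicator (\<Union>i<N. A i)) + approx_gap (K n) (indicator (A N))) \<longlonglongrightarrow> 0"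
        using tendsto_add[OF Suc union(3)[of N]] by simp
      ultimately show ?case by (rule tendsto_0_sandwich[OF approx_gap_nonneg])
    qed
    show ?case
    proof (rule approx_gap_dominated[where s="\<lambda>N. indicator (\<Union>i<N. A i)"])
      show "\<bar>indicator (\<Union>i<N. A i) x\<bar> \<le> 2 * \<bar>indicator (\<Union>i. A i) x :: real\<bar>" for N x
        by (auto simp: indicator_def)
      show "(\<lambda>N. indicator (\<Union>i<N. A i) x) \<longlonglongrightarrow> (indicator (\<Union>i. A i) x :: real)" for x
        by (rule LIMSEQ_indicator_UN)
      show "integrable P (indicator (\<Union>i<N. A i) :: _ \<Rightarrow> real)" for N
        by (rule ind) (use A in auto)
      show "integrable P (indicator (\<Union>i. A i) :: _ \<Rightarrow> real)"
        by (rule ind) (use A in auto)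
    qed (rule part)
  qed
qed

lemma approx_gap_tendsto_0:
  fixes f :: "('i \<Rightarrow> real) \<Rightarrow> real"
  assumes "integrable P f"
  shows "(\<lambda>n. approx_gap (K n) f) \<longlonglongrightarrow> 0"
  using assms
proof (induction rule: integrable_induct)
  case (base A c)
  have "\<bar>indicator A x *\<^sub>R c - indicator A y *\<^sub>R c\<bar> = \<bar>c\<bar> * \<bar>indicator A x - indicator A y\<bar>" for x y
    by (simp add: abs_mult flip: left_diff_distrib)
  then have "approx_gap (K n) (\<lambda>x. indicator A x *\<^sub>R c) = \<bar>c\<bar> * approx_gap (K n) (indicator A)" for n
    by (simp add: approx_gap_def)
  then show ?case using tendsto_mult_right_zero[OF approx_gap_indicator[OF base(1)]] by simp
next
  case (add f g)
  have "(\<lambda>n. approx_gap (K n) f + approx_gap (K n) g) \<longlonglongrightarrow> 0"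
    using tendsto_add[OF add(3,4)] by simp
  with approx_gap_add[OF add(1,2)] show ?case by (rule tendsto_0_sandwich[OF approx_gap_nonneg])
next
  case (lim f s)
  show ?case by (rule approx_gap_dominated[where s=s]) (use lim in auto)
qed

text \<open>The gap gives convergence in L1, and the uniform fourth moment upgrades it to L2 through
  h^2 <= R |h| + h^4 / R^2. This takes the place of martingale convergence.\<close>

lemma cexp_tendsto_L2:
  assumes [measurable]: "f \<in> borel_measurable P" and i4: "integrable P (\<lambda>x. (f x) ^ 4)"
  shows "(\<lambda>n. \<integral>x. (f x - cexp (K n) f x)\<^sup>2 \<partial>P) \<longlonglongrightarrow> 0"
proof (rule LIMSEQ_I)
  fix r :: real assume r: "0 < r"
  note i = P.integrable_of_power4[OF assms]
  \<comment> \<open>16 = 8 + 8: \<open>power4_sum_le\<close> is applied to f minus its projection,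
    whose fourth moment is at most that of f.\<close>
  define C where "C = 16 * (\<integral>x. (f x) ^ 4 \<partial>P)"
  have C0: "0 \<le> C" unfolding C_def by (intro mult_nonneg_nonneg integral_nonneg_AE) auto
  \<comment> \<open>Chosen to make the tail term C / R^2 smaller than r / 2; the summand 1 gives
    strictness and keeps R positive.\<close>
  define R where "R = sqrt (2 * C / r) + 1"
  have R: "0 < R" "C / R\<^sup>2 < r / 2"
  proof -
    show R0: "0 < R" using C0 r by (simp add: R_def add_nonneg_pos)
    have "sqrt (2 * C / r) < R" by (simp add: R_def)
    then have "(sqrt (2 * C / r))\<^sup>2 < R\<^sup>2" using C0 r by (intro power_strict_mono) auto
    then have "2 * C / r < R\<^sup>2" using C0 r by simp
    then show "C / R\<^sup>2 < r / 2" using R0 r by (simp add: field_simps)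
  qed
  have c4: "integrable P (\<lambda>x. (cexp k f x) ^ 4)" "(\<integral>x. (cexp k f x) ^ 4 \<partial>P) \<le> (\<integral>x. (f x) ^ 4 \<partial>P)" for k
    by (rule cexp_power4; use i4 in simp)+
  have gap: "(\<integral>x. \<bar>f x - cexp k f x\<bar> \<partial>P) \<le> approx_gap k f" for k
  proof -
    have "(\<integral>x. \<bar>f x - cexp k f x\<bar> \<partial>P) \<le> (\<integral>x. (\<integral>y. \<bar>f x - f (mix k x y)\<bar> \<partial>P) \<partial>P)"
    proof (rule integral_mono_AE)
      show "integrable P (\<lambda>x. \<bar>f x - cexp k f x\<bar>)"
        using i(1) P.integrable_of_power4(1)[OF _ c4(1)] by simp
      show "integrable P (\<lambda>x. \<integral>y. \<bar>f x - f (mix k x y)\<bar> \<partial>P)"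
        using PP.integrable_fst'[OF integrable_gap[OF i(1), of k]] by simp
      have "AE x in P. integrable P (\<lambda>y. f (mix k x y))"
        using PP.AE_integrable_fst'[OF integrable_mix[OF i(1), of k]] by simp
      then show "AE x in P. \<bar>f x - cexp k f x\<bar> \<le> (\<integral>y. \<bar>f x - f (mix k x y)\<bar> \<partial>P)"
      proof eventually_elim
        case (elim x)
        then have "f x - cexp k f x = (\<integral>y. f x - f (mix k x y) \<partial>P)"
          by (simp add: cexp_def P.prob_space[simplified])
        then show ?case by (simp add: integral_abs_bound)
      qed
    qed
    also have "\<dots> = approx_gap k f"
      unfolding approx_gap_def using integrable_gap[OF i(1), of k] by (subst PP.integral_fst'[symmetric]) auto
    finally show ?thesis .
  qed
  have "eventually (\<lambda>n. approx_gap (K n) f < r / (2 * R)) sequentially"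
    using r R approx_gap_tendsto_0[OF i(1)] by (intro order_tendstoD(2)[where y=0]) auto
  then obtain N where N: "\<And>n. n \<ge> N \<Longrightarrow> approx_gap (K n) f < r / (2 * R)" by (auto simp: eventually_sequentially)
  show "\<exists>N. \<forall>n\<ge>N. norm ((\<integral>x. (f x - cexp (K n) f x)\<^sup>2 \<partial>P) - 0) < r"
  proof (intro exI allI impI)
    fix n assume n: "n \<ge> N"
    let ?h = "\<lambda>x. f x - cexp (K n) f x"
    have ih4: "integrable P (\<lambda>x. (?h x) ^ 4)"
    proof (rule Bochner_Integration.integrable_bound)
      show "integrable P (\<lambda>x. 8 * ((f x) ^ 4 + (cexp (K n) f x) ^ 4))" using i4 c4 by simp
      show "AE x in P. norm ((?h x) ^ 4) \<le> norm (8 * ((f x) ^ 4 + (cexp (K n) f x) ^ 4))"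
        using power4_sum_le[of "f x" "- cexp (K n) f x" for x] by (intro AE_I2) simp
    qed measurable
    have h4: "(\<integral>x. (?h x) ^ 4 \<partial>P) \<le> C"
    proof -
      have "(\<integral>x. (?h x) ^ 4 \<partial>P) \<le> (\<integral>x. 8 * ((f x) ^ 4 + (cexp (K n) f x) ^ 4) \<partial>P)"
        using ih4 i4 c4 power4_sum_le[of "f x" "- cexp (K n) f x" for x] by (intro integral_mono) auto
      also have "\<dots> \<le> C" using i4 c4[of "K n"] by (simp add: C_def)
      finally show ?thesis .
    qed
    note ih = P.integrable_of_power4[OF _ ih4, simplified]
    have pt: "(?h x)\<^sup>2 \<le> R * \<bar>?h x\<bar> + (?h x) ^ 4 / R\<^sup>2" for x
    proof (cases "\<bar>?h x\<bar> \<le> R")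
      case True
      then have "\<bar>?h x\<bar> * \<bar>?h x\<bar> \<le> R * \<bar>?h x\<bar>" by (intro mult_right_mono) auto
      then show ?thesis by (simp add: power2_eq_square add_increasing2)
    next
      case False
      then have "R\<^sup>2 \<le> (?h x)\<^sup>2" using R(1) abs_le_square_iff[of R "?h x"] by simp
      then have "(?h x)\<^sup>2 * R\<^sup>2 \<le> (?h x)\<^sup>2 * (?h x)\<^sup>2" by (intro mult_left_mono) auto
      then have "(?h x)\<^sup>2 \<le> (?h x) ^ 4 / R\<^sup>2" using R(1) by (simp add: field_simps flip: power_add)
      then show ?thesis using R(1) by (simp add: add_increasing)
    qed
    have "(\<integral>x. (?h x)\<^sup>2 \<partial>P) \<le> (\<integral>x. R * \<bar>?h x\<bar> + (?h x) ^ 4 / R\<^sup>2 \<partial>P)"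
      using ih ih4 pt by (intro integral_mono) auto
    also have "\<dots> = R * (\<integral>x. \<bar>?h x\<bar> \<partial>P) + (\<integral>x. (?h x) ^ 4 \<partial>P) / R\<^sup>2"
      using ih ih4 by simp
    also have "\<dots> \<le> R * approx_gap (K n) f + C / R\<^sup>2"
      using R h4 gap[of "K n"] by (intro add_mono mult_left_mono divide_right_mono) auto
    also have "\<dots> < r"
    proof -
      have "R * approx_gap (K n) f < r / 2" using N[OF n] R(1) by (simp add: field_simps)
      from add_strict_mono[OF this R(2)] show ?thesis by simp
    qed
    finally have "(\<integral>x. (?h x)\<^sup>2 \<partial>P) < r" .
    moreover have "0 \<le> (\<integral>x. (?h x)\<^sup>2 \<partial>P)" by (rule integral_nonneg_AE) auto
    ultimately show "norm ((\<integral>x. (?h x)\<^sup>2 \<partial>P) - 0) < r" by simp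
  qed
qed

end

end

lemma le_power2_limit:
  fixes x c :: real
  assumes "\<And>e. 0 < e \<Longrightarrow> x \<le> (e + c)\<^sup>2"
  shows "x \<le> c\<^sup>2"
proof -
  have "((\<lambda>e. (e + c)\<^sup>2) \<longlongrightarrow> (0 + c)\<^sup>2) (at_right 0)"
    by (intro tendsto_intros)
  then have "x \<le> (0 + c)\<^sup>2"
    by (rule tendsto_lowerbound) (auto intro: eventually_mono[OF eventually_at_right_less] assms)
  then show ?thesis by simp
qed

section \<open>Martingale projections of causal functionals\<close>

locale innovation_space = coordinate_space \<mu> for \<mu> :: "int \<Rightarrow> real measure"
begin

text \<open>Keeps the dependence of \<open>f\<close>, a function of the past of \<open>i\<close>, on the last \<open>L\<close> innovations only.\<close>

definition trunc :: "nat \<Rightarrow> int \<Rightarrow> ((int \<Rightarrow> real) \<Rightarrow> real) \<Rightarrow> (int \<Rightarrow> real) \<Rightarrow> real" where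
  "trunc L i f = cexp {i - int L<..} f"

lemma measurable_trunc[measurable]: "f \<in> borel_measurable P \<Longrightarrow> trunc L i f \<in> borel_measurable P"
  unfolding trunc_def by (rule measurable_cexp)

lemma dep_trunc: "dep {..i} f \<Longrightarrow> dep {i - int L<..i} (trunc L i f)"
  using dep_cexp[of "{..i}" f "{i - int L<..}"] unfolding trunc_def
  by (rule dep_mono) auto

lemma trunc_power4:
  assumes "f \<in> borel_measurable P" "integrable P (\<lambda>x. (f x) ^ 4)"
  shows "integrable P (\<lambda>x. (trunc L i f x) ^ 4)" "(\<integral>x. (trunc L i f x) ^ 4 \<partial>P) \<le> (\<integral>x. (f x) ^ 4 \<partial>P)"
  unfolding trunc_def by (rule cexp_power4[OF assms])+

lemma integral_trunc:
  assumes "f \<in> borel_measurable P" "integrable P (\<lambda>x. (f x) ^ 4)"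
  shows "(\<integral>x. trunc L i f x \<partial>P) = (\<integral>x. f x \<partial>P)"
  unfolding trunc_def by (rule integral_cexp[OF assms(1) P.integrable_of_power4(1)[OF assms]])

text \<open>Innovations after i do not influence f, so everything that f depends on is averaged out;
  a centred function thus has truncation 0 at lag 0.\<close>

lemma trunc_0:
  assumes "dep {..i} f"
  shows "trunc 0 i f x = (\<integral>y. f y \<partial>P)"
proof -
  have "f (mix {i<..} x y) = f y" for y
  proof -
    have "\<forall>j\<in>{..i}. mix {i<..} x y j = y j" by (auto simp: mix_def)
    then show ?thesis using assms unfolding dep_def by blast
  qed
  then show ?thesis by (simp add: trunc_def cexp_def)
qed

text \<open>Raising the lag by one reveals exactly one more innovation, the one at i - l.\<close>

lemma trunc_Suc_diff:
  assumes "f \<in> borel_measurable P" "integrable P (\<lambda>x. (f x)\<^sup>2)"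
  shows "integrable P (\<lambda>x. (trunc (Suc l) i f x - trunc l i f x)\<^sup>2)"
    and "(\<integral>x. (trunc (Suc l) i f x - trunc l i f x)\<^sup>2 \<partial>P) \<le> (\<integral>z. (resample (i - int l) f z)\<^sup>2 \<partial>(P \<Otimes>\<^sub>M P))"
proof -
  have "{i - int (Suc l)<..} = insert (i - int l) {i - int l<..}" by auto
  then show "integrable P (\<lambda>x. (trunc (Suc l) i f x - trunc l i f x)\<^sup>2)"
    "(\<integral>x. (trunc (Suc l) i f x - trunc l i f x)\<^sup>2 \<partial>P) \<le> (\<integral>z. (resample (i - int l) f z)\<^sup>2 \<partial>(P \<Otimes>\<^sub>M P))"
    using cexp_insert_diff[OF assms, of "i - int l" "{i - int l<..}"] by (simp_all add: trunc_def)
qed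

lemma dep_binop: "dep K f \<Longrightarrow> dep K g \<Longrightarrow> dep K (\<lambda>x. F (f x) (g x))"
  unfolding dep_def by (intro allI impI arg_cong2[where f=F]) blast+

lemma dep_sum: "(\<And>i. i \<in> S \<Longrightarrow> dep K (f i)) \<Longrightarrow> dep K (\<lambda>x. \<Sum>i\<in>S. f i x)"
  unfolding dep_def by (intro allI impI sum.cong refl) blast

text \<open>For fixed \<open>l\<close> the increments are martingale differences with respect to decreasing time.\<close>

lemma trunc_increments_orthogonal:
  assumes f[measurable]: "f \<in> borel_measurable P" "integrable P (\<lambda>x. (f x) ^ 4)"
    and h[measurable]: "h \<in> borel_measurable P" "integrable P (\<lambda>x. (h x) ^ 4)" and ij: "i < j"
  shows "(\<integral>x. (trunc (Suc l) i f x - trunc l i f x) * (trunc (Suc l) j h x - trunc l j h x) \<partial>P) = 0"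
proof -
  let ?g = "\<lambda>x. trunc (Suc l) j h x - trunc l j h x"
  note f2 = P.integrable_of_power4(2)[OF f] and h2 = P.integrable_of_power4(2)[OF h]
  have t2: "integrable P (\<lambda>x. (trunc l' i f x)\<^sup>2)" for l'
    by (rule P.integrable_of_power4(2)[OF _ trunc_power4(1)[OF f]]) measurable
  have g2: "integrable P (\<lambda>x. (?g x)\<^sup>2)" by (rule trunc_Suc_diff[OF h(1) h2])
  have fg: "integrable P (\<lambda>x. f x * ?g x)"
    by (rule integrable_mult_square[OF _ _ f2 g2]) measurable
  have tg: "integrable P (\<lambda>x. trunc l' i f x * ?g x)" for l'
    by (rule integrable_mult_square[OF _ _ t2 g2]) measurable
  \<comment> \<open>Here i < j enters: j - (l + 1) >= i - l, so the increment at j does not see the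
    innovation i - l, the one that separates the two truncations of f.\<close>
  have d: "dep {i - int l<..} ?g"
  proof -
    have "dep {i - int l<..} (trunc l' j h)" if "l' \<le> Suc l" for l'
      using dep_cexp_self[of "{j - int l'<..}" h] ij that unfolding trunc_def by (elim dep_mono) auto
    from dep_binop[OF this[of "Suc l"] this[of l], of "(-)"] show ?thesis by simp
  qed
  have sub: "{i - int l<..} \<subseteq> {i - int (Suc l)<..}" by auto
  have "(\<integral>x. trunc (Suc l) i f x * ?g x \<partial>P) = (\<integral>x. f x * ?g x \<partial>P)"
    unfolding trunc_def[of "Suc l" i f] by (rule integral_cexp_mult[OF _ _ dep_mono[OF d sub] fg]) measurable
  moreover have "(\<integral>x. trunc l i f x * ?g x \<partial>P) = (\<integral>x. f x * ?g x \<partial>P)"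
    unfolding trunc_def[of l i f] by (rule integral_cexp_mult[OF _ _ d fg]) measurable
  ultimately have "(\<integral>x. trunc (Suc l) i f x * ?g x - trunc l i f x * ?g x \<partial>P) = 0"
    using tg by simp
  then show ?thesis by (simp add: left_diff_distrib)
qed

context
  fixes S :: "int set" and f :: "int \<Rightarrow> (int \<Rightarrow> real) \<Rightarrow> real" and \<delta> :: "nat \<Rightarrow> real"
  assumes finite_S: "finite S"
    and f_meas[measurable]: "\<And>i. i \<in> S \<Longrightarrow> f i \<in> borel_measurable P"
    and f_power4: "\<And>i. i \<in> S \<Longrightarrow> integrable P (\<lambda>x. (f i x) ^ 4)"
    and f_resample: "\<And>i l. i \<in> S \<Longrightarrow> (\<integral>z. (resample (i - int l) (f i) z)\<^sup>2 \<partial>(P \<Otimes>\<^sub>M P)) \<le> (\<delta> l)\<^sup>2"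
    and \<delta>_nonneg: "\<And>l. 0 \<le> \<delta> l" and \<delta>_summable: "summable \<delta>"
begin

text \<open>At a fixed lag the increments for different i are orthogonal, so second moments add and
  the sum has size sqrt (card S) rather than card S.\<close>

lemma trunc_sum_step:
  shows "integrable P (\<lambda>x. (\<Sum>i\<in>S. trunc (Suc l) i (f i) x - trunc l i (f i) x)\<^sup>2)"
    and "(\<integral>x. (\<Sum>i\<in>S. trunc (Suc l) i (f i) x - trunc l i (f i) x)\<^sup>2 \<partial>P) \<le> (sqrt (card S) * \<delta> l)\<^sup>2"
proof -
  define D where "D = (\<lambda>i x. trunc (Suc l) i (f i) x - trunc l i (f i) x)"
  have [measurable]: "D i \<in> borel_measurable P" if "i \<in> S" for i
    unfolding D_def using f_meas[OF that] by measurable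
  have D2: "integrable P (\<lambda>x. (D i x)\<^sup>2)" "(\<integral>x. (D i x)\<^sup>2 \<partial>P) \<le> (\<delta> l)\<^sup>2" if "i \<in> S" for i
    using trunc_Suc_diff[OF f_meas[OF that] P.integrable_of_power4(2)[OF f_meas[OF that] f_power4[OF that]], of l i]
      f_resample[OF that, of l] by (auto simp: D_def)
  have orth: "(\<integral>x. D i x * D j x \<partial>P) = 0" if "i \<in> S" "j \<in> S" "i \<noteq> j" for i j
  proof (cases "i < j")
    case True
    show ?thesis unfolding D_def by (rule trunc_increments_orthogonal) (use that f_power4 True in auto)
  next
    case False
    then have "j < i" using that by simp
    have "(\<integral>x. D j x * D i x \<partial>P) = 0"
      unfolding D_def by (rule trunc_increments_orthogonal) (use that f_power4 \<open>j < i\<close> in auto)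
    then show ?thesis by (simp add: mult.commute)
  qed
  have DD: "integrable P (\<lambda>x. D i x * D j x)" if "i \<in> S" "j \<in> S" for i j
    using that by (intro integrable_mult_square D2) auto
  have eq: "(\<Sum>i\<in>S. D i x)\<^sup>2 = (\<Sum>i\<in>S. \<Sum>j\<in>S. D i x * D j x)" for x
    by (simp add: power2_eq_square sum_product)
  have "integrable P (\<lambda>x. (\<Sum>i\<in>S. D i x)\<^sup>2)"
    unfolding eq using DD by (intro Bochner_Integration.integrable_sum) auto
  then show "integrable P (\<lambda>x. (\<Sum>i\<in>S. trunc (Suc l) i (f i) x - trunc l i (f i) x)\<^sup>2)"
    by (simp only: D_def)
  have "(\<integral>x. (\<Sum>i\<in>S. D i x)\<^sup>2 \<partial>P) = (\<Sum>i\<in>S. \<Sum>j\<in>S. \<integral>x. D i x * D j x \<partial>P)"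
    unfolding eq using DD by simp
  also have "\<dots> = (\<Sum>i\<in>S. \<Sum>j\<in>S. if j = i then \<integral>x. (D i x)\<^sup>2 \<partial>P else 0)"
    by (intro sum.cong refl) (auto simp: orth power2_eq_square)
  also have "\<dots> = (\<Sum>i\<in>S. \<integral>x. (D i x)\<^sup>2 \<partial>P)"
    using finite_S by (intro sum.cong refl) simp
  also have "\<dots> \<le> (\<Sum>i\<in>S. (\<delta> l)\<^sup>2)" by (intro sum_mono D2)
  also have "\<dots> = (sqrt (card S) * \<delta> l)\<^sup>2" by (simp add: power_mult_distrib)
  finally show "(\<integral>x. (\<Sum>i\<in>S. trunc (Suc l) i (f i) x - trunc l i (f i) x)\<^sup>2 \<partial>P) \<le> (sqrt (card S) * \<delta> l)\<^sup>2"
    by (simp add: D_def)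
qed

lemma trunc_sum_telescope:
  shows "integrable P (\<lambda>x. (\<Sum>i\<in>S. trunc (L + n) i (f i) x - trunc L i (f i) x)\<^sup>2)"
    and "(\<integral>x. (\<Sum>i\<in>S. trunc (L + n) i (f i) x - trunc L i (f i) x)\<^sup>2 \<partial>P) \<le> (sqrt (card S) * (\<Sum>k<n. \<delta> (L + k)))\<^sup>2"
proof -
  have "integrable P (\<lambda>x. (\<Sum>i\<in>S. trunc (L + n) i (f i) x - trunc L i (f i) x)\<^sup>2) \<and>
    (\<integral>x. (\<Sum>i\<in>S. trunc (L + n) i (f i) x - trunc L i (f i) x)\<^sup>2 \<partial>P) \<le> (sqrt (card S) * (\<Sum>k<n. \<delta> (L + k)))\<^sup>2"
  proof (induction n)
    case 0
    show ?case by simp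
  next
    case (Suc n)
    let ?f = "\<lambda>x. \<Sum>i\<in>S. trunc (L + n) i (f i) x - trunc L i (f i) x"
    let ?g = "\<lambda>x. \<Sum>i\<in>S. trunc (Suc (L + n)) i (f i) x - trunc (L + n) i (f i) x"
    have eq: "(\<Sum>i\<in>S. trunc (L + Suc n) i (f i) x - trunc L i (f i) x) = ?f x + ?g x" for x
      by (simp add: sum.distrib[symmetric])
    have "integrable P (\<lambda>x. (?f x + ?g x)\<^sup>2) \<and> (\<integral>x. (?f x + ?g x)\<^sup>2 \<partial>P)
        \<le> (sqrt (card S) * (\<Sum>k<n. \<delta> (L + k)) + sqrt (card S) * \<delta> (L + n))\<^sup>2"
      using Suc trunc_sum_step[of "L + n"] \<delta>_nonneg
      by (intro conjI integral_minkowski) (auto intro!: borel_measurable_sum borel_measurable_diff sum_nonneg mult_nonneg_nonneg)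
    then show ?case unfolding eq by (simp add: distrib_left)
  qed
  then show "integrable P (\<lambda>x. (\<Sum>i\<in>S. trunc (L + n) i (f i) x - trunc L i (f i) x)\<^sup>2)"
    "(\<integral>x. (\<Sum>i\<in>S. trunc (L + n) i (f i) x - trunc L i (f i) x)\<^sup>2 \<partial>P) \<le> (sqrt (card S) * (\<Sum>k<n. \<delta> (L + k)))\<^sup>2"
    by blast+
qed

text \<open>S is fixed while n grows, so the crude Cauchy-Schwarz factor \<open>card S\<close> does
  no harm.\<close>

lemma trunc_sum_limit:
  assumes "0 < e"
  obtains N where "\<And>n. n \<ge> N \<Longrightarrow> integrable P (\<lambda>x. (\<Sum>i\<in>S. f i x - trunc n i (f i) x)\<^sup>2) \<and>
    (\<integral>x. (\<Sum>i\<in>S. f i x - trunc n i (f i) x)\<^sup>2 \<partial>P) \<le> e\<^sup>2"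
proof -
  let ?h = "\<lambda>n i x. f i x - trunc n i (f i) x"
  have h2: "integrable P (\<lambda>x. (?h n i x)\<^sup>2)" if "i \<in> S" for n i
  proof -
    have m: "trunc n i (f i) \<in> borel_measurable P" using f_meas[OF that] by (rule measurable_trunc)
    have 1: "integrable P (\<lambda>x. (f i x)\<^sup>2)" by (rule P.integrable_of_power4[OF f_meas[OF that] f_power4[OF that]])
    have 2: "integrable P (\<lambda>x. (trunc n i (f i) x)\<^sup>2)"
      by (rule P.integrable_of_power4[OF m trunc_power4(1)[OF f_meas[OF that] f_power4[OF that]]])
    have 3: "integrable P (\<lambda>x. f i x * trunc n i (f i) x)"
      by (rule integrable_mult_square[OF f_meas[OF that] m 1 2])
    show ?thesis unfolding power2_diff using 1 2 3 by (simp add: mult.assoc)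
  qed
  have hh: "integrable P (\<lambda>x. ?h n i x * ?h n j x)" if "i \<in> S" "j \<in> S" for n i j
    using that f_meas by (intro integrable_mult_square h2) auto
  have eq: "(\<Sum>i\<in>S. ?h n i x)\<^sup>2 = (\<Sum>i\<in>S. \<Sum>j\<in>S. ?h n i x * ?h n j x)" for n x
    by (simp add: power2_eq_square sum_product)
  have int: "integrable P (\<lambda>x. (\<Sum>i\<in>S. ?h n i x)\<^sup>2)" for n
    unfolding eq using hh by (intro Bochner_Integration.integrable_sum) auto
  have lim: "(\<lambda>n. \<integral>x. (?h n i x)\<^sup>2 \<partial>P) \<longlonglongrightarrow> 0" if "i \<in> S" for i
    unfolding trunc_def
  proof (rule cexp_tendsto_L2[OF _ f_meas[OF that] f_power4[OF that]])
    fix j :: int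
    show "eventually (\<lambda>n. j \<in> {i - int n<..}) sequentially"
      unfolding eventually_sequentially by (intro exI[of _ "nat (i - j + 1)"]) auto
  qed
  have "(\<integral>x. (\<Sum>i\<in>S. ?h n i x)\<^sup>2 \<partial>P) \<le> card S * (\<Sum>i\<in>S. \<integral>x. (?h n i x)\<^sup>2 \<partial>P)" for n
  proof -
    have "(\<Sum>i\<in>S. ?h n i x)\<^sup>2 \<le> card S * (\<Sum>i\<in>S. (?h n i x)\<^sup>2)" for x
      using Cauchy_Schwarz_ineq_sum[of "\<lambda>_. 1::real" "\<lambda>i. ?h n i x" S]
      by (simp only: mult_1 power_one sum_constant mult_1_right)
    moreover have "integrable P (\<lambda>x. card S * (\<Sum>i\<in>S. (?h n i x)\<^sup>2))"
      by (intro integrable_mult_right Bochner_Integration.integrable_sum h2)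
    ultimately have "(\<integral>x. (\<Sum>i\<in>S. ?h n i x)\<^sup>2 \<partial>P) \<le> (\<integral>x. card S * (\<Sum>i\<in>S. (?h n i x)\<^sup>2) \<partial>P)"
      by (intro integral_mono int)
    also have "\<dots> = card S * (\<integral>x. (\<Sum>i\<in>S. (?h n i x)\<^sup>2) \<partial>P)" by (rule integral_mult_right_zero)
    also have "(\<integral>x. (\<Sum>i\<in>S. (?h n i x)\<^sup>2) \<partial>P) = (\<Sum>i\<in>S. \<integral>x. (?h n i x)\<^sup>2 \<partial>P)"
      by (rule Bochner_Integration.integral_sum) (rule h2)
    finally show ?thesis .
  qed
  note bound = this
  have "(\<lambda>n. card S * (\<Sum>i\<in>S. \<integral>x. (?h n i x)\<^sup>2 \<partial>P)) \<longlonglongrightarrow> real (card S) * (\<Sum>i\<in>S. 0)"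
    by (intro tendsto_intros lim)
  then have "eventually (\<lambda>n. card S * (\<Sum>i\<in>S. \<integral>x. (?h n i x)\<^sup>2 \<partial>P) < e\<^sup>2) sequentially"
    using assms by (intro order_tendstoD(2)[where y=0]) auto
  then obtain N where N: "\<And>n. n \<ge> N \<Longrightarrow> card S * (\<Sum>i\<in>S. \<integral>x. (?h n i x)\<^sup>2 \<partial>P) < e\<^sup>2"
    by (auto simp: eventually_sequentially)
  show ?thesis
  proof (rule that[of N])
    fix n assume "n \<ge> N"
    from order_trans[OF bound[of n] less_imp_le[OF N[OF this]]] int[of n]
    show "integrable P (\<lambda>x. (\<Sum>i\<in>S. ?h n i x)\<^sup>2) \<and> (\<integral>x. (\<Sum>i\<in>S. ?h n i x)\<^sup>2 \<partial>P) \<le> e\<^sup>2" by blast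
  qed
qed

text \<open>Split at a far lag L + N: beyond it the error is at most e by L2 convergence, and
  between L and L + N it telescopes at the cost of the \<open>\<delta>\<close>; then e tends to
  0.\<close>

lemma trunc_sum_error:
  shows "integrable P (\<lambda>x. (\<Sum>i\<in>S. f i x - trunc L i (f i) x)\<^sup>2)"
    and "(\<integral>x. (\<Sum>i\<in>S. f i x - trunc L i (f i) x)\<^sup>2 \<partial>P) \<le> (sqrt (card S) * (\<Sum>k. \<delta> (k + L)))\<^sup>2"
proof -
  have main: "integrable P (\<lambda>x. (\<Sum>i\<in>S. f i x - trunc L i (f i) x)\<^sup>2) \<and>
    (\<integral>x. (\<Sum>i\<in>S. f i x - trunc L i (f i) x)\<^sup>2 \<partial>P) \<le> (e + sqrt (card S) * (\<Sum>k. \<delta> (k + L)))\<^sup>2" if e: "0 < e" for e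
  proof -
    obtain N where N: "\<And>n. n \<ge> N \<Longrightarrow> integrable P (\<lambda>x. (\<Sum>i\<in>S. f i x - trunc n i (f i) x)\<^sup>2) \<and>
      (\<integral>x. (\<Sum>i\<in>S. f i x - trunc n i (f i) x)\<^sup>2 \<partial>P) \<le> e\<^sup>2"
      using trunc_sum_limit[OF e] by blast
    let ?f = "\<lambda>x. \<Sum>i\<in>S. f i x - trunc (L + N) i (f i) x"
    let ?g = "\<lambda>x. \<Sum>i\<in>S. trunc (L + N) i (f i) x - trunc L i (f i) x"
    have eq: "(\<Sum>i\<in>S. f i x - trunc L i (f i) x) = ?f x + ?g x" for x
      by (simp add: sum.distrib[symmetric])
    have "(\<Sum>k<N. \<delta> (L + k)) \<le> (\<Sum>k. \<delta> (k + L))"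
      using \<delta>_nonneg \<delta>_summable sum_le_suminf[of "\<lambda>k. \<delta> (k + L)" "{..<N}"] by (simp add: summable_iff_shift add.commute)
    then have le: "(sqrt (card S) * (\<Sum>k<N. \<delta> (L + k)))\<^sup>2 \<le> (sqrt (card S) * (\<Sum>k. \<delta> (k + L)))\<^sup>2"
      using \<delta>_nonneg by (intro power_mono mult_left_mono mult_nonneg_nonneg sum_nonneg) auto
    have pos: "0 \<le> (\<Sum>k. \<delta> (k + L))"
      using \<delta>_nonneg \<delta>_summable by (intro suminf_nonneg) (auto simp: summable_iff_shift)
    show ?thesis unfolding eq
      using N[of "L + N"] trunc_sum_telescope[of L N] le e pos
      by (intro conjI integral_minkowski[where a=e and b="sqrt (card S) * (\<Sum>k. \<delta> (k + L))"]) (auto intro!: borel_measurable_sum borel_measurable_diff)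
  qed
  from main[of 1] show "integrable P (\<lambda>x. (\<Sum>i\<in>S. f i x - trunc L i (f i) x)\<^sup>2)" by simp
  show "(\<integral>x. (\<Sum>i\<in>S. f i x - trunc L i (f i) x)\<^sup>2 \<partial>P) \<le> (sqrt (card S) * (\<Sum>k. \<delta> (k + L)))\<^sup>2"
    by (rule le_power2_limit) (use main in blast)
qed

end

end

subsection \<open>Interpolation for sums with finite-range dependence\<close>

text \<open>Expansions of (b - m)^2 (b + 2 m) >= 0 and (b - m)^2 (2 b + m) >= 0. These inequalities,
  linear in b and in b^2 apart from the cube, make power-mean bounds a matter of summing or
  integrating.\<close>

lemma cube_am_gm:
  fixes b m :: real
  assumes "0 \<le> b" "0 \<le> m"
  shows "3 * m\<^sup>2 * b \<le> b ^ 3 + 2 * m ^ 3" "3 * m * b\<^sup>2 \<le> 2 * b ^ 3 + m ^ 3"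
proof -
  have "0 \<le> (b - m)\<^sup>2 * (b + 2 * m)" "0 \<le> (b - m)\<^sup>2 * (2 * b + m)" using assms by simp_all
  then show "3 * m\<^sup>2 * b \<le> b ^ 3 + 2 * m ^ 3" "3 * m * b\<^sup>2 \<le> 2 * b ^ 3 + m ^ 3"
    by (simp_all add: power2_eq_square power3_eq_cube algebra_simps)
qed

text \<open>Sum the first inequality of \<open>cube_am_gm\<close> at the average m = B / n.\<close>

lemma sum_cube_le:
  fixes b :: "'a \<Rightarrow> real"
  assumes "finite A" "\<And>t. t \<in> A \<Longrightarrow> 0 \<le> b t"
  shows "(\<Sum>t\<in>A. b t) ^ 3 \<le> (real (card A))\<^sup>2 * (\<Sum>t\<in>A. b t ^ 3)"
proof (cases "A = {}")
  case False
  define n where "n = real (card A)"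
  have n: "0 < n" using False assms by (simp add: n_def card_gt_0_iff)
  define B where "B = (\<Sum>t\<in>A. b t)"
  have B: "0 \<le> B" unfolding B_def using assms by (intro sum_nonneg)
  have "(\<Sum>t\<in>A. 3 * (B / n)\<^sup>2 * b t) \<le> (\<Sum>t\<in>A. b t ^ 3 + 2 * (B / n) ^ 3)"
    using assms B n by (intro sum_mono cube_am_gm) auto
  then have "3 * (B / n)\<^sup>2 * B \<le> (\<Sum>t\<in>A. b t ^ 3) + n * (2 * (B / n) ^ 3)"
    by (simp add: sum.distrib sum_distrib_left[symmetric] B_def[symmetric] n_def)
  moreover have "3 * (B / n)\<^sup>2 * B - n * (2 * (B / n) ^ 3) = B ^ 3 / n\<^sup>2"
    using n by (simp add: field_simps power2_eq_square power3_eq_cube)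
  ultimately have "B ^ 3 / n\<^sup>2 \<le> (\<Sum>t\<in>A. b t ^ 3)" by linarith
  then show ?thesis using n by (simp add: B_def n_def field_simps)
qed simp

text \<open>Integrating \<open>cube_am_gm\<close> at m = K: first and second moments inherit the
  scale K of the third.\<close>

lemma (in prob_space) cube_moment_bounds:
  fixes B :: "'a \<Rightarrow> real"
  assumes i: "integrable M B" "integrable M (\<lambda>x. (B x)\<^sup>2)" "integrable M (\<lambda>x. (B x) ^ 3)"
    and B: "\<And>x. 0 \<le> B x" and K: "0 < K" "(\<integral>x. (B x) ^ 3 \<partial>M) \<le> K ^ 3"
  shows "(\<integral>x. B x \<partial>M) \<le> K" "(\<integral>x. (B x)\<^sup>2 \<partial>M) \<le> K\<^sup>2"
proof -
  have "3 * K\<^sup>2 * (\<integral>x. B x \<partial>M) = (\<integral>x. 3 * K\<^sup>2 * B x \<partial>M)" by simp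
  also have "\<dots> \<le> (\<integral>x. (B x) ^ 3 + 2 * K ^ 3 \<partial>M)"
    using cube_am_gm(1)[OF B] K i by (intro integral_mono) auto
  also have "\<dots> = (\<integral>x. (B x) ^ 3 \<partial>M) + 2 * K ^ 3" using i by (simp add: prob_space)
  also have "\<dots> \<le> 3 * K ^ 3" using K by linarith
  also have "\<dots> = 3 * K\<^sup>2 * K" by (simp add: power2_eq_square power3_eq_cube)
  finally show "(\<integral>x. B x \<partial>M) \<le> K" using K by (simp only: mult_le_cancel_left_pos zero_less_power mult_pos_pos zero_less_numeral)
  have "3 * K * (\<integral>x. (B x)\<^sup>2 \<partial>M) = (\<integral>x. 3 * K * (B x)\<^sup>2 \<partial>M)" by simp
  also have "\<dots> \<le> (\<integral>x. 2 * (B x) ^ 3 + K ^ 3 \<partial>M)"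
    using cube_am_gm(2)[OF B] K i by (intro integral_mono) auto
  also have "\<dots> = 2 * (\<integral>x. (B x) ^ 3 \<partial>M) + K ^ 3" using i by (simp add: prob_space)
  also have "\<dots> \<le> 3 * K ^ 3" using K by linarith
  also have "\<dots> = 3 * K * K\<^sup>2" by (simp add: power2_eq_square power3_eq_cube)
  finally show "(\<integral>x. (B x)\<^sup>2 \<partial>M) \<le> K\<^sup>2" using K by (simp only: mult_le_cancel_left_pos mult_pos_pos zero_less_numeral)
qed

text \<open>\<open>Y i j\<close> is meant to contain the factor 1 / sqrt T, and c bounds its L3
  norm. All lags j share one window of L innovations ending at i, so whole vectors at distance L or
  more are independent.\<close>

locale dependent_sum = innovation_space \<mu> + smooth_product J \<phi> \<beta>
  for \<mu> :: "int \<Rightarrow> real measure" and J :: "nat set" and \<phi> \<beta> +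
  fixes S :: "int set" and Y :: "int \<Rightarrow> nat \<Rightarrow> (int \<Rightarrow> real) \<Rightarrow> real" and L :: nat and c :: real
  assumes S_finite: "finite S"
    and Y_dep: "\<And>i j. i \<in> S \<Longrightarrow> j \<in> J \<Longrightarrow> dep {i - int L<..i} (Y i j)"
    and Y_meas: "\<And>i j. i \<in> S \<Longrightarrow> j \<in> J \<Longrightarrow> Y i j \<in> borel_measurable P"
    and Y_power4: "\<And>i j. i \<in> S \<Longrightarrow> j \<in> J \<Longrightarrow> integrable P (\<lambda>x. (Y i j x) ^ 4)"
    and Y_mean: "\<And>i j. i \<in> S \<Longrightarrow> j \<in> J \<Longrightarrow> (\<integral>x. Y i j x \<partial>P) = 0"
    and Y_cube: "\<And>i j. i \<in> S \<Longrightarrow> j \<in> J \<Longrightarrow> (\<integral>x. \<bar>Y i j x\<bar> ^ 3 \<partial>P) \<le> c ^ 3"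
    and L_pos: "0 < L" and c_pos: "0 < c" and J_nonempty: "J \<noteq> {}"
begin

definition total :: "nat \<Rightarrow> (int \<Rightarrow> real) \<Rightarrow> real" where
  "total j x = (\<Sum>i\<in>S. Y i j x)"

text \<open>Outside r = 1 the summands are independent of the one at i; r = 2 contains in addition
  every index that can depend on the neighbourhood with r = 1.\<close>

definition nbh :: "nat \<Rightarrow> int \<Rightarrow> int set" where
  "nbh r i = {k \<in> S. \<bar>k - i\<bar> < int (r * L)}"

definition local_sum :: "nat \<Rightarrow> int \<Rightarrow> nat \<Rightarrow> (int \<Rightarrow> real) \<Rightarrow> real" where
  "local_sum r i j x = (\<Sum>k\<in>nbh r i. Y k j x)"

text \<open>Dominates, summed over the lags, the summand at i, both local sums and their difference,
  so that every remainder is bounded by a power at most 3 of one random variable.\<close>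

definition envelope :: "int \<Rightarrow> (int \<Rightarrow> real) \<Rightarrow> real" where
  "envelope i x = (\<Sum>k\<in>nbh 2 i. \<Sum>l\<in>J. \<bar>Y k l x\<bar>)"

lemma nbh_sub: "nbh r i \<subseteq> S" "finite (nbh r i)"
  using S_finite by (auto simp: nbh_def)

lemma nbh_mono: "nbh 1 i \<subseteq> nbh 2 i"
  by (auto simp: nbh_def)

lemma self_nbh: "i \<in> S \<Longrightarrow> i \<in> nbh 1 i"
  using L_pos by (simp add: nbh_def)

lemma card_nbh: "card (nbh 2 i) \<le> 4 * L"
proof -
  have "nbh 2 i \<subseteq> {i - 2 * int L<..<i + 2 * int L}" by (auto simp: nbh_def)
  then have "card (nbh 2 i) \<le> card {i - 2 * int L<..<i + 2 * int L}" by (intro card_mono) auto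
  also have "\<dots> \<le> 4 * L" by simp
  finally show ?thesis .
qed

lemma measurable_sums[measurable]:
  "j \<in> J \<Longrightarrow> total j \<in> borel_measurable P" "j \<in> J \<Longrightarrow> local_sum r i j \<in> borel_measurable P"
  "envelope i \<in> borel_measurable P"
  using Y_meas nbh_sub(1) unfolding total_def[abs_def] local_sum_def[abs_def] envelope_def[abs_def]
  by (auto intro!: borel_measurable_sum borel_measurable_abs dest: subsetD[OF nbh_sub(1)])

lemma envelope_nonneg: "0 \<le> envelope i x"
  by (auto simp: envelope_def intro!: sum_nonneg)

lemma Y_envelope: "i \<in> S \<Longrightarrow> (\<Sum>j\<in>J. \<bar>Y i j x\<bar>) \<le> envelope i x"
  unfolding envelope_def using self_nbh[of i] nbh_mono[of i] nbh_sub(2)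
  by (intro member_le_sum[of i _ "\<lambda>k. \<Sum>l\<in>J. \<bar>Y k l x\<bar>"]) (auto intro: sum_nonneg)

text \<open>The constant is 1 because the two terms use disjoint parts of \<open>nbh 2 i\<close>:
  the difference only indices outside \<open>nbh 1 i\<close>, the other only those inside.\<close>

lemma local_sum_envelope:
  "(\<Sum>l\<in>J. \<bar>local_sum 2 i l x - local_sum 1 i l x\<bar> + \<bar>local_sum 1 i l x\<bar>) \<le> envelope i x"
proof -
  have "(\<Sum>l\<in>J. \<bar>local_sum 2 i l x - local_sum 1 i l x\<bar> + \<bar>local_sum 1 i l x\<bar>) \<le> (\<Sum>l\<in>J. \<Sum>k\<in>nbh 2 i. \<bar>Y k l x\<bar>)"
  proof (rule sum_mono)
    fix l
    have split: "(\<Sum>k\<in>nbh 2 i. h k) = (\<Sum>k\<in>nbh 2 i - nbh 1 i. h k) + (\<Sum>k\<in>nbh 1 i. h k)" for h :: "int \<Rightarrow> real"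
      using nbh_mono nbh_sub by (intro sum.subset_diff) auto
    have "\<bar>local_sum 2 i l x - local_sum 1 i l x\<bar> \<le> (\<Sum>k\<in>nbh 2 i - nbh 1 i. \<bar>Y k l x\<bar>)"
      unfolding local_sum_def split[of "\<lambda>k. Y k l x"] by (simp add: sum_abs)
    moreover have "\<bar>local_sum 1 i l x\<bar> \<le> (\<Sum>k\<in>nbh 1 i. \<bar>Y k l x\<bar>)"
      unfolding local_sum_def by (rule sum_abs)
    ultimately show "\<bar>local_sum 2 i l x - local_sum 1 i l x\<bar> + \<bar>local_sum 1 i l x\<bar> \<le> (\<Sum>k\<in>nbh 2 i. \<bar>Y k l x\<bar>)"
      unfolding split[of "\<lambda>k. \<bar>Y k l x\<bar>"] by linarith
  qed
  then show ?thesis unfolding envelope_def by (subst sum.swap)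
qed

lemma local_sum_envelope1: "(\<Sum>l\<in>J. \<bar>local_sum 1 i l x\<bar>) \<le> envelope i x"
  and local_sum_envelope2: "(\<Sum>l\<in>J. \<bar>local_sum 2 i l x\<bar>) \<le> envelope i x"
  by (rule order_trans[OF sum_mono local_sum_envelope], linarith)+

text \<open>Triangle bound for the L3 norm of the envelope: at most \<open>4 * L * card J\<close>
  terms of L3 norm at most c each.\<close>

definition scale :: real where "scale = real (4 * L * card J) * c"

lemma scale_pos: "0 < scale"
  using L_pos c_pos J_nonempty finite_J by (simp add: scale_def card_gt_0_iff)

lemma envelope_moments:
  shows "integrable P (\<lambda>x. (envelope i x) ^ 3)" "integrable P (\<lambda>x. (envelope i x)\<^sup>2)" "integrable P (envelope i)"
    and "(\<integral>x. (envelope i x) ^ 3 \<partial>P) \<le> scale ^ 3" "(\<integral>x. (envelope i x)\<^sup>2 \<partial>P) \<le> scale\<^sup>2" "(\<integral>x. envelope i x \<partial>P) \<le> scale"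
proof -
  let ?A = "nbh 2 i \<times> J"
  have fin: "finite ?A" using nbh_sub(2) finite_J by simp
  have env: "envelope i x = (\<Sum>t\<in>?A. \<bar>Y (fst t) (snd t) x\<bar>)" for x
    unfolding envelope_def by (simp add: sum.cartesian_product split_beta)
  have le: "(envelope i x) ^ 3 \<le> (real (card ?A))\<^sup>2 * (\<Sum>t\<in>?A. \<bar>Y (fst t) (snd t) x\<bar> ^ 3)" for x
    unfolding env by (rule sum_cube_le[OF fin]) simp
  have Y3: "integrable P (\<lambda>x. \<bar>Y (fst t) (snd t) x\<bar> ^ 3)" if "t \<in> ?A" for t
  proof -
    have "fst t \<in> S" "snd t \<in> J" using that nbh_sub(1)[of 2 i] by auto
    then show ?thesis by (intro P.integrable_of_power4(3)[OF Y_meas Y_power4])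
  qed
  have dom: "integrable P (\<lambda>x. (real (card ?A))\<^sup>2 * (\<Sum>t\<in>?A. \<bar>Y (fst t) (snd t) x\<bar> ^ 3))"
    by (intro integrable_mult_right Bochner_Integration.integrable_sum Y3)
  show i3: "integrable P (\<lambda>x. (envelope i x) ^ 3)"
  proof (rule Bochner_Integration.integrable_bound[OF dom])
    show "AE x in P. norm ((envelope i x) ^ 3) \<le> norm ((real (card ?A))\<^sup>2 * (\<Sum>t\<in>?A. \<bar>Y (fst t) (snd t) x\<bar> ^ 3))"
    proof (intro AE_I2)
      fix x
      have "norm ((envelope i x) ^ 3) = (envelope i x) ^ 3" using envelope_nonneg by simp
      then show "norm ((envelope i x) ^ 3) \<le> norm ((real (card ?A))\<^sup>2 * (\<Sum>t\<in>?A. \<bar>Y (fst t) (snd t) x\<bar> ^ 3))"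
        using order_trans[OF le abs_ge_self] by (simp only: real_norm_def)
    qed
  qed measurable
  have b: "integrable P (\<lambda>x. 1 + (envelope i x) ^ 3)" using i3 by simp
  have pw: "(envelope i x) ^ k \<le> 1 + (envelope i x) ^ 3" if "k \<le> 3" for k x
  proof (cases "envelope i x \<le> 1")
    case True
    then have "(envelope i x) ^ k \<le> 1" using envelope_nonneg by (simp add: power_le_one)
    then show ?thesis using envelope_nonneg by (simp add: add_increasing2)
  next
    case False
    then have "(envelope i x) ^ k \<le> (envelope i x) ^ 3" using that by (intro power_increasing) auto
    then show ?thesis by simp
  qed
  show i2: "integrable P (\<lambda>x. (envelope i x)\<^sup>2)"
    by (rule Bochner_Integration.integrable_bound[OF b])
       (use pw[of 2] envelope_nonneg in \<open>simp_all add: add_nonneg_nonneg\<close>)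
  show i1: "integrable P (envelope i)"
    by (rule Bochner_Integration.integrable_bound[OF b])
       (use pw[of 1] envelope_nonneg in \<open>simp_all add: add_nonneg_nonneg\<close>)
  have "(\<integral>x. (envelope i x) ^ 3 \<partial>P) \<le> (\<integral>x. (real (card ?A))\<^sup>2 * (\<Sum>t\<in>?A. \<bar>Y (fst t) (snd t) x\<bar> ^ 3) \<partial>P)"
    by (rule integral_mono[OF i3 dom le])
  also have "\<dots> = (real (card ?A))\<^sup>2 * (\<Sum>t\<in>?A. \<integral>x. \<bar>Y (fst t) (snd t) x\<bar> ^ 3 \<partial>P)"
    by (subst integral_mult_right_zero, subst Bochner_Integration.integral_sum) (use Y3 in auto)
  also have "\<dots> \<le> (real (card ?A))\<^sup>2 * (\<Sum>t\<in>?A. c ^ 3)"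
    using nbh_sub(1)[of 2 i] by (intro mult_left_mono sum_mono Y_cube) auto
  also have "\<dots> = (real (card ?A) * c) ^ 3"
    by (simp add: power_mult_distrib power2_eq_square power3_eq_cube)
  also have "\<dots> \<le> scale ^ 3"
  proof -
    have "card ?A \<le> 4 * L * card J"
      using card_nbh[of i] by (simp add: card_cartesian_product)
    then have "real (card ?A) \<le> real (4 * L * card J)" by (simp only: of_nat_le_iff)
    then show ?thesis unfolding scale_def using c_pos by (intro power_mono mult_right_mono) auto
  qed
  finally show i3K: "(\<integral>x. (envelope i x) ^ 3 \<partial>P) \<le> scale ^ 3" .
  show "(\<integral>x. (envelope i x)\<^sup>2 \<partial>P) \<le> scale\<^sup>2" "(\<integral>x. envelope i x \<partial>P) \<le> scale"
    using P.cube_moment_bounds[OF i1 i2 i3 envelope_nonneg scale_pos i3K] by blast+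
qed

lemma integrable_envelope_bound:
  assumes "f \<in> borel_measurable P" "\<And>x. \<bar>f x\<bar> \<le> C * (envelope i x) ^ k" "k \<in> {1, 2, 3}"
  shows "integrable P f"
proof (rule Bochner_Integration.integrable_bound)
  from assms(3) consider "k = 1" | "k = 2" | "k = 3" by blast
  then have "integrable P (\<lambda>x. (envelope i x) ^ k)"
    by cases (simp_all only: envelope_moments(1,2,3) power_one_right)
  then show "integrable P (\<lambda>x. C * (envelope i x) ^ k)" by (rule integrable_mult_right)
  show "AE x in P. norm (f x) \<le> norm (C * (envelope i x) ^ k)"
    unfolding real_norm_def by (intro AE_I2 order_trans[OF assms(2) abs_ge_self])
qed (rule assms(1))

lemma dep_far:
  assumes "j \<in> J" and far: "\<And>k. k \<in> S \<Longrightarrow> k \<notin> nbh r i \<Longrightarrow> {k - int L<..k} \<subseteq> K"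
  shows "dep K (\<lambda>x. total j x - local_sum r i j x)"
proof -
  have eq: "total j x - local_sum r i j x = (\<Sum>k\<in>S - nbh r i. Y k j x)" for x
    unfolding total_def local_sum_def using nbh_sub S_finite by (simp add: sum_diff)
  show ?thesis unfolding eq
    by (rule dep_sum) (use far assms(1) in \<open>auto intro!: dep_mono[OF Y_dep]\<close>)
qed

lemma dep_far1: "j \<in> J \<Longrightarrow> dep (- {i - int L<..i}) (\<lambda>x. total j x - local_sum 1 i j x)"
  by (rule dep_far) (auto simp: nbh_def)

text \<open>The interval from i - 2 L to i + L contains the windows of all indices nearer than L to
  i, and windows of indices at distance 2 L or more avoid it. It is asymmetric because windows only
  look back.\<close>

lemma dep_far2: "j \<in> J \<Longrightarrow> dep (- {i - 2 * int L<..<i + int L}) (\<lambda>x. total j x - local_sum 2 i j x)"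
  by (rule dep_far) (auto simp: nbh_def)

lemma dep_near: "j \<in> J \<Longrightarrow> dep {i - 2 * int L<..<i + int L} (local_sum 1 i j)"
  unfolding local_sum_def[abs_def]
  by (rule dep_sum) (auto intro!: dep_mono[OF Y_dep] simp: nbh_def)

lemma dep_G: "(\<And>k. k \<in> J \<Longrightarrow> dep K (\<lambda>x. w x k)) \<Longrightarrow> dep K (\<lambda>x. G \<nu> (w x))"
  unfolding dep_def by (intro allI impI G_cong) blast

lemma cross_moment_far:
  assumes "i \<in> S" "k \<in> S" "k \<notin> nbh 1 i" "j \<in> J" "l \<in> J"
  shows "(\<integral>x. Y i j x * Y k l x \<partial>P) = 0"
proof -
  have "(\<integral>x. Y i j x * Y k l x \<partial>P) = (\<integral>x. Y i j x \<partial>P) * (\<integral>x. Y k l x \<partial>P)"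
  proof (rule integral_mult_dep)
    show "{i - int L<..i} \<inter> {k - int L<..k} = {}" using assms by (auto simp: nbh_def)
    show "integrable P (\<lambda>x. Y i j x * Y k l x)"
      using assms by (intro integrable_mult_square P.integrable_of_power4(2) Y_meas Y_power4) auto
  qed (use assms Y_meas Y_dep in auto)
  then show ?thesis using assms by (simp add: Y_mean)
qed

lemma integrable_YY: "i \<in> S \<Longrightarrow> k \<in> S \<Longrightarrow> j \<in> J \<Longrightarrow> l \<in> J \<Longrightarrow> integrable P (\<lambda>x. Y i j x * Y k l x)"
  by (intro integrable_mult_square P.integrable_of_power4(2) Y_meas Y_power4) auto

text \<open>Summands outside the neighbourhood are uncorrelated with the one at i, so local
  covariances add up to the covariance of the totals: the second-order terms of the local expansions
  lose nothing.\<close>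

lemma sum_local_covariance:
  assumes "j \<in> J" "l \<in> J"
  shows "(\<Sum>i\<in>S. \<integral>x. Y i j x * local_sum 1 i l x \<partial>P) = (\<integral>x. total j x * total l x \<partial>P)"
proof -
  have "(\<integral>x. Y i j x * local_sum 1 i l x \<partial>P) = (\<Sum>k\<in>S. \<integral>x. Y i j x * Y k l x \<partial>P)" if i: "i \<in> S" for i
  proof -
    have "(\<integral>x. Y i j x * local_sum 1 i l x \<partial>P) = (\<Sum>k\<in>nbh 1 i. \<integral>x. Y i j x * Y k l x \<partial>P)"
      unfolding local_sum_def sum_distrib_left
      using integrable_YY[OF i _ assms] nbh_sub(1) by (intro Bochner_Integration.integral_sum) blast
    also have "\<dots> = (\<Sum>k\<in>S. \<integral>x. Y i j x * Y k l x \<partial>P)"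
      using S_finite nbh_sub(1) cross_moment_far[OF i _ _ assms] by (intro sum.mono_neutral_left) auto
    finally show ?thesis .
  qed
  moreover have "(\<integral>x. total j x * total l x \<partial>P) = (\<Sum>i\<in>S. \<Sum>k\<in>S. \<integral>x. Y i j x * Y k l x \<partial>P)"
    unfolding total_def sum_product using integrable_YY assms by simp
  ultimately show ?thesis by simp
qed

context
  fixes w :: "nat \<Rightarrow> real" and a :: real
  assumes a: "\<bar>a\<bar> \<le> 1"
begin

text \<open>Later w is \<open>cos t\<close> times a frozen Gaussian vector and a is
  \<open>sin t\<close>, so this is the interpolated vector for a fixed Gaussian outcome.\<close>

abbreviation point :: "(int \<Rightarrow> real) \<Rightarrow> nat \<Rightarrow> real" where
  "point x \<equiv> \<lambda>k. w k + a * total k x"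

abbreviation point_far :: "nat \<Rightarrow> int \<Rightarrow> (int \<Rightarrow> real) \<Rightarrow> nat \<Rightarrow> real" where
  "point_far r i x \<equiv> \<lambda>k. w k + a * (total k x - local_sum r i k x)"

text \<open>Adding back the near summands is a Taylor step from \<open>point_far 1\<close>. The
  coefficient of its linear term is taken at \<open>point_far 2\<close>, independent of the near
  summands that it multiplies; the change of base point costs no more than the remainder
  does.\<close>

lemma leave_out_taylor:
  assumes j: "j \<in> J"
  shows "\<bar>G (e1 j) (point x) - G (e1 j) (point_far 1 i x) - (\<Sum>l\<in>J. a * local_sum 1 i l x * G (e2 j l) (point_far 2 i x))\<bar>
    \<le> \<beta> ^ 3 * (envelope i x)\<^sup>2"
proof -
  have pt: "point x = (\<lambda>k. point_far 1 i x k + a * local_sum 1 i k x)"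
    by (simp add: algebra_simps)
  have "\<bar>G (e1 j) (point x) - G (e1 j) (point_far 1 i x) - (\<Sum>l\<in>J. a * local_sum 1 i l x * G (e2 j l) (point_far 2 i x))\<bar>
    \<le> \<beta> ^ Suc (Suc (sum (e1 j) J)) * (\<Sum>l\<in>J. \<bar>a * local_sum 1 i l x\<bar>) *
      (\<Sum>l\<in>J. \<bar>point_far 1 i x l - point_far 2 i x l\<bar> + \<bar>a * local_sum 1 i l x\<bar>)"
    unfolding pt e2_def by (rule G_taylor) (simp only: sum_e1[OF j])
  also have "\<beta> ^ Suc (Suc (sum (e1 j) J)) = \<beta> ^ 3"
    by (simp only: sum_e1[OF j]) (simp add: numeral_3_eq_3)
  also have "\<beta> ^ 3 * (\<Sum>l\<in>J. \<bar>a * local_sum 1 i l x\<bar>) *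
      (\<Sum>l\<in>J. \<bar>point_far 1 i x l - point_far 2 i x l\<bar> + \<bar>a * local_sum 1 i l x\<bar>) \<le> \<beta> ^ 3 * envelope i x * envelope i x"
  proof -
    have sc: "\<bar>a * t\<bar> \<le> \<bar>t\<bar>" for t using mult_right_mono[OF a, of "\<bar>t\<bar>"] by (simp add: abs_mult)
    have 1: "(\<Sum>l\<in>J. \<bar>a * local_sum 1 i l x\<bar>) \<le> envelope i x"
      by (rule order_trans[OF sum_mono[OF sc] local_sum_envelope1])
    have df: "point_far 1 i x l - point_far 2 i x l = a * (local_sum 2 i l x - local_sum 1 i l x)" for l
      by (simp add: algebra_simps)
    have 2: "(\<Sum>l\<in>J. \<bar>point_far 1 i x l - point_far 2 i x l\<bar> + \<bar>a * local_sum 1 i l x\<bar>) \<le> envelope i x"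
      unfolding df by (rule order_trans[OF sum_mono[OF add_mono[OF sc sc]] local_sum_envelope])
    show ?thesis
      using \<beta>_nonneg envelope_nonneg[of i x] by (intro mult_mono 1 2) (auto intro!: sum_nonneg mult_nonneg_nonneg)
  qed
  finally show ?thesis by (simp add: power2_eq_square mult.assoc)
qed

lemma measurable_G_point:
  assumes "sum \<nu> J < 3"
  shows "(\<lambda>x. G \<nu> (point x)) \<in> borel_measurable P" "(\<lambda>x. G \<nu> (point_far r i x)) \<in> borel_measurable P"
proof -
  show "(\<lambda>x. G \<nu> (point x)) \<in> borel_measurable P"
    by (rule borel_measurable_G[OF assms, where w=point]) measurable
  show "(\<lambda>x. G \<nu> (point_far r i x)) \<in> borel_measurable P"
    by (rule borel_measurable_G[OF assms, where w="point_far r i"]) measurable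
qed

lemma integrable_G_point:
  assumes "sum \<nu> J < 3"
  shows "integrable P (\<lambda>x. G \<nu> (point x))" "integrable P (\<lambda>x. G \<nu> (point_far r i x))"
  using G_bound[of \<nu>] assms
  by (auto intro!: P.integrable_const_bound[where B="\<beta> ^ sum \<nu> J"] AE_I2 measurable_G_point)

text \<open>The Lipschitz bound for second derivatives undoes the leaving-out in the factored
  terms.\<close>

lemma second_derivative_leave_out:
  assumes "j \<in> J" "l \<in> J"
  shows "\<bar>(\<integral>x. G (e2 j l) (point_far 2 i x) \<partial>P) - (\<integral>x. G (e2 j l) (point x) \<partial>P)\<bar> \<le> \<beta> ^ 3 * scale"
proof -
  have b3: "\<beta> ^ Suc (sum (e2 j l) J) = \<beta> ^ 3"
    by (simp add: sum_e2[OF assms] eval_nat_numeral)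
  have pt: "\<bar>G (e2 j l) (point_far 2 i x) - G (e2 j l) (point x)\<bar> \<le> \<beta> ^ 3 * envelope i x" for x
  proof -
    have "\<bar>G (e2 j l) (point_far 2 i x) - G (e2 j l) (point x)\<bar> \<le> \<beta> ^ 3 * (\<Sum>k\<in>J. \<bar>point_far 2 i x k - point x k\<bar>)"
      using G_lipschitz[OF sum_e2_less[OF assms], of "point_far 2 i x" "point x"] unfolding b3 .
    also have "(\<Sum>k\<in>J. \<bar>point_far 2 i x k - point x k\<bar>) \<le> (\<Sum>k\<in>J. \<bar>local_sum 2 i k x\<bar>)"
    proof (rule sum_mono)
      fix k
      have "point_far 2 i x k - point x k = a * - local_sum 2 i k x" by (simp add: algebra_simps)
      then show "\<bar>point_far 2 i x k - point x k\<bar> \<le> \<bar>local_sum 2 i k x\<bar>"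
        using mult_right_mono[OF a, of "\<bar>local_sum 2 i k x\<bar>"] by (simp add: abs_mult)
    qed
    also have "\<dots> \<le> envelope i x" by (rule local_sum_envelope2)
    finally show ?thesis using \<beta>_nonneg by (simp add: mult_left_mono)
  qed
  note int = integrable_G_point[OF sum_e2_less[OF assms]]
  have "\<bar>(\<integral>x. G (e2 j l) (point_far 2 i x) \<partial>P) - (\<integral>x. G (e2 j l) (point x) \<partial>P)\<bar>
      = \<bar>\<integral>x. G (e2 j l) (point_far 2 i x) - G (e2 j l) (point x) \<partial>P\<bar>"
    by (simp only: Bochner_Integration.integral_diff[OF int(2) int(1)])
  also have "\<dots> \<le> (\<integral>x. \<bar>G (e2 j l) (point_far 2 i x) - G (e2 j l) (point x)\<bar> \<partial>P)"
    by (rule integral_abs_bound)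
  also have "\<dots> \<le> (\<integral>x. \<beta> ^ 3 * envelope i x \<partial>P)"
    using envelope_moments(3)[of i]
    by (intro integral_mono integrable_abs Bochner_Integration.integrable_diff int integrable_mult_right pt)
  also have "\<dots> \<le> \<beta> ^ 3 * scale"
    using envelope_moments(6)[of i] \<beta>_nonneg by (simp add: mult_left_mono)
  finally show ?thesis .
qed

text \<open>The zeroth Taylor term vanishes, the linear one factorises into a covariance times a
  mean second derivative, and the remainder costs \<open>\<beta> ^ 3 * scale ^ 3\<close>. The factor
  2 adds the same cost for moving the second derivative back to the full point.\<close>

lemma leave_out_term:
  assumes i: "i \<in> S"
  shows "\<bar>(\<Sum>j\<in>J. \<integral>x. Y i j x * G (e1 j) (point x) \<partial>P) -
     (\<Sum>j\<in>J. \<Sum>l\<in>J. a * (\<integral>x. Y i j x * local_sum 1 i l x \<partial>P) * (\<integral>x. G (e2 j l) (point x) \<partial>P))\<bar>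
     \<le> 2 * \<beta> ^ 3 * scale ^ 3"
proof -
  define R where "R = (\<lambda>j x. G (e1 j) (point x) - G (e1 j) (point_far 1 i x)
      - (\<Sum>l\<in>J. a * local_sum 1 i l x * G (e2 j l) (point_far 2 i x)))"
  have R_bound: "\<bar>R j x\<bar> \<le> \<beta> ^ 3 * (envelope i x)\<^sup>2" if "j \<in> J" for j x
    unfolding R_def by (rule leave_out_taylor[OF that])
  have R_meas: "R j \<in> borel_measurable P" if "j \<in> J" for j
    unfolding R_def using that
    by (intro borel_measurable_diff borel_measurable_sum borel_measurable_times borel_measurable_const
        measurable_G_point measurable_sums sum_e1_less sum_e2_less)
  have Ym: "Y i j \<in> borel_measurable P" if "j \<in> J" for j using Y_meas[OF i that] .
  have Yb: "\<bar>Y i j x\<bar> \<le> envelope i x" if "j \<in> J" for j x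
    using member_le_sum[of j J "\<lambda>j. \<bar>Y i j x\<bar>"] that finite_J Y_envelope[OF i, of x] by simp
  have Db: "\<bar>local_sum 1 i l x\<bar> \<le> envelope i x" if "l \<in> J" for l x
    using member_le_sum[of l J "\<lambda>j. \<bar>local_sum 1 i j x\<bar>"] that finite_J local_sum_envelope1[of i x] by simp
  have YDb: "\<bar>Y i j x * local_sum 1 i l x\<bar> \<le> 1 * (envelope i x) ^ 2" if "j \<in> J" "l \<in> J" for j l x
    using abs_mult_le_bounds[OF Yb Db] that by (simp add: power2_eq_square)
  have int_YF: "integrable P (\<lambda>x. Y i j x * G (e1 j) (point_far 1 i x))" if "j \<in> J" for j
  proof (rule integrable_envelope_bound[where k=1 and C=\<beta> and i=i])
    show "\<bar>Y i j x * G (e1 j) (point_far 1 i x)\<bar> \<le> \<beta> * (envelope i x) ^ 1" for x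
      using abs_mult_le_bounds[OF Yb[OF that, of x] G_e1_bound[OF that, of "point_far 1 i x"]] by (simp add: mult.commute)
    show "(\<lambda>x. Y i j x * G (e1 j) (point_far 1 i x)) \<in> borel_measurable P"
      by (intro borel_measurable_times Ym measurable_G_point sum_e1_less that)
  qed simp
  have int_YD: "integrable P (\<lambda>x. Y i j x * local_sum 1 i l x)" if "j \<in> J" "l \<in> J" for j l
    by (rule integrable_envelope_bound[where k=2 and C=1 and i=i], intro borel_measurable_times Ym measurable_sums that,
        rule YDb[OF that], simp)
  have int_YDH: "integrable P (\<lambda>x. (Y i j x * local_sum 1 i l x) * G (e2 j l) (point_far 2 i x))" if "j \<in> J" "l \<in> J" for j l
  proof (rule integrable_envelope_bound[where k=2 and C="\<beta>\<^sup>2" and i=i])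
    show "\<bar>(Y i j x * local_sum 1 i l x) * G (e2 j l) (point_far 2 i x)\<bar> \<le> \<beta>\<^sup>2 * (envelope i x) ^ 2" for x
      using abs_mult_le_bounds[OF YDb[OF that, of x] G_e2_bound[OF that, of "point_far 2 i x"]] by (simp add: mult.commute)
    show "(\<lambda>x. (Y i j x * local_sum 1 i l x) * G (e2 j l) (point_far 2 i x)) \<in> borel_measurable P"
      by (intro borel_measurable_times Ym measurable_sums measurable_G_point sum_e2_less that)
  qed simp
  have YRb: "\<bar>Y i j x * R j x\<bar> \<le> \<beta> ^ 3 * (envelope i x)\<^sup>2 * \<bar>Y i j x\<bar>" if "j \<in> J" for j x
    using mult_right_mono[OF R_bound[OF that, of x], of "\<bar>Y i j x\<bar>"] by (simp add: abs_mult mult.commute)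
  have int_YR: "integrable P (\<lambda>x. Y i j x * R j x)" if "j \<in> J" for j
  proof (rule integrable_envelope_bound[where k=3 and C="\<beta> ^ 3" and i=i])
    show "\<bar>Y i j x * R j x\<bar> \<le> \<beta> ^ 3 * (envelope i x) ^ 3" for x
      using abs_mult_le_bounds[OF Yb[OF that, of x] R_bound[OF that, of x]]
      by (simp add: power2_eq_square power3_eq_cube mult_ac)
    show "(\<lambda>x. Y i j x * R j x) \<in> borel_measurable P"
      by (intro borel_measurable_times Ym R_meas that)
  qed simp
  \<comment> \<open>\<open>Y i j\<close> is centred and independent of \<open>point_far 1\<close>,
    which omits all summands within distance L of i.\<close>
  have zero: "(\<integral>x. Y i j x * G (e1 j) (point_far 1 i x) \<partial>P) = 0" if "j \<in> J" for j
  proof -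
    have "(\<integral>x. Y i j x * G (e1 j) (point_far 1 i x) \<partial>P) = (\<integral>x. Y i j x \<partial>P) * (\<integral>x. G (e1 j) (point_far 1 i x) \<partial>P)"
    proof (rule integral_mult_dep[OF Ym[OF that] _ Y_dep[OF i that] _ _ int_YF[OF that]])
      show "dep (- {i - int L<..i}) (\<lambda>x. G (e1 j) (point_far 1 i x))"
        by (rule dep_G) (use dep_far1 in \<open>auto simp: dep_def\<close>)
    qed (use measurable_G_point[OF sum_e1_less[OF that]] in auto)
    then show ?thesis by (simp add: Y_mean[OF i that])
  qed
  \<comment> \<open>Both near factors live on the innovations between i - 2 L and i + L, which
    \<open>point_far 2\<close> avoids.\<close>
  have factor: "(\<integral>x. (Y i j x * local_sum 1 i l x) * G (e2 j l) (point_far 2 i x) \<partial>P)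
      = (\<integral>x. Y i j x * local_sum 1 i l x \<partial>P) * (\<integral>x. G (e2 j l) (point_far 2 i x) \<partial>P)" if "j \<in> J" "l \<in> J" for j l
  proof (rule integral_mult_dep[OF _ _ _ _ _ int_YDH[OF that]])
    have "dep {i - 2 * int L<..<i + int L} (Y i j)"
      by (rule dep_mono[OF Y_dep[OF i that(1)]]) (use L_pos in auto)
    from dep_binop[OF this dep_near[OF that(2), of i], of "(*)"]
    show "dep {i - 2 * int L<..<i + int L} (\<lambda>x. Y i j x * local_sum 1 i l x)" .
    show "dep (- {i - 2 * int L<..<i + int L}) (\<lambda>x. G (e2 j l) (point_far 2 i x))"
      by (rule dep_G) (use dep_far2 in \<open>auto simp: dep_def\<close>)
    show "(\<lambda>x. Y i j x * local_sum 1 i l x) \<in> borel_measurable P"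
      by (intro borel_measurable_times Ym measurable_sums that)
  qed (use measurable_G_point[OF sum_e2_less[OF that]] in auto)
  have expand: "(\<integral>x. Y i j x * G (e1 j) (point x) \<partial>P) = (\<integral>x. Y i j x * R j x \<partial>P) +
      (\<Sum>l\<in>J. a * (\<integral>x. Y i j x * local_sum 1 i l x \<partial>P) * (\<integral>x. G (e2 j l) (point_far 2 i x) \<partial>P))" if j: "j \<in> J" for j
  proof -
    have "Y i j x * G (e1 j) (point x) = Y i j x * R j x + (Y i j x * G (e1 j) (point_far 1 i x) +
        (\<Sum>l\<in>J. a * ((Y i j x * local_sum 1 i l x) * G (e2 j l) (point_far 2 i x))))" for x
      by (simp add: R_def right_diff_distrib sum_distrib_left mult_ac)
    then have "(\<integral>x. Y i j x * G (e1 j) (point x) \<partial>P) = (\<integral>x. Y i j x * R j x + (Y i j x * G (e1 j) (point_far 1 i x) +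
        (\<Sum>l\<in>J. a * ((Y i j x * local_sum 1 i l x) * G (e2 j l) (point_far 2 i x)))) \<partial>P)"
      by (simp only:)
    also have "\<dots> = (\<integral>x. Y i j x * R j x \<partial>P) + ((\<integral>x. Y i j x * G (e1 j) (point_far 1 i x) \<partial>P) +
        (\<Sum>l\<in>J. a * (\<integral>x. (Y i j x * local_sum 1 i l x) * G (e2 j l) (point_far 2 i x) \<partial>P)))"
      using int_YR[OF j] int_YF[OF j] int_YDH[OF j] by simp
    also have "(\<Sum>l\<in>J. a * (\<integral>x. (Y i j x * local_sum 1 i l x) * G (e2 j l) (point_far 2 i x) \<partial>P))
        = (\<Sum>l\<in>J. a * (\<integral>x. Y i j x * local_sum 1 i l x \<partial>P) * (\<integral>x. G (e2 j l) (point_far 2 i x) \<partial>P))"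
      by (intro sum.cong refl) (simp only: factor[OF j] mult.assoc[of a])
    finally show ?thesis by (simp only: zero[OF j] add_0_left)
  qed
  have part1: "\<bar>\<Sum>j\<in>J. \<integral>x. Y i j x * R j x \<partial>P\<bar> \<le> \<beta> ^ 3 * scale ^ 3"
  proof -
    have "\<bar>\<Sum>j\<in>J. \<integral>x. Y i j x * R j x \<partial>P\<bar> = \<bar>\<integral>x. (\<Sum>j\<in>J. Y i j x * R j x) \<partial>P\<bar>"
      using int_YR by simp
    also have "\<dots> \<le> (\<integral>x. \<bar>\<Sum>j\<in>J. Y i j x * R j x\<bar> \<partial>P)" by (rule integral_abs_bound)
    also have "\<dots> \<le> (\<integral>x. \<beta> ^ 3 * (envelope i x) ^ 3 \<partial>P)"
    proof (rule integral_mono)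
      fix x
      have "\<bar>\<Sum>j\<in>J. Y i j x * R j x\<bar> \<le> (\<Sum>j\<in>J. \<beta> ^ 3 * (envelope i x)\<^sup>2 * \<bar>Y i j x\<bar>)"
        by (rule order_trans[OF sum_abs sum_mono[OF YRb]])
      also have "\<dots> = \<beta> ^ 3 * (envelope i x)\<^sup>2 * (\<Sum>j\<in>J. \<bar>Y i j x\<bar>)" by (simp only: sum_distrib_left)
      also have "\<dots> \<le> \<beta> ^ 3 * (envelope i x)\<^sup>2 * envelope i x"
        using \<beta>_nonneg by (intro mult_left_mono Y_envelope[OF i]) auto
      finally show "\<bar>\<Sum>j\<in>J. Y i j x * R j x\<bar> \<le> \<beta> ^ 3 * (envelope i x) ^ 3"
        by (simp add: power2_eq_square power3_eq_cube mult.assoc)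
    qed (use int_YR envelope_moments(1)[of i] in auto)
    also have "\<dots> \<le> \<beta> ^ 3 * scale ^ 3"
      using envelope_moments(4)[of i] \<beta>_nonneg by (simp add: mult_left_mono)
    finally show ?thesis .
  qed
  let ?d = "\<lambda>j l. (\<integral>x. G (e2 j l) (point_far 2 i x) \<partial>P) - (\<integral>x. G (e2 j l) (point x) \<partial>P)"
  \<comment> \<open>The sums over j and l are kept inside the integral, where they factor into two
    sums below the envelope; bounding term by term would cost extra powers of
    \<open>card J\<close>.\<close>
  have part2: "\<bar>\<Sum>j\<in>J. \<Sum>l\<in>J. a * (\<integral>x. Y i j x * local_sum 1 i l x \<partial>P) * ?d j l\<bar> \<le> \<beta> ^ 3 * scale ^ 3"
  proof -
    have "\<bar>\<Sum>j\<in>J. \<Sum>l\<in>J. a * (\<integral>x. Y i j x * local_sum 1 i l x \<partial>P) * ?d j l\<bar>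
        \<le> (\<Sum>j\<in>J. \<Sum>l\<in>J. (\<integral>x. \<bar>Y i j x * local_sum 1 i l x\<bar> \<partial>P) * (\<beta> ^ 3 * scale))"
    proof (rule order_trans[OF sum_abs], rule sum_mono, rule order_trans[OF sum_abs], rule sum_mono)
      fix j l assume jl: "j \<in> J" "l \<in> J"
      have "\<bar>a * (\<integral>x. Y i j x * local_sum 1 i l x \<partial>P)\<bar> \<le> 1 * (\<integral>x. \<bar>Y i j x * local_sum 1 i l x\<bar> \<partial>P)"
        by (rule abs_mult_le_bounds[OF a integral_abs_bound])
      from abs_mult_le_bounds[OF this second_derivative_leave_out[OF jl, of i]]
      show "\<bar>a * (\<integral>x. Y i j x * local_sum 1 i l x \<partial>P) * ?d j l\<bar>
          \<le> (\<integral>x. \<bar>Y i j x * local_sum 1 i l x\<bar> \<partial>P) * (\<beta> ^ 3 * scale)" by simp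
    qed
    also have "\<dots> = (\<integral>x. (\<Sum>j\<in>J. \<Sum>l\<in>J. \<bar>Y i j x * local_sum 1 i l x\<bar>) \<partial>P) * (\<beta> ^ 3 * scale)"
      using int_YD by (simp add: sum_distrib_right)
    also have "(\<integral>x. (\<Sum>j\<in>J. \<Sum>l\<in>J. \<bar>Y i j x * local_sum 1 i l x\<bar>) \<partial>P) \<le> (\<integral>x. (envelope i x)\<^sup>2 \<partial>P)"
    proof (rule integral_mono)
      fix x
      have "(\<Sum>j\<in>J. \<Sum>l\<in>J. \<bar>Y i j x * local_sum 1 i l x\<bar>) = (\<Sum>j\<in>J. \<bar>Y i j x\<bar>) * (\<Sum>l\<in>J. \<bar>local_sum 1 i l x\<bar>)"
        by (simp add: sum_product abs_mult)
      also have "\<dots> \<le> envelope i x * envelope i x"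
        by (intro mult_mono Y_envelope[OF i] local_sum_envelope1 envelope_nonneg sum_nonneg) simp
      finally show "(\<Sum>j\<in>J. \<Sum>l\<in>J. \<bar>Y i j x * local_sum 1 i l x\<bar>) \<le> (envelope i x)\<^sup>2"
        by (simp only: power2_eq_square)
    qed (use int_YD envelope_moments(2)[of i] in auto)
    also have "\<dots> \<le> scale\<^sup>2" by (rule envelope_moments(5))
    also have "scale\<^sup>2 * (\<beta> ^ 3 * scale) = \<beta> ^ 3 * scale ^ 3"
      by (simp add: power2_eq_square power3_eq_cube)
    finally show ?thesis
      using \<beta>_nonneg scale_pos by (simp add: mult_right_mono)
  qed
  have "(\<Sum>j\<in>J. \<integral>x. Y i j x * G (e1 j) (point x) \<partial>P) -
     (\<Sum>j\<in>J. \<Sum>l\<in>J. a * (\<integral>x. Y i j x * local_sum 1 i l x \<partial>P) * (\<integral>x. G (e2 j l) (point x) \<partial>P))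
     = (\<Sum>j\<in>J. \<integral>x. Y i j x * R j x \<partial>P) + (\<Sum>j\<in>J. \<Sum>l\<in>J. a * (\<integral>x. Y i j x * local_sum 1 i l x \<partial>P) * ?d j l)"
    by (simp add: expand sum.distrib right_diff_distrib sum_subtractf)
  then show ?thesis using part1 part2 by linarith
qed

lemma leave_out_bound:
  "\<bar>(\<Sum>j\<in>J. \<integral>x. total j x * G (e1 j) (point x) \<partial>P) -
     (\<Sum>j\<in>J. \<Sum>l\<in>J. a * (\<integral>x. total j x * total l x \<partial>P) * (\<integral>x. G (e2 j l) (point x) \<partial>P))\<bar>
     \<le> 2 * real (card S) * \<beta> ^ 3 * scale ^ 3"
proof -
  let ?A = "\<lambda>i. \<Sum>j\<in>J. \<integral>x. Y i j x * G (e1 j) (point x) \<partial>P"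
  let ?B = "\<lambda>i. \<Sum>j\<in>J. \<Sum>l\<in>J. a * (\<integral>x. Y i j x * local_sum 1 i l x \<partial>P) * (\<integral>x. G (e2 j l) (point x) \<partial>P)"
  have int: "integrable P (\<lambda>x. Y i j x * G (e1 j) (point x))" if "i \<in> S" "j \<in> J" for i j
    using P.integrable_of_power4(1)[OF Y_meas Y_power4] that
    by (intro integrable_mult_bounded[where C=\<beta>] measurable_G_point sum_e1_less G_e1_bound) auto
  have A: "(\<Sum>j\<in>J. \<integral>x. total j x * G (e1 j) (point x) \<partial>P) = (\<Sum>i\<in>S. ?A i)"
  proof -
    have "(\<integral>x. total j x * G (e1 j) (point x) \<partial>P) = (\<Sum>i\<in>S. \<integral>x. Y i j x * G (e1 j) (point x) \<partial>P)" if "j \<in> J" for j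
      unfolding total_def[of j] sum_distrib_right
      by (rule Bochner_Integration.integral_sum) (rule int[OF _ that])
    then show ?thesis by (subst sum.swap) simp
  qed
  have B: "(\<Sum>j\<in>J. \<Sum>l\<in>J. a * (\<integral>x. total j x * total l x \<partial>P) * (\<integral>x. G (e2 j l) (point x) \<partial>P)) = (\<Sum>i\<in>S. ?B i)"
  proof -
    have "(\<Sum>i\<in>S. ?B i) = (\<Sum>j\<in>J. \<Sum>l\<in>J. \<Sum>i\<in>S. a * (\<integral>x. Y i j x * local_sum 1 i l x \<partial>P) * (\<integral>x. G (e2 j l) (point x) \<partial>P))"
      by (subst sum.swap) (intro sum.cong refl, rule sum.swap)
    also have "\<dots> = (\<Sum>j\<in>J. \<Sum>l\<in>J. a * (\<integral>x. total j x * total l x \<partial>P) * (\<integral>x. G (e2 j l) (point x) \<partial>P))"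
      by (intro sum.cong refl)
         (simp only: sum_local_covariance[symmetric] sum_distrib_left[symmetric] sum_distrib_right[symmetric])
    finally show ?thesis by simp
  qed
  have "\<bar>(\<Sum>i\<in>S. ?A i) - (\<Sum>i\<in>S. ?B i)\<bar> \<le> (\<Sum>i\<in>S. \<bar>?A i - ?B i\<bar>)"
    unfolding sum_subtractf[symmetric] by (rule sum_abs)
  also have "\<dots> \<le> (\<Sum>i\<in>S. 2 * \<beta> ^ 3 * scale ^ 3)"
    by (rule sum_mono) (rule leave_out_term)
  finally show ?thesis unfolding A B by (simp add: mult_ac)
qed

end

end

text \<open>The mean value inequality bounds the difference quotients by g uniformly in the
  increment, and dominated convergence along arbitrary null sequences gives the derivative.\<close>

lemma DERIV_integral:
  fixes f f' :: "real \<Rightarrow> 'a \<Rightarrow> real"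
  assumes f: "\<And>t. integrable M (f t)"
    and f'_meas: "\<And>t. f' t \<in> borel_measurable M"
    and deriv: "\<And>t x. ((\<lambda>t. f t x) has_real_derivative f' t x) (at t)"
    and g: "integrable M g" "\<And>t x. \<bar>f' t x\<bar> \<le> g x"
  shows "((\<lambda>t. \<integral>x. f t x \<partial>M) has_real_derivative (\<integral>x. f' t x \<partial>M)) (at t)"
  unfolding DERIV_def tendsto_at_iff_sequentially comp_def
proof (intro allI impI)
  fix h :: "nat \<Rightarrow> real" assume h0: "\<forall>i. h i \<in> UNIV - {0}" and h: "h \<longlonglongrightarrow> 0"
  have h0': "h n \<noteq> 0" for n using h0 by simp
  have "(\<lambda>n. \<integral>x. (f (t + h n) x - f t x) / h n \<partial>M) \<longlonglongrightarrow> (\<integral>x. f' t x \<partial>M)"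
  proof (rule integral_dominated_convergence[where w=g])
    show "AE x in M. (\<lambda>n. (f (t + h n) x - f t x) / h n) \<longlonglongrightarrow> f' t x"
    proof (intro AE_I2)
      fix x
      have "((\<lambda>h. (f (t + h) x - f t x) / h) \<longlongrightarrow> f' t x) (at 0)"
        using deriv[where t=t and x=x] by (simp add: DERIV_def)
      then show "(\<lambda>n. (f (t + h n) x - f t x) / h n) \<longlonglongrightarrow> f' t x"
        using h h0' by (simp add: tendsto_at_iff_sequentially comp_def)
    qed
    show "AE x in M. norm ((f (t + h n) x - f t x) / h n) \<le> g x" for n
    proof (intro AE_I2)
      fix x
      have "norm (f (t + h n) x - f t x) \<le> g x * norm (t + h n - t)"
        by (rule field_differentiable_bound[of UNIV "\<lambda>t. f t x" "\<lambda>t. f' t x"])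
           (use deriv g(2) in \<open>auto intro: has_field_derivative_at_within\<close>)
      then show "norm ((f (t + h n) x - f t x) / h n) \<le> g x"
        using h0'[of n] by (simp add: field_simps)
    qed
  qed (use f f'_meas g in auto)
  then show "(\<lambda>n. ((\<integral>x. f (t + h n) x \<partial>M) - (\<integral>x. f t x \<partial>M)) / h n) \<longlonglongrightarrow> (\<integral>x. f' t x \<partial>M)"
    using f by simp
qed

section \<open>Interpolation between the dependent sum and the Gaussian vector\<close>

context dependent_sum
begin

context
  fixes N :: "'b measure" and \<xi> :: "nat \<Rightarrow> 'b \<Rightarrow> real" and \<Gamma> :: "nat \<Rightarrow> nat \<Rightarrow> real"
  assumes gauss: "centered_gaussian N J \<xi> \<Gamma>" and variance_pos: "\<And>j. j \<in> J \<Longrightarrow> 0 < \<Gamma> j j"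
begin

text \<open>At t = 0 this is the Gaussian vector, at t = pi / 2 the vector of totals; the squared
  coefficients always add up to 1.\<close>

abbreviation path :: "real \<Rightarrow> (int \<Rightarrow> real) \<times> 'b \<Rightarrow> nat \<Rightarrow> real" where
  "path t z \<equiv> \<lambda>k. cos t * \<xi> k (snd z) + sin t * total k (fst z)"

definition discrepancy :: real where
  "discrepancy = 2 * real (card S) * \<beta> ^ 3 * scale ^ 3 +
     \<beta>\<^sup>2 * (\<Sum>j\<in>J. \<Sum>l\<in>J. \<bar>(\<integral>x. total j x * total l x \<partial>P) - \<Gamma> j l\<bar>)"

lemma prob_space_N: "prob_space N"
  using gauss by (simp add: centered_gaussian_def)

lemma xi_meas[measurable]: "j \<in> J \<Longrightarrow> \<xi> j \<in> borel_measurable N"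
  by (rule centered_gaussian_measurable[OF gauss])

lemma path_meas: "j \<in> J \<Longrightarrow> (\<lambda>z. path t z j) \<in> borel_measurable (P \<Otimes>\<^sub>M N)"
  by measurable

lemma G_path_meas: "sum \<nu> J < 3 \<Longrightarrow> (\<lambda>z. G \<nu> (path t z)) \<in> borel_measurable (P \<Otimes>\<^sub>M N)"
  by (rule borel_measurable_G[where w="path t"]) (auto intro: path_meas)

lemma integrable_total: "j \<in> J \<Longrightarrow> integrable P (total j)"
  unfolding total_def[abs_def]
  by (intro Bochner_Integration.integrable_sum P.integrable_of_power4(1)[OF Y_meas Y_power4])

lemma integrable_pair_left: "integrable P f \<Longrightarrow> integrable (P \<Otimes>\<^sub>M N) (\<lambda>z. f (fst z))" for f :: "(int \<Rightarrow> real) \<Rightarrow> real"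
proof -
  interpret N: prob_space N by (rule prob_space_N)
  assume "integrable P f"
  then have "integrable (distr (P \<Otimes>\<^sub>M N) P fst) f" by (simp only: N.distr_pair_fst)
  then show ?thesis by (rule integrable_distr[rotated]) simp
qed

lemma integrable_pair_right: "integrable N f \<Longrightarrow> integrable (P \<Otimes>\<^sub>M N) (\<lambda>z. f (snd z))" for f :: "'b \<Rightarrow> real"
proof -
  assume "integrable N f"
  then have "integrable (distr (P \<Otimes>\<^sub>M N) N snd) f" by (simp only: distr_pair_snd[OF P.prob_space_axioms prob_space_N])
  then show ?thesis by (rule integrable_distr[rotated]) simp
qed

lemma integrable_path:
  assumes "sum \<nu> J < 3"
  shows "integrable (P \<Otimes>\<^sub>M N) (\<lambda>z. G \<nu> (path t z))"
    and "j \<in> J \<Longrightarrow> integrable (P \<Otimes>\<^sub>M N) (\<lambda>z. total j (fst z) * G \<nu> (path t z))"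
    and "j \<in> J \<Longrightarrow> integrable (P \<Otimes>\<^sub>M N) (\<lambda>z. \<xi> j (snd z) * G \<nu> (path t z))"
proof -
  interpret N: prob_space N by (rule prob_space_N)
  interpret PN: pair_prob_space P N ..
  have b: "\<bar>G \<nu> v\<bar> \<le> \<beta> ^ sum \<nu> J" for v using G_bound[of \<nu> v] assms by simp
  show "integrable (P \<Otimes>\<^sub>M N) (\<lambda>z. G \<nu> (path t z))"
    by (rule PN.P.integrable_const_bound[where B="\<beta> ^ sum \<nu> J"]) (use b G_path_meas[OF assms] in auto)
  show "integrable (P \<Otimes>\<^sub>M N) (\<lambda>z. total j (fst z) * G \<nu> (path t z))" if "j \<in> J"
    by (rule integrable_mult_bounded[OF integrable_pair_left[OF integrable_total[OF that]] G_path_meas[OF assms] b])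
  show "integrable (P \<Otimes>\<^sub>M N) (\<lambda>z. \<xi> j (snd z) * G \<nu> (path t z))" if "j \<in> J"
    by (rule integrable_mult_bounded[OF integrable_pair_right[OF centered_gaussian_moments(1)[OF gauss finite_J that]] G_path_meas[OF assms] b])
qed

text \<open>For each frozen Gaussian outcome y this is the leave-out bound with w the vector of
  \<open>cos t * \<xi> k y\<close> and a = \<open>sin t\<close>; the bound is uniform in y and so
  survives integration.\<close>

lemma path_total_part:
  "\<bar>(\<Sum>j\<in>J. \<integral>z. total j (fst z) * G (e1 j) (path t z) \<partial>(P \<Otimes>\<^sub>M N)) -
    (\<Sum>j\<in>J. \<Sum>l\<in>J. sin t * (\<integral>x. total j x * total l x \<partial>P) * (\<integral>z. G (e2 j l) (path t z) \<partial>(P \<Otimes>\<^sub>M N)))\<bar>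
    \<le> 2 * real (card S) * \<beta> ^ 3 * scale ^ 3"
proof -
  interpret N: prob_space N by (rule prob_space_N)
  interpret PN: pair_prob_space P N ..
  let ?v = "\<lambda>y k. cos t * \<xi> k y"
  let ?A = "\<lambda>j y. \<integral>x. total j x * G (e1 j) (\<lambda>k. ?v y k + sin t * total k x) \<partial>P"
  let ?B = "\<lambda>j l y. \<integral>x. G (e2 j l) (\<lambda>k. ?v y k + sin t * total k x) \<partial>P"
  have A: "(\<integral>z. total j (fst z) * G (e1 j) (path t z) \<partial>(P \<Otimes>\<^sub>M N)) = (\<integral>y. ?A j y \<partial>N)"
    and A_int: "integrable N (?A j)" if "j \<in> J" for j
  proof -
    let ?f = "\<lambda>x y. total j x * G (e1 j) (\<lambda>k. ?v y k + sin t * total k x)"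
    have f: "(\<lambda>z. total j (fst z) * G (e1 j) (path t z)) = case_prod ?f" by (simp add: fun_eq_iff)
    have int: "integrable (P \<Otimes>\<^sub>M N) (case_prod ?f)"
      using integrable_path(2)[OF sum_e1_less[OF that] that, of t] unfolding f .
    show "(\<integral>z. total j (fst z) * G (e1 j) (path t z) \<partial>(P \<Otimes>\<^sub>M N)) = (\<integral>y. ?A j y \<partial>N)"
      unfolding f by (rule PN.integral_snd[OF int, symmetric])
    show "integrable N (?A j)" by (rule PN.integrable_snd[OF int])
  qed
  have B: "(\<integral>z. G (e2 j l) (path t z) \<partial>(P \<Otimes>\<^sub>M N)) = (\<integral>y. ?B j l y \<partial>N)"
    and B_int: "integrable N (?B j l)" if "j \<in> J" "l \<in> J" for j l
  proof -
    let ?f = "\<lambda>x y. G (e2 j l) (\<lambda>k. ?v y k + sin t * total k x)"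
    have f: "(\<lambda>z. G (e2 j l) (path t z)) = case_prod ?f" by (simp add: fun_eq_iff)
    have int: "integrable (P \<Otimes>\<^sub>M N) (case_prod ?f)"
      using integrable_path(1)[OF sum_e2_less[OF that], of t] unfolding f .
    show "(\<integral>z. G (e2 j l) (path t z) \<partial>(P \<Otimes>\<^sub>M N)) = (\<integral>y. ?B j l y \<partial>N)"
      unfolding f by (rule PN.integral_snd[OF int, symmetric])
    show "integrable N (?B j l)" by (rule PN.integrable_snd[OF int])
  qed
  let ?C = "\<lambda>j l. sin t * (\<integral>x. total j x * total l x \<partial>P)"
  let ?D = "\<lambda>y. (\<Sum>j\<in>J. ?A j y) - (\<Sum>j\<in>J. \<Sum>l\<in>J. ?C j l * ?B j l y)"
  have D_int: "integrable N ?D"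
    by (intro Bochner_Integration.integrable_diff Bochner_Integration.integrable_sum integrable_mult_right A_int B_int)
  have eq: "(\<Sum>j\<in>J. \<integral>z. total j (fst z) * G (e1 j) (path t z) \<partial>(P \<Otimes>\<^sub>M N)) -
    (\<Sum>j\<in>J. \<Sum>l\<in>J. ?C j l * (\<integral>z. G (e2 j l) (path t z) \<partial>(P \<Otimes>\<^sub>M N))) = (\<integral>y. ?D y \<partial>N)"
    using A_int B_int by (simp add: A B cong: sum.cong)
  have "\<bar>\<integral>y. ?D y \<partial>N\<bar> \<le> (\<integral>y. \<bar>?D y\<bar> \<partial>N)" by (rule integral_abs_bound)
  also have "\<dots> \<le> (\<integral>y. 2 * real (card S) * \<beta> ^ 3 * scale ^ 3 \<partial>N)"
  proof (rule integral_mono)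
    show "integrable N (\<lambda>y. \<bar>?D y\<bar>)" by (rule integrable_abs[OF D_int])
    show "\<bar>?D y\<bar> \<le> 2 * real (card S) * \<beta> ^ 3 * scale ^ 3" for y
      by (rule leave_out_bound[where a="sin t" and w="?v y", OF abs_sin_le_one])
  qed simp
  also have "\<dots> = 2 * real (card S) * \<beta> ^ 3 * scale ^ 3" by (simp add: N.prob_space)
  finally show ?thesis unfolding eq .
qed

text \<open>Now the innovations are frozen, and Gaussian integration by parts acts on the other
  factor.\<close>

lemma path_gauss_part:
  assumes j: "j \<in> J"
  shows "(\<integral>z. \<xi> j (snd z) * G (e1 j) (path t z) \<partial>(P \<Otimes>\<^sub>M N)) =
    (\<Sum>l\<in>J. cos t * \<Gamma> j l * (\<integral>z. G (e2 j l) (path t z) \<partial>(P \<Otimes>\<^sub>M N)))"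
proof -
  interpret N: prob_space N by (rule prob_space_N)
  interpret PN: pair_prob_space P N ..
  let ?v = "\<lambda>x k. sin t * total k x"
  have e2: "e2 j l = (e1 j)(l := Suc (e1 j l))" for l by (simp add: e2_def)
  have path: "path t (x, y) = (\<lambda>k. ?v x k + cos t * \<xi> k y)" for x y by (simp add: add.commute)
  let ?B = "\<lambda>l x. \<integral>y. G (e2 j l) (path t (x, y)) \<partial>N"
  have B: "(\<integral>z. G (e2 j l) (path t z) \<partial>(P \<Otimes>\<^sub>M N)) = (\<integral>x. ?B l x \<partial>P)" and B_int: "integrable P (?B l)" if "l \<in> J" for l
    using PN.integral_fst'[OF integrable_path(1)[OF sum_e2_less[OF j that], of t]]
      PN.integrable_fst'[OF integrable_path(1)[OF sum_e2_less[OF j that], of t]] by simp_all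
  have "(\<integral>z. \<xi> j (snd z) * G (e1 j) (path t z) \<partial>(P \<Otimes>\<^sub>M N)) = (\<integral>x. (\<integral>y. \<xi> j y * G (e1 j) (path t (x, y)) \<partial>N) \<partial>P)"
    using PN.integral_fst'[OF integrable_path(3)[OF sum_e1_less[OF j] j, of t]] by simp
  also have "\<dots> = (\<integral>x. (\<Sum>l\<in>J. cos t * \<Gamma> j l * ?B l x) \<partial>P)"
  proof (intro Bochner_Integration.integral_cong refl)
    fix x
    have "sum (e1 j) J < 2" using sum_e1[OF j] by simp
    from gaussian_integration_by_parts[OF smooth_product_axioms gauss j variance_pos[OF j] this, of "?v x" "cos t"]
    show "(\<integral>y. \<xi> j y * G (e1 j) (path t (x, y)) \<partial>N) = (\<Sum>l\<in>J. cos t * \<Gamma> j l * ?B l x)"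
      unfolding path e2 by (simp only: sum_distrib_left mult.assoc)
  qed
  also have "\<dots> = (\<Sum>l\<in>J. cos t * \<Gamma> j l * (\<integral>x. ?B l x \<partial>P))"
    using B_int by simp
  finally show ?thesis using B by simp
qed

text \<open>The two halves of the derivative produce second-derivative terms with the same factor
  cos t sin t and opposite signs. Matching covariances cancel; the covariance mismatch and the
  leave-out error remain.\<close>

lemma path_derivative_bound:
  "\<bar>\<integral>z. (\<Sum>j\<in>J. (cos t * total j (fst z) - sin t * \<xi> j (snd z)) * G (e1 j) (path t z)) \<partial>(P \<Otimes>\<^sub>M N)\<bar> \<le> discrepancy"
proof -
  interpret N: prob_space N by (rule prob_space_N)
  interpret PN: pair_prob_space P N ..
  let ?A = "\<lambda>j. \<integral>z. total j (fst z) * G (e1 j) (path t z) \<partial>(P \<Otimes>\<^sub>M N)"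
  let ?X = "\<lambda>j. \<integral>z. \<xi> j (snd z) * G (e1 j) (path t z) \<partial>(P \<Otimes>\<^sub>M N)"
  let ?H = "\<lambda>j l. \<integral>z. G (e2 j l) (path t z) \<partial>(P \<Otimes>\<^sub>M N)"
  let ?C = "\<lambda>j l. \<integral>x. total j x * total l x \<partial>P"
  have "(\<integral>z. (\<Sum>j\<in>J. (cos t * total j (fst z) - sin t * \<xi> j (snd z)) * G (e1 j) (path t z)) \<partial>(P \<Otimes>\<^sub>M N))
      = (\<integral>z. (\<Sum>j\<in>J. cos t * (total j (fst z) * G (e1 j) (path t z)) - sin t * (\<xi> j (snd z) * G (e1 j) (path t z))) \<partial>(P \<Otimes>\<^sub>M N))"
    by (simp add: left_diff_distrib mult.assoc)
  also have "\<dots> = (\<Sum>j\<in>J. cos t * ?A j - sin t * ?X j)"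
    using integrable_path(2,3)[OF sum_e1_less] by simp
  also have "\<dots> = cos t * ((\<Sum>j\<in>J. ?A j) - (\<Sum>j\<in>J. \<Sum>l\<in>J. sin t * ?C j l * ?H j l))
      + cos t * sin t * (\<Sum>j\<in>J. \<Sum>l\<in>J. (?C j l - \<Gamma> j l) * ?H j l)"
    by (simp add: path_gauss_part sum_subtractf sum_distrib_left left_diff_distrib right_diff_distrib mult_ac)
  finally have eq: "(\<integral>z. (\<Sum>j\<in>J. (cos t * total j (fst z) - sin t * \<xi> j (snd z)) * G (e1 j) (path t z)) \<partial>(P \<Otimes>\<^sub>M N)) = \<dots>" .
  have c: "\<bar>cos t\<bar> \<le> 1" "\<bar>sin t\<bar> \<le> 1" by simp_all
  have 1: "\<bar>cos t * ((\<Sum>j\<in>J. ?A j) - (\<Sum>j\<in>J. \<Sum>l\<in>J. sin t * ?C j l * ?H j l))\<bar> \<le> 1 * (2 * real (card S) * \<beta> ^ 3 * scale ^ 3)"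
    by (rule abs_mult_le_bounds[OF c(1) path_total_part])
  have H: "\<bar>?H j l\<bar> \<le> \<beta>\<^sup>2" if "j \<in> J" "l \<in> J" for j l
  proof -
    have "\<bar>?H j l\<bar> \<le> (\<integral>z. \<bar>G (e2 j l) (path t z)\<bar> \<partial>(P \<Otimes>\<^sub>M N))" by (rule integral_abs_bound)
    also have "\<dots> \<le> (\<integral>z. \<beta>\<^sup>2 \<partial>(P \<Otimes>\<^sub>M N))"
      using integrable_path(1)[OF sum_e2_less[OF that], of t] G_e2_bound[OF that]
      by (intro integral_mono) auto
    finally show ?thesis using PN.P.prob_space by simp
  qed
  have "\<bar>\<Sum>j\<in>J. \<Sum>l\<in>J. (?C j l - \<Gamma> j l) * ?H j l\<bar> \<le> (\<Sum>j\<in>J. \<Sum>l\<in>J. \<bar>?C j l - \<Gamma> j l\<bar> * \<beta>\<^sup>2)"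
    by (rule order_trans[OF sum_abs], rule sum_mono, rule order_trans[OF sum_abs], rule sum_mono)
       (intro abs_mult_le_bounds H order_refl)
  also have "\<dots> = \<beta>\<^sup>2 * (\<Sum>j\<in>J. \<Sum>l\<in>J. \<bar>?C j l - \<Gamma> j l\<bar>)"
    by (simp only: sum_distrib_left mult.commute)
  finally have 2: "\<bar>\<Sum>j\<in>J. \<Sum>l\<in>J. (?C j l - \<Gamma> j l) * ?H j l\<bar> \<le> \<beta>\<^sup>2 * (\<Sum>j\<in>J. \<Sum>l\<in>J. \<bar>?C j l - \<Gamma> j l\<bar>)" .
  have cs: "\<bar>cos t * sin t\<bar> \<le> 1" using abs_mult_le_bounds[OF c] by simp
  from 1 abs_mult_le_bounds[OF cs 2] show ?thesis
    unfolding eq discrepancy_def by linarith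
qed

lemma gaussian_comparison:
  "\<bar>(\<integral>x. G e0 (\<lambda>k. total k x) \<partial>P) - (\<integral>y. G e0 (\<lambda>k. \<xi> k y) \<partial>N)\<bar> \<le> 2 * discrepancy"
proof -
  interpret N: prob_space N by (rule prob_space_N)
  interpret PN: pair_prob_space P N ..
  let ?f' = "\<lambda>t z. \<Sum>j\<in>J. (cos t * total j (fst z) - sin t * \<xi> j (snd z)) * G (e1 j) (path t z)"
  define F where "F = (\<lambda>t. \<integral>z. G e0 (path t z) \<partial>(P \<Otimes>\<^sub>M N))"
  have F': "(F has_real_derivative (\<integral>z. ?f' t z \<partial>(P \<Otimes>\<^sub>M N))) (at t)" for t
    unfolding F_def
  proof (rule DERIV_integral[where g="\<lambda>z. \<Sum>j\<in>J. (\<bar>total j (fst z)\<bar> + \<bar>\<xi> j (snd z)\<bar>) * \<beta>"])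
    show "integrable (P \<Otimes>\<^sub>M N) (\<lambda>z. G e0 (path t z))" for t
      by (rule integrable_path) simp
    show "?f' t \<in> borel_measurable (P \<Otimes>\<^sub>M N)" for t
      using G_path_meas[OF sum_e1_less] by measurable
    show "((\<lambda>t. G e0 (path t z)) has_real_derivative ?f' t z) (at t)" for t z
      unfolding e1_def
      by (rule DERIV_G[where w="\<lambda>t. path t z"]) (auto intro!: derivative_eq_intros)
    show "integrable (P \<Otimes>\<^sub>M N) (\<lambda>z. \<Sum>j\<in>J. (\<bar>total j (fst z)\<bar> + \<bar>\<xi> j (snd z)\<bar>) * \<beta>)"
      by (intro Bochner_Integration.integrable_sum integrable_mult_left Bochner_Integration.integrable_add integrable_abs
          integrable_pair_left integrable_pair_right integrable_total centered_gaussian_moments(1)[OF gauss finite_J])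
    show "\<bar>?f' t z\<bar> \<le> (\<Sum>j\<in>J. (\<bar>total j (fst z)\<bar> + \<bar>\<xi> j (snd z)\<bar>) * \<beta>)" for t z
    proof (rule order_trans[OF sum_abs], rule sum_mono)
      fix j assume j: "j \<in> J"
      have "\<bar>cos t * total j (fst z)\<bar> \<le> 1 * \<bar>total j (fst z)\<bar>" "\<bar>sin t * \<xi> j (snd z)\<bar> \<le> 1 * \<bar>\<xi> j (snd z)\<bar>"
        by (rule abs_mult_le_bounds; simp)+
      then have "\<bar>cos t * total j (fst z) - sin t * \<xi> j (snd z)\<bar> \<le> \<bar>total j (fst z)\<bar> + \<bar>\<xi> j (snd z)\<bar>" by linarith
      then show "\<bar>(cos t * total j (fst z) - sin t * \<xi> j (snd z)) * G (e1 j) (path t z)\<bar> \<le> (\<bar>total j (fst z)\<bar> + \<bar>\<xi> j (snd z)\<bar>) * \<beta>"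
        by (rule abs_mult_le_bounds[OF _ G_e1_bound[OF j]])
    qed
  qed
  have bound: "norm (F (pi / 2) - F 0) \<le> discrepancy * norm (pi / 2 - 0)"
    by (rule field_differentiable_bound[of UNIV F "\<lambda>t. \<integral>z. ?f' t z \<partial>(P \<Otimes>\<^sub>M N)"])
       (use F' path_derivative_bound in \<open>auto intro: has_field_derivative_at_within\<close>)
  have d0: "0 \<le> discrepancy"
    using path_derivative_bound[of 0] by linarith
  have m1: "(\<lambda>x. G e0 (\<lambda>k. total k x)) \<in> borel_measurable P"
    by (rule borel_measurable_G[where w="\<lambda>x k. total k x"]) auto
  have m2: "(\<lambda>y. G e0 (\<lambda>k. \<xi> k y)) \<in> borel_measurable N"
    by (rule borel_measurable_G[where w="\<lambda>y k. \<xi> k y"]) auto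
  have "F (pi / 2) = (\<integral>z. G e0 (\<lambda>k. total k (fst z)) \<partial>(P \<Otimes>\<^sub>M N))"
    by (simp add: F_def)
  also have "\<dots> = (\<integral>x. G e0 (\<lambda>k. total k x) \<partial>distr (P \<Otimes>\<^sub>M N) P fst)"
    by (rule integral_distr[symmetric]) (use m1 in auto)
  finally have F1: "F (pi / 2) = (\<integral>x. G e0 (\<lambda>k. total k x) \<partial>P)" by (simp only: N.distr_pair_fst)
  have "F 0 = (\<integral>z. G e0 (\<lambda>k. \<xi> k (snd z)) \<partial>(P \<Otimes>\<^sub>M N))"
    by (simp add: F_def)
  also have "\<dots> = (\<integral>y. G e0 (\<lambda>k. \<xi> k y) \<partial>distr (P \<Otimes>\<^sub>M N) N snd)"
    by (rule integral_distr[symmetric]) (use m2 in auto)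
  finally have F0: "F 0 = (\<integral>y. G e0 (\<lambda>k. \<xi> k y) \<partial>N)" by (simp only: distr_pair_snd[OF P.prob_space_axioms prob_space_N])
  \<comment> \<open>The parameter interval has length pi / 2, below 2: the origin of the factor 2 in
    the claim.\<close>
  have "norm (pi / 2 - 0 :: real) \<le> 2" using pi_less_4 by simp
  then have "discrepancy * norm (pi / 2 - 0) \<le> discrepancy * 2" using d0 by (rule mult_left_mono)
  then have "norm (F (pi / 2) - F 0) \<le> 2 * discrepancy" using bound by linarith
  then show ?thesis unfolding F0 F1 real_norm_def .
qed

end

end

subsection \<open>Comparison of maxima\<close>

text \<open>Weierstrass' product inequality wants factors in [0, 1], hence the case split; if 2 exp
  (- b t) > 1 and J is nonempty, the left side is negative.\<close>

lemma prod_bump_inside: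
  assumes J: "finite J" and "\<And>j. j \<in> J \<Longrightarrow> \<bar>w j\<bar> \<le> x - t" "0 \<le> b"
  shows "1 - 2 * real (card J) * exp (- (b * t)) \<le> (\<Prod>j\<in>J. bump b x 0 (w j))"
proof (cases "2 * exp (- (b * t)) \<le> 1")
  case True
  have "1 - (\<Sum>j\<in>J. 2 * exp (- (b * t))) \<le> (\<Prod>j\<in>J. 1 - 2 * exp (- (b * t)))"
    using True by (intro Weierstrass_prod_ineq) auto
  also have "\<dots> \<le> (\<Prod>j\<in>J. bump b x 0 (w j))"
    using True assms by (intro prod_mono) (auto intro: bump_0_inside)
  finally show ?thesis by (simp add: mult_ac)
next
  case False
  show ?thesis
  proof (cases "J = {}")
    case False
    then have "1 \<le> real (card J)" using J by (simp add: Suc_le_eq card_gt_0_iff)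
    then have "1 * 1 \<le> real (card J) * (2 * exp (- (b * t)))"
      using \<open>\<not> 2 * exp (- (b * t)) \<le> 1\<close> by (intro mult_mono) auto
    moreover have "0 \<le> (\<Prod>j\<in>J. bump b x 0 (w j))"
      by (intro prod_nonneg) (simp add: bump_0_range)
    ultimately show ?thesis by (simp add: mult_ac)
  qed simp
qed

lemma prod_bump_outside:
  assumes J: "finite J" "j \<in> J" and w: "x + t \<le> \<bar>w j\<bar>" "0 \<le> b"
  shows "(\<Prod>j\<in>J. bump b x 0 (w j)) \<le> exp (- (b * t))"
proof -
  have "(\<Prod>j\<in>J. bump b x 0 (w j)) = bump b x 0 (w j) * (\<Prod>j\<in>J-{j}. bump b x 0 (w j))"
    using J by (simp add: prod.remove)
  also have "\<dots> \<le> bump b x 0 (w j) * 1"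
    by (intro mult_left_mono prod_le_1) (auto simp: bump_0_range)
  also have "\<dots> \<le> exp (- (b * t))" using bump_0_outside[OF w] by simp
  finally show ?thesis .
qed

lemma prod_bump_range: "0 \<le> (\<Prod>j\<in>J. bump b x 0 (w j))" "(\<Prod>j\<in>J. bump b x 0 (w j)) \<le> 1"
  by (auto intro!: prod_nonneg prod_le_1 simp: bump_0_range)

lemma borel_measurable_bump[measurable]: "bump b x 0 \<in> borel_measurable borel"
  unfolding bump_def[abs_def] logistic_def by simp

text \<open>Used for the process and for the Gaussian vector with the same slope b and width t. Its
  two inequalities sandwich the probability that all \<open>V j\<close> are below a level between
  shifted smooth functionals.\<close>

locale max_event = prob_space M for M :: "'a measure" +
  fixes J :: "nat set" and V :: "nat \<Rightarrow> 'a \<Rightarrow> real" and b t :: real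
  assumes finite_J: "finite J" and V_meas[measurable]: "\<And>j. j \<in> J \<Longrightarrow> V j \<in> borel_measurable M"
    and b_nonneg: "0 \<le> b" and J_ne: "J \<noteq> {}"
begin

abbreviation smooth :: "real \<Rightarrow> real" where
  "smooth x \<equiv> \<integral>\<omega>. (\<Prod>j\<in>J. bump b x 0 (V j \<omega>)) \<partial>M"

lemma sets_below[measurable]: "{\<omega> \<in> space M. \<forall>j\<in>J. \<bar>V j \<omega>\<bar> \<le> x} \<in> sets M" "{\<omega> \<in> space M. \<forall>j\<in>J. \<bar>V j \<omega>\<bar> < x} \<in> sets M"
  using finite_J by measurable

lemma integrable_smooth: "integrable M (\<lambda>\<omega>. \<Prod>j\<in>J. bump b x 0 (V j \<omega>))"
  by (rule integrable_const_bound[where B=1]) (auto simp: prod_bump_range abs_le_iff order_trans[OF _ prod_bump_range(1)])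

lemma prob_le_smooth:
  "prob {\<omega> \<in> space M. \<forall>j\<in>J. \<bar>V j \<omega>\<bar> \<le> x - t} \<le> smooth x + 2 * real (card J) * exp (- (b * t))"
proof -
  let ?A = "{\<omega> \<in> space M. \<forall>j\<in>J. \<bar>V j \<omega>\<bar> \<le> x - t}"
  have "prob ?A = (\<integral>\<omega>. indicator ?A \<omega> \<partial>M)" by simp
  also have "\<dots> \<le> (\<integral>\<omega>. (\<Prod>j\<in>J. bump b x 0 (V j \<omega>)) + 2 * real (card J) * exp (- (b * t)) \<partial>M)"
  proof (rule integral_mono)
    fix \<omega>
    have "0 \<le> (\<Prod>j\<in>J. bump b x 0 (V j \<omega>)) + 2 * real (card J) * exp (- (b * t))"
      using prod_bump_range(1) by (intro add_nonneg_nonneg) auto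
    moreover have "\<omega> \<in> ?A \<Longrightarrow> 1 \<le> (\<Prod>j\<in>J. bump b x 0 (V j \<omega>)) + 2 * real (card J) * exp (- (b * t))"
      using prod_bump_inside[OF finite_J, of "\<lambda>j. V j \<omega>" x t b] b_nonneg by auto
    ultimately show "indicator ?A \<omega> \<le> (\<Prod>j\<in>J. bump b x 0 (V j \<omega>)) + 2 * real (card J) * exp (- (b * t))"
      by (auto simp: indicator_def)
  qed (auto intro!: integrable_smooth integrable_real_indicator simp: emeasure_eq_measure)
  also have "\<dots> = smooth x + 2 * real (card J) * exp (- (b * t))"
    using integrable_smooth by (simp add: prob_space)
  finally show ?thesis .
qed

lemma smooth_le_prob:
  "smooth x \<le> prob {\<omega> \<in> space M. \<forall>j\<in>J. \<bar>V j \<omega>\<bar> < x + t} + exp (- (b * t))"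
proof -
  let ?A = "{\<omega> \<in> space M. \<forall>j\<in>J. \<bar>V j \<omega>\<bar> < x + t}"
  have "smooth x \<le> (\<integral>\<omega>. indicator ?A \<omega> + exp (- (b * t)) \<partial>M)"
  proof (rule integral_mono)
    fix \<omega> assume \<omega>: "\<omega> \<in> space M"
    show "(\<Prod>j\<in>J. bump b x 0 (V j \<omega>)) \<le> indicator ?A \<omega> + exp (- (b * t))"
    proof (cases "\<omega> \<in> ?A")
      case True
      have "(\<Prod>j\<in>J. bump b x 0 (V j \<omega>)) \<le> 1" by (rule prod_bump_range)
      then show ?thesis using True by (simp add: add_increasing2)
    next
      case False
      then obtain j where "j \<in> J" "x + t \<le> \<bar>V j \<omega>\<bar>" using \<omega> by force
      from prod_bump_outside[OF finite_J this(1), of x t "\<lambda>j. V j \<omega>" b] this b_nonneg False show ?thesis by simp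
    qed
  qed (auto intro!: integrable_smooth integrable_real_indicator Bochner_Integration.integrable_add simp: emeasure_eq_measure)
  also have "\<dots> = prob ?A + exp (- (b * t))"
    by (subst Bochner_Integration.integral_add) (auto simp: prob_space emeasure_eq_measure intro!: integrable_real_indicator)
  finally show ?thesis .
qed

end

text \<open>Three shifts by t accumulate in either direction: passing between W and V, leaving the
  indicator, and returning to it. Hence bumps at x + 2 t and x - 2 t, and an anti-concentration
  window of length 3 t, which is paid for on the Gaussian side only.\<close>

lemma smoothing_comparison:
  fixes V W :: "nat \<Rightarrow> 'a \<Rightarrow> real" and \<xi> :: "nat \<Rightarrow> 'b \<Rightarrow> real"
  assumes M: "prob_space M" and N: "prob_space N" and J: "finite J" "J \<noteq> {}"
    and V[measurable]: "\<And>j. j \<in> J \<Longrightarrow> V j \<in> borel_measurable M"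
    and W[measurable]: "\<And>j. j \<in> J \<Longrightarrow> W j \<in> borel_measurable M"
    and \<xi>[measurable]: "\<And>j. j \<in> J \<Longrightarrow> \<xi> j \<in> borel_measurable N"
    and b: "0 \<le> b"
    and smooth: "\<And>x. \<bar>(\<integral>\<omega>. (\<Prod>j\<in>J. bump b x 0 (V j \<omega>)) \<partial>M) - (\<integral>\<omega>. (\<Prod>j\<in>J. bump b x 0 (\<xi> j \<omega>)) \<partial>N)\<bar> \<le> D"
    and close: "measure M {\<omega> \<in> space M. \<exists>j\<in>J. t < \<bar>W j \<omega> - V j \<omega>\<bar>} \<le> \<eta>"
    and anti: "\<And>u. measure N {\<omega> \<in> space N. \<exists>j\<in>J. u \<le> \<bar>\<xi> j \<omega>\<bar> \<and> \<bar>\<xi> j \<omega>\<bar> \<le> u + 3 * t} \<le> A"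
  shows "\<bar>measure M {\<omega> \<in> space M. \<forall>j\<in>J. \<bar>W j \<omega>\<bar> \<le> x} - measure N {\<omega> \<in> space N. \<forall>j\<in>J. \<bar>\<xi> j \<omega>\<bar> \<le> x}\<bar>
    \<le> \<eta> + D + 3 * real (card J) * exp (- (b * t)) + A"
proof -
  interpret M: prob_space M by fact
  interpret N: prob_space N by fact
  interpret V: max_event M J V b t by unfold_locales (use J b in auto)
  interpret \<xi>: max_event N J \<xi> b t by unfold_locales (use J b in auto)
  let ?e = "exp (- (b * t))"
  have "1 \<le> real (card J)" using J by (simp add: Suc_le_eq card_gt_0_iff)
  then have e: "?e + 2 * real (card J) * ?e \<le> 3 * real (card J) * ?e"
    using mult_right_mono[of 1 "real (card J)" ?e] by simp
  let ?B = "{\<omega> \<in> space M. \<exists>j\<in>J. t < \<bar>W j \<omega> - V j \<omega>\<bar>}"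
  let ?C = "\<lambda>u. {\<omega> \<in> space N. \<exists>j\<in>J. u \<le> \<bar>\<xi> j \<omega>\<bar> \<and> \<bar>\<xi> j \<omega>\<bar> \<le> u + 3 * t}"
  have sB[measurable]: "?B \<in> sets M" using J by measurable
  have sC[measurable]: "?C u \<in> sets N" for u using J by measurable
  have sW[measurable]: "{\<omega> \<in> space M. \<forall>j\<in>J. \<bar>W j \<omega>\<bar> \<le> x} \<in> sets M" using J by measurable
  have "measure M {\<omega> \<in> space M. \<forall>j\<in>J. \<bar>W j \<omega>\<bar> \<le> x} \<le> measure M (?B \<union> {\<omega> \<in> space M. \<forall>j\<in>J. \<bar>V j \<omega>\<bar> \<le> (x + 2 * t) - t})"
  proof (rule M.finite_measure_mono)
    show "{\<omega> \<in> space M. \<forall>j\<in>J. \<bar>W j \<omega>\<bar> \<le> x} \<subseteq> ?B \<union> {\<omega> \<in> space M. \<forall>j\<in>J. \<bar>V j \<omega>\<bar> \<le> (x + 2 * t) - t}"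
    proof (intro subsetI)
      fix \<omega> assume \<omega>: "\<omega> \<in> {\<omega> \<in> space M. \<forall>j\<in>J. \<bar>W j \<omega>\<bar> \<le> x}"
      show "\<omega> \<in> ?B \<union> {\<omega> \<in> space M. \<forall>j\<in>J. \<bar>V j \<omega>\<bar> \<le> (x + 2 * t) - t}"
      proof (cases "\<omega> \<in> ?B")
        case False
        have "\<bar>V j \<omega>\<bar> \<le> (x + 2 * t) - t" if "j \<in> J" for j
        proof -
          have "\<bar>W j \<omega> - V j \<omega>\<bar> \<le> t" "\<bar>W j \<omega>\<bar> \<le> x" using False \<omega> that by (auto simp: not_less)
          then show ?thesis by linarith
        qed
        then show ?thesis using \<omega> by auto
      qed simp
    qed
  qed measurable
  also have "\<dots> \<le> \<eta> + measure M {\<omega> \<in> space M. \<forall>j\<in>J. \<bar>V j \<omega>\<bar> \<le> (x + 2 * t) - t}"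
    using measure_Un_le[OF sB V.sets_below(1)[of "(x + 2 * t) - t"]] close by linarith
  also have "\<dots> \<le> \<eta> + (V.smooth (x + 2 * t) + 2 * real (card J) * ?e)"
    using V.prob_le_smooth[of "x + 2 * t"] by simp
  also have "\<dots> \<le> \<eta> + (\<xi>.smooth (x + 2 * t) + D + 2 * real (card J) * ?e)"
    using smooth[of "x + 2 * t"] by (auto simp: abs_le_iff)
  also have "\<dots> \<le> \<eta> + (measure N {\<omega> \<in> space N. \<forall>j\<in>J. \<bar>\<xi> j \<omega>\<bar> < (x + 2 * t) + t} + ?e + D + 2 * real (card J) * ?e)"
    using \<xi>.smooth_le_prob[of "x + 2 * t"] by simp
  also have "measure N {\<omega> \<in> space N. \<forall>j\<in>J. \<bar>\<xi> j \<omega>\<bar> < (x + 2 * t) + t} \<le>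
      measure N ({\<omega> \<in> space N. \<forall>j\<in>J. \<bar>\<xi> j \<omega>\<bar> \<le> x} \<union> ?C x)"
    by (rule N.finite_measure_mono) (auto, force)
  also have "\<dots> \<le> measure N {\<omega> \<in> space N. \<forall>j\<in>J. \<bar>\<xi> j \<omega>\<bar> \<le> x} + A"
    using measure_Un_le[OF \<xi>.sets_below(1)[of x] sC[of x]] anti[of x] by linarith
  finally have upper: "measure M {\<omega> \<in> space M. \<forall>j\<in>J. \<bar>W j \<omega>\<bar> \<le> x} \<le> measure N {\<omega> \<in> space N. \<forall>j\<in>J. \<bar>\<xi> j \<omega>\<bar> \<le> x}
      + (\<eta> + D + 3 * real (card J) * ?e + A)"
    using e by linarith
  have "measure N {\<omega> \<in> space N. \<forall>j\<in>J. \<bar>\<xi> j \<omega>\<bar> \<le> x} \<le> measure N ({\<omega> \<in> space N. \<forall>j\<in>J. \<bar>\<xi> j \<omega>\<bar> \<le> (x - 2 * t) - t} \<union> ?C (x - 3 * t))"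
    by (rule N.finite_measure_mono) (auto, force)
  also have "\<dots> \<le> measure N {\<omega> \<in> space N. \<forall>j\<in>J. \<bar>\<xi> j \<omega>\<bar> \<le> (x - 2 * t) - t} + A"
    using measure_Un_le[OF \<xi>.sets_below(1)[of "(x - 2 * t) - t"] sC[of "x - 3 * t"]] anti[of "x - 3 * t"] by linarith
  also have "\<dots> \<le> (\<xi>.smooth (x - 2 * t) + 2 * real (card J) * ?e) + A"
    using \<xi>.prob_le_smooth[of "x - 2 * t"] by simp
  also have "\<dots> \<le> (V.smooth (x - 2 * t) + D + 2 * real (card J) * ?e) + A"
    using smooth[of "x - 2 * t"] by (auto simp: abs_le_iff)
  also have "\<dots> \<le> (measure M {\<omega> \<in> space M. \<forall>j\<in>J. \<bar>V j \<omega>\<bar> < (x - 2 * t) + t} + ?e + D + 2 * real (card J) * ?e) + A"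
    using V.smooth_le_prob[of "x - 2 * t"] by simp
  also have "measure M {\<omega> \<in> space M. \<forall>j\<in>J. \<bar>V j \<omega>\<bar> < (x - 2 * t) + t} \<le>
      measure M (?B \<union> {\<omega> \<in> space M. \<forall>j\<in>J. \<bar>W j \<omega>\<bar> \<le> x})"
  proof (rule M.finite_measure_mono)
    show "{\<omega> \<in> space M. \<forall>j\<in>J. \<bar>V j \<omega>\<bar> < (x - 2 * t) + t} \<subseteq> ?B \<union> {\<omega> \<in> space M. \<forall>j\<in>J. \<bar>W j \<omega>\<bar> \<le> x}"
    proof (intro subsetI)
      fix \<omega> assume \<omega>: "\<omega> \<in> {\<omega> \<in> space M. \<forall>j\<in>J. \<bar>V j \<omega>\<bar> < (x - 2 * t) + t}"
      show "\<omega> \<in> ?B \<union> {\<omega> \<in> space M. \<forall>j\<in>J. \<bar>W j \<omega>\<bar> \<le> x}"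
      proof (cases "\<omega> \<in> ?B")
        case False
        have "\<bar>W j \<omega>\<bar> \<le> x" if "j \<in> J" for j
        proof -
          have "\<bar>W j \<omega> - V j \<omega>\<bar> \<le> t" "\<bar>V j \<omega>\<bar> < (x - 2 * t) + t" using False \<omega> that by (auto simp: not_less)
          then show ?thesis by linarith
        qed
        then show ?thesis using \<omega> by auto
      qed simp
    qed
  qed measurable
  also have "\<dots> \<le> \<eta> + measure M {\<omega> \<in> space M. \<forall>j\<in>J. \<bar>W j \<omega>\<bar> \<le> x}"
    using measure_Un_le[OF sB sW] close by linarith
  finally have lower: "measure N {\<omega> \<in> space N. \<forall>j\<in>J. \<bar>\<xi> j \<omega>\<bar> \<le> x} \<le> measure M {\<omega> \<in> space M. \<forall>j\<in>J. \<bar>W j \<omega>\<bar> \<le> x}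
      + (\<eta> + D + 3 * real (card J) * ?e + A)"
    using e by linarith
  from upper lower show ?thesis by (simp add: abs_le_iff algebra_simps)
qed

text \<open>Each coordinate has two intervals to avoid, one per sign, each of probability at most t
  / c since its deviation is at least c. The union bound holds whatever the correlations.\<close>

lemma centered_gaussian_anticoncentration:
  assumes cg: "centered_gaussian N J \<xi> \<Gamma>" and J: "finite J" and c: "0 < c" "\<And>j. j \<in> J \<Longrightarrow> c\<^sup>2 \<le> \<Gamma> j j" and t: "0 \<le> t"
  shows "measure N {\<omega> \<in> space N. \<exists>j\<in>J. u \<le> \<bar>\<xi> j \<omega>\<bar> \<and> \<bar>\<xi> j \<omega>\<bar> \<le> u + t} \<le> 2 * real (card J) * t / c"
proof -
  interpret N: prob_space N using cg by (simp add: centered_gaussian_def)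
  have xi[measurable]: "\<And>j. j \<in> J \<Longrightarrow> \<xi> j \<in> borel_measurable N"
    by (rule centered_gaussian_measurable[OF cg])
  have one: "measure N {\<omega> \<in> space N. \<xi> j \<omega> \<in> {v..v + t}} \<le> t / c" if j: "j \<in> J" for j v
  proof -
    have g: "0 < \<Gamma> j j" using c(2)[OF j] c(1) zero_less_power[of c 2] by linarith
    have "c \<le> sqrt (\<Gamma> j j)" using c(2)[OF j] c(1) by (simp add: real_le_rsqrt)
    have "measure N {\<omega> \<in> space N. \<xi> j \<omega> \<in> {v..v + t}} = measure (distr N borel (\<xi> j)) {v..v + t}"
      using j by (subst measure_distr) (auto intro!: arg_cong[where f="measure N"])
    also have "\<dots> \<le> t / sqrt (\<Gamma> j j)"
      unfolding centered_gaussian_component[OF cg J j]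
      using measure_gauss_law_interval[of "sqrt (\<Gamma> j j)" v "v + t" 0] g t by simp
    also have "\<dots> \<le> t / c" using \<open>c \<le> sqrt (\<Gamma> j j)\<close> c(1) t g by (intro divide_left_mono mult_pos_pos) auto
    finally show ?thesis .
  qed
  let ?S = "\<lambda>j. {\<omega> \<in> space N. \<xi> j \<omega> \<in> {u..u + t}} \<union> {\<omega> \<in> space N. \<xi> j \<omega> \<in> {- (u + t)..- (u + t) + t}}"
  have S[measurable]: "?S j \<in> sets N" if "j \<in> J" for j using xi[OF that] by measurable
  have "measure N {\<omega> \<in> space N. \<exists>j\<in>J. u \<le> \<bar>\<xi> j \<omega>\<bar> \<and> \<bar>\<xi> j \<omega>\<bar> \<le> u + t} \<le> measure N (\<Union>j\<in>J. ?S j)"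
    using J S by (intro N.finite_measure_mono) (auto simp: abs_if split: if_splits)
  also have "\<dots> \<le> (\<Sum>j\<in>J. measure N (?S j))"
    using J S by (intro N.finite_measure_subadditive_finite) auto
  also have "\<dots> \<le> (\<Sum>j\<in>J. 2 * t / c)"
  proof (rule sum_mono)
    fix j assume j: "j \<in> J"
    have "measure N (?S j) \<le> measure N {\<omega> \<in> space N. \<xi> j \<omega> \<in> {u..u + t}} + measure N {\<omega> \<in> space N. \<xi> j \<omega> \<in> {- (u + t)..- (u + t) + t}}"
      using xi[OF j] by (intro measure_Un_le) auto
    then show "measure N (?S j) \<le> 2 * t / c" using one[OF j, of u] one[OF j, of "- (u + t)"] by simp
  qed
  also have "\<dots> = 2 * real (card J) * t / c" by simp
  finally show ?thesis .
qed

text \<open>In f' g' = f g - f (g - g') - (f - f') g + (f - f') (g - g') each correction is at most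
  r a by Cauchy-Schwarz; r <= a enters for the last one.\<close>

lemma integral_product_difference:
  fixes f f' g g' :: "'a \<Rightarrow> real"
  assumes [measurable]: "f \<in> borel_measurable M" "f' \<in> borel_measurable M" "g \<in> borel_measurable M" "g' \<in> borel_measurable M"
    and i: "integrable M (\<lambda>x. (f x)\<^sup>2)" "integrable M (\<lambda>x. (g x)\<^sup>2)"
      "integrable M (\<lambda>x. (f x - f' x)\<^sup>2)" "integrable M (\<lambda>x. (g x - g' x)\<^sup>2)"
    and a: "(\<integral>x. (f x)\<^sup>2 \<partial>M) \<le> a\<^sup>2" "(\<integral>x. (g x)\<^sup>2 \<partial>M) \<le> a\<^sup>2" "0 \<le> a"
    and r: "(\<integral>x. (f x - f' x)\<^sup>2 \<partial>M) \<le> r\<^sup>2" "(\<integral>x. (g x - g' x)\<^sup>2 \<partial>M) \<le> r\<^sup>2" "0 \<le> r" "r \<le> a"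
  shows "\<bar>(\<integral>x. f' x * g' x \<partial>M) - (\<integral>x. f x * g x \<partial>M)\<bar> \<le> 3 * r * a"
proof -
  have 1: "integrable M (\<lambda>x. f x * g x)" by (rule integrable_mult_square) (use i in auto)
  have 2: "integrable M (\<lambda>x. f x * (g x - g' x))" by (rule integrable_mult_square) (use i in auto)
  have 3: "integrable M (\<lambda>x. (f x - f' x) * g x)" by (rule integrable_mult_square) (use i in auto)
  have 4: "integrable M (\<lambda>x. (f x - f' x) * (g x - g' x))" by (rule integrable_mult_square) (use i in auto)
  have eq: "f' x * g' x = f x * g x - f x * (g x - g' x) - (f x - f' x) * g x + (f x - f' x) * (g x - g' x)" for x
    by (simp add: algebra_simps)
  have "(\<integral>x. f' x * g' x \<partial>M) - (\<integral>x. f x * g x \<partial>M) = - (\<integral>x. f x * (g x - g' x) \<partial>M) - (\<integral>x. (f x - f' x) * g x \<partial>M)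
      + (\<integral>x. (f x - f' x) * (g x - g' x) \<partial>M)"
    unfolding eq using 1 2 3 4 by simp
  moreover have "\<bar>\<integral>x. f x * (g x - g' x) \<partial>M\<bar> \<le> a * r"
    by (rule order_trans[OF integral_abs_bound integral_cauchy_schwarz]) (use i a r in auto)
  moreover have "\<bar>\<integral>x. (f x - f' x) * g x \<partial>M\<bar> \<le> r * a"
    by (rule order_trans[OF integral_abs_bound integral_cauchy_schwarz]) (use i a r in auto)
  moreover have "\<bar>\<integral>x. (f x - f' x) * (g x - g' x) \<partial>M\<bar> \<le> r * r"
    by (rule order_trans[OF integral_abs_bound integral_cauchy_schwarz]) (use i a r in auto)
  moreover have "r * r \<le> r * a" using r by (intro mult_left_mono) auto
  ultimately show ?thesis unfolding mult.commute[of a r] by linarith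
qed

lemma (in prob_space) chebyshev_square:
  fixes f :: "'a \<Rightarrow> real"
  assumes [measurable]: "f \<in> borel_measurable M" and i: "integrable M (\<lambda>x. (f x)\<^sup>2)"
    and "(\<integral>x. (f x)\<^sup>2 \<partial>M) \<le> r" "0 < t"
  shows "prob {x \<in> space M. t < \<bar>f x\<bar>} \<le> r / t\<^sup>2"
proof -
  have "prob {x \<in> space M. t < \<bar>f x\<bar>} \<le> prob {x \<in> space M. t\<^sup>2 \<le> (f x)\<^sup>2}"
  proof (rule finite_measure_mono)
    have "t\<^sup>2 \<le> (f x)\<^sup>2" if "t < \<bar>f x\<bar>" for x
      using that \<open>0 < t\<close> abs_le_square_iff[of t "f x"] by simp
    then show "{x \<in> space M. t < \<bar>f x\<bar>} \<subseteq> {x \<in> space M. t\<^sup>2 \<le> (f x)\<^sup>2}" by auto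
  qed measurable
  also have "\<dots> \<le> (\<integral>x. (f x)\<^sup>2 \<partial>M) / t\<^sup>2"
    by (rule integral_Markov_inequality_measure[OF i, where A="{}"]) (use \<open>0 < t\<close> in auto)
  also have "\<dots> \<le> r / t\<^sup>2" using assms by (intro divide_right_mono) auto
  finally show ?thesis .
qed

section \<open>Bound at a fixed sample size for arrays of causal summands\<close>

context innovation_space
begin

context
  fixes T :: nat and J :: "nat set" and Z :: "int \<Rightarrow> nat \<Rightarrow> (int \<Rightarrow> real) \<Rightarrow> real" and \<delta> :: "nat \<Rightarrow> nat \<Rightarrow> real" and r0 C :: real
  assumes T: "0 < T" and J: "finite J" "J \<noteq> {}"
    and Z_meas[measurable]: "\<And>i j. i \<in> {1..int T} \<Longrightarrow> j \<in> J \<Longrightarrow> Z i j \<in> borel_measurable P"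
    and Z_dep: "\<And>i j. i \<in> {1..int T} \<Longrightarrow> j \<in> J \<Longrightarrow> dep {..i} (Z i j)"
    and Z_mean: "\<And>i j. i \<in> {1..int T} \<Longrightarrow> j \<in> J \<Longrightarrow> (\<integral>x. Z i j x \<partial>P) = 0"
    and Z_power4: "\<And>i j. i \<in> {1..int T} \<Longrightarrow> j \<in> J \<Longrightarrow> integrable P (\<lambda>x. (Z i j x) ^ 4)"
    and Z_bound: "\<And>i j. i \<in> {1..int T} \<Longrightarrow> j \<in> J \<Longrightarrow> 1 + (\<integral>x. (Z i j x) ^ 4 \<partial>P) \<le> C"
    and Z_resample: "\<And>i j l. i \<in> {1..int T} \<Longrightarrow> j \<in> J \<Longrightarrow>
      (\<integral>z. (resample (i - int l) (Z i j) z)\<^sup>2 \<partial>(P \<Otimes>\<^sub>M P)) \<le> (\<delta> j l)\<^sup>2"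
    and \<delta>: "\<And>j l. j \<in> J \<Longrightarrow> 0 \<le> \<delta> j l" "\<And>j. j \<in> J \<Longrightarrow> summable (\<delta> j)" "\<And>j. j \<in> J \<Longrightarrow> (\<Sum>l. \<delta> j l) \<le> r0"
begin

definition truncated :: "nat \<Rightarrow> int \<Rightarrow> nat \<Rightarrow> (int \<Rightarrow> real) \<Rightarrow> real" where
  "truncated L i j x = 1 / sqrt (real T) * trunc L i (Z i j) x"

lemma sums_measurable[measurable]:
  "j \<in> J \<Longrightarrow> scaled_sum T Z j \<in> borel_measurable P"
  unfolding scaled_sum_def[abs_def]
  by (intro borel_measurable_times borel_measurable_const borel_measurable_sum Z_meas)

lemma truncated_measurable:
  "i \<in> {1..int T} \<Longrightarrow> j \<in> J \<Longrightarrow> truncated L i j \<in> borel_measurable P"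
  unfolding truncated_def[abs_def]
  by (intro borel_measurable_times borel_measurable_const measurable_trunc Z_meas)

text \<open>The factor sqrt T from T orthogonal increments cancels against the normalisation and
  leaves a plain tail sum of the resampling bounds.\<close>

lemma truncation_error:
  assumes j: "j \<in> J" and r: "(\<Sum>k. \<delta> j (k + L)) \<le> r"
  shows "integrable P (\<lambda>x. (scaled_sum T Z j x - (\<Sum>i\<in>{1..int T}. truncated L i j x))\<^sup>2)"
    and "(\<integral>x. (scaled_sum T Z j x - (\<Sum>i\<in>{1..int T}. truncated L i j x))\<^sup>2 \<partial>P) \<le> r\<^sup>2"
proof -
  have fin: "finite {1..int T}" by simp
  have err: "integrable P (\<lambda>x. (\<Sum>i\<in>{1..int T}. Z i j x - trunc L i (Z i j) x)\<^sup>2)"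
    "(\<integral>x. (\<Sum>i\<in>{1..int T}. Z i j x - trunc L i (Z i j) x)\<^sup>2 \<partial>P) \<le> (sqrt (card {1..int T}) * (\<Sum>k. \<delta> j (k + L)))\<^sup>2"
    by (rule trunc_sum_error[where f="\<lambda>i. Z i j" and \<delta>="\<delta> j", OF fin]; (rule Z_meas Z_power4 Z_resample \<delta> j; assumption?)+)+
  have eq: "(scaled_sum T Z j x - (\<Sum>i\<in>{1..int T}. truncated L i j x))\<^sup>2
      = 1 / real T * (\<Sum>i\<in>{1..int T}. Z i j x - trunc L i (Z i j) x)\<^sup>2" for x
  proof -
    have "scaled_sum T Z j x - (\<Sum>i\<in>{1..int T}. truncated L i j x)
        = 1 / sqrt (real T) * (\<Sum>i\<in>{1..int T}. Z i j x - trunc L i (Z i j) x)"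
      by (simp only: scaled_sum_def truncated_def sum_distrib_left[symmetric] right_diff_distrib[symmetric] sum_subtractf)
    then show ?thesis using T by (simp add: power_mult_distrib power_divide)
  qed
  show "integrable P (\<lambda>x. (scaled_sum T Z j x - (\<Sum>i\<in>{1..int T}. truncated L i j x))\<^sup>2)"
    unfolding eq using err(1) by simp
  have pos: "0 \<le> (\<Sum>k. \<delta> j (k + L))"
    using \<delta>[OF j] by (intro suminf_nonneg) (auto simp: summable_iff_shift)
  have "(\<integral>x. (scaled_sum T Z j x - (\<Sum>i\<in>{1..int T}. truncated L i j x))\<^sup>2 \<partial>P)
      = 1 / real T * (\<integral>x. (\<Sum>i\<in>{1..int T}. Z i j x - trunc L i (Z i j) x)\<^sup>2 \<partial>P)"
    unfolding eq by simp
  also have "\<dots> \<le> 1 / real T * (sqrt (card {1..int T}) * (\<Sum>k. \<delta> j (k + L)))\<^sup>2"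
    by (rule mult_left_mono[OF err(2)]) simp
  also have "\<dots> = (\<Sum>k. \<delta> j (k + L))\<^sup>2" using T by (simp add: power_mult_distrib)
  also have "\<dots> \<le> r\<^sup>2" using r pos by (rule power_mono)
  finally show "(\<integral>x. (scaled_sum T Z j x - (\<Sum>i\<in>{1..int T}. truncated L i j x))\<^sup>2 \<partial>P) \<le> r\<^sup>2" .
qed

text \<open>Centred summands have truncation 0 at lag 0, so the truncation error at L = 0 is the
  whole sum.\<close>

lemma scaled_sum_second_moment:
  assumes j: "j \<in> J"
  shows "integrable P (\<lambda>x. (scaled_sum T Z j x)\<^sup>2)" "(\<integral>x. (scaled_sum T Z j x)\<^sup>2 \<partial>P) \<le> r0\<^sup>2"
proof -
  have "(\<Sum>i\<in>{1..int T}. truncated 0 i j x) = 0" for x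
    by (intro sum.neutral) (simp add: truncated_def trunc_0[OF Z_dep[OF _ j]] Z_mean[OF _ j])
  with truncation_error[OF j, of 0 r0] \<delta>(3)[OF j]
  show "integrable P (\<lambda>x. (scaled_sum T Z j x)\<^sup>2)" "(\<integral>x. (scaled_sum T Z j x)\<^sup>2 \<partial>P) \<le> r0\<^sup>2" by simp_all
qed

lemma scaled_sum_cov_eq:
  assumes "j \<in> J" "l \<in> J"
  shows "scaled_sum_cov P T Z j l = (\<integral>x. scaled_sum T Z j x * scaled_sum T Z l x \<partial>P)"
proof -
  have int: "integrable P (\<lambda>x. Z i j x * Z k l x)" if "i \<in> {1..int T}" "k \<in> {1..int T}" for i k
    by (rule integrable_mult_square[OF Z_meas Z_meas P.integrable_of_power4(2)[OF Z_meas Z_power4] P.integrable_of_power4(2)[OF Z_meas Z_power4]])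
       (use that assms in auto)
  have eq: "scaled_sum T Z j x * scaled_sum T Z l x = 1 / real T * (\<Sum>i = 1..int T. \<Sum>k = 1..int T. Z i j x * Z k l x)" for x
  proof -
    have "scaled_sum T Z j x * scaled_sum T Z l x = (1 / sqrt (real T) * (1 / sqrt (real T))) *
        ((\<Sum>i = 1..int T. Z i j x) * (\<Sum>k = 1..int T. Z k l x))"
      by (simp only: scaled_sum_def mult_ac)
    then show ?thesis using T by (simp add: sum_product)
  qed
  have "(\<integral>x. (\<Sum>i = 1..int T. \<Sum>k = 1..int T. Z i j x * Z k l x) \<partial>P) = (\<Sum>i = 1..int T. \<integral>x. (\<Sum>k = 1..int T. Z i j x * Z k l x) \<partial>P)"
    by (intro Bochner_Integration.integral_sum Bochner_Integration.integrable_sum int)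
  also have "\<dots> = (\<Sum>i = 1..int T. \<Sum>k = 1..int T. \<integral>x. Z i j x * Z k l x \<partial>P)"
    by (intro sum.cong refl Bochner_Integration.integral_sum int)
  finally show ?thesis unfolding eq scaled_sum_cov_def by simp
qed

text \<open>The tolerance t is spent twice, on replacing W by the normalised sum and on truncating
  that sum, so smoothing and anti-concentration run at width 2 t. Truncation also perturbs the
  covariances, which is where \<open>3 * r * r0\<close> comes from.\<close>

theorem fixed_sample_bound:
  fixes \<xi> :: "nat \<Rightarrow> 'b \<Rightarrow> real" and W :: "nat \<Rightarrow> (int \<Rightarrow> real) \<Rightarrow> real"
  assumes cg: "centered_gaussian N J \<xi> (scaled_sum_cov P T Z)"
    and c: "0 < c" "\<And>j. j \<in> J \<Longrightarrow> c\<^sup>2 \<le> scaled_sum_cov P T Z j j"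
    and W[measurable]: "\<And>j. j \<in> J \<Longrightarrow> W j \<in> borel_measurable P"
    and close: "measure P {x \<in> space P. \<exists>j\<in>J. t < \<bar>W j x - scaled_sum T Z j x\<bar>} \<le> \<eta>"
    and L: "0 < L" and r: "\<And>j. j \<in> J \<Longrightarrow> (\<Sum>k. \<delta> j (k + L)) \<le> r" "r \<le> r0" and t: "0 < t" and b: "0 \<le> b"
  shows "\<bar>measure P {x \<in> space P. \<forall>j\<in>J. \<bar>W j x\<bar> \<le> y} - measure N {\<omega> \<in> space N. \<forall>j\<in>J. \<bar>\<xi> j \<omega>\<bar> \<le> y}\<bar>
    \<le> (\<eta> + real (card J) * (r\<^sup>2 / t\<^sup>2))
      + 2 * (2 * real T * (8 * b) ^ 3 * (real (4 * L * card J) * (C / sqrt (real T))) ^ 3 + (8 * b)\<^sup>2 * ((real (card J))\<^sup>2 * (3 * r * r0)))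
      + 3 * real (card J) * exp (- (b * (2 * t))) + 2 * real (card J) * (3 * (2 * t)) / c"
proof -
  define V where "V = (\<lambda>j x. \<Sum>i\<in>{1..int T}. truncated L i j x)"
  have V[measurable]: "V j \<in> borel_measurable P" if "j \<in> J" for j
    unfolding V_def using that by (intro borel_measurable_sum truncated_measurable)
  have V_err: "integrable P (\<lambda>x. (scaled_sum T Z j x - V j x)\<^sup>2)" "(\<integral>x. (scaled_sum T Z j x - V j x)\<^sup>2 \<partial>P) \<le> r\<^sup>2" if "j \<in> J" for j
    unfolding V_def by (rule truncation_error[OF that r(1)[OF that]])+
  obtain i1 j1 where ij1: "i1 \<in> {1..int T}" "j1 \<in> J" using T J by fastforce
  have r_nonneg: "0 \<le> r"
  proof -
    have "0 \<le> (\<Sum>k. \<delta> j1 (k + L))"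
      using \<delta>[OF ij1(2)] by (intro suminf_nonneg) (auto simp: summable_iff_shift)
    then show ?thesis using r(1)[OF ij1(2)] by linarith
  qed
  have r0_nonneg: "0 \<le> r0" using r_nonneg r by simp
  have C1: "1 \<le> C"
  proof -
    have "0 \<le> (\<integral>x. (Z i1 j1 x) ^ 4 \<partial>P)" by (rule integral_nonneg_AE) simp
    then show ?thesis using Z_bound[OF ij1] by linarith
  qed
  let ?D = "2 * (2 * real T * (8 * b) ^ 3 * (real (4 * L * card J) * (C / sqrt (real T))) ^ 3 + (8 * b)\<^sup>2 * ((real (card J))\<^sup>2 * (3 * r * r0)))"
  have var_pos: "0 < scaled_sum_cov P T Z j j" if "j \<in> J" for j
    using c(2)[OF that] zero_less_power[OF c(1), of 2] by linarith
  have cov: "\<bar>(\<integral>x. V j x * V l x \<partial>P) - scaled_sum_cov P T Z j l\<bar> \<le> 3 * r * r0" if "j \<in> J" "l \<in> J" for j l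
    unfolding scaled_sum_cov_eq[OF that]
    by (rule integral_product_difference) (use that V V_err scaled_sum_second_moment r r_nonneg r0_nonneg in auto)
  have smooth: "\<bar>(\<integral>x. (\<Prod>j\<in>J. bump b z 0 (V j x)) \<partial>P) - (\<integral>\<omega>. (\<Prod>j\<in>J. bump b z 0 (\<xi> j \<omega>)) \<partial>N)\<bar> \<le> ?D" for z
  proof -
    interpret D: dependent_sum \<mu> J "bump b z" "8 * b" "{1..int T}" "truncated L" L "C / sqrt (real T)"
    proof
      show "finite J" "J \<noteq> {}" "0 < L" by (fact J L)+
      show "(bump b z n has_real_derivative bump b z (Suc n) u) (at u)" if "n < 3" for n u by (rule DERIV_bump[OF that])
      show "\<bar>bump b z n u\<bar> \<le> (8 * b) ^ n" if "n \<le> 3" for n u by (rule bump_bound[OF that b])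
      show "0 \<le> 8 * b" using b by simp
      show "finite {1..int T}" by simp
      show "0 < C / sqrt (real T)" using C1 T by simp
      fix i j assume ij: "i \<in> {1..int T}" "j \<in> J"
      show "truncated L i j \<in> borel_measurable P" by (rule truncated_measurable[OF ij])
      show "dep {i - int L<..i} (truncated L i j)"
        using dep_trunc[OF Z_dep[OF ij], of L] unfolding truncated_def dep_def by simp
      show "integrable P (\<lambda>x. (truncated L i j x) ^ 4)"
        using trunc_power4(1)[OF Z_meas[OF ij] Z_power4[OF ij]] by (simp add: truncated_def power_divide)
      show "(\<integral>x. truncated L i j x \<partial>P) = 0"
        by (simp add: truncated_def integral_trunc[OF Z_meas[OF ij] Z_power4[OF ij]] Z_mean[OF ij])
      let ?f = "trunc L i (Z i j)"
      have f: "?f \<in> borel_measurable P" "integrable P (\<lambda>x. (?f x) ^ 4)" "(\<integral>x. (?f x) ^ 4 \<partial>P) \<le> (\<integral>x. (Z i j x) ^ 4 \<partial>P)"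
        by (rule measurable_trunc[OF Z_meas[OF ij]] trunc_power4[OF Z_meas[OF ij] Z_power4[OF ij]])+
      \<comment> \<open>The bound C on 1 plus the fourth moment thereby bounds the third absolute
        moment; C >= 1 then allows \<open>C ^ 3\<close>, the form that the locale demands.\<close>
      have p: "\<bar>?f x\<bar> ^ 3 \<le> 1 + (?f x) ^ 4" for x
      proof (cases "\<bar>?f x\<bar> \<le> 1")
        case True
        then have "\<bar>?f x\<bar> ^ 3 \<le> 1" by (simp add: power_le_one)
        then show ?thesis by (simp add: add_increasing2)
      next
        case False
        then have "\<bar>?f x\<bar> ^ 3 \<le> \<bar>?f x\<bar> ^ 4" by (intro power_increasing) auto
        then show ?thesis by simp
      qed
      have "(\<integral>x. \<bar>truncated L i j x\<bar> ^ 3 \<partial>P) = (1 / sqrt (real T)) ^ 3 * (\<integral>x. \<bar>?f x\<bar> ^ 3 \<partial>P)"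
      proof -
        have "\<bar>truncated L i j x\<bar> ^ 3 = (1 / sqrt (real T)) ^ 3 * \<bar>?f x\<bar> ^ 3" for x
          by (simp add: truncated_def power_divide)
        then show ?thesis by simp
      qed
      also have "\<dots> \<le> (1 / sqrt (real T)) ^ 3 * C ^ 3"
      proof (rule mult_left_mono)
        have "(\<integral>x. \<bar>?f x\<bar> ^ 3 \<partial>P) \<le> (\<integral>x. 1 + (?f x) ^ 4 \<partial>P)"
          using P.integrable_of_power4(3)[OF f(1,2)] f(2) p by (intro integral_mono) auto
        also have "\<dots> = 1 + (\<integral>x. (?f x) ^ 4 \<partial>P)" using f(2) P.prob_space by simp
        also have "\<dots> \<le> C" using f(3) Z_bound[OF ij] by simp
        also have "\<dots> \<le> C ^ 3" using C1 self_le_power[of C 3] by simp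
        finally show "(\<integral>x. \<bar>?f x\<bar> ^ 3 \<partial>P) \<le> C ^ 3" .
      qed simp
      also have "\<dots> = (C / sqrt (real T)) ^ 3" by (simp add: power_divide)
      finally show "(\<integral>x. \<bar>truncated L i j x\<bar> ^ 3 \<partial>P) \<le> (C / sqrt (real T)) ^ 3" .
    qed
    have tot: "D.total j = V j" for j by (simp add: D.total_def V_def fun_eq_iff)
    have "\<bar>(\<integral>x. D.G D.e0 (\<lambda>k. D.total k x) \<partial>P) - (\<integral>\<omega>. D.G D.e0 (\<lambda>k. \<xi> k \<omega>) \<partial>N)\<bar> \<le> 2 * D.discrepancy (scaled_sum_cov P T Z)"
      by (rule D.gaussian_comparison[OF cg var_pos])
    also have "D.discrepancy (scaled_sum_cov P T Z) \<le> 2 * real T * (8 * b) ^ 3 * (real (4 * L * card J) * (C / sqrt (real T))) ^ 3 + (8 * b)\<^sup>2 * ((real (card J))\<^sup>2 * (3 * r * r0))"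
    proof -
      have "(\<Sum>j\<in>J. \<Sum>l\<in>J. \<bar>(\<integral>x. V j x * V l x \<partial>P) - scaled_sum_cov P T Z j l\<bar>) \<le> (\<Sum>j\<in>J. \<Sum>l\<in>J. 3 * r * r0)"
        by (intro sum_mono cov)
      also have "\<dots> = (real (card J))\<^sup>2 * (3 * r * r0)" by (simp add: power2_eq_square)
      finally have "(8 * b)\<^sup>2 * (\<Sum>j\<in>J. \<Sum>l\<in>J. \<bar>(\<integral>x. V j x * V l x \<partial>P) - scaled_sum_cov P T Z j l\<bar>) \<le> (8 * b)\<^sup>2 * ((real (card J))\<^sup>2 * (3 * r * r0))"
        by (rule mult_left_mono) simp
      moreover have "D.discrepancy (scaled_sum_cov P T Z) = 2 * real (card {1..int T}) * (8 * b) ^ 3 * D.scale ^ 3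
          + (8 * b)\<^sup>2 * (\<Sum>j\<in>J. \<Sum>l\<in>J. \<bar>(\<integral>x. D.total j x * D.total l x \<partial>P) - scaled_sum_cov P T Z j l\<bar>)"
        by (rule D.discrepancy_def[OF cg var_pos])
      ultimately show ?thesis unfolding D.scale_def tot by simp
    qed
    finally show ?thesis by (simp add: D.G_def tot)
  qed
  have cl: "measure P {x \<in> space P. \<exists>j\<in>J. 2 * t < \<bar>W j x - V j x\<bar>} \<le> \<eta> + real (card J) * (r\<^sup>2 / t\<^sup>2)"
  proof -
    let ?A = "{x \<in> space P. \<exists>j\<in>J. t < \<bar>W j x - scaled_sum T Z j x\<bar>}"
    let ?B = "\<lambda>j. {x \<in> space P. t < \<bar>scaled_sum T Z j x - V j x\<bar>}"
    have A: "?A \<in> sets P" using J sums_measurable by measurable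
    have B: "?B j \<in> sets P" if "j \<in> J" for j using sums_measurable[OF that] V[OF that] by measurable
    have BU: "(\<Union>j\<in>J. ?B j) \<in> sets P" using J B by auto
    have "measure P {x \<in> space P. \<exists>j\<in>J. 2 * t < \<bar>W j x - V j x\<bar>} \<le> measure P (?A \<union> (\<Union>j\<in>J. ?B j))"
    proof (rule P.finite_measure_mono)
      show "{x \<in> space P. \<exists>j\<in>J. 2 * t < \<bar>W j x - V j x\<bar>} \<subseteq> ?A \<union> (\<Union>j\<in>J. ?B j)"
      proof
        fix x assume "x \<in> {x \<in> space P. \<exists>j\<in>J. 2 * t < \<bar>W j x - V j x\<bar>}"
        then obtain j where j: "j \<in> J" "2 * t < \<bar>W j x - V j x\<bar>" by auto
        then have "t < \<bar>W j x - scaled_sum T Z j x\<bar> \<or> t < \<bar>scaled_sum T Z j x - V j x\<bar>" by linarith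
        then show "x \<in> ?A \<union> (\<Union>j\<in>J. ?B j)" using j by auto
      qed
    qed (use A BU in auto)
    also have "\<dots> \<le> measure P ?A + measure P (\<Union>j\<in>J. ?B j)" by (rule measure_Un_le[OF A BU])
    also have "measure P (\<Union>j\<in>J. ?B j) \<le> (\<Sum>j\<in>J. measure P (?B j))"
      using J B by (intro P.finite_measure_subadditive_finite) auto
    also have "\<dots> \<le> (\<Sum>j\<in>J. r\<^sup>2 / t\<^sup>2)"
    proof (rule sum_mono)
      fix j assume j: "j \<in> J"
      show "measure P (?B j) \<le> r\<^sup>2 / t\<^sup>2"
        by (rule P.chebyshev_square[OF _ V_err[OF j] t]) (use j V sums_measurable in auto)
    qed
    finally show ?thesis using close by simp
  qed
  have anti: "measure N {\<omega> \<in> space N. \<exists>j\<in>J. u \<le> \<bar>\<xi> j \<omega>\<bar> \<and> \<bar>\<xi> j \<omega>\<bar> \<le> u + 3 * (2 * t)} \<le> 2 * real (card J) * (3 * (2 * t)) / c" for u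
    by (rule centered_gaussian_anticoncentration[OF cg J(1) c]) (use t in auto)
  have N: "prob_space N" using cg by (simp add: centered_gaussian_def)
  show ?thesis
    by (rule smoothing_comparison[OF P.prob_space_axioms N J V W centered_gaussian_measurable[OF cg] b smooth cl anti])
qed

end

end

subsection \<open>Autocovariances of a dependent process\<close>

lemma abs_le_power2_half: "\<bar>a * b\<bar> \<le> (a\<^sup>2 + b\<^sup>2) / 2" for a b :: real
proof -
  have "0 \<le> (\<bar>a\<bar> - \<bar>b\<bar>)\<^sup>2" by simp
  then show ?thesis by (simp add: power2_diff abs_mult)
qed

lemma power2_power2: "(u\<^sup>2)\<^sup>2 = u ^ 4" for u :: real
  by (simp flip: power_mult)

text \<open>Fourth moments of X and of its resampling differences combine to second moments for
  resampled products; eighth moments of X give fourth moments of products. B and D are at least 1 so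
  that they absorb numerical constants.\<close>

locale dependent_process = innovation_space \<mu> for \<mu> :: "int \<Rightarrow> real measure" +
  fixes X :: "int \<Rightarrow> (int \<Rightarrow> real) \<Rightarrow> real" and B D :: real and d :: "nat \<Rightarrow> real"
  assumes X_meas[measurable]: "\<And>i. X i \<in> borel_measurable P"
    and X_dep: "\<And>i. dep {..i} (X i)"
    and X_power8: "\<And>i. integrable P (\<lambda>x. (X i x) ^ 8)" "\<And>i. (\<integral>x. (X i x) ^ 8 \<partial>P) \<le> B ^ 8"
    and X_power4: "\<And>i. (\<integral>x. (X i x) ^ 4 \<partial>P) \<le> B ^ 4"
    and X_resample: "\<And>i l. (\<integral>z. (resample (i - int l) (X i) z) ^ 4 \<partial>(P \<Otimes>\<^sub>M P)) \<le> (d l) ^ 4"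
    and d_nonneg: "\<And>l. 0 \<le> d l" and d_summable: "summable d"
    and d_tail: "\<And>n. (\<Sum>k. d (k + n)) \<le> D / (1 + real n)\<^sup>2"
    and B: "1 \<le> B" and D: "1 \<le> D"
    and stationary: "\<And>i j. (\<integral>x. X i x * X (i - int j) x \<partial>P) = autocov P X j"
begin

lemma X_integrable_power4: "integrable P (\<lambda>x. (X i x) ^ 4)"
proof -
  have "integrable P (\<lambda>x. ((X i x)\<^sup>2) ^ 4)" using X_power8[of i] by (simp flip: power_mult)
  then have "integrable P (\<lambda>x. ((X i x)\<^sup>2)\<^sup>2)" by (rule P.integrable_of_power4(2)[rotated]) measurable
  then show ?thesis by (simp flip: power_mult)
qed

lemma X_integrable_square: "integrable P (\<lambda>x. (X i x)\<^sup>2)"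
  by (rule P.integrable_of_power4(2)[OF X_meas X_integrable_power4])

lemma X_square: "(\<integral>x. (X i x)\<^sup>2 \<partial>P) \<le> B\<^sup>2"
proof -
  have "(\<integral>x. (X i x)\<^sup>2 \<partial>P)\<^sup>2 \<le> (\<integral>x. ((X i x)\<^sup>2)\<^sup>2 \<partial>P)"
    using X_integrable_power4[of i] by (intro P.jensen_square) (auto simp flip: power_mult)
  also have "\<dots> \<le> (B\<^sup>2)\<^sup>2" using X_power4[of i] by (simp flip: power_mult)
  finally show ?thesis by (rule power2_le_imp_le) simp
qed

lemma X_product: "integrable P (\<lambda>x. X i x * X k x)" "(\<integral>x. \<bar>X i x * X k x\<bar> \<partial>P) \<le> B\<^sup>2"
proof -
  show "integrable P (\<lambda>x. X i x * X k x)"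
    by (rule integrable_mult_square[OF X_meas X_meas X_integrable_square X_integrable_square])
  have "(\<integral>x. \<bar>X i x * X k x\<bar> \<partial>P) \<le> B * B"
    by (rule integral_cauchy_schwarz) (use X_integrable_square X_square B in auto)
  then show "(\<integral>x. \<bar>X i x * X k x\<bar> \<partial>P) \<le> B\<^sup>2" by (simp add: power2_eq_square)
qed

lemma autocov_bound: "\<bar>autocov P X j\<bar> \<le> B\<^sup>2"
  using order_trans[OF integral_abs_bound X_product(2)] by (simp add: autocov_def)

lemma cov_measurable[measurable]: "cov_summand P X i j \<in> borel_measurable P"
  unfolding cov_summand_def[abs_def] by measurable

lemma cov_mean: "(\<integral>x. cov_summand P X i j x \<partial>P) = 0"
  using X_product(1) P.prob_space by (simp add: cov_summand_def stationary)

lemma cov_dep: "dep {..i} (cov_summand P X i j)"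
proof -
  have "dep {..i} (X (i - int j))" by (rule dep_mono[OF X_dep]) auto
  from dep_binop[OF X_dep[of i] this, of "\<lambda>u v. u * v - autocov P X j"]
  show ?thesis by (simp only: cov_summand_def[abs_def])
qed

text \<open>\<open>power4_sum_le\<close> gives 8 (B^8 + B^8): one B^8 for the fourth moment of the
  product, one for the fourth power of its mean.\<close>

lemma cov_power4:
  shows "integrable P (\<lambda>x. (cov_summand P X i j x) ^ 4)" "(\<integral>x. (cov_summand P X i j x) ^ 4 \<partial>P) \<le> 16 * B ^ 8"
proof -
  let ?g = "\<lambda>x. 4 * ((X i x) ^ 8 + (X (i - int j) x) ^ 8) + 8 * B ^ 8"
  have le: "(cov_summand P X i j x) ^ 4 \<le> ?g x" for x
  proof -
    have 1: "(X i x * X (i - int j) x) ^ 4 \<le> ((X i x) ^ 8 + (X (i - int j) x) ^ 8) / 2"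
      using abs_le_power2_half[of "(X i x) ^ 4" "(X (i - int j) x) ^ 4"] by (simp add: power_mult_distrib flip: power_mult)
    have 2: "(- autocov P X j) ^ 4 \<le> B ^ 8"
      using power_mono[OF autocov_bound[of j], of 4] by (simp flip: power_mult)
    have "(cov_summand P X i j x) ^ 4 \<le> 8 * ((X i x * X (i - int j) x) ^ 4 + (- autocov P X j) ^ 4)"
      unfolding cov_summand_def using power4_sum_le[of "X i x * X (i - int j) x" "- autocov P X j"] by simp
    also have "\<dots> \<le> 8 * (((X i x) ^ 8 + (X (i - int j) x) ^ 8) / 2 + B ^ 8)"
      by (rule mult_left_mono[OF add_mono[OF 1 2]]) simp
    also have "\<dots> = ?g x" by simp
    finally show ?thesis .
  qed
  have g: "integrable P ?g" using X_power8(1) by simp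
  show i: "integrable P (\<lambda>x. (cov_summand P X i j x) ^ 4)"
    by (rule Bochner_Integration.integrable_bound[OF g]) (use le in \<open>auto intro!: order_trans[OF le abs_ge_self]\<close>)
  have "(\<integral>x. (cov_summand P X i j x) ^ 4 \<partial>P) \<le> (\<integral>x. ?g x \<partial>P)"
    by (rule integral_mono[OF i g le])
  also have "\<dots> = 4 * ((\<integral>x. (X i x) ^ 8 \<partial>P) + (\<integral>x. (X (i - int j) x) ^ 8 \<partial>P)) + 8 * B ^ 8"
    using X_power8(1) P.prob_space by simp
  also have "\<dots> \<le> 16 * B ^ 8" using X_power8(2)[of i] X_power8(2)[of "i - int j"] by simp
  finally show "(\<integral>x. (cov_summand P X i j x) ^ 4 \<partial>P) \<le> 16 * B ^ 8" .
qed

lemma integrable_resample_power4: "integrable (P \<Otimes>\<^sub>M P) (\<lambda>z. (resample k (X i) z) ^ 4)"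
proof (rule Bochner_Integration.integrable_bound)
  show "integrable (P \<Otimes>\<^sub>M P) (\<lambda>z. 8 * ((X i (fst z)) ^ 4 + (X i (mix (- {k}) (fst z) (snd z))) ^ 4))"
    using integrable_pair_fst[OF X_integrable_power4] integrable_mix[OF X_integrable_power4] by simp
  show "AE z in P \<Otimes>\<^sub>M P. norm ((resample k (X i) z) ^ 4) \<le> norm (8 * ((X i (fst z)) ^ 4 + (X i (mix (- {k}) (fst z) (snd z))) ^ 4))"
    using power4_sum_le[of "X i (fst z)" "- X i (mix (- {k}) (fst z) (snd z))" for z]
    by (intro AE_I2) (simp add: resample_def)
qed measurable

text \<open>Cauchy-Schwarz applied to the squares: two L4 bounds multiply to an L2 bound.\<close>

lemma square_product_moment:
  fixes f g :: "(int \<Rightarrow> real) \<times> (int \<Rightarrow> real) \<Rightarrow> real"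
  assumes [measurable]: "f \<in> borel_measurable (P \<Otimes>\<^sub>M P)" "g \<in> borel_measurable (P \<Otimes>\<^sub>M P)"
    and f: "integrable (P \<Otimes>\<^sub>M P) (\<lambda>z. (f z) ^ 4)" "(\<integral>z. (f z) ^ 4 \<partial>(P \<Otimes>\<^sub>M P)) \<le> a ^ 4" "0 \<le> a"
    and g: "integrable (P \<Otimes>\<^sub>M P) (\<lambda>z. (g z) ^ 4)" "(\<integral>z. (g z) ^ 4 \<partial>(P \<Otimes>\<^sub>M P)) \<le> b ^ 4" "0 \<le> b"
  shows "integrable (P \<Otimes>\<^sub>M P) (\<lambda>z. (f z * g z)\<^sup>2)" "(\<integral>z. (f z * g z)\<^sup>2 \<partial>(P \<Otimes>\<^sub>M P)) \<le> (a * b)\<^sup>2"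
proof -
  have i_f: "integrable (P \<Otimes>\<^sub>M P) (\<lambda>z. ((f z)\<^sup>2)\<^sup>2)" unfolding power2_power2 by (fact f(1))
  have i_g: "integrable (P \<Otimes>\<^sub>M P) (\<lambda>z. ((g z)\<^sup>2)\<^sup>2)" unfolding power2_power2 by (fact g(1))
  note i = i_f i_g
  have "integrable (P \<Otimes>\<^sub>M P) (\<lambda>z. (f z)\<^sup>2 * (g z)\<^sup>2)"
    by (rule integrable_mult_square[OF _ _ i]) measurable
  then show "integrable (P \<Otimes>\<^sub>M P) (\<lambda>z. (f z * g z)\<^sup>2)" by (simp add: power_mult_distrib)
  have "(\<integral>z. \<bar>(f z)\<^sup>2 * (g z)\<^sup>2\<bar> \<partial>(P \<Otimes>\<^sub>M P)) \<le> a\<^sup>2 * b\<^sup>2"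
    by (rule integral_cauchy_schwarz[OF _ _ i]) (use f(2,3) g(2,3) in \<open>simp_all add: power2_power2\<close>)
  then show "(\<integral>z. (f z * g z)\<^sup>2 \<partial>(P \<Otimes>\<^sub>M P)) \<le> (a * b)\<^sup>2" by (simp add: power_mult_distrib)
qed

text \<open>The innovation at lag l behind i has lag l - j behind i - j; for l < j it lies in the
  future of i - j and has no effect there.\<close>

definition lagged :: "nat \<Rightarrow> nat \<Rightarrow> real" where
  "lagged j l = (if j \<le> l then d (l - j) else 0)"

lemma resample_lagged:
  "(\<integral>z. (resample (i - int l) (X (i - int j)) z) ^ 4 \<partial>(P \<Otimes>\<^sub>M P)) \<le> (lagged j l) ^ 4"
proof (cases "j \<le> l")
  case True
  then have "i - int l = (i - int j) - int (l - j)" by simp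
  then show ?thesis using X_resample[of "i - int j" "l - j"] True by (simp only: lagged_def if_True)
next
  case False
  have "X (i - int j) (mix (- {i - int l}) x y) = X (i - int j) x" for x y
  proof -
    have "\<forall>k\<in>{..i - int j}. mix (- {i - int l}) x y k = x k" using False by (auto simp: mix_def)
    then show ?thesis using X_dep[of "i - int j"] unfolding dep_def by blast
  qed
  then show ?thesis using False by (simp add: lagged_def resample_def)
qed

text \<open>Discrete product rule: the change of X_i X_{i-j} is the change of the first factor times
  the old second one, plus the new first factor times the change of the second. The centring
  cancels.\<close>

lemma cov_resample:
  shows "integrable (P \<Otimes>\<^sub>M P) (\<lambda>z. (resample (i - int l) (cov_summand P X i j) z)\<^sup>2)"
    and "(\<integral>z. (resample (i - int l) (cov_summand P X i j) z)\<^sup>2 \<partial>(P \<Otimes>\<^sub>M P)) \<le> (B * (d l + lagged j l))\<^sup>2"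
proof -
  let ?k = "i - int l"
  let ?u = "\<lambda>z. resample ?k (X i) z * X (i - int j) (fst z)"
  let ?v = "\<lambda>z. X i (mix (- {?k}) (fst z) (snd z)) * resample ?k (X (i - int j)) z"
  have eq: "resample ?k (cov_summand P X i j) z = ?u z + ?v z" for z
    by (simp add: resample_def cov_summand_def algebra_simps)
  have lag: "0 \<le> lagged j l" using d_nonneg by (simp add: lagged_def)
  have B0: "0 \<le> B" using B by linarith
  have a: "(\<integral>z. (X i (mix K (fst z) (snd z))) ^ 4 \<partial>(P \<Otimes>\<^sub>M P)) \<le> B ^ 4" for i K
    using X_power4[of i] integral_mix[of "\<lambda>x. (X i x) ^ 4" K] by simp
  have a': "integrable (P \<Otimes>\<^sub>M P) (\<lambda>z. (X i (mix K (fst z) (snd z))) ^ 4)" for i K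
    by (rule integrable_mix[OF X_integrable_power4])
  have u: "integrable (P \<Otimes>\<^sub>M P) (\<lambda>z. (?u z)\<^sup>2)" "(\<integral>z. (?u z)\<^sup>2 \<partial>(P \<Otimes>\<^sub>M P)) \<le> (d l * B)\<^sup>2"
    using X_resample[of i l] integrable_resample_power4[of ?k i] a[of "i - int j" UNIV] a'[of "i - int j" UNIV] d_nonneg B0
    by (intro square_product_moment[where a="d l" and b=B]; simp)+
  have v: "integrable (P \<Otimes>\<^sub>M P) (\<lambda>z. (?v z)\<^sup>2)" "(\<integral>z. (?v z)\<^sup>2 \<partial>(P \<Otimes>\<^sub>M P)) \<le> (B * lagged j l)\<^sup>2"
    using resample_lagged[of i l j] integrable_resample_power4[of ?k "i - int j"] a[of i "- {?k}"] a'[of i "- {?k}"] lag B0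
    by (intro square_product_moment[where a=B and b="lagged j l"]; simp)+
  have meas: "?u \<in> borel_measurable (P \<Otimes>\<^sub>M P)" "?v \<in> borel_measurable (P \<Otimes>\<^sub>M P)" by measurable
  have pos: "0 \<le> d l * B" "0 \<le> B * lagged j l" using d_nonneg B lag by simp_all
  have e: "(B * (d l + lagged j l))\<^sup>2 = (d l * B + B * lagged j l)\<^sup>2" by (simp add: algebra_simps)
  show "integrable (P \<Otimes>\<^sub>M P) (\<lambda>z. (resample ?k (cov_summand P X i j) z)\<^sup>2)"
    unfolding eq by (rule integral_minkowski(1)[OF meas u(1) v(1) u(2) pos(1) v(2) pos(2)])
  show "(\<integral>z. (resample ?k (cov_summand P X i j) z)\<^sup>2 \<partial>(P \<Otimes>\<^sub>M P)) \<le> (B * (d l + lagged j l))\<^sup>2"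
    unfolding eq e by (rule integral_minkowski(2)[OF meas u(1) v(1) u(2) pos(1) v(2) pos(2)])
qed

lemma lagged_tail:
  assumes "j \<le> n"
  shows "summable (lagged j)" "(\<Sum>k. lagged j (k + n)) \<le> D / (1 + real (n - j))\<^sup>2"
proof -
  have eq: "lagged j (k + n) = d (k + (n - j))" for k using assms by (simp add: lagged_def)
  have "summable (\<lambda>k. lagged j (k + n))" unfolding eq using d_summable by (simp only: summable_iff_shift)
  then show "summable (lagged j)" by (simp only: summable_iff_shift)
  show "(\<Sum>k. lagged j (k + n)) \<le> D / (1 + real (n - j))\<^sup>2" unfolding eq by (rule d_tail)
qed

lemma lagged_total: "(\<Sum>k. lagged j k) \<le> D"
proof -
  have s: "summable (lagged j)" by (rule lagged_tail(1)[of j j]) simp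
  have "(\<Sum>k. lagged j k) = (\<Sum>k. lagged j (k + j)) + (\<Sum>k<j. lagged j k)"
    by (rule suminf_split_initial_segment[OF s])
  also have "(\<Sum>k<j. lagged j k) = 0" by (intro sum.neutral) (simp add: lagged_def)
  finally show ?thesis using lagged_tail(2)[of j j] by simp
qed

text \<open>Treats both statements at once: coefficients 0 and 1 give the autocovariance summands,
  the delta-method coefficients the autocorrelation summands, whose X_i^2 part is the summand at lag
  0.\<close>

definition combined :: "(nat \<Rightarrow> real) \<Rightarrow> (nat \<Rightarrow> real) \<Rightarrow> int \<Rightarrow> nat \<Rightarrow> (int \<Rightarrow> real) \<Rightarrow> real" where
  "combined a b i j x = a j * cov_summand P X i 0 x + b j * cov_summand P X i j x"

text \<open>The summand at lag 0 contributes \<open>d l + lagged 0 l = 2 * d l\<close> and the one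
  at lag j contributes \<open>d l + lagged j l\<close>; this explains the 3.\<close>

definition rate :: "real \<Rightarrow> nat \<Rightarrow> nat \<Rightarrow> real" where
  "rate A j l = A * B * (3 * d l + lagged j l)"

end

locale process_combination = dependent_process \<mu> X B D d
  for \<mu> :: "int \<Rightarrow> real measure" and X B D d +
  fixes a b :: "nat \<Rightarrow> real" and A :: real and J :: "nat set"
  assumes ab: "\<And>j. j \<in> J \<Longrightarrow> \<bar>a j\<bar> \<le> A" "\<And>j. j \<in> J \<Longrightarrow> \<bar>b j\<bar> \<le> A" and A: "1 \<le> A"
begin

lemma combined_measurable[measurable]: "combined a b i j \<in> borel_measurable P"
  unfolding combined_def[abs_def] by measurable

lemma combined_dep: "dep {..i} (combined a b i j)"
  using dep_binop[OF cov_dep[of i 0] cov_dep[of i j], of "\<lambda>u v. a j * u + b j * v"]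
  by (simp only: combined_def[abs_def])

lemma combined_mean: "(\<integral>x. combined a b i j x \<partial>P) = 0"
  using P.integrable_of_power4(1)[OF cov_measurable cov_power4(1)] by (simp add: combined_def cov_mean)

text \<open>The constant is 8 (16 + 16) = 256, plus 1 that is absorbed because A and B are at least
  1.\<close>

lemma combined_power4:
  assumes j: "j \<in> J"
  shows "integrable P (\<lambda>x. (combined a b i j x) ^ 4)" "1 + (\<integral>x. (combined a b i j x) ^ 4 \<partial>P) \<le> 257 * A ^ 4 * B ^ 8"
proof -
  let ?g = "\<lambda>x. 8 * A ^ 4 * ((cov_summand P X i 0 x) ^ 4 + (cov_summand P X i j x) ^ 4)"
  have a4: "a j ^ 4 \<le> A ^ 4" "b j ^ 4 \<le> A ^ 4"
    using power_mono[OF ab(1)[OF j], of 4] power_mono[OF ab(2)[OF j], of 4] by simp_all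
  have le: "(combined a b i j x) ^ 4 \<le> ?g x" for x
  proof -
    have "(combined a b i j x) ^ 4 \<le> 8 * ((a j * cov_summand P X i 0 x) ^ 4 + (b j * cov_summand P X i j x) ^ 4)"
      unfolding combined_def by (rule power4_sum_le)
    also have "\<dots> \<le> 8 * (A ^ 4 * (cov_summand P X i 0 x) ^ 4 + A ^ 4 * (cov_summand P X i j x) ^ 4)"
      unfolding power_mult_distrib using a4 by (intro mult_left_mono add_mono mult_right_mono) auto
    finally show ?thesis by (simp add: algebra_simps)
  qed
  have g: "integrable P ?g" using cov_power4(1) by simp
  show i: "integrable P (\<lambda>x. (combined a b i j x) ^ 4)"
    by (rule Bochner_Integration.integrable_bound[OF g]) (use le in \<open>auto intro!: order_trans[OF le abs_ge_self]\<close>)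
  have "(\<integral>x. (combined a b i j x) ^ 4 \<partial>P) \<le> (\<integral>x. ?g x \<partial>P)"
    by (rule integral_mono[OF i g le])
  also have "\<dots> = 8 * A ^ 4 * ((\<integral>x. (cov_summand P X i 0 x) ^ 4 \<partial>P) + (\<integral>x. (cov_summand P X i j x) ^ 4 \<partial>P))"
    using cov_power4(1) by simp
  also have "\<dots> \<le> 8 * A ^ 4 * (16 * B ^ 8 + 16 * B ^ 8)"
    using A by (intro mult_left_mono add_mono cov_power4(2)) auto
  finally have "(\<integral>x. (combined a b i j x) ^ 4 \<partial>P) \<le> 256 * (A ^ 4 * B ^ 8)" by simp
  moreover have "1 * 1 \<le> A ^ 4 * B ^ 8" using A B by (intro mult_mono) auto
  ultimately show "1 + (\<integral>x. (combined a b i j x) ^ 4 \<partial>P) \<le> 257 * A ^ 4 * B ^ 8" by simp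
qed

lemma combined_resample:
  assumes j: "j \<in> J"
  shows "(\<integral>z. (resample (i - int l) (combined a b i j) z)\<^sup>2 \<partial>(P \<Otimes>\<^sub>M P)) \<le> (rate A j l)\<^sup>2"
proof -
  let ?u = "resample (i - int l) (cov_summand P X i 0)" and ?v = "resample (i - int l) (cov_summand P X i j)"
  have eq: "resample (i - int l) (combined a b i j) z = a j * ?u z + b j * ?v z" for z
    by (simp add: resample_def combined_def algebra_simps)
  have sc: "integrable (P \<Otimes>\<^sub>M P) (\<lambda>z. (s * w z)\<^sup>2)" "(\<integral>z. (s * w z)\<^sup>2 \<partial>(P \<Otimes>\<^sub>M P)) \<le> (A * q)\<^sup>2"
    if w: "integrable (P \<Otimes>\<^sub>M P) (\<lambda>z. (w z)\<^sup>2)" "(\<integral>z. (w z)\<^sup>2 \<partial>(P \<Otimes>\<^sub>M P)) \<le> q\<^sup>2" and s: "\<bar>s\<bar> \<le> A" for s w q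
  proof -
    show "integrable (P \<Otimes>\<^sub>M P) (\<lambda>z. (s * w z)\<^sup>2)" using w by (simp add: power_mult_distrib)
    have "s\<^sup>2 \<le> A\<^sup>2" using power_mono[OF s, of 2] by simp
    then have "s\<^sup>2 * (\<integral>z. (w z)\<^sup>2 \<partial>(P \<Otimes>\<^sub>M P)) \<le> A\<^sup>2 * q\<^sup>2"
      using w(2) by (intro mult_mono integral_nonneg_AE) auto
    then show "(\<integral>z. (s * w z)\<^sup>2 \<partial>(P \<Otimes>\<^sub>M P)) \<le> (A * q)\<^sup>2" by (simp add: power_mult_distrib)
  qed
  have lag: "0 \<le> lagged j l" for j using d_nonneg by (simp add: lagged_def)
  have pos: "0 \<le> A * (B * (d l + lagged j l))" for j using A B lag d_nonneg by simp
  have "(\<integral>z. (a j * ?u z + b j * ?v z)\<^sup>2 \<partial>(P \<Otimes>\<^sub>M P)) \<le> (A * (B * (d l + lagged 0 l)) + A * (B * (d l + lagged j l)))\<^sup>2"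
    by (rule integral_minkowski(2)[OF _ _ sc(1)[OF cov_resample ab(1)[OF j]] sc(1)[OF cov_resample ab(2)[OF j]]
          sc(2)[OF cov_resample ab(1)[OF j]] pos sc(2)[OF cov_resample ab(2)[OF j]] pos]) measurable
  also have "A * (B * (d l + lagged 0 l)) + A * (B * (d l + lagged j l)) = rate A j l"
    by (simp add: rate_def lagged_def algebra_simps)
  finally show ?thesis by (simp only: eq)
qed

lemma rate_nonneg: "0 \<le> rate A j l"
  using A B d_nonneg by (simp add: rate_def lagged_def)

lemma rate_summable: "summable (rate A j)"
  unfolding rate_def[abs_def] using d_summable lagged_tail(1)[of j j] by (intro summable_mult summable_add) auto

text \<open>The slowest tail is that of the lagged factor, which starts j lags late; the three other
  shares are weakened to it.\<close>

lemma rate_tail: "(\<Sum>k. rate A j (k + n)) \<le> 4 * A * B * D / (1 + real (n - j))\<^sup>2" if "j \<le> n"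
proof -
  have s: "summable (\<lambda>k. d (k + n))" "summable (\<lambda>k. lagged j (k + n))"
    using d_summable lagged_tail(1)[OF that] by (simp_all only: summable_iff_shift)
  have "(\<Sum>k. rate A j (k + n)) = A * B * (3 * (\<Sum>k. d (k + n)) + (\<Sum>k. lagged j (k + n)))"
    unfolding rate_def using s by (simp add: suminf_mult suminf_add summable_mult summable_add flip: suminf_mult)
  also have "\<dots> \<le> A * B * (3 * (D / (1 + real (n - j))\<^sup>2) + D / (1 + real (n - j))\<^sup>2)"
  proof (intro mult_left_mono add_mono lagged_tail(2)[OF that])
    have "D / (1 + real n)\<^sup>2 \<le> D / (1 + real (n - j))\<^sup>2"
      using D by (intro divide_left_mono power_mono mult_pos_pos zero_less_power) auto
    then show "(\<Sum>k. d (k + n)) \<le> D / (1 + real (n - j))\<^sup>2" using d_tail[of n] by linarith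
  qed (use A B in auto)
  finally show ?thesis by (simp add: field_simps)
qed

lemma rate_total: "(\<Sum>k. rate A j k) \<le> 4 * A * B * D"
proof -
  have s: "summable (lagged j)" by (rule lagged_tail(1)[of j j]) simp
  have "(\<Sum>k. rate A j k) = A * B * (3 * (\<Sum>k. d k) + (\<Sum>k. lagged j k))"
    unfolding rate_def using s d_summable by (simp add: suminf_mult suminf_add summable_mult summable_add flip: suminf_mult)
  also have "\<dots> \<le> A * B * (3 * D + D)"
    using A B d_tail[of 0] lagged_total[of j] by (intro mult_left_mono add_mono) auto
  finally show ?thesis by (simp add: algebra_simps)
qed

end

text \<open>p is the number of lags, n the sample size, l the truncation lag, Q the moment constant,
  R and r bound total and tail of the resampling rates, t and b are width and slope of the
  smoothing, c is the floor for the deviations. The summands stand for truncation, Gaussian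
  comparison, smoothing and anti-concentration.\<close>

definition err_bound :: "real \<Rightarrow> real \<Rightarrow> real \<Rightarrow> real \<Rightarrow> real \<Rightarrow> real \<Rightarrow> real \<Rightarrow> real \<Rightarrow> real \<Rightarrow> real" where
  "err_bound p n l Q R r t b c = p * (r\<^sup>2 / t\<^sup>2)
    + 2 * (2 * n * (8 * b) ^ 3 * (4 * l * p * (Q / sqrt n)) ^ 3 + (8 * b)\<^sup>2 * (p\<^sup>2 * (3 * r * R)))
    + 3 * p * exp (- (b * (2 * t))) + 2 * p * (3 * (2 * t)) / c"

context process_combination
begin

text \<open>The tail at lag j effectively starts at L - j; it is replaced by the worst case L - dd,
  common to all lags in J.\<close>

lemma combined_fixed_sample_bound:
  fixes \<xi> :: "nat \<Rightarrow> 'b \<Rightarrow> real" and W :: "nat \<Rightarrow> (int \<Rightarrow> real) \<Rightarrow> real"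
  assumes T: "0 < T" and J: "finite J" "J \<noteq> {}" "J \<subseteq> {0..dd}" and L: "0 < L" "dd \<le> L"
    and cg: "centered_gaussian N J \<xi> (scaled_sum_cov P T (combined a b))"
    and c: "0 < c" "\<And>j. j \<in> J \<Longrightarrow> c\<^sup>2 \<le> (\<integral>x. (scaled_sum T (combined a b) j x)\<^sup>2 \<partial>P)"
    and W: "\<And>j. j \<in> J \<Longrightarrow> W j \<in> borel_measurable P"
    and close: "measure P {x \<in> space P. \<exists>j\<in>J. t < \<bar>W j x - scaled_sum T (combined a b) j x\<bar>} \<le> \<eta>"
    and t: "0 < t" and h: "0 \<le> h"
  shows "\<bar>measure P {x \<in> space P. \<forall>j\<in>J. \<bar>W j x\<bar> \<le> y} - measure N {\<omega> \<in> space N. \<forall>j\<in>J. \<bar>\<xi> j \<omega>\<bar> \<le> y}\<bar>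
    \<le> \<eta> + err_bound (real (card J)) (real T) (real L) (257 * A ^ 4 * B ^ 8) (4 * A * B * D)
        (4 * A * B * D / (1 + real (L - dd))\<^sup>2) t h c"
proof -
  have pos: "0 \<le> 4 * A * B * D" using A B D by simp
  have rt: "(\<Sum>k. rate A j (k + L)) \<le> 4 * A * B * D / (1 + real (L - dd))\<^sup>2" if j: "j \<in> J" for j
  proof -
    have "j \<le> dd" using j J by auto
    then have jL: "j \<le> L" "real (L - dd) \<le> real (L - j)" using L by auto
    have "4 * A * B * D / (1 + real (L - j))\<^sup>2 \<le> 4 * A * B * D / (1 + real (L - dd))\<^sup>2"
      using pos jL by (intro divide_left_mono power_mono mult_pos_pos zero_less_power) auto
    with rate_tail[OF jL(1)] show ?thesis by linarith
  qed
  have le: "4 * A * B * D / (1 + real (L - dd))\<^sup>2 \<le> 4 * A * B * D"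
  proof -
    have "1 \<le> (1 + real (L - dd))\<^sup>2" by (rule one_le_power) simp
    then have "4 * A * B * D / (1 + real (L - dd))\<^sup>2 \<le> 4 * A * B * D / 1"
      using pos by (intro divide_left_mono) auto
    then show ?thesis by simp
  qed
  have var: "c\<^sup>2 \<le> scaled_sum_cov P T (combined a b) j j" if j: "j \<in> J" for j
  proof -
    have "scaled_sum_cov P T (combined a b) j j = (\<integral>x. scaled_sum T (combined a b) j x * scaled_sum T (combined a b) j x \<partial>P)"
      by (rule scaled_sum_cov_eq[where J=J and \<delta>="rate A" and C="257 * A ^ 4 * B ^ 8" and ?r0.0="4 * A * B * D"];
          (fact T J j)?; (rule combined_measurable combined_dep combined_mean combined_power4 combined_resample
            rate_nonneg rate_summable rate_total; assumption?)?)
    then show ?thesis using c(2)[OF j] by (simp add: power2_eq_square)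
  qed
  have "\<bar>measure P {x \<in> space P. \<forall>j\<in>J. \<bar>W j x\<bar> \<le> y} - measure N {\<omega> \<in> space N. \<forall>j\<in>J. \<bar>\<xi> j \<omega>\<bar> \<le> y}\<bar>
    \<le> (\<eta> + real (card J) * ((4 * A * B * D / (1 + real (L - dd))\<^sup>2)\<^sup>2 / t\<^sup>2))
      + 2 * (2 * real T * (8 * h) ^ 3 * (real (4 * L * card J) * ((257 * A ^ 4 * B ^ 8) / sqrt (real T))) ^ 3
          + (8 * h)\<^sup>2 * ((real (card J))\<^sup>2 * (3 * (4 * A * B * D / (1 + real (L - dd))\<^sup>2) * (4 * A * B * D))))
      + 3 * real (card J) * exp (- (h * (2 * t))) + 2 * real (card J) * (3 * (2 * t)) / c"
    by (rule fixed_sample_bound[where Z="combined a b" and \<delta>="rate A"];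
        (fact T J W close L t h c(1) cg le)?; (rule combined_measurable combined_dep combined_mean combined_power4 combined_resample
          rate_nonneg rate_summable rate_total rt var; assumption?)?)
  then show ?thesis by (simp add: err_bound_def mult.assoc)
qed

end

section \<open>Sample autocovariances and autocorrelations at a fixed sample size\<close>

context dependent_process
begin

lemma cov_combined: "combined (\<lambda>_. 0) (\<lambda>_. 1) = cov_summand P X"
  by (simp add: combined_def fun_eq_iff)

lemma corr_combined: "combined (\<lambda>j. - (autocov P X j / (autocov P X 0)\<^sup>2)) (\<lambda>_. 1 / autocov P X 0) = corr_summand P X"
  by (simp add: combined_def corr_summand_def cov_summand_def fun_eq_iff power2_eq_square)

definition w :: "nat \<Rightarrow> nat \<Rightarrow> (int \<Rightarrow> real) \<Rightarrow> real" where
  "w T j x = sqrt (real T) * (sample_autocov T X j x - autocov P X j)"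

abbreviation S :: "nat \<Rightarrow> nat \<Rightarrow> (int \<Rightarrow> real) \<Rightarrow> real" where
  "S T j \<equiv> scaled_sum T (cov_summand P X) j"

lemma w_measurable[measurable]: "w T j \<in> borel_measurable P"
  unfolding w_def[abs_def] sample_autocov_def[abs_def] by measurable

lemma S_measurable[measurable]: "S T j \<in> borel_measurable P"
  unfolding scaled_sum_def[abs_def] by measurable

text \<open>The sample autocovariance sums from j + 1 on but divides by T, so against the full sum
  it lacks exactly the first j products, while the centring terms agree.\<close>

lemma w_remainder:
  assumes "0 < T" "j \<le> T"
  shows "w T j x - S T j x = - (1 / sqrt (real T) * (\<Sum>i\<in>{1..int j}. X i x * X (i - int j) x))"
proof -
  have un: "{1..int T} = {1..int j} \<union> {int j + 1..int T}" using assms by auto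
  have "(\<Sum>i\<in>{1..int T}. X i x * X (i - int j) x) = (\<Sum>i\<in>{1..int j}. X i x * X (i - int j) x) + (\<Sum>i\<in>{int j + 1..int T}. X i x * X (i - int j) x)"
    unfolding un by (rule sum.union_disjoint) auto
  then have "S T j x = 1 / sqrt (real T) * ((\<Sum>i\<in>{1..int j}. X i x * X (i - int j) x) + (\<Sum>i\<in>{int j + 1..int T}. X i x * X (i - int j) x) - real T * autocov P X j)"
    by (simp add: scaled_sum_def cov_summand_def sum_subtractf)
  moreover have "w T j x = 1 / sqrt (real T) * ((\<Sum>i\<in>{int j + 1..int T}. X i x * X (i - int j) x) - real T * autocov P X j)"
  proof -
    have "sqrt (real T) * (1 / real T) = 1 / sqrt (real T)" "sqrt (real T) = 1 / sqrt (real T) * real T"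
      using assms by (simp_all add: real_div_sqrt field_simps)
    then show ?thesis
      unfolding w_def sample_autocov_def by (metis (no_types, lifting) mult.assoc right_diff_distrib)
  qed
  ultimately show ?thesis by (simp add: algebra_simps)
qed

text \<open>At most dd products, each of mean modulus at most \<open>B\<^sup>2\<close>: Markov's
  inequality and a union bound over J.\<close>

lemma w_remainder_prob:
  assumes T: "0 < T" and J: "finite J" "J \<subseteq> {0..dd}" "dd \<le> T" and s: "0 < s"
  shows "measure P {x \<in> space P. \<exists>j\<in>J. s < \<bar>w T j x - S T j x\<bar>} \<le> real (card J) * (real dd * B\<^sup>2 / (sqrt (real T) * s))"
proof -
  have one: "measure P {x \<in> space P. s < \<bar>w T j x - S T j x\<bar>} \<le> real dd * B\<^sup>2 / (sqrt (real T) * s)" if j: "j \<in> J" for j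
  proof -
    have jd: "j \<le> dd" "j \<le> T" using j J by auto
    let ?R = "\<lambda>x. 1 / sqrt (real T) * (\<Sum>i\<in>{1..int j}. \<bar>X i x * X (i - int j) x\<bar>)"
    have R: "integrable P ?R" using X_product(1) by (intro integrable_mult_right Bochner_Integration.integrable_sum integrable_abs) auto
    have le: "\<bar>w T j x - S T j x\<bar> \<le> ?R x" for x
      unfolding w_remainder[OF T jd(2)] abs_minus_cancel abs_mult using T
      by (simp add: divide_right_mono sum_abs abs_mult[symmetric] del: abs_mult)
    have "measure P {x \<in> space P. s < \<bar>w T j x - S T j x\<bar>} \<le> measure P {x \<in> space P. s \<le> ?R x}"
    proof (rule P.finite_measure_mono)
      show "{x \<in> space P. s < \<bar>w T j x - S T j x\<bar>} \<subseteq> {x \<in> space P. s \<le> ?R x}"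
      proof (intro subsetI CollectI conjI)
        fix x assume "x \<in> {x \<in> space P. s < \<bar>w T j x - S T j x\<bar>}"
        then have "s < \<bar>w T j x - S T j x\<bar>" by simp
        then show "s \<le> ?R x" using le[of x] by linarith
      qed simp
    qed measurable
    also have "\<dots> \<le> (\<integral>x. ?R x \<partial>P) / s"
      by (rule integral_Markov_inequality_measure[OF R, where A="{}"]) (use s T in \<open>auto intro!: sum_nonneg divide_nonneg_nonneg\<close>)
    also have "(\<integral>x. ?R x \<partial>P) = 1 / sqrt (real T) * (\<Sum>i\<in>{1..int j}. \<integral>x. \<bar>X i x * X (i - int j) x\<bar> \<partial>P)"
      by (subst integral_mult_right_zero, subst Bochner_Integration.integral_sum) (auto intro!: integrable_abs X_product(1))
    also have "\<dots> \<le> 1 / sqrt (real T) * (\<Sum>i\<in>{1..int j}. B\<^sup>2)"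
      by (intro mult_left_mono sum_mono X_product(2)) simp
    also have "\<dots> \<le> 1 / sqrt (real T) * (real dd * B\<^sup>2)"
      using jd by (intro mult_left_mono) (auto intro!: mult_right_mono)
    finally show ?thesis using s by (simp add: divide_right_mono field_simps)
  qed
  have "measure P {x \<in> space P. \<exists>j\<in>J. s < \<bar>w T j x - S T j x\<bar>} = measure P (\<Union>j\<in>J. {x \<in> space P. s < \<bar>w T j x - S T j x\<bar>})"
    by (rule arg_cong[where f="measure P"]) auto
  also have "\<dots> \<le> (\<Sum>j\<in>J. measure P {x \<in> space P. s < \<bar>w T j x - S T j x\<bar>})"
    by (rule P.finite_measure_subadditive_finite[OF J(1)], rule image_subsetI, measurable)
  also have "\<dots> \<le> (\<Sum>j\<in>J. real dd * B\<^sup>2 / (sqrt (real T) * s))" by (intro sum_mono one)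
  finally show ?thesis by simp
qed

lemma cov_combination: "process_combination \<mu> X B D d (\<lambda>_. 0) (\<lambda>_. 1) 1 J"
  by unfold_locales auto

theorem autocov_fixed_sample:
  fixes \<xi> :: "nat \<Rightarrow> 'b \<Rightarrow> real"
  assumes T: "0 < T" and J: "finite J" "J \<noteq> {}" "J \<subseteq> {0..dd}" and L: "0 < L" "dd \<le> L" "dd \<le> T"
    and cg: "centered_gaussian N J \<xi> (scaled_sum_cov P T (cov_summand P X))"
    and c: "0 < c" "\<And>j. j \<in> J \<Longrightarrow> c\<^sup>2 \<le> (\<integral>x. (S T j x)\<^sup>2 \<partial>P)" and t: "0 < t" and h: "0 \<le> h"
  shows "\<bar>measure P {x \<in> space P. \<forall>j\<in>J. \<bar>w T j x\<bar> \<le> y} - measure N {\<omega> \<in> space N. \<forall>j\<in>J. \<bar>\<xi> j \<omega>\<bar> \<le> y}\<bar>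
    \<le> real (card J) * (real dd * B\<^sup>2 / (sqrt (real T) * t)) + err_bound (real (card J)) (real T) (real L) (257 * 1 ^ 4 * B ^ 8) (4 * 1 * B * D)
        (4 * 1 * B * D / (1 + real (L - dd))\<^sup>2) t h c"
proof -
  interpret C: process_combination \<mu> X B D d "\<lambda>_. 0" "\<lambda>_. 1" 1 J by (rule cov_combination)
  show ?thesis
    by (rule C.combined_fixed_sample_bound[unfolded cov_combined, OF T J L(1,2) cg c w_measurable w_remainder_prob[OF T J(1,3) L(3) t] t h])
qed

lemma S_tail:
  assumes T: "0 < T" and k: "0 < k"
  shows "measure P {x \<in> space P. k < \<bar>S T j x\<bar>} \<le> (4 * B * D)\<^sup>2 / k\<^sup>2"
proof -
  interpret C: process_combination \<mu> X B D d "\<lambda>_. 0" "\<lambda>_. 1" 1 "{j}" by (rule cov_combination)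
  have "integrable P (\<lambda>x. (scaled_sum T (combined (\<lambda>_. 0) (\<lambda>_. 1)) j x)\<^sup>2)"
    by (rule scaled_sum_second_moment[where J="{j}" and \<delta>="rate 1" and C="257 * 1 ^ 4 * B ^ 8" and ?r0.0="4 * 1 * B * D"];
        (fact T finite.emptyI[THEN finite.insertI] insert_not_empty singletonI)?;
        (rule C.combined_measurable C.combined_dep C.combined_mean C.combined_power4 C.combined_resample
          C.rate_nonneg C.rate_summable C.rate_total; assumption?)?)
  moreover have "(\<integral>x. (scaled_sum T (combined (\<lambda>_. 0) (\<lambda>_. 1)) j x)\<^sup>2 \<partial>P) \<le> (4 * 1 * B * D)\<^sup>2"
    by (rule scaled_sum_second_moment[where J="{j}" and \<delta>="rate 1" and C="257 * 1 ^ 4 * B ^ 8" and ?r0.0="4 * 1 * B * D"];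
        (fact T finite.emptyI[THEN finite.insertI] insert_not_empty singletonI)?;
        (rule C.combined_measurable C.combined_dep C.combined_mean C.combined_power4 C.combined_resample
          C.rate_nonneg C.rate_summable C.rate_total; assumption?)?)
  ultimately show ?thesis
    using P.chebyshev_square[of "S T j" "(4 * B * D)\<^sup>2" k] k by (simp add: cov_combined)
qed

definition rho_dev :: "nat \<Rightarrow> nat \<Rightarrow> (int \<Rightarrow> real) \<Rightarrow> real" where
  "rho_dev T j x = sqrt (real T) * (sample_autocorr T X j x - autocorr P X j)"

lemma rho_dev_measurable[measurable]: "rho_dev T j \<in> borel_measurable P"
  unfolding rho_dev_def[abs_def] sample_autocorr_def[abs_def] sample_autocov_def[abs_def] by measurable

text \<open>Here p and q stand for the autocovariances at lags 0 and j, and n for sqrt T. With the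
  perturbed denominator r the error is exactly - (p v - q u) u / (n p^2 r). The numerator is at most
  3 K k^2, and r >= c / 2 doubles the constant to 6.\<close>

lemma ratio_linearization:
  fixes p q u v n :: real
  assumes c: "0 < c" "c < p" and pq: "p \<le> K" "\<bar>q\<bar> \<le> K" and n: "0 < n"
    and u: "\<bar>u\<bar> \<le> k" and v: "\<bar>v\<bar> \<le> 2 * k" and small: "k / n \<le> c / 2"
  shows "\<bar>n * ((q + v / n) / (p + u / n) - q / p) - (- (q / p\<^sup>2) * u + 1 / p * v)\<bar> \<le> 6 * K * k\<^sup>2 / (n * c ^ 3)"
proof -
  define r where "r = p + u / n"
  have k: "0 \<le> k" using u by linarith
  have p: "0 < p" using c by linarith
  have "\<bar>u / n\<bar> \<le> k / n" using u n by (simp add: divide_right_mono)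
  then have r: "c / 2 \<le> r" "0 < r" using small c unfolding r_def by linarith+
  have ur: "u = n * (r - p)" using n by (simp add: r_def)
  have eq: "n * ((q + v / n) / r - q / p) - (- (q / p\<^sup>2) * u + 1 / p * v) = - ((p * v - q * u) * u / (n * p\<^sup>2 * r))"
  proof -
    have "n * ((q + v / n) / r - q / p) = (p * v - q * u) / (p * r)"
      using n p r by (simp add: ur field_simps)
    moreover have "- (q / p\<^sup>2) * u + 1 / p * v = (p * v - q * u) / p\<^sup>2"
      using p by (simp add: field_simps power2_eq_square)
    moreover have "(p * v - q * u) / (p * r) - (p * v - q * u) / p\<^sup>2 = (p * v - q * u) * ((p - r) / (p\<^sup>2 * r))"
      using p r by (simp add: field_simps power2_eq_square)
    moreover have "(p - r) / (p\<^sup>2 * r) = - (u / (n * p\<^sup>2 * r))"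
      using n p r by (simp add: ur field_simps)
    ultimately show ?thesis by simp
  qed
  have num: "\<bar>(p * v - q * u) * u\<bar> \<le> (3 * K * k) * k"
  proof (rule abs_mult_le_bounds[OF _ u])
    have "\<bar>p * v\<bar> \<le> K * (2 * k)" using p pq by (intro abs_mult_le_bounds v) auto
    moreover have "\<bar>q * u\<bar> \<le> K * k" by (rule abs_mult_le_bounds[OF pq(2) u])
    ultimately show "\<bar>p * v - q * u\<bar> \<le> 3 * K * k" by linarith
  qed
  have den: "n * c\<^sup>2 * (c / 2) \<le> n * p\<^sup>2 * r"
    using c p r n by (intro mult_mono power_mono) auto
  have "\<bar>- ((p * v - q * u) * u / (n * p\<^sup>2 * r))\<bar> = \<bar>(p * v - q * u) * u\<bar> / (n * p\<^sup>2 * r)"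
    using n p r by (simp add: abs_mult)
  also have "\<dots> \<le> (3 * K * k) * k / (n * c\<^sup>2 * (c / 2))"
    using n c num den by (intro frac_le) auto
  also have "\<dots> = 6 * K * k\<^sup>2 / (n * c ^ 3)"
    using n c by (simp add: field_simps power2_eq_square power3_eq_cube)
  finally show ?thesis unfolding r_def[symmetric] eq .
qed

text \<open>Off an exceptional event the edge remainder is at most s and the normalised sums at lags
  0 and j are at most k; then w at lag j is at most s + k <= 2 k and the linearisation applies. Lag
  0 may lie outside J, hence \<open>card J + 1\<close>. The last summand of A secures A >=
  1.\<close>

theorem autocorr_fixed_sample:
  fixes \<xi> :: "nat \<Rightarrow> 'b \<Rightarrow> real"
  assumes T: "0 < T" and J: "finite J" "J \<noteq> {}" "J \<subseteq> {0..dd}" and L: "0 < L" "dd \<le> L" "dd \<le> T"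
    and cg: "centered_gaussian N J \<xi> (scaled_sum_cov P T (corr_summand P X))"
    and c: "0 < c" "c < autocov P X 0" "\<And>j. j \<in> J \<Longrightarrow> c\<^sup>2 \<le> (\<integral>x. (scaled_sum T (corr_summand P X) j x)\<^sup>2 \<partial>P)"
    and s: "0 < s" "s \<le> k" and small: "k / sqrt (real T) \<le> c / 2"
    and t: "s / c + 6 * B\<^sup>2 * k\<^sup>2 / (sqrt (real T) * c ^ 3) \<le> t" and h: "0 \<le> h"
  defines "A \<equiv> B\<^sup>2 / c\<^sup>2 + 1 / c + 1"
  shows "\<bar>measure P {x \<in> space P. \<forall>j\<in>J. \<bar>rho_dev T j x\<bar> \<le> y} - measure N {\<omega> \<in> space N. \<forall>j\<in>J. \<bar>\<xi> j \<omega>\<bar> \<le> y}\<bar>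
    \<le> (real (card J) * (real dd * B\<^sup>2 / (sqrt (real T) * s)) + (real (card J) + 1) * ((4 * B * D)\<^sup>2 / k\<^sup>2))
      + err_bound (real (card J)) (real T) (real L) (257 * A ^ 4 * B ^ 8) (4 * A * B * D)
        (4 * A * B * D / (1 + real (L - dd))\<^sup>2) t h c"
proof -
  let ?p = "autocov P X 0" and ?n = "sqrt (real T)"
  have n: "0 < ?n" using T by simp
  have p: "0 < ?p" using c by linarith
  have cp: "c\<^sup>2 \<le> ?p\<^sup>2" using c by (intro power_mono) auto
  interpret C: process_combination \<mu> X B D d "\<lambda>j. - (autocov P X j / ?p\<^sup>2)" "\<lambda>_. 1 / ?p" A J
  proof unfold_locales
    have nn: "0 \<le> B\<^sup>2 / c\<^sup>2" "0 \<le> 1 / c" using c by auto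
    show "1 \<le> A" using nn by (simp add: A_def)
    fix j
    have "\<bar>autocov P X j\<bar> / ?p\<^sup>2 \<le> B\<^sup>2 / c\<^sup>2"
      using autocov_bound[of j] cp c by (intro frac_le) auto
    moreover have "\<bar>- (autocov P X j / ?p\<^sup>2)\<bar> = \<bar>autocov P X j\<bar> / ?p\<^sup>2" by simp
    ultimately show "\<bar>- (autocov P X j / ?p\<^sup>2)\<bar> \<le> A" using nn unfolding A_def by linarith
    have "1 / ?p \<le> 1 / c" using c by (intro frac_le) auto
    moreover have "\<bar>1 / ?p\<bar> = 1 / ?p" using p by simp
    ultimately show "\<bar>1 / ?p\<bar> \<le> A" using nn unfolding A_def by linarith
  qed
  let ?R = "\<lambda>j. scaled_sum T (corr_summand P X) j"
  have R: "?R j x = - (autocov P X j / ?p\<^sup>2) * S T 0 x + 1 / ?p * S T j x" for j x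
    unfolding scaled_sum_def corr_combined[symmetric] combined_def
    by (simp only: sum.distrib sum_distrib_left[symmetric]) (simp add: algebra_simps)
  \<comment> \<open>At lag 0 no product is missing, so the denominator has no edge
    remainder.\<close>
  have rem0: "w T 0 x = S T 0 x" for x using w_remainder[OF T, of 0 x] by simp
  have dev: "\<bar>rho_dev T j x - ?R j x\<bar> \<le> t"
    if j: "\<bar>w T j x - S T j x\<bar> \<le> s" and S: "\<bar>S T 0 x\<bar> \<le> k" "\<bar>S T j x\<bar> \<le> k" for j x
  proof -
    have sc: "sample_autocov T X j x = autocov P X j + w T j x / ?n" for j
      using n by (simp add: w_def)
    have "\<bar>w T j x\<bar> \<le> 2 * k" using j S(2) s by linarith
    from ratio_linearization[OF c(1,2) _ autocov_bound[of j] n _ this small, of "w T 0 x"]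
    have 1: "\<bar>rho_dev T j x - (- (autocov P X j / ?p\<^sup>2) * w T 0 x + 1 / ?p * w T j x)\<bar> \<le> 6 * B\<^sup>2 * k\<^sup>2 / (?n * c ^ 3)"
      using autocov_bound[of 0] S(1) unfolding rho_dev_def sample_autocorr_def autocorr_def sc rem0 by simp
    have "(- (autocov P X j / ?p\<^sup>2) * w T 0 x + 1 / ?p * w T j x) - ?R j x = (w T j x - S T j x) / ?p"
      unfolding R rem0 by (simp add: diff_divide_distrib)
    moreover have "\<bar>(w T j x - S T j x) / ?p\<bar> \<le> s / c"
      using j c p s by (simp add: frac_le)
    ultimately show ?thesis using 1 t by linarith
  qed
  have tpos: "0 < t"
  proof -
    have "0 < s / c" using s c by simp
    moreover have "0 \<le> 6 * B\<^sup>2 * k\<^sup>2 / (?n * c ^ 3)" using n c by (intro divide_nonneg_nonneg mult_nonneg_nonneg) auto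
    ultimately show ?thesis using t by linarith
  qed
  have close: "measure P {x \<in> space P. \<exists>j\<in>J. t < \<bar>rho_dev T j x - ?R j x\<bar>}
      \<le> real (card J) * (real dd * B\<^sup>2 / (?n * s)) + (real (card J) + 1) * ((4 * B * D)\<^sup>2 / k\<^sup>2)"
  proof -
    let ?A = "{x \<in> space P. \<exists>j\<in>J. s < \<bar>w T j x - S T j x\<bar>}"
    let ?B = "\<lambda>j. {x \<in> space P. k < \<bar>S T j x\<bar>}"
    have k: "0 < k" using s by linarith
    have A: "?A \<in> sets P" using J by measurable
    have B1: "?B j \<in> sets P" for j by measurable
    have Bm: "(\<Union>j\<in>insert 0 J. ?B j) \<in> sets P" using J(1) B1 by (intro sets.finite_UN) simp_all
    have "measure P {x \<in> space P. \<exists>j\<in>J. t < \<bar>rho_dev T j x - ?R j x\<bar>} \<le> measure P (?A \<union> (\<Union>j\<in>insert 0 J. ?B j))"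
    proof (rule P.finite_measure_mono)
      show "{x \<in> space P. \<exists>j\<in>J. t < \<bar>rho_dev T j x - ?R j x\<bar>} \<subseteq> ?A \<union> (\<Union>j\<in>insert 0 J. ?B j)"
      proof
        fix x assume "x \<in> {x \<in> space P. \<exists>j\<in>J. t < \<bar>rho_dev T j x - ?R j x\<bar>}"
        then obtain j where j: "j \<in> J" "t < \<bar>rho_dev T j x - ?R j x\<bar>" by auto
        then have "s < \<bar>w T j x - S T j x\<bar> \<or> k < \<bar>S T 0 x\<bar> \<or> k < \<bar>S T j x\<bar>"
          using dev[of j x] by linarith
        then show "x \<in> ?A \<union> (\<Union>j\<in>insert 0 J. ?B j)" using j by auto
      qed
    qed (use A Bm in auto)
    also have "\<dots> \<le> measure P ?A + measure P (\<Union>j\<in>insert 0 J. ?B j)" by (rule measure_Un_le[OF A Bm])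
    also have "measure P (\<Union>j\<in>insert 0 J. ?B j) \<le> (\<Sum>j\<in>insert 0 J. measure P (?B j))"
      using J(1) B1 by (intro P.finite_measure_subadditive_finite image_subsetI) simp_all
    also have "\<dots> \<le> (\<Sum>j\<in>insert 0 J. (4 * B * D)\<^sup>2 / k\<^sup>2)" by (intro sum_mono S_tail T k)
    also have "\<dots> = real (card (insert 0 J)) * ((4 * B * D)\<^sup>2 / k\<^sup>2)" by simp
    also have "\<dots> \<le> (real (card J) + 1) * ((4 * B * D)\<^sup>2 / k\<^sup>2)"
      using J by (intro mult_right_mono) (auto simp: card_insert_if)
    finally show ?thesis using w_remainder_prob[OF T J(1,3) L(3) s(1)] by simp
  qed
  show ?thesis
    by (rule C.combined_fixed_sample_bound[unfolded corr_combined, OF T J L(1,2) cg c(1,3) rho_dev_measurable close tpos h])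
qed

end

subsection \<open>Transfer to causal representations\<close>

text \<open>Weighted AM-GM for u^m and 1 with weights q / m and 1 - q / m: a linear form of
  Lyapunov's inequality, ready for integration.\<close>

lemma power_le_powr_combination:
  fixes u m :: real
  assumes u: "0 \<le> u" and q: "0 < q" "real q \<le> m"
  shows "u ^ q \<le> real q / m * u powr m + (1 - real q / m)"
proof (cases "u = 0")
  case True
  have "real q / m \<le> 1" using q by simp
  with True show ?thesis using q by (simp add: power_0_left)
next
  case False
  then have u': "0 < u" using u by simp
  have m: "0 < m" using q by linarith
  have "(u powr m) powr (real q / m) * 1 powr (1 - real q / m) \<le> real q / m * u powr m + (1 - real q / m) * 1"
    using q m u' by (intro Youngs_inequality_0) auto
  moreover have "(u powr m) powr (real q / m) = u ^ q"
    using m u' by (simp add: powr_powr powr_realpow)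
  ultimately show ?thesis by simp
qed

text \<open>The linear inequality loses nothing after division by the norm, so it is applied to Y /
  K with K = B + e; the positive e allows B = 0 and tends to 0.\<close>

lemma Lnorm_moment:
  fixes Y :: "'a \<Rightarrow> real"
  assumes "prob_space M" and Y[measurable]: "Y \<in> borel_measurable M"
    and q: "0 < q" "real q \<le> m" and B: "0 \<le> B" "Lnorm M m Y \<le> ennreal B"
  shows "integrable M (\<lambda>\<omega>. \<bar>Y \<omega>\<bar> ^ q)" "(\<integral>\<omega>. \<bar>Y \<omega>\<bar> ^ q \<partial>M) \<le> B ^ q"
proof -
  interpret prob_space M by fact
  have m: "0 < m" using q by linarith
  define I where "I = (\<integral>\<^sup>+\<omega>. ennreal (\<bar>Y \<omega>\<bar> powr m) \<partial>M)"
  have fin: "I \<noteq> \<infinity>"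
  proof
    assume "I = \<infinity>"
    then have "Lnorm M m Y = \<infinity>" by (simp add: Lnorm_def I_def)
    with B(2) show False by (simp add: top_unique)
  qed
  have root: "enn2real I powr (1 / m) \<le> B"
    using B fin by (simp add: Lnorm_def I_def[symmetric])
  have int: "integrable M (\<lambda>\<omega>. \<bar>Y \<omega>\<bar> powr m)"
    by (rule integrableI_nonneg) (use fin in \<open>auto simp: I_def less_top\<close>)
  have val: "(\<integral>\<omega>. \<bar>Y \<omega>\<bar> powr m \<partial>M) = enn2real I"
    unfolding I_def by (rule integral_eq_nn_integral) auto
  have main: "integrable M (\<lambda>\<omega>. \<bar>Y \<omega>\<bar> ^ q) \<and> (\<integral>\<omega>. \<bar>Y \<omega>\<bar> ^ q \<partial>M) \<le> (B + e) ^ q" if e: "0 < e" for e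
  proof -
    define K where "K = B + e"
    have K: "0 < K" using B e by (simp add: K_def)
    have "enn2real I = (enn2real I powr (1 / m)) powr m" using m by (simp add: powr_powr)
    also have "\<dots> \<le> K powr m" using root m e by (intro powr_mono2) (auto simp: K_def)
    finally have IK: "enn2real I \<le> K powr m" .
    let ?g = "\<lambda>\<omega>. K ^ q * (real q / m * (\<bar>Y \<omega>\<bar> powr m / K powr m) + (1 - real q / m))"
    have le: "\<bar>Y \<omega>\<bar> ^ q \<le> ?g \<omega>" for \<omega>
    proof -
      have "\<bar>Y \<omega>\<bar> ^ q = K ^ q * (\<bar>Y \<omega>\<bar> / K) ^ q" using K by (simp add: power_divide)
      also have "\<dots> \<le> K ^ q * (real q / m * (\<bar>Y \<omega>\<bar> / K) powr m + (1 - real q / m))"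
        using K q by (intro mult_left_mono power_le_powr_combination) auto
      finally show ?thesis using K by (simp add: powr_divide)
    qed
    have g: "integrable M ?g" using int by simp
    have i: "integrable M (\<lambda>\<omega>. \<bar>Y \<omega>\<bar> ^ q)"
    proof (rule Bochner_Integration.integrable_bound[OF g])
      show "AE \<omega> in M. norm (\<bar>Y \<omega>\<bar> ^ q) \<le> norm (?g \<omega>)"
      proof (intro AE_I2)
        fix \<omega>
        have "norm (\<bar>Y \<omega>\<bar> ^ q) = \<bar>Y \<omega>\<bar> ^ q" by simp
        then show "norm (\<bar>Y \<omega>\<bar> ^ q) \<le> norm (?g \<omega>)" using order_trans[OF le abs_ge_self] by (simp only: real_norm_def)
      qed
    qed measurable
    have "(\<integral>\<omega>. \<bar>Y \<omega>\<bar> ^ q \<partial>M) \<le> (\<integral>\<omega>. ?g \<omega> \<partial>M)" by (rule integral_mono[OF i g le])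
    also have "\<dots> = K ^ q * (real q / m * (enn2real I / K powr m) + (1 - real q / m))"
      using int by (simp add: prob_space val)
    also have "\<dots> \<le> K ^ q * (real q / m * 1 + (1 - real q / m))"
      using K q m IK by (intro mult_left_mono add_right_mono) auto
    finally show ?thesis using i by (simp add: K_def)
  qed
  from main[of 1] show "integrable M (\<lambda>\<omega>. \<bar>Y \<omega>\<bar> ^ q)" by simp
  have "((\<lambda>e. (B + e) ^ q) \<longlongrightarrow> (B + 0) ^ q) (at_right 0)" by (intro tendsto_intros)
  then have "(\<integral>\<omega>. \<bar>Y \<omega>\<bar> ^ q \<partial>M) \<le> (B + 0) ^ q"
    by (rule tendsto_lowerbound) (use main in \<open>auto intro: eventually_mono[OF eventually_at_right_less]\<close>)
  then show "(\<integral>\<omega>. \<bar>Y \<omega>\<bar> ^ q \<partial>M) \<le> B ^ q" by simp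
qed

lemma Lnorm_2_lower:
  fixes Y :: "'a \<Rightarrow> real"
  assumes [measurable]: "Y \<in> borel_measurable M" and i: "integrable M (\<lambda>\<omega>. (Y \<omega>)\<^sup>2)"
    and c: "0 < c" "ennreal c < Lnorm M 2 Y"
  shows "c\<^sup>2 \<le> (\<integral>\<omega>. (Y \<omega>)\<^sup>2 \<partial>M)"
proof -
  let ?I = "\<integral>\<omega>. (Y \<omega>)\<^sup>2 \<partial>M"
  have nn: "0 \<le> ?I" by (rule integral_nonneg_AE) simp
  have "(\<integral>\<^sup>+\<omega>. ennreal (\<bar>Y \<omega>\<bar> powr 2) \<partial>M) = (\<integral>\<^sup>+\<omega>. ennreal ((Y \<omega>)\<^sup>2) \<partial>M)"
    by (intro nn_integral_cong) (simp add: powr_numeral)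
  also have "\<dots> = ennreal ?I" using i by (intro nn_integral_eq_integral) auto
  finally have "Lnorm M 2 Y = ennreal (?I powr (1 / 2))" using nn by (simp add: Lnorm_def)
  then have "c < sqrt ?I" using c nn by (simp add: ennreal_less_iff powr_half_sqrt)
  then have "c\<^sup>2 \<le> (sqrt ?I)\<^sup>2" using c by (intro power_mono) auto
  then show ?thesis using nn by simp
qed

text \<open>Factors the process on M through the innovation sequence E, whose law is the product
  measure, so that moments and probabilities transfer by image measures.\<close>

locale process_representation = M: prob_space M + dependent_process \<mu> X' B D d
  for M :: "'a measure" and \<mu> X' B D d +
  fixes X :: "int \<Rightarrow> 'a \<Rightarrow> real" and E :: "'a \<Rightarrow> int \<Rightarrow> real"
  assumes E_meas[measurable]: "E \<in> measurable M P" and E_law: "distr M P E = P"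
    and X_rep: "\<And>i \<omega>. \<omega> \<in> space M \<Longrightarrow> X i \<omega> = X' i (E \<omega>)"
begin

lemma integral_rep:
  fixes F :: "(int \<Rightarrow> real) \<Rightarrow> real"
  assumes "F \<in> borel_measurable P" "\<And>\<omega>. \<omega> \<in> space M \<Longrightarrow> f \<omega> = F (E \<omega>)"
  shows "(\<integral>\<omega>. f \<omega> \<partial>M) = (\<integral>x. F x \<partial>P)"
proof -
  have "(\<integral>\<omega>. f \<omega> \<partial>M) = (\<integral>\<omega>. F (E \<omega>) \<partial>M)" using assms(2) by (intro Bochner_Integration.integral_cong) auto
  also have "\<dots> = (\<integral>x. F x \<partial>distr M P E)" by (rule integral_distr[symmetric]) (use assms(1) in measurable)
  finally show ?thesis by (simp only: E_law)
qed

lemma autocov_rep: "autocov M X j = autocov P X' j"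
  unfolding autocov_def by (rule integral_rep) (simp_all add: X_rep)

lemma cov_summand_rep: "\<omega> \<in> space M \<Longrightarrow> cov_summand M X i j \<omega> = cov_summand P X' i j (E \<omega>)"
  by (simp add: cov_summand_def autocov_rep X_rep)

lemma corr_summand_rep: "\<omega> \<in> space M \<Longrightarrow> corr_summand M X i j \<omega> = corr_summand P X' i j (E \<omega>)"
  by (simp add: corr_summand_def autocov_rep X_rep)

lemma scaled_sum_cov_rep:
  assumes "\<And>i j \<omega>. \<omega> \<in> space M \<Longrightarrow> Z i j \<omega> = Z' i j (E \<omega>)" "\<And>i j. Z' i j \<in> borel_measurable P"
  shows "scaled_sum_cov M T Z = scaled_sum_cov P T Z'"
  unfolding scaled_sum_cov_def fun_eq_iff
  by (intro allI arg_cong[where f="\<lambda>s. 1 / real T * s"] sum.cong refl integral_rep) (use assms in auto)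

lemma scaled_sum_rep:
  assumes "\<And>i j \<omega>. \<omega> \<in> space M \<Longrightarrow> Z i j \<omega> = Z' i j (E \<omega>)"
  shows "\<omega> \<in> space M \<Longrightarrow> scaled_sum T Z j \<omega> = scaled_sum T Z' j (E \<omega>)"
  unfolding scaled_sum_def using assms by (intro arg_cong[where f="\<lambda>s. 1 / sqrt (real T) * s"] sum.cong refl) auto

lemma Lnorm_rep:
  fixes F :: "(int \<Rightarrow> real) \<Rightarrow> real"
  assumes [measurable]: "F \<in> borel_measurable P" and "\<And>\<omega>. \<omega> \<in> space M \<Longrightarrow> f \<omega> = F (E \<omega>)"
  shows "Lnorm M q f = Lnorm P q F"
proof -
  have "(\<integral>\<^sup>+\<omega>. ennreal (\<bar>f \<omega>\<bar> powr q) \<partial>M) = (\<integral>\<^sup>+\<omega>. ennreal (\<bar>F (E \<omega>)\<bar> powr q) \<partial>M)"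
    using assms(2) by (intro nn_integral_cong) auto
  also have "\<dots> = (\<integral>\<^sup>+x. ennreal (\<bar>F x\<bar> powr q) \<partial>distr M P E)"
    by (rule nn_integral_distr[symmetric]) measurable
  finally show ?thesis by (simp only: E_law Lnorm_def)
qed

lemma prob_rep:
  fixes W' :: "nat \<Rightarrow> (int \<Rightarrow> real) \<Rightarrow> real"
  assumes [measurable]: "\<And>j. W' j \<in> borel_measurable P" and "\<And>j \<omega>. \<omega> \<in> space M \<Longrightarrow> W j \<omega> = \<bar>W' j (E \<omega>)\<bar>" and "finite J"
  shows "measure M {\<omega> \<in> space M. \<forall>j\<in>J. W j \<omega> \<le> y} = measure P {x \<in> space P. \<forall>j\<in>J. \<bar>W' j x\<bar> \<le> y}"
proof -
  have S: "{x \<in> space P. \<forall>j\<in>J. \<bar>W' j x\<bar> \<le> y} \<in> sets P"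
    by (intro sets.sets_Collect_finite_All borel_measurable_le borel_measurable_abs borel_measurable_const assms)
  have "measure P {x \<in> space P. \<forall>j\<in>J. \<bar>W' j x\<bar> \<le> y} = measure (distr M P E) {x \<in> space P. \<forall>j\<in>J. \<bar>W' j x\<bar> \<le> y}"
    by (simp only: E_law)
  also have "\<dots> = measure M (E -` {x \<in> space P. \<forall>j\<in>J. \<bar>W' j x\<bar> \<le> y} \<inter> space M)"
    by (rule measure_distr[OF E_meas S])
  also have "E -` {x \<in> space P. \<forall>j\<in>J. \<bar>W' j x\<bar> \<le> y} \<inter> space M = {\<omega> \<in> space M. \<forall>j\<in>J. W j \<omega> \<le> y}"
    using assms(2) by auto
  finally show ?thesis by simp
qed

end

text \<open>For finite nonempty J the maximum is at most y iff every entry is, so a bound uniform in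
  y passes to the supremum. The value at a single y shows the supremum to be nonnegative, which
  settles the outer modulus.\<close>

lemma kolmogorov_dist_Max_le:
  assumes J: "finite J" "J \<noteq> {}"
    and le: "\<And>y. \<bar>measure M {\<omega> \<in> space M. \<forall>j\<in>J. f j \<omega> \<le> y} - measure N {\<omega> \<in> space N. \<forall>j\<in>J. h j \<omega> \<le> y}\<bar> \<le> K"
  shows "\<bar>kolmogorov_dist M (\<lambda>\<omega>. MAX j\<in>J. f j \<omega>) N (\<lambda>\<omega>. MAX j\<in>J. h j \<omega>)\<bar> \<le> K"
proof -
  have eq: "\<bar>measure M {\<omega> \<in> space M. (MAX j\<in>J. f j \<omega>) \<le> y} - measure N {\<omega> \<in> space N. (MAX j\<in>J. h j \<omega>) \<le> y}\<bar> \<le> K" for y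
    using le[of y] J by simp
  have up: "kolmogorov_dist M (\<lambda>\<omega>. MAX j\<in>J. f j \<omega>) N (\<lambda>\<omega>. MAX j\<in>J. h j \<omega>) \<le> K"
    unfolding kolmogorov_dist_def by (rule cSUP_least) (use eq in auto)
  have "0 \<le> \<bar>measure M {\<omega> \<in> space M. (MAX j\<in>J. f j \<omega>) \<le> 0} - measure N {\<omega> \<in> space N. (MAX j\<in>J. h j \<omega>) \<le> 0}\<bar>" by simp
  also have "\<dots> \<le> kolmogorov_dist M (\<lambda>\<omega>. MAX j\<in>J. f j \<omega>) N (\<lambda>\<omega>. MAX j\<in>J. h j \<omega>)"
    unfolding kolmogorov_dist_def by (rule cSUP_upper[OF UNIV_I]) (use eq in \<open>auto intro!: bdd_aboveI[of _ K]\<close>)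
  finally show ?thesis using up by simp
qed

context prob_space
begin

lemma integrable_square_sum:
  fixes f :: "'i \<Rightarrow> 'a \<Rightarrow> real"
  assumes m: "\<And>i. i \<in> A \<Longrightarrow> f i \<in> borel_measurable M" and i: "\<And>i. i \<in> A \<Longrightarrow> integrable M (\<lambda>x. (f i x)\<^sup>2)" and A: "finite A"
  shows "integrable M (\<lambda>x. (\<Sum>i\<in>A. f i x)\<^sup>2)"
proof (rule Bochner_Integration.integrable_bound)
  show "integrable M (\<lambda>x. real (card A) * (\<Sum>i\<in>A. (f i x)\<^sup>2))"
    by (intro integrable_mult_right Bochner_Integration.integrable_sum i)
  show "(\<lambda>x. (\<Sum>i\<in>A. f i x)\<^sup>2) \<in> borel_measurable M"
    by (intro borel_measurable_power borel_measurable_sum m)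
  have le: "(\<Sum>i\<in>A. f i x)\<^sup>2 \<le> real (card A) * (\<Sum>i\<in>A. (f i x)\<^sup>2)" for x
    using sum_squared_le_sum_of_squares[of "\<lambda>i. f i x" A] by (simp add: mult.commute)
  show "AE x in M. norm ((\<Sum>i\<in>A. f i x)\<^sup>2) \<le> norm (real (card A) * (\<Sum>i\<in>A. (f i x)\<^sup>2))"
    using order_trans[OF le abs_ge_self] by (intro AE_I2) simp
qed

end

context dependent_process
begin

lemma cov_square: "integrable P (\<lambda>x. (cov_summand P X i j x)\<^sup>2)"
  by (rule P.integrable_of_power4(2)[OF cov_measurable cov_power4(1)])

lemma corr_square: "integrable P (\<lambda>x. (corr_summand P X i j x)\<^sup>2)"
proof -
  let ?a = "- (autocov P X j / (autocov P X 0)\<^sup>2)" and ?b = "1 / autocov P X 0"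
  \<comment> \<open>The two-term combination is written as a sum over truth values so that the lemma
    on finite sums applies.\<close>
  have "integrable P (\<lambda>x. (\<Sum>k\<in>{False, True}. if k then ?a * cov_summand P X i 0 x else ?b * cov_summand P X i j x)\<^sup>2)"
  proof (rule P.integrable_square_sum)
    fix k
    show "(\<lambda>x. if k then ?a * cov_summand P X i 0 x else ?b * cov_summand P X i j x) \<in> borel_measurable P"
      by (cases k) simp_all
    show "integrable P (\<lambda>x. (if k then ?a * cov_summand P X i 0 x else ?b * cov_summand P X i j x)\<^sup>2)"
      using cov_square[of i 0] cov_square[of i j] by (cases k) (simp_all only: power_mult_distrib if_True if_False integrable_mult_right)
  qed simp
  then show ?thesis by (simp add: corr_summand_def cov_summand_def power2_eq_square add.commute)
qed

lemma corr_measurable: "corr_summand P X i j \<in> borel_measurable P"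
  unfolding corr_summand_def[abs_def] by measurable

lemma scaled_sum_square:
  assumes "\<And>i. Z i j \<in> borel_measurable P" "\<And>i. integrable P (\<lambda>x. (Z i j x)\<^sup>2)"
  shows "integrable P (\<lambda>x. (scaled_sum T Z j x)\<^sup>2)"
  unfolding scaled_sum_def power_mult_distrib
  by (intro integrable_mult_right P.integrable_square_sum assms) simp

end

context process_representation
begin

lemma sample_autocov_rep: "\<omega> \<in> space M \<Longrightarrow> sample_autocov T X j \<omega> = sample_autocov T X' j (E \<omega>)"
  by (simp add: sample_autocov_def X_rep)

lemma cov_kolmogorov:
  fixes \<xi> :: "nat \<Rightarrow> 'b \<Rightarrow> real"
  assumes T: "0 < T" and J: "finite J" "J \<noteq> {}" "J \<subseteq> {0..dd}" and L: "0 < L" "dd \<le> L" "dd \<le> T"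
    and cg: "centered_gaussian N J \<xi> (scaled_sum_cov M T (cov_summand M X))"
    and c: "0 < c" "\<And>j. j \<in> J \<Longrightarrow> ennreal c < Lnorm M 2 (scaled_sum T (cov_summand M X) j)"
    and t: "0 < t" and h: "0 \<le> h"
  shows "\<bar>kolmogorov_dist M (\<lambda>\<omega>. MAX j\<in>J. sqrt (real T) * \<bar>sample_autocov T X j \<omega> - autocov M X j\<bar>) N (\<lambda>\<omega>. MAX j\<in>J. \<bar>\<xi> j \<omega>\<bar>)\<bar>
    \<le> real (card J) * (real dd * B\<^sup>2 / (sqrt (real T) * t)) + err_bound (real (card J)) (real T) (real L) (257 * 1 ^ 4 * B ^ 8) (4 * 1 * B * D)
        (4 * 1 * B * D / (1 + real (L - dd))\<^sup>2) t h c"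
proof (rule kolmogorov_dist_Max_le[OF J(1,2)])
  fix y
  have cg': "centered_gaussian N J \<xi> (scaled_sum_cov P T (cov_summand P X'))"
    using cg scaled_sum_cov_rep[of "cov_summand M X" "cov_summand P X'" T, OF cov_summand_rep cov_measurable] by simp
  have c': "c\<^sup>2 \<le> (\<integral>x. (S T j x)\<^sup>2 \<partial>P)" if "j \<in> J" for j
  proof (rule Lnorm_2_lower[OF S_measurable scaled_sum_square[OF cov_measurable cov_square] c(1)])
    have "Lnorm M 2 (scaled_sum T (cov_summand M X) j) = Lnorm P 2 (S T j)"
      by (rule Lnorm_rep[OF S_measurable], rule scaled_sum_rep, rule cov_summand_rep, assumption+)
    then show "ennreal c < Lnorm P 2 (S T j)" using c(2)[OF that] by simp
  qed
  have "measure M {\<omega> \<in> space M. \<forall>j\<in>J. sqrt (real T) * \<bar>sample_autocov T X j \<omega> - autocov M X j\<bar> \<le> y}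
      = measure P {x \<in> space P. \<forall>j\<in>J. \<bar>w T j x\<bar> \<le> y}"
    by (rule prob_rep[OF w_measurable _ J(1)]) (simp add: w_def abs_mult sample_autocov_rep autocov_rep)
  then show "\<bar>measure M {\<omega> \<in> space M. \<forall>j\<in>J. sqrt (real T) * \<bar>sample_autocov T X j \<omega> - autocov M X j\<bar> \<le> y}
      - measure N {\<omega> \<in> space N. \<forall>j\<in>J. \<bar>\<xi> j \<omega>\<bar> \<le> y}\<bar>
    \<le> real (card J) * (real dd * B\<^sup>2 / (sqrt (real T) * t)) + err_bound (real (card J)) (real T) (real L) (257 * 1 ^ 4 * B ^ 8) (4 * 1 * B * D)
        (4 * 1 * B * D / (1 + real (L - dd))\<^sup>2) t h c"
    using autocov_fixed_sample[OF T J L cg' c(1) c' t h, of y] by simp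
qed

lemma corr_kolmogorov:
  fixes \<xi> :: "nat \<Rightarrow> 'b \<Rightarrow> real"
  assumes T: "0 < T" and J: "finite J" "J \<noteq> {}" "J \<subseteq> {0..dd}" and L: "0 < L" "dd \<le> L" "dd \<le> T"
    and cg: "centered_gaussian N J \<xi> (scaled_sum_cov M T (corr_summand M X))"
    and c: "0 < c" "c < autocov M X 0" "\<And>j. j \<in> J \<Longrightarrow> ennreal c < Lnorm M 2 (scaled_sum T (corr_summand M X) j)"
    and s: "0 < s" "s \<le> k" and small: "k / sqrt (real T) \<le> c / 2"
    and t: "s / c + 6 * B\<^sup>2 * k\<^sup>2 / (sqrt (real T) * c ^ 3) \<le> t" and h: "0 \<le> h"
  defines "A \<equiv> B\<^sup>2 / c\<^sup>2 + 1 / c + 1"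
  shows "\<bar>kolmogorov_dist M (\<lambda>\<omega>. MAX j\<in>J. sqrt (real T) * \<bar>sample_autocorr T X j \<omega> - autocorr M X j\<bar>) N (\<lambda>\<omega>. MAX j\<in>J. \<bar>\<xi> j \<omega>\<bar>)\<bar>
    \<le> (real (card J) * (real dd * B\<^sup>2 / (sqrt (real T) * s)) + (real (card J) + 1) * ((4 * B * D)\<^sup>2 / k\<^sup>2))
      + err_bound (real (card J)) (real T) (real L) (257 * A ^ 4 * B ^ 8) (4 * A * B * D)
        (4 * A * B * D / (1 + real (L - dd))\<^sup>2) t h c"
proof (rule kolmogorov_dist_Max_le[OF J(1,2)])
  fix y
  have cg': "centered_gaussian N J \<xi> (scaled_sum_cov P T (corr_summand P X'))"
    using cg scaled_sum_cov_rep[of "corr_summand M X" "corr_summand P X'" T, OF corr_summand_rep corr_measurable] by simp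
  have cp: "c < autocov P X' 0" using c(2) by (simp add: autocov_rep)
  have mS: "scaled_sum T (corr_summand P X') j \<in> borel_measurable P" for j
    unfolding scaled_sum_def[abs_def] by (intro borel_measurable_times borel_measurable_const borel_measurable_sum corr_measurable)
  have c': "c\<^sup>2 \<le> (\<integral>x. (scaled_sum T (corr_summand P X') j x)\<^sup>2 \<partial>P)" if "j \<in> J" for j
  proof (rule Lnorm_2_lower[OF mS scaled_sum_square[OF corr_measurable corr_square] c(1)])
    have "Lnorm M 2 (scaled_sum T (corr_summand M X) j) = Lnorm P 2 (scaled_sum T (corr_summand P X') j)"
      by (rule Lnorm_rep[OF mS], rule scaled_sum_rep, rule corr_summand_rep, assumption+)
    then show "ennreal c < Lnorm P 2 (scaled_sum T (corr_summand P X') j)" using c(3)[OF that] by simp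
  qed
  have "measure M {\<omega> \<in> space M. \<forall>j\<in>J. sqrt (real T) * \<bar>sample_autocorr T X j \<omega> - autocorr M X j\<bar> \<le> y}
      = measure P {x \<in> space P. \<forall>j\<in>J. \<bar>rho_dev T j x\<bar> \<le> y}"
    by (rule prob_rep[OF rho_dev_measurable _ J(1)])
      (simp add: rho_dev_def abs_mult sample_autocorr_def autocorr_def sample_autocov_rep autocov_rep)
  then show "\<bar>measure M {\<omega> \<in> space M. \<forall>j\<in>J. sqrt (real T) * \<bar>sample_autocorr T X j \<omega> - autocorr M X j\<bar> \<le> y}
      - measure N {\<omega> \<in> space N. \<forall>j\<in>J. \<bar>\<xi> j \<omega>\<bar> \<le> y}\<bar>
    \<le> (real (card J) * (real dd * B\<^sup>2 / (sqrt (real T) * s)) + (real (card J) + 1) * ((4 * B * D)\<^sup>2 / k\<^sup>2))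
      + err_bound (real (card J)) (real T) (real L) (257 * A ^ 4 * B ^ 8) (4 * A * B * D)
        (4 * A * B * D / (1 + real (L - dd))\<^sup>2) t h c"
    using autocorr_fixed_sample[OF T J L cg' c(1) cp c' s small t h, of y] by (simp add: A_def)
qed

end

text \<open>Joint independence makes the pair of e and e' two independent copies of the product law,
  under which \<open>resample\<close> at i - l is distributed as X_i - X_i(l). The L^m bounds with m
  >= 8 then give the fourth and eighth moments demanded on the product space.\<close>

lemma process_representation_exists:
  fixes X e e' :: "int \<Rightarrow> 'a \<Rightarrow> real" and g :: "int \<Rightarrow> (nat \<Rightarrow> real) \<Rightarrow> real"
  assumes "prob_space M" and ws: "weakly_stationary_mean_zero M X"
    and cr: "causal_representation M e g X" and ic: "independent_copy M e e'"
    and m: "8 \<le> m" and \<alpha>: "2 < \<alpha>" and B: "1 \<le> B" and D: "1 \<le> D"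
    and norm: "(SUP i. Lnorm M m (X i)) \<le> ennreal B"
    and srd: "(SUP k. ennreal ((1 + real k) powr \<alpha>) * (\<Sum>l. dependence_coeff M e e' g X m (k + l))) \<le> ennreal D"
  shows "process_representation M (\<lambda>i. distr M borel (e i)) (\<lambda>i x. g i (\<lambda>l. x (i - int l))) B D
    (\<lambda>l. enn2real (dependence_coeff M e e' g X m l)) X (\<lambda>\<omega> i. e i \<omega>)"
proof -
  interpret M: prob_space M by fact
  define \<mu> where "\<mu> = (\<lambda>i. distr M borel (e i))"
  define X' where "X' = (\<lambda>i (x :: int \<Rightarrow> real). g i (\<lambda>l. x (i - int l)))"
  define dc where "dc = dependence_coeff M e e' g X m"
  define d where "d = (\<lambda>l. enn2real (dc l))"
  define E where "E = (\<lambda>\<omega> i. e i \<omega>)"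
  define E' where "E' = (\<lambda>\<omega> i. e' i \<omega>)"
  have ind: "M.indep_vars (\<lambda>_. borel) (case_sum e e') UNIV" using ic by (simp add: independent_copy_def)
  have rv: "case_sum e e' s \<in> borel_measurable M" for s using ind by (auto simp: M.indep_vars_def)
  have rve: "e i \<in> borel_measurable M" "e' i \<in> borel_measurable M" for i
    using rv[of "Inl i"] rv[of "Inr i"] by simp_all
  interpret innovation_space \<mu>
    by (rule innovation_space.intro, rule coordinate_space.intro) (simp_all only: \<mu>_def sets_distr M.prob_space_distr[OF rve(1)])
  have E: "E \<in> measurable M P" and E': "E' \<in> measurable M P"
    unfolding E_def E'_def by (rule measurable_to_P, rule rve)+
  have pair: "(\<lambda>\<omega>. (E \<omega>, E' \<omega>)) \<in> measurable M (P \<Otimes>\<^sub>M P)" using E E' by (rule measurable_Pair)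
  have law: "distr M (P \<Otimes>\<^sub>M P) (\<lambda>\<omega>. (E \<omega>, E' \<omega>)) = P \<Otimes>\<^sub>M P"
  proof -
    have "distr M (P \<Otimes>\<^sub>M P) (\<lambda>\<omega>. (E \<omega>, E' \<omega>)) = distr M (PiM UNIV (\<lambda>_. borel) \<Otimes>\<^sub>M PiM UNIV (\<lambda>_. borel)) (\<lambda>\<omega>. (E \<omega>, E' \<omega>))"
      by (rule distr_cong) (auto intro!: sets_pair_measure_cong sets_P)
    also have "\<dots> = PiM UNIV (\<lambda>i. distr M borel (e i)) \<Otimes>\<^sub>M PiM UNIV (\<lambda>i. distr M borel (e' i))"
      unfolding E_def E'_def by (rule M.distr_pair_indep_vars[OF ind])
    also have "(\<lambda>i. distr M borel (e' i)) = (\<lambda>i. distr M borel (e i))" using ic by (simp add: independent_copy_def)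
    also have "PiM UNIV (\<lambda>i. distr M borel (e i)) = P" by (simp only: P_def) (simp only: \<mu>_def)
    finally show ?thesis .
  qed
  have E_law: "distr M P E = P"
  proof -
    have "distr M P E = distr (distr M (P \<Otimes>\<^sub>M P) (\<lambda>\<omega>. (E \<omega>, E' \<omega>))) P fst"
      by (subst distr_distr[OF measurable_fst pair]) (simp add: comp_def)
    also have "\<dots> = P" unfolding law by (rule P.distr_pair_fst)
    finally show ?thesis .
  qed
  have X'_meas[measurable]: "X' i \<in> borel_measurable P" for i
  proof -
    have g: "g i \<in> borel_measurable (PiM UNIV (\<lambda>_. borel))" using cr by (simp add: causal_representation_def)
    have "(\<lambda>x l. x (i - int l)) \<in> measurable P (PiM (UNIV :: nat set) (\<lambda>_. borel))"
      by (rule measurable_PiM_single') (auto intro: measurable_coord)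
    from measurable_compose[OF this g] show ?thesis by (simp add: X'_def)
  qed
  have X_rep: "X i \<omega> = X' i (E \<omega>)" if "\<omega> \<in> space M" for i \<omega>
    using cr that by (simp add: causal_representation_def X'_def E_def)
  have X_meas: "X i \<in> borel_measurable M" for i
    using ws by (auto simp: weakly_stationary_mean_zero_def)
  have integral_E: "(\<integral>x. F x \<partial>P) = (\<integral>\<omega>. F (E \<omega>) \<partial>M)" and integrable_E: "integrable P F \<longleftrightarrow> integrable M (\<lambda>\<omega>. F (E \<omega>))"
    if "F \<in> borel_measurable P" for F :: "(int \<Rightarrow> real) \<Rightarrow> real"
    using integral_distr[OF E that] integrable_distr_eq[OF E that] by (simp_all only: E_law)
  have moment: "integrable P (\<lambda>x. X' i x ^ q) \<and> (\<integral>x. X' i x ^ q \<partial>P) \<le> B ^ q" if q: "0 < q" "real q \<le> m" "even q" for i q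
  proof -
    have le: "Lnorm M m (X i) \<le> ennreal B" by (rule order_trans[OF SUP_upper norm]) simp
    note L = Lnorm_moment[OF \<open>prob_space M\<close> X_meas q(1,2) _ le]
    have F: "(\<lambda>x. X' i x ^ q) \<in> borel_measurable P" by measurable
    have i1: "integrable M (\<lambda>\<omega>. X' i (E \<omega>) ^ q) \<longleftrightarrow> integrable M (\<lambda>\<omega>. \<bar>X i \<omega>\<bar> ^ q)"
      by (rule Bochner_Integration.integrable_cong) (simp_all add: X_rep power_even_abs[OF q(3)])
    have i2: "(\<integral>\<omega>. X' i (E \<omega>) ^ q \<partial>M) = (\<integral>\<omega>. \<bar>X i \<omega>\<bar> ^ q \<partial>M)"
      by (rule Bochner_Integration.integral_cong) (simp_all add: X_rep power_even_abs[OF q(3)])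
    show ?thesis using L B by (simp add: integral_E[OF F] integrable_E[OF F] i1 i2)
  qed
  have tail: "ennreal ((1 + real k) powr \<alpha>) * (\<Sum>l. dc (k + l)) \<le> ennreal D" for k
    by (rule order_trans[OF SUP_upper[OF UNIV_I] srd[folded dc_def]])
  have total: "(\<Sum>l. dc l) \<le> ennreal D" using tail[of 0] by simp
  have "dc l \<le> (\<Sum>l. dc l)" for l
    using sum_le_suminf[of dc "{l}"] by (simp add: summableI)
  then have "dc l \<le> ennreal D" for l by (rule order_trans[OF _ total])
  \<comment> \<open>A finite total makes every coefficient finite, so the passage to reals by
    \<open>enn2real\<close> loses nothing.\<close>
  then have dc: "dc l = ennreal (d l)" for l
    by (metis d_def ennreal_enn2real_if ennreal_neq_top neq_top_trans)
  have d: "0 \<le> d l" for l by (simp add: d_def)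
  have summable: "summable d"
    using total d by (intro summable_suminf_not_top) (auto simp: dc[symmetric] top_unique)
  have d_tail: "(\<Sum>l. d (l + n)) \<le> D / (1 + real n)\<^sup>2" for n
  proof -
    have sn: "summable (\<lambda>l. d (l + n))" using summable by (simp add: summable_iff_shift)
    have "(\<Sum>l. dc (n + l)) = ennreal (\<Sum>l. d (l + n))"
      unfolding dc by (subst suminf_ennreal2) (use sn d in \<open>auto simp: add.commute\<close>)
    with tail[of n] have "ennreal ((1 + real n) powr \<alpha> * (\<Sum>l. d (l + n))) \<le> ennreal D"
      using suminf_nonneg[OF sn d] by (simp add: ennreal_mult)
    then have le: "(1 + real n) powr \<alpha> * (\<Sum>l. d (l + n)) \<le> D" using D by (simp add: ennreal_le_iff)
    \<comment> \<open>Here \<alpha> > 2 enters: the weighted tail bound becomes quadratic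
      decay.\<close>
    have "(1 + real n) powr 2 \<le> (1 + real n) powr \<alpha>" using \<alpha> by (intro powr_mono) auto
    then have "(1 + real n)\<^sup>2 * (\<Sum>l. d (l + n)) \<le> (1 + real n) powr \<alpha> * (\<Sum>l. d (l + n))"
      using suminf_nonneg[OF sn d] by (intro mult_right_mono) (auto simp: powr_numeral)
    with le have "(\<Sum>l. d (l + n)) * (1 + real n)\<^sup>2 \<le> D" by (simp add: mult.commute)
    then show ?thesis by (subst pos_le_divide_eq) auto
  qed
  have resample4: "(\<integral>z. (resample (i - int l) (X' i) z) ^ 4 \<partial>(P \<Otimes>\<^sub>M P)) \<le> d l ^ 4" for i l
  proof -
    define Y where "Y \<omega> = resample (i - int l) (X' i) (E \<omega>, E' \<omega>)" for \<omega>
    have F: "(\<lambda>z. (resample (i - int l) (X' i) z) ^ 4) \<in> borel_measurable (P \<Otimes>\<^sub>M P)" by measurable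
    have Y: "Y \<in> borel_measurable M"
      unfolding Y_def[abs_def] by (rule measurable_compose[OF pair measurable_resample[OF X'_meas]])
    have eq: "Y \<omega> = X i \<omega> - coupled e e' g i l \<omega>" if "\<omega> \<in> space M" for \<omega>
    proof -
      \<comment> \<open>Coordinate i - l of the two-sided sequence is position l of the past seen
        from i.\<close>
      have "(\<lambda>k. mix (- {i - int l}) (E \<omega>) (E' \<omega>) (i - int k)) = (\<lambda>k. if k = l then e' (i - int l) \<omega> else e (i - int k) \<omega>)"
        by (auto simp: mix_def E_def E'_def)
      then show ?thesis by (simp add: Y_def resample_def X_rep[OF that] coupled_def X'_def)
    qed
    have "(\<integral>\<^sup>+\<omega>. ennreal (\<bar>Y \<omega>\<bar> powr m) \<partial>M) = (\<integral>\<^sup>+\<omega>. ennreal (\<bar>X i \<omega> - coupled e e' g i l \<omega>\<bar> powr m) \<partial>M)"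
      by (intro nn_integral_cong) (simp add: eq)
    then have "Lnorm M m Y = Lnorm M m (\<lambda>\<omega>. X i \<omega> - coupled e e' g i l \<omega>)" by (simp only: Lnorm_def)
    also have "\<dots> \<le> dc l" unfolding dc_def dependence_coeff_def by (rule SUP_upper) simp
    finally have le: "Lnorm M m Y \<le> ennreal (d l)" by (simp only: dc)
    have "(\<integral>\<omega>. \<bar>Y \<omega>\<bar> ^ 4 \<partial>M) \<le> d l ^ 4"
      by (rule Lnorm_moment(2)[OF \<open>prob_space M\<close> Y _ _ d le]) (use m in auto)
    moreover have "(\<integral>z. (resample (i - int l) (X' i) z) ^ 4 \<partial>(P \<Otimes>\<^sub>M P)) = (\<integral>\<omega>. Y \<omega> ^ 4 \<partial>M)"
      using integral_distr[OF pair F] by (simp only: law Y_def)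
    ultimately show ?thesis by (simp add: power_even_abs)
  qed
  have prods: "(\<integral>x. X' i x * X' k x \<partial>P) = (\<integral>\<omega>. X i \<omega> * X k \<omega> \<partial>M)" for i k
  proof -
    have "(\<lambda>x. X' i x * X' k x) \<in> borel_measurable P" by measurable
    from integral_E[OF this] have "(\<integral>x. X' i x * X' k x \<partial>P) = (\<integral>\<omega>. X' i (E \<omega>) * X' k (E \<omega>) \<partial>M)" .
    also have "\<dots> = (\<integral>\<omega>. X i \<omega> * X k \<omega> \<partial>M)" by (rule Bochner_Integration.integral_cong) (simp_all add: X_rep)
    finally show ?thesis .
  qed
  have "process_representation M \<mu> X' B D d X E"
  proof (unfold_locales, goal_cases)
    case (2 i) then show ?case by (auto simp: dep_def X'_def intro!: arg_cong[where f="g i"])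
  next
    case (3 i) then show ?case using moment[of 8 i] m by simp
  next
    case (4 i) then show ?case using moment[of 8 i] m by simp
  next
    case (5 i) then show ?case using moment[of 4 i] m by simp
  next
    case (6 i l) then show ?case by (rule resample4)
  next
    case (12 i j)
    have "(\<integral>\<omega>. X i \<omega> * X (i - int j) \<omega> \<partial>M) = (\<integral>\<omega>. X 0 \<omega> * X (0 - int j) \<omega> \<partial>M)"
      using ws unfolding weakly_stationary_mean_zero_def by blast
    then show ?case by (simp only: autocov_def prods)
  qed (fact X'_meas d summable d_tail B D E E_law X_rep)+
  then show ?thesis by (simp only: \<mu>_def X'_def d_def dc_def E_def)
qed

subsection \<open>Rates\<close>

text \<open>The first and third condition give s < 1 - 20 \<alpha> \<beta>. Multiplying by v =
  \<alpha> - 1 and inserting the second gives \<beta> (20 v^2 + 24 v + 4) < v. For \<beta> >= 1/48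
  this would force (5 v - 1)(v - 1) < 0, impossible for v > 1; the threshold is 1 / (20 + 24 + 4),
  the value at v = 1.\<close>

lemma dimension_exponent:
  fixes m \<alpha> \<beta> s l :: real
  assumes "0 < m" and \<alpha>: "2 < \<alpha>" and c1: "12 * \<beta> / m + 12 * \<alpha> * \<beta> + l < 1"
    and c2: "4 * \<alpha> * \<beta> < (\<alpha> - 1) * s" and c3: "8 * \<alpha> * \<beta> + s < l"
  shows "\<beta> < 1 / 48"
proof (rule ccontr)
  assume "\<not> \<beta> < 1 / 48"
  then have \<beta>: "1 / 48 \<le> \<beta>" by simp
  define v where "v = \<alpha> - 1"
  have v: "1 < v" using \<alpha> by (simp add: v_def)
  have "0 \<le> 12 * \<beta> / m" using \<beta> assms(1) by simp
  with c1 c3 have "s < 1 - 20 * \<alpha> * \<beta>" by linarith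
  then have "v * s < v * (1 - 20 * \<alpha> * \<beta>)" using v by simp
  with c2 have "4 * \<alpha> * \<beta> < v * (1 - 20 * \<alpha> * \<beta>)" by (simp add: v_def)
  then have 1: "\<beta> * (20 * v\<^sup>2 + 24 * v + 4) < v" by (simp add: v_def algebra_simps power2_eq_square)
  have "1 / 48 * (20 * v\<^sup>2 + 24 * v + 4) \<le> \<beta> * (20 * v\<^sup>2 + 24 * v + 4)"
    using \<beta> v by (intro mult_right_mono) auto
  with 1 have "20 * v\<^sup>2 + 24 * v + 4 < 48 * v" by simp
  moreover have "0 < (5 * v - 1) * (v - 1)" using v by simp
  ultimately show False by (simp add: algebra_simps power2_eq_square)
qed

lemma err_bound_mono:
  assumes "0 \<le> p" "p \<le> p'" "0 \<le> l" "l \<le> l'" "0 \<le> r" "r \<le> r'" "0 \<le> n" "0 \<le> Q" "0 \<le> R" "0 \<le> b" "0 \<le> t" "0 < c"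
  shows "err_bound p n l Q R r t b c \<le> err_bound p' n l' Q R r' t b c"
proof -
  have 0: "0 \<le> p'" "0 \<le> l'" "0 \<le> r'" using assms by linarith+
  have s: "0 \<le> Q / sqrt n" using assms by simp
  have 1: "p * (r\<^sup>2 / t\<^sup>2) \<le> p' * (r'\<^sup>2 / t\<^sup>2)"
    using assms 0 by (intro mult_mono divide_right_mono power_mono) auto
  have 2: "2 * n * (8 * b) ^ 3 * (4 * l * p * (Q / sqrt n)) ^ 3 \<le> 2 * n * (8 * b) ^ 3 * (4 * l' * p' * (Q / sqrt n)) ^ 3"
    using assms 0 s by (intro mult_left_mono power_mono mult_right_mono mult_mono) auto
  have 3: "(8 * b)\<^sup>2 * (p\<^sup>2 * (3 * r * R)) \<le> (8 * b)\<^sup>2 * (p'\<^sup>2 * (3 * r' * R))"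
    using assms 0 by (intro mult_left_mono mult_mono mult_right_mono power_mono) auto
  have 4: "3 * p * exp (- (b * (2 * t))) \<le> 3 * p' * exp (- (b * (2 * t)))"
    using assms by (intro mult_right_mono) auto
  have 5: "2 * p * (3 * (2 * t)) / c \<le> 2 * p' * (3 * (2 * t)) / c"
    using assms by (intro divide_right_mono mult_right_mono) auto
  show ?thesis
    unfolding err_bound_def by (rule add_mono[OF add_mono[OF add_mono[OF 1 mult_left_mono[OF add_mono[OF 2 3]]] 4] 5]) simp
qed

text \<open>The scales: the dimension is at most \<open>K T\<^bsup>1/48\<^esup>\<close>, the innovations are truncated at lag \<open>T\<^bsup>1/12\<^esup>\<close>,
  the indicator is smoothed at scale \<open>T\<^bsup>-1/32\<^esup>\<close> by products of bumps with slope \<open>T\<^bsup>1/24\<^esup>\<close>.\<close>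

definition err_scale :: "real \<Rightarrow> real \<Rightarrow> real \<Rightarrow> real \<Rightarrow> real \<Rightarrow> real" where
  "err_scale K Q R c T = err_bound (K * T powr (1 / 48)) T (2 * T powr (1 / 12)) Q R (4 * R * T powr (- 1 / 6))
     (T powr (- 1 / 32)) (T powr (1 / 24)) c"

text \<open>The orders of the terms are T^(-1/4) for truncation, T^(-1/16) and T^(-1/24) for the two
  parts of the comparison, T^(1/48) exp (- 2 T^(1/96)) for smoothing and T^(-1/96) for
  anti-concentration.\<close>

lemma err_scale_tendsto:
  assumes "0 < K" "0 < Q" "0 < R" "0 < c"
  shows "((\<lambda>T :: nat. err_scale K Q R c (real T)) \<longlongrightarrow> 0) sequentially"
proof -
  have 1: "((\<lambda>T :: nat. K * real T powr (1 / 48) * ((4 * R * real T powr (- 1 / 6))\<^sup>2 / (real T powr (- 1 / 32))\<^sup>2)) \<longlongrightarrow> 0) sequentially"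
    using assms by real_asymp
  have 2: "((\<lambda>T :: nat. 2 * real T * (8 * real T powr (1 / 24)) ^ 3 * (4 * (2 * real T powr (1 / 12)) * (K * real T powr (1 / 48)) * (Q / sqrt (real T))) ^ 3) \<longlongrightarrow> 0) sequentially"
    using assms by real_asymp
  have 3: "((\<lambda>T :: nat. (8 * real T powr (1 / 24))\<^sup>2 * ((K * real T powr (1 / 48))\<^sup>2 * (3 * (4 * R * real T powr (- 1 / 6)) * R))) \<longlongrightarrow> 0) sequentially"
    using assms by real_asymp
  have 4: "((\<lambda>T :: nat. 3 * (K * real T powr (1 / 48)) * exp (- (real T powr (1 / 24) * (2 * real T powr (- 1 / 32))))) \<longlongrightarrow> 0) sequentially"
    using assms by real_asymp
  have 5: "((\<lambda>T :: nat. 2 * (K * real T powr (1 / 48)) * (3 * (2 * real T powr (- 1 / 32))) / c) \<longlongrightarrow> 0) sequentially"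
    using assms by real_asymp
  show ?thesis
    unfolding err_scale_def err_bound_def
    using tendsto_add[OF tendsto_add[OF tendsto_add[OF 1 tendsto_mult_left[OF tendsto_add[OF 2 3], of 2]] 4] 5] by simp
qed

text \<open>Lags are at most half of T^(1/12), and L lies between T^(1/12) and its double, so L - dd
  is still at least T^(1/12) / 2; the quadratic tail is then at most 4 R T^(-1/6).\<close>

lemma err_bound_le_err_scale:
  fixes T dd :: nat
  assumes T: "0 < T" and p: "0 \<le> p" "p \<le> K * real T powr (1 / 48)"
    and dd: "real dd \<le> K * real T powr (1 / 48)" and K: "K * real T powr (1 / 48) \<le> real T powr (1 / 12) / 2"
    and Q: "0 \<le> Q" and R: "0 \<le> R" and c: "0 < c"
  defines "L \<equiv> nat \<lceil>real T powr (1 / 12)\<rceil>"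
  shows "dd \<le> L" "0 < L"
    "err_bound p (real T) (real L) Q R (R / (1 + real (L - dd))\<^sup>2) (real T powr (- 1 / 32)) (real T powr (1 / 24)) c \<le> err_scale K Q R c (real T)"
proof -
  let ?x = "real T powr (1 / 12)"
  have x: "1 \<le> ?x" using T by (simp add: ge_one_powr_ge_zero)
  have L: "?x \<le> real L" "real L \<le> 2 * ?x"
    using x unfolding L_def by linarith+
  have ddx: "real dd \<le> ?x / 2" using dd K by linarith
  then show dL: "dd \<le> L" using L x by linarith
  show "0 < L" using L x by linarith
  have half: "?x / 2 \<le> 1 + real (L - dd)" using L ddx dL by (simp add: of_nat_diff)
  have "R / (1 + real (L - dd))\<^sup>2 \<le> R / (?x / 2)\<^sup>2"
    using half x R T by (intro divide_left_mono power_mono mult_pos_pos zero_less_power) auto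
  also have "\<dots> = 4 * R * real T powr (- 1 / 6)"
  proof -
    have "?x\<^sup>2 = real T powr (1 / 6)" using T by (simp add: powr_power)
    then show ?thesis by (simp add: power_divide powr_minus divide_simps)
  qed
  finally have "R / (1 + real (L - dd))\<^sup>2 \<le> 4 * R * real T powr (- 1 / 6)" .
  then show "err_bound p (real T) (real L) Q R (R / (1 + real (L - dd))\<^sup>2) (real T powr (- 1 / 32)) (real T powr (1 / 24)) c \<le> err_scale K Q R c (real T)"
    unfolding err_scale_def using p L R Q c by (intro err_bound_mono) auto
qed

lemma smallo_one_of_bound:
  fixes f g :: "nat \<Rightarrow> real"
  assumes "\<forall>\<^sub>F T in sequentially. \<bar>f T\<bar> \<le> g T" "(g \<longlongrightarrow> 0) sequentially"
  shows "f \<in> o(\<lambda>_. 1)"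
proof (rule smalloI_tendsto)
  have "(f \<longlongrightarrow> 0) sequentially" by (rule Lim_null_comparison[OF _ assms(2)]) (use assms(1) in simp)
  then show "((\<lambda>T. f T / 1) \<longlongrightarrow> 0) sequentially" by simp
qed simp

text \<open>The bound is raised to at least 1, as the constants B and D require.\<close>

lemma bigo_one_bound:
  assumes "bigo_one a"
  obtains B :: real where "1 \<le> B" "\<forall>\<^sub>F T in sequentially. a T \<le> ennreal B"
proof -
  obtain C where C: "\<forall>\<^sub>F T in sequentially. a T \<le> ennreal C" using assms by (auto simp: bigo_one_def)
  have le: "ennreal C \<le> ennreal (max 1 C)" by (rule ennreal_leI) simp
  have "\<forall>\<^sub>F T in sequentially. a T \<le> ennreal (max 1 C)"
    by (rule eventually_mono[OF C]) (rule order_trans[OF _ le])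
  then show thesis by (intro that[of "max 1 C"]) auto
qed

theorem theorem2:
  fixes M :: "nat \<Rightarrow> 'a measure"
    and e e' :: "nat \<Rightarrow> int \<Rightarrow> 'a \<Rightarrow> real"
    and g :: "nat \<Rightarrow> int \<Rightarrow> (nat \<Rightarrow> real) \<Rightarrow> real"
    and X :: "nat \<Rightarrow> int \<Rightarrow> 'a \<Rightarrow> real"
    and m \<alpha>\<^sub>X \<beta>\<^sub>X \<alpha>\<^sub>s \<alpha>\<^sub>l :: real
    and d :: "nat \<Rightarrow> nat"
    and H I :: "nat \<Rightarrow> nat set"
  assumes "\<And>T. T \<ge> 1 \<Longrightarrow> prob_space (M T)"
    and "\<And>T. T \<ge> 1 \<Longrightarrow> weakly_stationary_mean_zero (M T) (X T)"
    and "short_range_dependent M e e' g X m \<alpha>\<^sub>X"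
    and "m \<ge> 8" and "\<alpha>\<^sub>X > 2"
    and "\<And>T. T \<ge> 1 \<Longrightarrow> d T > 0"
    and "(\<lambda>T. real (d T)) \<in> O(\<lambda>T. real T powr \<beta>\<^sub>X)"
    and "\<And>T. T \<ge> 1 \<Longrightarrow> H T \<subseteq> {0..d T} \<and> H T \<noteq> {}"
    and "\<And>T. T \<ge> 1 \<Longrightarrow> I T \<subseteq> {1..d T} \<and> I T \<noteq> {}"
    and "0 < \<alpha>\<^sub>s" and "\<alpha>\<^sub>s < \<alpha>\<^sub>l" and "\<alpha>\<^sub>l < 1"
    and "2 * \<beta>\<^sub>X / m + 2 * \<alpha>\<^sub>X * \<beta>\<^sub>X < (\<alpha>\<^sub>X - 1) * \<alpha>\<^sub>s"
    and "4 * \<beta>\<^sub>X / m + 4 * \<alpha>\<^sub>X * \<beta>\<^sub>X + \<alpha>\<^sub>s < \<alpha>\<^sub>l"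
    and "12 * \<beta>\<^sub>X / m + 12 * \<alpha>\<^sub>X * \<beta>\<^sub>X + \<alpha>\<^sub>l < 1"
    and "4 * \<alpha>\<^sub>X * \<beta>\<^sub>X < (\<alpha>\<^sub>X - 1) * \<alpha>\<^sub>s"
    and "8 * \<alpha>\<^sub>X * \<beta>\<^sub>X + \<alpha>\<^sub>s < \<alpha>\<^sub>l"
  shows
    "((\<exists>c::real. c > 0 \<and> (\<forall>T\<ge>1. \<forall>j\<in>H T.
          Lnorm (M T) 2 (scaled_sum T (cov_summand (M T) (X T)) j) > ennreal c))
      \<longrightarrow>
      (\<forall>(N :: nat \<Rightarrow> 'b measure) \<xi>.
         (\<forall>\<^sub>F T in sequentially. centered_gaussian (N T) (H T) (\<xi> T)
                  (scaled_sum_cov (M T) T (cov_summand (M T) (X T))))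
         \<longrightarrow>
         (\<lambda>T. kolmogorov_dist
                (M T) (\<lambda>\<omega>. MAX j\<in>H T. sqrt (real T) * \<bar>sample_autocov T (X T) j \<omega> - autocov (M T) (X T) j\<bar>)
                (N T) (\<lambda>\<omega>. MAX j\<in>H T. \<bar>\<xi> T j \<omega>\<bar>))
           \<in> o(\<lambda>_. 1)))
     \<and>
     ((\<exists>c::real. c > 0 \<and> (\<forall>T\<ge>1. autocov (M T) (X T) 0 > c \<and> (\<forall>j\<in>I T.
          Lnorm (M T) 2 (scaled_sum T (corr_summand (M T) (X T)) j) > ennreal c)))
      \<longrightarrow>
      (\<forall>(N :: nat \<Rightarrow> 'b measure) \<zeta>.
         (\<forall>\<^sub>F T in sequentially. centered_gaussian (N T) (I T) (\<zeta> T)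
                  (scaled_sum_cov (M T) T (corr_summand (M T) (X T))))
         \<longrightarrow>
         (\<lambda>T. kolmogorov_dist
                (M T) (\<lambda>\<omega>. MAX j\<in>I T. sqrt (real T) * \<bar>sample_autocorr T (X T) j \<omega> - autocorr (M T) (X T) j\<bar>)
                (N T) (\<lambda>\<omega>. MAX j\<in>I T. \<bar>\<zeta> T j \<omega>\<bar>))
           \<in> o(\<lambda>_. 1)))"
proof -
  let ?x = "\<lambda>T. real T powr (1 / 48)" and ?t = "\<lambda>T. real T powr (- 1 / 32)"
  have cr: "causal_representation (M T) (e T) (g T) (X T)" and ic: "independent_copy (M T) (e T) (e' T)" if "1 \<le> T" for T
    using assms(3) that by (simp_all add: short_range_dependent_def)
  obtain B where B: "1 \<le> B" and evB: "\<forall>\<^sub>F T in sequentially. (SUP i. Lnorm (M T) m (X T i)) \<le> ennreal B"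
    using assms(3) unfolding short_range_dependent_def by (elim conjE bigo_one_bound)
  have "bigo_one (\<lambda>T. SUP k. ennreal ((1 + real k) powr \<alpha>\<^sub>X) * (\<Sum>l. dependence_coeff (M T) (e T) (e' T) (g T) (X T) m (k + l)))"
    using assms(3) unfolding short_range_dependent_def by (elim conjE)
  then obtain D where D: "1 \<le> D"
    and evD: "\<forall>\<^sub>F T in sequentially. (SUP k. ennreal ((1 + real k) powr \<alpha>\<^sub>X) * (\<Sum>l. dependence_coeff (M T) (e T) (e' T) (g T) (X T) m (k + l))) \<le> ennreal D"
    by (rule bigo_one_bound)
  have "\<beta>\<^sub>X < 1 / 48"
    by (rule dimension_exponent[OF _ assms(5,15,16,17)]) (use assms(4) in simp)
  obtain C where C: "0 < C" and evC: "\<forall>\<^sub>F T in sequentially. norm (real (d T)) \<le> C * norm (real T powr \<beta>\<^sub>X)"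
    using assms(7) by (rule landau_o.bigE)
  \<comment> \<open>The extra 1 pays for the cardinality d + 1 of {0..d}.\<close>
  define K where "K = C + 1"
  have K: "0 < K" using C by (simp add: K_def)
  \<comment> \<open>Everything required of a large sample is collected here, including a process
    representation whose constants B and D do not vary with T.\<close>
  have ev: "\<forall>\<^sub>F T in sequentially. 1 \<le> T \<and> real (d T) + 1 \<le> K * ?x T \<and> K * ?x T \<le> real T powr (1 / 12) / 2 \<and> d T \<le> T \<and>
    process_representation (M T) (\<lambda>i. distr (M T) borel (e T i)) (\<lambda>i x. g T i (\<lambda>l. x (i - int l))) B D
      (\<lambda>l. enn2real (dependence_coeff (M T) (e T) (e' T) (g T) (X T) m l)) (X T) (\<lambda>\<omega> i. e T i \<omega>)"
  proof -
    have s1: "\<forall>\<^sub>F T :: nat in sequentially. K * ?x T \<le> real T powr (1 / 12) / 2" using K by real_asymp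
    have s2: "\<forall>\<^sub>F T :: nat in sequentially. K * ?x T \<le> real T" using K by real_asymp
    show ?thesis
      using eventually_ge_at_top[of 1] evB evD evC s1 s2
    proof eventually_elim
      case (elim T)
      then have T: "1 \<le> T" by blast
      have "real T powr \<beta>\<^sub>X \<le> ?x T" using T \<open>\<beta>\<^sub>X < 1 / 48\<close> by (intro powr_mono) auto
      then have "C * real T powr \<beta>\<^sub>X \<le> C * ?x T" using C by simp
      moreover have "1 \<le> ?x T" using T by (simp add: ge_one_powr_ge_zero)
      moreover have "real (d T) \<le> C * real T powr \<beta>\<^sub>X" using elim(4) by simp
      ultimately have dK: "real (d T) + 1 \<le> K * ?x T" unfolding K_def distrib_right by linarith
      with elim(6) have "real (d T) \<le> real T" by linarith
      then have "d T \<le> T" by simp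
      with T dK elim(5) show ?case
        by (intro conjI process_representation_exists[OF assms(1,2) cr ic assms(4,5) B D elim(2,3)]) assumption+
    qed
  qed
  have card_bound: "finite J \<and> 0 \<le> real (card J) \<and> real (card J) \<le> K * ?x T"
    if "J \<subseteq> {0..d T}" "real (d T) + 1 \<le> K * ?x T" for J T
    using card_mono[OF _ that(1)] that finite_subset[OF that(1)] by simp
  have product_bound: "p * (real (d T) * B\<^sup>2 / u) \<le> (K * ?x T) * (K * ?x T * B\<^sup>2 / u)"
    if "0 \<le> p" "p \<le> K * ?x T" "real (d T) + 1 \<le> K * ?x T" "0 \<le> u" for p u T
    using that by (intro mult_mono divide_right_mono mult_right_mono) auto
  show ?thesis
  proof (intro conjI impI allI; elim exE conjE)
    fix N :: "nat \<Rightarrow> 'b measure" and \<xi> c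
    assume cg: "\<forall>\<^sub>F T in sequentially. centered_gaussian (N T) (H T) (\<xi> T) (scaled_sum_cov (M T) T (cov_summand (M T) (X T)))"
      and c: "0 < c" "\<forall>T\<ge>1. \<forall>j\<in>H T. Lnorm (M T) 2 (scaled_sum T (cov_summand (M T) (X T)) j) > ennreal c"
    define Q R where "Q = 257 * 1 ^ 4 * B ^ 8" and "R = 4 * 1 * B * D"
    have QR: "0 < Q" "0 < R" using B D by (simp_all add: Q_def R_def)
    show "(\<lambda>T. kolmogorov_dist
                (M T) (\<lambda>\<omega>. MAX j\<in>H T. sqrt (real T) * \<bar>sample_autocov T (X T) j \<omega> - autocov (M T) (X T) j\<bar>)
                (N T) (\<lambda>\<omega>. MAX j\<in>H T. \<bar>\<xi> T j \<omega>\<bar>)) \<in> o(\<lambda>_. 1)"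
    proof (rule smallo_one_of_bound)
      show "\<forall>\<^sub>F T in sequentially. \<bar>kolmogorov_dist
                (M T) (\<lambda>\<omega>. MAX j\<in>H T. sqrt (real T) * \<bar>sample_autocov T (X T) j \<omega> - autocov (M T) (X T) j\<bar>)
                (N T) (\<lambda>\<omega>. MAX j\<in>H T. \<bar>\<xi> T j \<omega>\<bar>)\<bar>
          \<le> (K * ?x T) * (K * ?x T * B\<^sup>2 / (sqrt (real T) * ?t T)) + err_scale K Q R c (real T)"
        using ev cg
      proof eventually_elim
        case (elim T)
        then have T: "1 \<le> T" "0 < T" and dK: "real (d T) + 1 \<le> K * ?x T" and small: "K * ?x T \<le> real T powr (1 / 12) / 2"
          and dT: "d T \<le> T" by auto
        interpret process_representation "M T" "\<lambda>i. distr (M T) borel (e T i)" "\<lambda>i x. g T i (\<lambda>l. x (i - int l))" B D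
          "\<lambda>l. enn2real (dependence_coeff (M T) (e T) (e' T) (g T) (X T) m l)" "X T" "\<lambda>\<omega> i. e T i \<omega>"
          using elim by blast
        have H: "H T \<subseteq> {0..d T}" "H T \<noteq> {}" using assms(8)[OF T(1)] by blast+
        note p = card_bound[OF H(1) dK, THEN conjunct1] card_bound[OF H(1) dK, THEN conjunct2, THEN conjunct1]
          card_bound[OF H(1) dK, THEN conjunct2, THEN conjunct2]
        have dK': "real (d T) \<le> K * ?x T" using dK by linarith
        note e = err_bound_le_err_scale[OF T(2) p(2,3) dK' small less_imp_le[OF QR(1)] less_imp_le[OF QR(2)] c(1)]
        have t: "0 < ?t T" "0 \<le> real T powr (1 / 24)" using T by simp_all
        have cH: "ennreal c < Lnorm (M T) 2 (scaled_sum T (cov_summand (M T) (X T)) j)" if "j \<in> H T" for j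
          using c(2) T(1) that by blast
        have "0 \<le> sqrt (real T) * ?t T" by simp
        from product_bound[OF p(2,3) dK this] e(3)
          cov_kolmogorov[OF T(2) p(1) H(2,1) e(2,1) dT elim(2) c(1) cH t, folded Q_def R_def]
        show ?case by linarith
      qed
      \<comment> \<open>The edge effect is of order T^(1/24) over T^(1/2 - 1/32).\<close>
      have "((\<lambda>T :: nat. (K * ?x T) * (K * ?x T * B\<^sup>2 / (sqrt (real T) * ?t T))) \<longlongrightarrow> 0) sequentially"
        using K B by real_asymp
      from tendsto_add[OF this err_scale_tendsto[OF K QR c(1)]]
      show "((\<lambda>T. (K * ?x T) * (K * ?x T * B\<^sup>2 / (sqrt (real T) * ?t T)) + err_scale K Q R c (real T)) \<longlongrightarrow> 0) sequentially"
        by simp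
    qed
  next
    fix N :: "nat \<Rightarrow> 'b measure" and \<zeta> c
    assume cg: "\<forall>\<^sub>F T in sequentially. centered_gaussian (N T) (I T) (\<zeta> T) (scaled_sum_cov (M T) T (corr_summand (M T) (X T)))"
      and c: "0 < c" "\<forall>T\<ge>1. autocov (M T) (X T) 0 > c \<and>
        (\<forall>j\<in>I T. Lnorm (M T) 2 (scaled_sum T (corr_summand (M T) (X T)) j) > ennreal c)"
    define A where "A = B\<^sup>2 / c\<^sup>2 + 1 / c + 1"
    define Q R where "Q = 257 * A ^ 4 * B ^ 8" and "R = 4 * A * B * D"
    have "0 \<le> B\<^sup>2 / c\<^sup>2 + 1 / c" using c(1) by simp
    then have A: "0 < A" unfolding A_def by linarith
    have QR: "0 < Q" "0 < R" using A B D by (simp_all add: Q_def R_def)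
    \<comment> \<open>Two demands on k: k^2 must outgrow the T^(1/48) lags, and the quadratic error
      k^2 / sqrt T must stay below the width T^(-1/32). T^(1/8) meets both.\<close>
    let ?k = "\<lambda>T. real T powr (1 / 8)"
    let ?G = "\<lambda>T. ((K * ?x T) * (K * ?x T * B\<^sup>2 / (sqrt (real T) * (c * ?t T / 2))) + (K * ?x T + 1) * ((4 * B * D)\<^sup>2 / (?k T)\<^sup>2))
      + err_scale K Q R c (real T)"
    show "(\<lambda>T. kolmogorov_dist
                (M T) (\<lambda>\<omega>. MAX j\<in>I T. sqrt (real T) * \<bar>sample_autocorr T (X T) j \<omega> - autocorr (M T) (X T) j\<bar>)
                (N T) (\<lambda>\<omega>. MAX j\<in>I T. \<bar>\<zeta> T j \<omega>\<bar>)) \<in> o(\<lambda>_. 1)"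
    proof (rule smallo_one_of_bound)
      have k1: "\<forall>\<^sub>F T :: nat in sequentially. c * ?t T / 2 \<le> ?k T" using c(1) by real_asymp
      have k2: "\<forall>\<^sub>F T :: nat in sequentially. ?k T / sqrt (real T) \<le> c / 2" using c(1) by real_asymp
      have k3: "\<forall>\<^sub>F T :: nat in sequentially. 6 * B\<^sup>2 * (?k T)\<^sup>2 / (sqrt (real T) * c ^ 3) \<le> ?t T / 2" using c(1) B by real_asymp
      show "\<forall>\<^sub>F T in sequentially. \<bar>kolmogorov_dist
                (M T) (\<lambda>\<omega>. MAX j\<in>I T. sqrt (real T) * \<bar>sample_autocorr T (X T) j \<omega> - autocorr (M T) (X T) j\<bar>)
                (N T) (\<lambda>\<omega>. MAX j\<in>I T. \<bar>\<zeta> T j \<omega>\<bar>)\<bar> \<le> ?G T"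
        using ev cg k1 k2 k3
      proof eventually_elim
        case (elim T)
        then have T: "1 \<le> T" "0 < T" and dK: "real (d T) + 1 \<le> K * ?x T" and small: "K * ?x T \<le> real T powr (1 / 12) / 2"
          and dT: "d T \<le> T" by auto
        interpret process_representation "M T" "\<lambda>i. distr (M T) borel (e T i)" "\<lambda>i x. g T i (\<lambda>l. x (i - int l))" B D
          "\<lambda>l. enn2real (dependence_coeff (M T) (e T) (e' T) (g T) (X T) m l)" "X T" "\<lambda>\<omega> i. e T i \<omega>"
          using elim(1) by blast
        have I: "I T \<subseteq> {0..d T}" "I T \<noteq> {}" using assms(9)[OF T(1)] by force+
        note p = card_bound[OF I(1) dK, THEN conjunct1] card_bound[OF I(1) dK, THEN conjunct2, THEN conjunct1]
          card_bound[OF I(1) dK, THEN conjunct2, THEN conjunct2]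
        have dK': "real (d T) \<le> K * ?x T" using dK by linarith
        note e = err_bound_le_err_scale[OF T(2) p(2,3) dK' small less_imp_le[OF QR(1)] less_imp_le[OF QR(2)] c(1)]
        \<comment> \<open>With s = c t / 2 the linear part s / c takes half of the width t, and the
          other half is left for the quadratic error.\<close>
        have s: "0 < c * ?t T / 2" "0 \<le> real T powr (1 / 24)" using T c(1) by simp_all
        have cI: "ennreal c < Lnorm (M T) 2 (scaled_sum T (corr_summand (M T) (X T)) j)" if "j \<in> I T" for j
          using c(2) T(1) that by blast
        have c0: "c < autocov (M T) (X T) 0" using c(2) T(1) by blast
        have "c * ?t T / 2 / c = ?t T / 2" using c(1) by simp
        then have t: "c * ?t T / 2 / c + 6 * B\<^sup>2 * (?k T)\<^sup>2 / (sqrt (real T) * c ^ 3) \<le> ?t T" using elim(5) by linarith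
        have "0 \<le> sqrt (real T) * (c * ?t T / 2)" using c(1) by simp
        note prod = product_bound[OF p(2,3) dK this]
        have tail: "(real (card (I T)) + 1) * ((4 * B * D)\<^sup>2 / (?k T)\<^sup>2) \<le> (K * ?x T + 1) * ((4 * B * D)\<^sup>2 / (?k T)\<^sup>2)"
          using p(3) by (intro mult_right_mono) auto
        from prod tail e(3)
          corr_kolmogorov[OF T(2) p(1) I(2,1) e(2,1) dT elim(2) c(1) c0 cI s(1) elim(3,4) t s(2), folded A_def, folded Q_def R_def]
        show ?case by linarith
      qed
      have 1: "((\<lambda>T :: nat. (K * ?x T) * (K * ?x T * B\<^sup>2 / (sqrt (real T) * (c * ?t T / 2)))) \<longlongrightarrow> 0) sequentially"
        using K B c(1) by real_asymp
      have 2: "((\<lambda>T :: nat. (K * ?x T + 1) * ((4 * B * D)\<^sup>2 / (?k T)\<^sup>2)) \<longlongrightarrow> 0) sequentially"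
        using K B D by real_asymp
      show "(?G \<longlongrightarrow> 0) sequentially"
        using tendsto_add[OF tendsto_add[OF 1 2] err_scale_tendsto[OF K QR c(1)]] by simp
    qed
  qed
qed

end
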